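(* Let $d\ge 2$, $\alpha\in\mathbb{R}$, let $\Lambda_\omega$ be a non-negative self-adjoint operator with domain $\mathrm{dom}(\Lambda_\omega)\subset L^2(\mathbb{S}^{d-1};d\omega)$, and assume that $\Lambda_\omega$ has purely discrete spectrum, consisting of isolated eigenvalues $\lambda_m$, $m\in\mathcal{I}$ (repeated according to multiplicity, $\mathcal I$ a countable index set), which can accumulate only at infinity, with corresponding normalized eigenfunctions $u_m$, $m\in\mathcal{I}$. Let $\mathcal{L}$, $\mathrm{dom}(\mathcal{L})$, $\mathcal{D}$, $C(d,\alpha)$ and the cut-off functions $g_\epsilon$ be as defined in the context. For any $\epsilon\in(0,1/2)$ define $$\psi_\epsilon(x):=\begin{cases}|x|^{\frac{-(d-4)+\alpha}{2}}\,g_\epsilon(|x|)\,u_{m_0}\big(\tfrac{x}{|x|}\big), & \text{if } d-\alpha-4\neq 0\ \text{ or }\ C(d,\alpha)=\lambda_{m_0},\\ h_\epsilon(|x|), & \text{if } d-\alpha-4=0\ \text{ and }\ C(d,\alpha)=(d-2)^2,\end{cases}$$ where $m_0\in\mathcal{I}$ is a minimizing index in the definition of $C(d,\alpha)$, $u_{m_0}$ is the eigenfunction corresponding to the eigenvalue $\lambda_{m_0}$ of $\Lambda_\omega$, and $h_\epsilon$ is defined such that $h_\epsilon'(r)=r^{-1}g_\epsilon(r)$, $r=|x|$. Then $\{\psi_\epsilon\}_{\epsilon}\subset\mathrm{dom}(\mathcal{L})$ is a minimizing sequence for $C(d,\alpha)$, i.e. $$\frac{\int_{\mathbb{R}^d}|\mathcal{L}\psi_\epsilon(x)|^2/|x|^\alpha\,dx}{\int_{\mathbb{R}^d}\mathcal{D}(\psi_\epsilon)(x)/|x|^{\alpha+2}\,dx}\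 \longrightarrow\ C(d,\alpha)\quad\text{from above, as }\epsilon\searrow 0.$$ Moreover, the constant $C(d,\alpha)$ is not attained in $\mathrm{dom}(\mathcal{L})$, i.e. there is no non-zero $\psi\in\mathrm{dom}(\mathcal{L})$ for which $\int_{\mathbb{R}^d}|\mathcal{L}\psi|^2/|x|^\alpha\,dx=C(d,\alpha)\int_{\mathbb{R}^d}\mathcal{D}(\psi)/|x|^{\alpha+2}\,dx$.
   Context: Write $x\in\mathbb{R}^d\setminus\{0\}$ in spherical coordinates as $x=r\omega$, $r=|x|>0$, $\omega\in\mathbb{S}^{d-1}$; functions are complex-valued. Set $L_r:=-\frac{\partial^2}{\partial r^2}-\frac{d-1}{r}\frac{\partial}{\partial r}$. The operator $\mathcal{L}:=L_r+\frac{1}{r^2}\Lambda_\omega$ (with $\Lambda_\omega$ acting in the variable $\omega$) acts on $$\mathrm{dom}(\mathcal{L}):=\{\psi:\ \psi\in C_0^\infty(\mathbb{R}^d\setminus\{0\}),\ \psi(r,\cdot)\in\mathrm{dom}(\Lambda_\omega)\text{ for } r>0,\ \mathcal{L}\psi\in L^2(\mathbb{R}^d)\}.$$ The first-order operator $\mathcal{D}$ is $\mathcal{D}(\psi):=\big|\frac{\partial\psi}{\partial r}\big|^2+\frac{1}{r^2}|\Lambda_\omega^{1/2}\psi|^2$, where $\Lambda_\omega^{1/2}$ is the non-negative self-adjoint square root of $\Lambda_\omega$. The constant is $$C(d,\alpha)=\begin{cases}\displaystyle\min_{m\in\mathcal{I}}\frac{\big(4\lambda_m+(d+\alpha)(d-\alpha-4)\big)^2}{4\big(4\lambda_m+(d-\alpha-4)^2\big)},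 & \text{if } d-\alpha-4\neq 0,\\[2mm] \displaystyle\min\Big((d-2)^2;\ \min_{m\in\mathcal{I},\,\lambda_m\neq 0}\lambda_m\Big), & \text{if } d-\alpha-4=0.\end{cases}$$ Cut-off: $g_\epsilon\in C_0^\infty(\mathbb{R}^+)$ is a smooth function with $0\le g_\epsilon\le 1$ on $[0,\infty)$, $g_\epsilon(r)=0$ for $0\le r\le\epsilon$ or $r\ge\frac1\epsilon$, $g_\epsilon(r)=1$ for $2\epsilon\le r\le\frac{1}{2\epsilon}$, and, for some constant $c>0$ (independent of $\epsilon$), $|g_\epsilon'(r)|\le\frac{c}{\epsilon}$ and $|g_\epsilon''(r)|\le\frac{c}{\epsilon^2}$ for $\epsilon\le r\le 2\epsilon$, while $|g_\epsilon'(r)|\le c\epsilon$ and $|g_\epsilon''(r)|\le c\epsilon^2$ for $\frac{1}{2\epsilon}\le r\le\frac1\epsilon$.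
   Formalization: In the first case ψ_ε∈dom(L) is claimed only if u_{m0} is smooth; in the second case Λ_ω1=0 is assumed for the constant function 1, and h_ε(|x|), which is never compactly supported away from 0, is shown only to be a limit of elements of dom(L) in both integrals of the quotient. *)

theory Defs
  imports "HOL-Analysis.Analysis"
begin

section \<open>Square-integrable functions and unbounded operators\<close>

text \<open>
  The Hilbert space \<open>L\<^sup>2(M)\<close> is handled through representatives: its elements are honest functions,
  and every identity between them is an identity almost everywhere. An unbounded operator is a pair
  \<open>(D, A)\<close>, where \<open>D\<close> is its domain and only the values of \<open>A\<close> on \<open>D\<close> matter, up to null sets.
\<close>

definition L2 :: "'a measure \<Rightarrow> ('a \<Rightarrow> complex) set" where
  "L2 M = {f \<in> borel_measurable M. integrable M (\<lambda>x. (cmod (f x))\<^sup>2)}"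

definition L2_inner :: "'a measure \<Rightarrow> ('a \<Rightarrow> complex) \<Rightarrow> ('a \<Rightarrow> complex) \<Rightarrow> complex" where
  "L2_inner M f g = (LINT x|M. f x * cnj (g x))"

definition L2_norm :: "'a measure \<Rightarrow> ('a \<Rightarrow> complex) \<Rightarrow> real" where
  "L2_norm M f = sqrt (LINT x|M. (cmod (f x))\<^sup>2)"

definition ae_eq :: "'a measure \<Rightarrow> ('a \<Rightarrow> complex) \<Rightarrow> ('a \<Rightarrow> complex) \<Rightarrow> bool" where
  "ae_eq M f g \<longleftrightarrow> (AE x in M. f x = g x)"

definition densely_defined_operator ::
    "'a measure \<Rightarrow> ('a \<Rightarrow> complex) set \<Rightarrow> (('a \<Rightarrow> complex) \<Rightarrow> ('a \<Rightarrow> complex)) \<Rightarrow> bool" where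
  "densely_defined_operator M D A \<longleftrightarrow>
     D \<subseteq> L2 M \<and> A ` D \<subseteq> L2 M \<and>
     (\<forall>f\<in>D. \<forall>g\<in>D. \<forall>a b. (\<lambda>x. a * f x + b * g x) \<in> D \<and>
        ae_eq M (A (\<lambda>x. a * f x + b * g x)) (\<lambda>x. a * A f x + b * A g x)) \<and>
     (\<forall>f\<in>L2 M. \<forall>e>0. \<exists>g\<in>D. L2_norm M (\<lambda>x. f x - g x) < e)"

text \<open>
  Self-adjointness is the equality of the graphs of \<open>A\<close> and of its adjoint. In particular \<open>D\<close> is
  closed under changing a function on a null set, and \<open>A\<close> respects such changes.
\<close>

definition selfadjoint ::
    "'a measure \<Rightarrow> ('a \<Rightarrow> complex) set \<Rightarrow> (('a \<Rightarrow> complex) \<Rightarrow> ('a \<Rightarrow> complex)) \<Rightarrow> bool" where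
  "selfadjoint M D A \<longleftrightarrow> densely_defined_operator M D A \<and>
     (\<forall>g\<in>L2 M. \<forall>h\<in>L2 M.
        (g \<in> D \<and> ae_eq M (A g) h) \<longleftrightarrow> (\<forall>f\<in>D. L2_inner M (A f) g = L2_inner M f h))"

definition nonnegative_selfadjoint ::
    "'a measure \<Rightarrow> ('a \<Rightarrow> complex) set \<Rightarrow> (('a \<Rightarrow> complex) \<Rightarrow> ('a \<Rightarrow> complex)) \<Rightarrow> bool" where
  "nonnegative_selfadjoint M D A \<longleftrightarrow> selfadjoint M D A \<and> (\<forall>f\<in>D. 0 \<le> Re (L2_inner M (A f) f))"

text \<open>\<open>(E, B)\<close> is the non-negative self-adjoint square root of \<open>(D, A)\<close>; such a root is unique.\<close>

definition selfadjoint_sqrt ::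
    "'a measure \<Rightarrow> ('a \<Rightarrow> complex) set \<Rightarrow> (('a \<Rightarrow> complex) \<Rightarrow> ('a \<Rightarrow> complex)) \<Rightarrow>
     ('a \<Rightarrow> complex) set \<Rightarrow> (('a \<Rightarrow> complex) \<Rightarrow> ('a \<Rightarrow> complex)) \<Rightarrow> bool" where
  "selfadjoint_sqrt M D A E B \<longleftrightarrow> nonnegative_selfadjoint M E B \<and>
     D = {f \<in> E. B f \<in> E} \<and> (\<forall>f\<in>D. ae_eq M (B (B f)) (A f))"

definition resolvent_set ::
    "'a measure \<Rightarrow> ('a \<Rightarrow> complex) set \<Rightarrow> (('a \<Rightarrow> complex) \<Rightarrow> ('a \<Rightarrow> complex)) \<Rightarrow> complex set" where
  "resolvent_set M D A = {z.
     (\<forall>h\<in>L2 M. \<exists>f\<in>D. ae_eq M (\<lambda>x. A f x - z * f x) h) \<and>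
     (\<exists>K. \<forall>f\<in>D. L2_norm M f \<le> K * L2_norm M (\<lambda>x. A f x - z * f x))}"

definition op_spectrum ::
    "'a measure \<Rightarrow> ('a \<Rightarrow> complex) set \<Rightarrow> (('a \<Rightarrow> complex) \<Rightarrow> ('a \<Rightarrow> complex)) \<Rightarrow> complex set" where
  "op_spectrum M D A = - resolvent_set M D A"

definition eigenfunction ::
    "'a measure \<Rightarrow> ('a \<Rightarrow> complex) set \<Rightarrow> (('a \<Rightarrow> complex) \<Rightarrow> ('a \<Rightarrow> complex)) \<Rightarrow>
     real \<Rightarrow> ('a \<Rightarrow> complex) \<Rightarrow> bool" where
  "eigenfunction M D A l f \<longleftrightarrow> f \<in> D \<and> ae_eq M (A f) (\<lambda>x. of_real l * f x)"

text \<open>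
  Purely discrete spectrum, enumerated as \<open>lam m\<close> (\<open>m \<in> I\<close>) with repetition according to
  multiplicity. The last two clauses say that the orthonormal eigenfunctions \<open>u n\<close> with
  \<open>lam n = l\<close> span the eigenspace of \<open>l\<close>, so that the number of repetitions is the multiplicity, and
  that multiplicities are finite and the eigenvalues accumulate only at infinity (hence are isolated).
  For a non-negative operator the spectrum is bounded below, so \<open>lam m \<le> R\<close> covers bounded sets.
\<close>

definition purely_discrete_spectrum ::
    "'a measure \<Rightarrow> ('a \<Rightarrow> complex) set \<Rightarrow> (('a \<Rightarrow> complex) \<Rightarrow> ('a \<Rightarrow> complex)) \<Rightarrow>
     'i set \<Rightarrow> ('i \<Rightarrow> real) \<Rightarrow> ('i \<Rightarrow> ('a \<Rightarrow> complex)) \<Rightarrow> bool" where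
  "purely_discrete_spectrum M D A I lam u \<longleftrightarrow>
     countable I \<and>
     op_spectrum M D A = (\<lambda>m. complex_of_real (lam m)) ` I \<and>
     (\<forall>m\<in>I. eigenfunction M D A (lam m) (u m)) \<and>
     (\<forall>m\<in>I. \<forall>n\<in>I. L2_inner M (u m) (u n) = (if m = n then 1 else 0)) \<and>
     (\<forall>l f. eigenfunction M D A l f \<longrightarrow>
        ae_eq M f (\<lambda>x. \<Sum>n | n \<in> I \<and> lam n = l. L2_inner M f (u n) * u n x)) \<and>
     (\<forall>R. finite {m \<in> I. lam m \<le> R})"


section \<open>The sphere and smooth functions\<close>

text \<open>
  Surface measure on the unit sphere: the measure of \<open>A\<close> is \<open>d\<close> times the Lebesgue measure of the
  cone \<open>{r \<omega> | 0 < r < 1, \<omega> \<in> A}\<close>. Note \<open>sgn x = x / norm x\<close>.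
\<close>

definition sphere_measure :: "'a::euclidean_space measure" where
  "sphere_measure = scale_measure (of_nat DIM('a))
     (distr (restrict_space lborel (ball 0 1 - {0})) (restrict_space borel (sphere 0 1)) sgn)"

fun Ck_on :: "nat \<Rightarrow> 'a::euclidean_space set \<Rightarrow> ('a \<Rightarrow> 'b::real_normed_vector) \<Rightarrow> bool" where
  "Ck_on 0 S f \<longleftrightarrow> continuous_on S f"
| "Ck_on (Suc k) S f \<longleftrightarrow> (\<forall>x\<in>S. f differentiable (at x)) \<and>
     (\<forall>b\<in>Basis. Ck_on k S (\<lambda>x. frechet_derivative f (at x) b))"

text \<open>Used for open \<open>S\<close> only.\<close>

definition smooth_on :: "'a::euclidean_space set \<Rightarrow> ('a \<Rightarrow> 'b::real_normed_vector) \<Rightarrow> bool" where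
  "smooth_on S f \<longleftrightarrow> (\<forall>k. Ck_on k S f)"

definition test_function_away0 :: "('a::euclidean_space \<Rightarrow> complex) \<Rightarrow> bool" where
  "test_function_away0 \<psi> \<longleftrightarrow> smooth_on (- {0}) \<psi> \<and>
     compact (closure {x. \<psi> x \<noteq> 0}) \<and> 0 \<notin> closure {x. \<psi> x \<noteq> 0}"


section \<open>The operators \<open>\<L>\<close> and \<open>\<D>\<close>\<close>

definition radial_deriv :: "('a::euclidean_space \<Rightarrow> complex) \<Rightarrow> 'a \<Rightarrow> complex" where
  "radial_deriv \<psi> x = vector_derivative (\<lambda>s. \<psi> (s *\<^sub>R sgn x)) (at (norm x))"

definition L_rad :: "('a::euclidean_space \<Rightarrow> complex) \<Rightarrow> 'a \<Rightarrow> complex" where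
  "L_rad \<psi> x = - radial_deriv (radial_deriv \<psi>) x
     - of_real ((real DIM('a) - 1) / norm x) * radial_deriv \<psi> x"

text \<open>
  An operator \<open>A\<close> on \<open>L\<^sup>2\<close> of the sphere acting in the variable \<open>\<omega>\<close>. As \<open>A\<close> is only determined up to
  null sets on each sphere, \<open>A \<psi>\<close> is a jointly measurable function on the whole space that agrees
  on the sphere of radius \<open>r\<close> with \<open>A (\<psi>(r, \<cdot>))\<close>; it is unique almost everywhere, and \<open>angular_op\<close>
  picks a version.
\<close>

definition angular_version ::
    "(('a::euclidean_space \<Rightarrow> complex) \<Rightarrow> ('a \<Rightarrow> complex)) \<Rightarrow> ('a \<Rightarrow> complex) \<Rightarrow> ('a \<Rightarrow> complex) \<Rightarrow> bool" where
  "angular_version A \<psi> F \<longleftrightarrow> F \<in> borel_measurable borel \<and>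
     (AE r in lborel. 0 < r \<longrightarrow>
        ae_eq sphere_measure (\<lambda>\<omega>. F (r *\<^sub>R \<omega>)) (A (\<lambda>\<omega>. \<psi> (r *\<^sub>R \<omega>))))"

definition angular_op ::
    "(('a::euclidean_space \<Rightarrow> complex) \<Rightarrow> ('a \<Rightarrow> complex)) \<Rightarrow> ('a \<Rightarrow> complex) \<Rightarrow> 'a \<Rightarrow> complex" where
  "angular_op A \<psi> = (SOME F. angular_version A \<psi> F)"

text \<open>\<open>A\<close> is \<open>\<Lambda>\<^sub>\<omega>\<close> in \<open>calL\<close>, and \<open>B\<close> is its square root in \<open>calD\<close>.\<close>

definition calL ::
    "(('a::euclidean_space \<Rightarrow> complex) \<Rightarrow> ('a \<Rightarrow> complex)) \<Rightarrow> ('a \<Rightarrow> complex) \<Rightarrow> 'a \<Rightarrow> complex" where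
  "calL A \<psi> x = L_rad \<psi> x + of_real (1 / (norm x)\<^sup>2) * angular_op A \<psi> x"

definition calD ::
    "(('a::euclidean_space \<Rightarrow> complex) \<Rightarrow> ('a \<Rightarrow> complex)) \<Rightarrow> ('a \<Rightarrow> complex) \<Rightarrow> 'a \<Rightarrow> real" where
  "calD B \<psi> x = (cmod (radial_deriv \<psi> x))\<^sup>2 + 1 / (norm x)\<^sup>2 * (cmod (angular_op B \<psi> x))\<^sup>2"

text \<open>\<open>\<psi>(r, \<cdot>) \<in> dom(\<Lambda>\<^sub>\<omega>)\<close> for \<open>r > 0\<close>, and \<open>\<L>\<psi>\<close> is a (measurable) function in \<open>L\<^sup>2\<close>.\<close>

definition calL_in_L2 ::
    "('a::euclidean_space \<Rightarrow> complex) set \<Rightarrow> (('a \<Rightarrow> complex) \<Rightarrow> ('a \<Rightarrow> complex)) \<Rightarrow>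
     ('a \<Rightarrow> complex) \<Rightarrow> bool" where
  "calL_in_L2 D A \<psi> \<longleftrightarrow> (\<forall>r>0. (\<lambda>\<omega>. \<psi> (r *\<^sub>R \<omega>)) \<in> D) \<and>
     (\<exists>F. angular_version A \<psi> F) \<and> calL A \<psi> \<in> L2 lborel"

definition dom_calL ::
    "('a::euclidean_space \<Rightarrow> complex) set \<Rightarrow> (('a \<Rightarrow> complex) \<Rightarrow> ('a \<Rightarrow> complex)) \<Rightarrow>
     ('a \<Rightarrow> complex) set" where
  "dom_calL D A = {\<psi>. test_function_away0 \<psi> \<and> calL_in_L2 D A \<psi>}"

definition rellich_num ::
    "real \<Rightarrow> (('a::euclidean_space \<Rightarrow> complex) \<Rightarrow> ('a \<Rightarrow> complex)) \<Rightarrow> ('a \<Rightarrow> complex) \<Rightarrow> real" where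
  "rellich_num \<alpha> A \<psi> = (LINT x|lborel. (cmod (calL A \<psi> x))\<^sup>2 / norm x powr \<alpha>)"

definition rellich_den ::
    "real \<Rightarrow> (('a::euclidean_space \<Rightarrow> complex) \<Rightarrow> ('a \<Rightarrow> complex)) \<Rightarrow> ('a \<Rightarrow> complex) \<Rightarrow> real" where
  "rellich_den \<alpha> B \<psi> = (LINT x|lborel. calD B \<psi> x / norm x powr (\<alpha> + 2))"

text \<open>
  Functions smooth away from the origin, with \<open>\<L>\<psi>\<close> in \<open>L\<^sup>2\<close>, that are limits of elements of
  \<open>dom(\<L>)\<close> with respect to the two integrals of the quotient. This is only needed for the trial
  functions \<open>h\<^sub>\<epsilon>(|x|)\<close>, which are not compactly supported away from the origin (see
  \<open>radial_trial_not_test_function\<close> below).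
\<close>

definition dom_calL_energy_closure ::
    "real \<Rightarrow> ('a::euclidean_space \<Rightarrow> complex) set \<Rightarrow> (('a \<Rightarrow> complex) \<Rightarrow> ('a \<Rightarrow> complex)) \<Rightarrow>
     (('a \<Rightarrow> complex) \<Rightarrow> ('a \<Rightarrow> complex)) \<Rightarrow> ('a \<Rightarrow> complex) set" where
  "dom_calL_energy_closure \<alpha> D A B = {\<psi>. smooth_on (- {0}) \<psi> \<and> calL_in_L2 D A \<psi> \<and>
     (\<forall>e>0. \<exists>\<phi>\<in>dom_calL D A.
        (\<integral>\<^sup>+x. ennreal ((cmod (calL A (\<lambda>y. \<psi> y - \<phi> y) x))\<^sup>2 / norm x powr \<alpha>) \<partial>lborel) < ennreal e \<and>
        (\<integral>\<^sup>+x. ennreal (calD B (\<lambda>y. \<psi> y - \<phi> y) x / norm x powr (\<alpha> + 2)) \<partial>lborel) < ennreal e)}"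


section \<open>The constant and the trial functions\<close>

definition rellich_quot :: "nat \<Rightarrow> real \<Rightarrow> real \<Rightarrow> real" where
  "rellich_quot d \<alpha> l = (4 * l + (d + \<alpha>) * (d - \<alpha> - 4))\<^sup>2 / (4 * (4 * l + (d - \<alpha> - 4)\<^sup>2))"

text \<open>\<open>LEAST\<close> on the reals is the minimum of a set whenever the minimum exists, as it does here.\<close>

definition rellich_const :: "nat \<Rightarrow> real \<Rightarrow> 'i set \<Rightarrow> ('i \<Rightarrow> real) \<Rightarrow> real" where
  "rellich_const d \<alpha> I lam =
     (if d - \<alpha> - 4 \<noteq> 0 then LEAST c. c \<in> (\<lambda>m. rellich_quot d \<alpha> (lam m)) ` I
      else min ((real d - 2)\<^sup>2) (LEAST c. c \<in> lam ` {m \<in> I. lam m \<noteq> 0}))"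

definition minimizing_index :: "nat \<Rightarrow> real \<Rightarrow> 'i set \<Rightarrow> ('i \<Rightarrow> real) \<Rightarrow> 'i \<Rightarrow> bool" where
  "minimizing_index d \<alpha> I lam m0 \<longleftrightarrow>
     (if d - \<alpha> - 4 \<noteq> 0 then is_arg_min (\<lambda>m. rellich_quot d \<alpha> (lam m)) (\<lambda>m. m \<in> I) m0
      else is_arg_min lam (\<lambda>m. m \<in> I \<and> lam m \<noteq> 0) m0)"

definition cutoff_family :: "(real \<Rightarrow> real \<Rightarrow> real) \<Rightarrow> bool" where
  "cutoff_family g \<longleftrightarrow> (\<exists>c>0. \<forall>\<epsilon>\<in>{0<..<1/2}.
     smooth_on {0<..} (g \<epsilon>) \<and>
     (\<forall>r\<ge>0. 0 \<le> g \<epsilon> r \<and> g \<epsilon> r \<le> 1) \<and>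
     (\<forall>r. 0 \<le> r \<and> r \<le> \<epsilon> \<or> 1 / \<epsilon> \<le> r \<longrightarrow> g \<epsilon> r = 0) \<and>
     (\<forall>r. 2 * \<epsilon> \<le> r \<and> r \<le> 1 / (2 * \<epsilon>) \<longrightarrow> g \<epsilon> r = 1) \<and>
     (\<forall>r. \<epsilon> \<le> r \<and> r \<le> 2 * \<epsilon> \<longrightarrow>
        \<bar>deriv (g \<epsilon>) r\<bar> \<le> c / \<epsilon> \<and> \<bar>deriv (deriv (g \<epsilon>)) r\<bar> \<le> c / \<epsilon>\<^sup>2) \<and>
     (\<forall>r. 1 / (2 * \<epsilon>) \<le> r \<and> r \<le> 1 / \<epsilon> \<longrightarrow>
        \<bar>deriv (g \<epsilon>) r\<bar> \<le> c * \<epsilon> \<and> \<bar>deriv (deriv (g \<epsilon>)) r\<bar> \<le> c * \<epsilon>\<^sup>2))"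

definition power_trial ::
    "real \<Rightarrow> (real \<Rightarrow> real \<Rightarrow> real) \<Rightarrow> ('a::euclidean_space \<Rightarrow> complex) \<Rightarrow> real \<Rightarrow> 'a \<Rightarrow> complex" where
  "power_trial \<alpha> g v \<epsilon> x =
     of_real (norm x powr ((- (real DIM('a) - 4) + \<alpha>) / 2) * g \<epsilon> (norm x)) * v (sgn x)"

definition radial_trial :: "(real \<Rightarrow> real \<Rightarrow> real) \<Rightarrow> real \<Rightarrow> 'a::euclidean_space \<Rightarrow> complex" where
  "radial_trial h \<epsilon> x = of_real (h \<epsilon> (norm x))"

lemma radial_trial_not_test_function:
  fixes g h :: "real \<Rightarrow> real \<Rightarrow> real"
  assumes g: "cutoff_family g" and \<epsilon>: "\<epsilon> \<in> {0<..<1/2}"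
    and h: "\<forall>r>0. (h \<epsilon> has_real_derivative g \<epsilon> r / r) (at r)"
  shows "\<not> test_function_away0 (radial_trial h \<epsilon> :: 'a::euclidean_space \<Rightarrow> complex)"
proof
  define S where "S = {x::'a. radial_trial h \<epsilon> x \<noteq> 0}"
  assume "test_function_away0 (radial_trial h \<epsilon> :: 'a \<Rightarrow> complex)"
  then have S: "compact (closure S)" "0 \<notin> closure S"
    by (auto simp: test_function_away0_def S_def)
  obtain R where R: "\<And>x. x \<in> closure S \<Longrightarrow> norm x \<le> R"
    using compact_imp_bounded[OF S(1)] by (auto simp: bounded_iff)
  have "open (- closure S)" "0 \<in> - closure S" using S by auto
  then obtain e where e: "e > 0" "ball 0 e \<subseteq> - closure S"
    using open_contains_ball by blast
  obtain b :: 'a where b: "b \<in> Basis" using nonempty_Basis by blast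
  have mem: "r *\<^sub>R b \<in> S" if "h \<epsilon> r \<noteq> 0" "r > 0" for r
    using that b by (auto simp: S_def radial_trial_def)
  have big: "h \<epsilon> r = 0" if "r > R" "r > 0" for r
  proof (rule ccontr)
    assume "h \<epsilon> r \<noteq> 0"
    then have "r *\<^sub>R b \<in> closure S" using mem that closure_subset by blast
    from R[OF this] show False using that b by auto
  qed
  have small: "h \<epsilon> r = 0" if "r < e" "r > 0" for r
  proof (rule ccontr)
    assume "h \<epsilon> r \<noteq> 0"
    then have "r *\<^sub>R b \<in> closure S" using mem that closure_subset by blast
    moreover have "r *\<^sub>R b \<in> ball 0 e" using that b by auto
    ultimately show False using e by blast
  qed
  have g0: "g \<epsilon> r \<ge> 0" if "r > 0" for r
    using g \<epsilon> that unfolding cutoff_family_def by (meson less_imp_le)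
  have mono: "h \<epsilon> r \<le> h \<epsilon> s" if "0 < r" "r \<le> s" for r s
  proof (rule DERIV_nonneg_imp_nondecreasing[OF that(2)])
    fix x assume "r \<le> x" "x \<le> s"
    with that have "x > 0" by linarith
    with h g0[of x] show "\<exists>y. (h \<epsilon> has_real_derivative y) (at x) \<and> y \<ge> 0"
      by (meson divide_nonneg_pos)
  qed
  have zero: "h \<epsilon> r = 0" if "r > 0" for r
  proof -
    define p where "p = min r (e / 2)"
    define q where "q = max r (max R 0 + 1)"
    have "p > 0" "p < e" "p \<le> r" "q > R" "q > 0" "r \<le> q"
      using that e by (auto simp: p_def q_def)
    then have "h \<epsilon> p = 0" "h \<epsilon> q = 0" "h \<epsilon> p \<le> h \<epsilon> r" "h \<epsilon> r \<le> h \<epsilon> q"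
      using that small[of p] big[of q] mono[of p r] mono[of r q] by simp_all
    then show ?thesis by linarith
  qed
  have "(h \<epsilon> has_real_derivative 0) (at 1)"
  proof (rule has_field_derivative_transform_within_open)
    show "((\<lambda>_. 0::real) has_real_derivative 0) (at 1)" by simp
    show "open {0::real<..}" by simp
  qed (use zero in auto)
  moreover have "(h \<epsilon> has_real_derivative g \<epsilon> 1 / 1) (at 1)" using h[rule_format, of 1] by simp
  ultimately have "g \<epsilon> 1 = 0" using DERIV_unique by fastforce
  moreover have "g \<epsilon> 1 = 1"
  proof -
    have "2 * \<epsilon> \<le> 1" "1 \<le> 1 / (2 * \<epsilon>)" using \<epsilon> by (auto simp: field_simps)
    then show ?thesis using g \<epsilon> unfolding cutoff_family_def by meson
  qed
  ultimately show False by simp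
qed

end

theory Submission
  imports Defs
begin

text \<open>
  Expanding \<open>\<psi>\<close> in the eigenfunctions \<open>u m\<close> reduces everything to the radial coefficients \<open>c\<close> of \<open>\<psi>\<close>.
  With \<open>\<gamma> = (d - 4 - \<alpha>) / 2\<close>, \<open>v = r powr \<gamma> * c\<close> and \<open>v'\<close>, \<open>v''\<close> the derivatives of \<open>v\<close> in the variable \<open>ln r\<close>,
  the contributions of one coefficient to the two integrals are
  \<open>N = \<integral>\<bar>v'' + (\<alpha> + 2) v' - A v\<bar>\<^sup>2 dr/r\<close> and \<open>E = \<integral>(\<bar>v'\<bar>\<^sup>2 + B \<bar>v\<bar>\<^sup>2) dr/r\<close>, where
  \<open>B = \<lambda>\<^sub>m + \<gamma>\<^sup>2\<close> and \<open>A = B + \<gamma> (\<alpha> + 2)\<close>. Integrating by parts,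
  \<open>N - K E = \<integral>(\<bar>v''\<bar>\<^sup>2 + \<kappa> \<bar>v'\<bar>\<^sup>2) dr/r\<close> whenever \<open>K B = A\<^sup>2\<close>, with \<open>\<kappa> = (\<alpha> + 2)\<^sup>2 + 2 A - K\<close>. For
  \<open>B > 0\<close> the number \<open>K = A\<^sup>2 / B\<close> is the quotient in the definition of the constant and
  \<open>\<kappa> = B + (\<alpha> + 2)\<^sup>2 \<lambda>\<^sub>m / B\<close>; for \<open>B = 0\<close> one takes \<open>K = (\<alpha> + 2)\<^sup>2 = (d - 2)\<^sup>2\<close> and \<open>\<kappa> = 0\<close>. The remainder is
  positive unless \<open>v = 0\<close>, so the constant is not attained. For the trial functions \<open>v\<close> (or \<open>v'\<close>, in the
  radial case) is the cut-off, whose logarithmic derivatives are bounded and live on two intervals of bounded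
  logarithmic length: the remainder stays bounded while \<open>E\<close> grows like \<open>ln (1 / \<epsilon>)\<close>.

  That the \<open>u m\<close> are complete is part of the spectral theorem. It is obtained here from two facts: the
  distance from a real point to the spectrum is the lower bound of \<open>A\<close> minus that point, and isolated points
  of the spectrum of a self-adjoint operator are eigenvalues.
\<close>


section \<open>The Hilbert space of square-integrable functions\<close>

text \<open>The value of \<open>K\<close> is forced. After the integrations by parts the two
  integrals carry \<open>|v|^2\<close> with the factors \<open>A^2\<close> and \<open>B\<close>, and
  \<open>K B = A^2\<close> makes these terms cancel, leaving only derivatives of \<open>v\<close>.
  The remainder is thus blind to a long plateau of \<open>v\<close> (of \<open>v'\<close> if
  \<open>B = 0\<close>) in the variable \<open>ln r\<close>, while the energy grows with its length;
  this is the source of the sharpness of the constant. The obstacle is integrability. The integrals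
  in the quotient have the value 0 on non-integrable functions, and membership in the domain says
  nothing directly about the square root of the angular operator. All expansions are therefore
  carried out with integrals in \<open>[0, \<infinity>]\<close>. The numerator is finite because
  \<open>\<L>\<psi>\<close> is square-integrable and the weight is bounded on the annulus that
  carries \<open>\<psi>\<close>; the denominator is then controlled by the inequality for the single
  modes, provided that the constant is positive, and the value 0 is treated apart.\<close>

lemma borel_measurable_cnj [measurable (raw)]:
  "f \<in> borel_measurable M \<Longrightarrow> (\<lambda>x. cnj (f x)) \<in> borel_measurable M"
  by (rule measurable_compose[of f M borel])
     (auto intro!: borel_measurable_continuous_onI continuous_intros)

lemma L2_measurable [measurable_dest]: "f \<in> L2 M \<Longrightarrow> f \<in> borel_measurable M"
  by (simp add: L2_def)

lemma L2_integrable: "f \<in> L2 M \<Longrightarrow> integrable M (\<lambda>x. (cmod (f x))\<^sup>2)"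
  by (simp add: L2_def)

lemma L2_prod_integrable:
  assumes "f \<in> L2 M" "g \<in> L2 M"
  shows "integrable M (\<lambda>x. f x * cnj (g x))"
proof (rule Bochner_Integration.integrable_bound)
  show "integrable M (\<lambda>x. (cmod (f x))\<^sup>2 + (cmod (g x))\<^sup>2)"
    using assms by (auto intro: L2_integrable)
  show "(\<lambda>x. f x * cnj (g x)) \<in> borel_measurable M"
    using assms[THEN L2_measurable] by measurable
  have "cmod (f x) * cmod (g x) \<le> (cmod (f x))\<^sup>2 + (cmod (g x))\<^sup>2" for x
  proof -
    have "0 \<le> cmod (f x) * cmod (g x)" by simp
    then show ?thesis using sum_squares_bound[of "cmod (f x)" "cmod (g x)"] by linarith
  qed
  then show "AE x in M. norm (f x * cnj (g x)) \<le> norm ((cmod (f x))\<^sup>2 + (cmod (g x))\<^sup>2)"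
    by (simp add: norm_mult)
qed

lemma L2_cmult [intro, simp]:
  assumes "f \<in> L2 M" shows "(\<lambda>x. c * f x) \<in> L2 M"
  using assms by (auto simp: L2_def norm_mult power_mult_distrib)

lemma L2_add [intro, simp]:
  assumes "f \<in> L2 M" "g \<in> L2 M" shows "(\<lambda>x. f x + g x) \<in> L2 M"
proof -
  have [measurable]: "f \<in> borel_measurable M" "g \<in> borel_measurable M"
    using assms by (auto dest: L2_measurable)
  have "integrable M (\<lambda>x. (cmod (f x + g x))\<^sup>2)"
  proof (rule Bochner_Integration.integrable_bound)
    show "integrable M (\<lambda>x. 2 * (cmod (f x))\<^sup>2 + 2 * (cmod (g x))\<^sup>2)"
      using assms by (intro Bochner_Integration.integrable_add integrable_mult_right L2_integrable)
    have "(cmod (f x + g x))\<^sup>2 \<le> 2 * (cmod (f x))\<^sup>2 + 2 * (cmod (g x))\<^sup>2" for x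
    proof -
      have "(cmod (f x + g x))\<^sup>2 \<le> (cmod (f x) + cmod (g x))\<^sup>2"
        by (intro power_mono norm_triangle_ineq) auto
      then show ?thesis
        using sum_squares_bound[of "cmod (f x)" "cmod (g x)"] by (simp add: power2_sum)
    qed
    then show "AE x in M. norm ((cmod (f x + g x))\<^sup>2) \<le> norm (2 * (cmod (f x))\<^sup>2 + 2 * (cmod (g x))\<^sup>2)"
      by simp
  qed simp
  then show ?thesis by (simp add: L2_def)
qed

lemma L2_uminus [intro, simp]: "f \<in> L2 M \<Longrightarrow> (\<lambda>x. - f x) \<in> L2 M"
  using L2_cmult[of f M "-1"] by simp

lemma L2_diff [intro, simp]:
  assumes "f \<in> L2 M" "g \<in> L2 M" shows "(\<lambda>x. f x - g x) \<in> L2 M"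
  using L2_add[OF assms(1) L2_uminus[OF assms(2)]] by simp

lemma L2_zero [intro, simp]: "(\<lambda>x. 0) \<in> L2 M"
  by (simp add: L2_def)

lemma L2_sum [intro, simp]:
  assumes "\<And>i. i \<in> F \<Longrightarrow> f i \<in> L2 M" shows "(\<lambda>x. \<Sum>i\<in>F. f i x) \<in> L2 M"
  using assms by (induction F rule: infinite_finite_induct) auto

lemma L2_inner_cnj:
  "L2_inner M g f = cnj (L2_inner M f g)"
  unfolding L2_inner_def by (subst Bochner_Integration.integral_cnj[symmetric]) (simp add: mult.commute)

lemma L2_inner_cmult_left [simp]: "L2_inner M (\<lambda>x. c * f x) g = c * L2_inner M f g"
  unfolding L2_inner_def by (simp add: mult.assoc)

lemma L2_inner_cmult_right [simp]: "L2_inner M f (\<lambda>x. c * g x) = cnj c * L2_inner M f g"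
  by (subst L2_inner_cnj, subst (2) L2_inner_cnj) simp

lemma L2_inner_add_left [simp]:
  assumes "f \<in> L2 M" "g \<in> L2 M" "h \<in> L2 M"
  shows "L2_inner M (\<lambda>x. f x + g x) h = L2_inner M f h + L2_inner M g h"
  unfolding L2_inner_def using assms by (simp add: distrib_right L2_prod_integrable)

lemma L2_inner_diff_left [simp]:
  assumes "f \<in> L2 M" "g \<in> L2 M" "h \<in> L2 M"
  shows "L2_inner M (\<lambda>x. f x - g x) h = L2_inner M f h - L2_inner M g h"
  unfolding L2_inner_def using assms by (simp add: left_diff_distrib L2_prod_integrable)

lemma L2_inner_add_right [simp]:
  assumes "f \<in> L2 M" "g \<in> L2 M" "h \<in> L2 M"
  shows "L2_inner M h (\<lambda>x. f x + g x) = L2_inner M h f + L2_inner M h g"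
  using assms by (subst L2_inner_cnj, subst (2) L2_inner_cnj, subst (3) L2_inner_cnj) simp

lemma L2_inner_diff_right [simp]:
  assumes "f \<in> L2 M" "g \<in> L2 M" "h \<in> L2 M"
  shows "L2_inner M h (\<lambda>x. f x - g x) = L2_inner M h f - L2_inner M h g"
  using assms by (subst L2_inner_cnj, subst (2) L2_inner_cnj, subst (3) L2_inner_cnj) simp

lemma L2_inner_zero_left [simp]: "L2_inner M (\<lambda>x. 0) h = 0"
  by (simp add: L2_inner_def)

lemma L2_inner_zero_right [simp]: "L2_inner M h (\<lambda>x. 0) = 0"
  by (simp add: L2_inner_def)

lemma L2_inner_sum_left:
  assumes "\<And>i. i \<in> F \<Longrightarrow> f i \<in> L2 M" "h \<in> L2 M"
  shows "L2_inner M (\<lambda>x. \<Sum>i\<in>F. f i x) h = (\<Sum>i\<in>F. L2_inner M (f i) h)"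
  using assms by (induction F rule: infinite_finite_induct) auto

lemma L2_inner_sum_right:
  assumes "\<And>i. i \<in> F \<Longrightarrow> f i \<in> L2 M" "h \<in> L2 M"
  shows "L2_inner M h (\<lambda>x. \<Sum>i\<in>F. f i x) = (\<Sum>i\<in>F. L2_inner M h (f i))"
  using assms by (induction F rule: infinite_finite_induct) auto

lemma L2_norm_nonneg [simp]: "0 \<le> L2_norm M f"
  by (simp add: L2_norm_def)

lemma L2_norm_power2: "(L2_norm M f)\<^sup>2 = (LINT x|M. (cmod (f x))\<^sup>2)"
  by (simp add: L2_norm_def)

lemma L2_inner_self: "L2_inner M f f = of_real ((L2_norm M f)\<^sup>2)"
  unfolding L2_inner_def L2_norm_power2 by (simp add: complex_norm_square[symmetric] flip: of_real_power)

lemma nn_integral_L2: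
  assumes "f \<in> L2 M"
  shows "(\<integral>\<^sup>+x. ennreal ((cmod (f x))\<^sup>2) \<partial>M) = ennreal ((L2_norm M f)\<^sup>2)"
  unfolding L2_norm_power2 using assms by (intro nn_integral_eq_integral L2_integrable) auto

lemma L2_I_nn_integral:
  assumes "f \<in> borel_measurable M" "(\<integral>\<^sup>+x. ennreal ((cmod (f x))\<^sup>2) \<partial>M) < \<infinity>"
  shows "f \<in> L2 M"
  using assms by (auto simp: L2_def intro!: integrableI_nonneg)

lemma L2_norm_eq_0_iff:
  assumes "f \<in> L2 M" shows "L2_norm M f = 0 \<longleftrightarrow> (AE x in M. f x = 0)"
proof -
  have "L2_norm M f = 0 \<longleftrightarrow> (LINT x|M. (cmod (f x))\<^sup>2) = 0"
    by (simp add: L2_norm_def)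
  also have "\<dots> \<longleftrightarrow> (AE x in M. (cmod (f x))\<^sup>2 = 0)"
    using assms by (intro integral_nonneg_eq_0_iff_AE L2_integrable) auto
  finally show ?thesis by simp
qed

lemma ae_eq_sym: "ae_eq M f g \<Longrightarrow> ae_eq M g f"
  unfolding ae_eq_def by (auto elim: AE_mp)

lemma ae_eq_trans [trans]: "ae_eq M f g \<Longrightarrow> ae_eq M g h \<Longrightarrow> ae_eq M f h"
  unfolding ae_eq_def by (auto elim: AE_mp)

lemma ae_eq_refl [simp]: "ae_eq M f f"
  unfolding ae_eq_def by auto

lemma ae_eq_iff_norm:
  assumes "f \<in> L2 M" "g \<in> L2 M"
  shows "ae_eq M f g \<longleftrightarrow> L2_norm M (\<lambda>x. f x - g x) = 0"
  using assms by (simp add: L2_norm_eq_0_iff ae_eq_def)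

lemma L2_inner_cong:
  assumes "ae_eq M f f'" "ae_eq M g g'" "f \<in> L2 M" "f' \<in> L2 M" "g \<in> L2 M" "g' \<in> L2 M"
  shows "L2_inner M f g = L2_inner M f' g'"
  unfolding L2_inner_def
proof (rule integral_cong_AE)
  show "AE x in M. f x * cnj (g x) = f' x * cnj (g' x)"
    using assms(1,2) unfolding ae_eq_def by eventually_elim simp
qed (use assms in \<open>auto intro: borel_measurable_integrable[OF L2_prod_integrable]\<close>)

lemma L2_norm_cong:
  assumes "ae_eq M f f'" "f \<in> L2 M" "f' \<in> L2 M"
  shows "L2_norm M f = L2_norm M f'"
  unfolding L2_norm_def
proof (intro arg_cong[of _ _ sqrt] integral_cong_AE)
  show "AE x in M. (cmod (f x))\<^sup>2 = (cmod (f' x))\<^sup>2"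
    using assms(1) unfolding ae_eq_def by eventually_elim simp
qed (use assms in \<open>auto intro: borel_measurable_integrable[OF L2_integrable]\<close>)

lemma L2_norm_cmult [simp]: "L2_norm M (\<lambda>x. c * f x) = cmod c * L2_norm M f"
  unfolding L2_norm_def by (simp add: norm_mult power_mult_distrib real_sqrt_mult)

lemma L2_norm_diff_power2:
  assumes "f \<in> L2 M" "g \<in> L2 M"
  shows "(L2_norm M (\<lambda>x. f x - g x))\<^sup>2 = (L2_norm M f)\<^sup>2 - 2 * Re (L2_inner M f g) + (L2_norm M g)\<^sup>2"
proof -
  have "complex_of_real ((L2_norm M (\<lambda>x. f x - g x))\<^sup>2) =
      L2_inner M f f - L2_inner M f g - cnj (L2_inner M f g) + L2_inner M g g"
    using assms by (subst L2_inner_self[symmetric]) (simp add: L2_inner_cnj[of M g f])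
  from arg_cong[OF this, of Re] show ?thesis by (simp add: L2_inner_self)
qed

lemma L2_norm_add_power2:
  assumes "f \<in> L2 M" "g \<in> L2 M"
  shows "(L2_norm M (\<lambda>x. f x + g x))\<^sup>2 = (L2_norm M f)\<^sup>2 + 2 * Re (L2_inner M f g) + (L2_norm M g)\<^sup>2"
proof -
  have "complex_of_real ((L2_norm M (\<lambda>x. f x + g x))\<^sup>2) =
      L2_inner M f f + L2_inner M f g + cnj (L2_inner M f g) + L2_inner M g g"
    using assms by (subst L2_inner_self[symmetric]) (simp add: L2_inner_cnj[of M g f])
  from arg_cong[OF this, of Re] show ?thesis by (simp add: L2_inner_self)
qed

lemma L2_Cauchy_Schwarz:
  assumes "f \<in> L2 M" "g \<in> L2 M"
  shows "cmod (L2_inner M f g) \<le> L2_norm M f * L2_norm M g"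
proof (cases "L2_norm M g = 0")
  case True
  then have "ae_eq M g (\<lambda>x. 0)" using assms by (simp add: ae_eq_iff_norm)
  then have "L2_inner M f g = L2_inner M f (\<lambda>x. 0)"
    using assms by (intro L2_inner_cong) auto
  then show ?thesis by simp
next
  case False
  define z where "z = L2_inner M f g"
  define a where "a = (L2_norm M g)\<^sup>2"
  have a: "a > 0" using False by (simp add: a_def)
  \<comment> \<open>The defect of the projection of \<open>f\<close> onto the line of
    \<open>g\<close>, multiplied by \<open>a = |g|^2\<close> so that no division occurs.\<close>
  have "0 \<le> (L2_norm M (\<lambda>x. of_real a * f x - z * g x))\<^sup>2" by simp
  also have "\<dots> = a\<^sup>2 * (L2_norm M f)\<^sup>2 - 2 * Re (of_real a * (cnj z * z)) + (cmod z)\<^sup>2 * a"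
    by (subst L2_norm_diff_power2[OF L2_cmult[OF assms(1)] L2_cmult[OF assms(2)]])
      (simp only: L2_inner_cmult_left L2_inner_cmult_right L2_norm_cmult z_def[symmetric]
        power_mult_distrib a_def[symmetric] norm_of_real power2_abs)
  also have "cnj z * z = of_real ((cmod z)\<^sup>2)" using complex_norm_square[of z] by (simp add: mult.commute)
  also have "a\<^sup>2 * (L2_norm M f)\<^sup>2 - 2 * Re (of_real a * of_real ((cmod z)\<^sup>2)) + (cmod z)\<^sup>2 * a =
      a * (a * (L2_norm M f)\<^sup>2 - (cmod z)\<^sup>2)"
    by (simp add: power2_eq_square algebra_simps)
  finally have "(cmod z)\<^sup>2 \<le> a * (L2_norm M f)\<^sup>2"
    using a by (simp add: zero_le_mult_iff)
  also have "\<dots> = (L2_norm M f * L2_norm M g)\<^sup>2" by (simp add: a_def power_mult_distrib)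
  finally show ?thesis unfolding z_def by (rule power2_le_imp_le) simp
qed

lemma L2_norm_triangle:
  assumes "f \<in> L2 M" "g \<in> L2 M"
  shows "L2_norm M (\<lambda>x. f x + g x) \<le> L2_norm M f + L2_norm M g"
proof (rule power2_le_imp_le)
  have "Re (L2_inner M f g) \<le> L2_norm M f * L2_norm M g"
    using L2_Cauchy_Schwarz[OF assms] complex_Re_le_cmod order_trans by blast
  then show "(L2_norm M (\<lambda>x. f x + g x))\<^sup>2 \<le> (L2_norm M f + L2_norm M g)\<^sup>2"
    using assms by (simp add: L2_norm_add_power2 power2_sum)
qed simp

lemma L2_norm_uminus [simp]: "L2_norm M (\<lambda>x. - f x) = L2_norm M f"
  by (simp add: L2_norm_def)

lemma L2_norm_minus_commute: "L2_norm M (\<lambda>x. f x - g x) = L2_norm M (\<lambda>x. g x - f x)"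
  by (simp add: L2_norm_def norm_minus_commute)

section \<open>Pointwise limits, completeness of L2 and orthogonal projection\<close>

lemma AE_tendsto_if_summable_L2_dist:
  fixes f :: "nat \<Rightarrow> 'a \<Rightarrow> complex"
  assumes [measurable]: "\<And>k. f k \<in> borel_measurable M" "g \<in> borel_measurable M"
    and le: "\<And>k. (\<integral>\<^sup>+x. ennreal ((cmod (f k x - g x))\<^sup>2) \<partial>M) \<le> ennreal ((1/2) ^ k)"
  shows "AE x in M. (\<lambda>k. f k x) \<longlonglongrightarrow> g x"
proof -
  have "(\<integral>\<^sup>+x. (\<Sum>k. ennreal ((cmod (f k x - g x))\<^sup>2)) \<partial>M) =
      (\<Sum>k. \<integral>\<^sup>+x. ennreal ((cmod (f k x - g x))\<^sup>2) \<partial>M)"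
    by (intro nn_integral_suminf) auto
  also have "\<dots> \<le> (\<Sum>k. ennreal ((1/2) ^ k))"
    by (intro suminf_le le) auto
  also have "\<dots> < \<infinity>"
    by (subst suminf_ennreal2) auto
  finally have "AE x in M. (\<Sum>k. ennreal ((cmod (f k x - g x))\<^sup>2)) \<noteq> \<infinity>"
    by (intro nn_integral_PInf_AE) auto
  then show ?thesis
  proof (rule AE_mp, intro AE_I2 impI)
    fix x assume "(\<Sum>k. ennreal ((cmod (f k x - g x))\<^sup>2)) \<noteq> \<infinity>"
    then have "summable (\<lambda>k. (cmod (f k x - g x))\<^sup>2)"
      by (intro summable_suminf_not_top) auto
    then have "(\<lambda>k. (cmod (f k x - g x))\<^sup>2) \<longlonglongrightarrow> 0" by (rule summable_LIMSEQ_zero)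
    then have "(\<lambda>k. sqrt ((cmod (f k x - g x))\<^sup>2)) \<longlonglongrightarrow> sqrt 0" by (intro tendsto_intros)
    then have "(\<lambda>k. f k x - g x) \<longlonglongrightarrow> 0" by (simp add: tendsto_norm_zero_iff)
    \<comment> \<open>The geometric rate makes the squared distances summable at almost every point,
      so the sequence itself converges there, with no passage to a subsequence.\<close>
    then show "(\<lambda>k. f k x) \<longlonglongrightarrow> g x" by (simp add: LIM_zero_iff)
  qed
qed

text \<open>Riesz and Fischer: along a subsequence with geometrically small steps the increments are
  absolutely summable almost everywhere, which produces the pointwise limit \<open>g\<close>.
  Fatou's lemma along this subsequence then bounds the distance of every late \<open>f n\<close> to
  \<open>g\<close>.\<close>

theorem L2_complete:
  fixes f :: "nat \<Rightarrow> 'a \<Rightarrow> complex"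
  assumes f: "\<And>n. f n \<in> L2 M"
    and Cauchy: "\<And>e. e > 0 \<Longrightarrow> \<exists>N. \<forall>m\<ge>N. \<forall>n\<ge>N. L2_norm M (\<lambda>x. f m x - f n x) < e"
  obtains g where "g \<in> L2 M" "(\<lambda>n. L2_norm M (\<lambda>x. f n x - g x)) \<longlonglongrightarrow> 0"
proof -
  have [measurable]: "\<And>n. f n \<in> borel_measurable M" using f by (auto dest: L2_measurable)
  have nn: "(\<integral>\<^sup>+x. ennreal ((cmod (f m x - f n x))\<^sup>2) \<partial>M) = ennreal ((L2_norm M (\<lambda>x. f m x - f n x))\<^sup>2)" for m n
    using f by (intro nn_integral_L2) auto
  have "\<exists>N. \<forall>k. \<forall>m\<ge>N k. \<forall>n\<ge>N k. L2_norm M (\<lambda>x. f m x - f n x) < (1/2)^k"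
    by (intro choice allI Cauchy) auto
  then obtain N where N: "\<And>k m n. m \<ge> N k \<Longrightarrow> n \<ge> N k \<Longrightarrow> L2_norm M (\<lambda>x. f m x - f n x) < (1/2)^k"
    by blast
  \<comment> \<open>Partial sums of the thresholds: \<open>r j\<close> exceeds \<open>N k\<close>
    for all \<open>k \<le> j\<close>, so the subsequence respects every earlier threshold although
    \<open>N\<close> itself need not be monotone.\<close>
  define r where "r k = (\<Sum>j\<le>k. N j)" for k
  have r: "N k \<le> r j" if "k \<le> j" for k j
    unfolding r_def using that by (intro member_le_sum) auto
  have "AE x in M. (\<Sum>k. ennreal (2^k * (cmod (f (r (Suc k)) x - f (r k) x))\<^sup>2)) \<noteq> \<infinity>"
  proof (rule nn_integral_PInf_AE)
    have "(\<integral>\<^sup>+x. (\<Sum>k. ennreal (2^k * (cmod (f (r (Suc k)) x - f (r k) x))\<^sup>2)) \<partial>M) =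
        (\<Sum>k. \<integral>\<^sup>+x. ennreal (2^k) * ennreal ((cmod (f (r (Suc k)) x - f (r k) x))\<^sup>2) \<partial>M)"
      by (subst nn_integral_suminf) (auto simp: ennreal_mult)
    also have "\<dots> = (\<Sum>k. ennreal (2^k) * ennreal ((L2_norm M (\<lambda>x. f (r (Suc k)) x - f (r k) x))\<^sup>2))"
      by (subst nn_integral_cmult) (auto simp: nn)
    also have "\<dots> \<le> (\<Sum>k. ennreal ((1/2)^k))"
    proof (intro suminf_le)
      fix k
      have "(L2_norm M (\<lambda>x. f (r (Suc k)) x - f (r k) x))\<^sup>2 \<le> ((1/2)^k)\<^sup>2"
        using N[of k "r (Suc k)" "r k"] r by (intro power_mono) auto
      then have "2^k * (L2_norm M (\<lambda>x. f (r (Suc k)) x - f (r k) x))\<^sup>2 \<le> 2^k * ((1/2)^k)\<^sup>2"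
        by (intro mult_left_mono) auto
      also have "\<dots> = (1/2::real)^k" by (simp add: power2_eq_square power_one_over)
      finally show "ennreal (2^k) * ennreal ((L2_norm M (\<lambda>x. f (r (Suc k)) x - f (r k) x))\<^sup>2)
          \<le> ennreal ((1/2)^k)"
        by (subst ennreal_mult[symmetric]) (auto intro!: ennreal_leI)
    qed auto
    also have "\<dots> < \<infinity>" by (subst suminf_ennreal2) auto
    finally show "(\<integral>\<^sup>+x. (\<Sum>k. ennreal (2^k * (cmod (f (r (Suc k)) x - f (r k) x))\<^sup>2)) \<partial>M) \<noteq> \<infinity>"
      by simp
  qed simp
  then have conv: "AE x in M. convergent (\<lambda>k. f (r k) x)"
  proof (rule AE_mp, intro AE_I2 impI)
    fix x assume "(\<Sum>k. ennreal (2^k * (cmod (f (r (Suc k)) x - f (r k) x))\<^sup>2)) \<noteq> \<infinity>"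
    then have "summable (\<lambda>k. 2^k * (cmod (f (r (Suc k)) x - f (r k) x))\<^sup>2)"
      by (intro summable_suminf_not_top) auto
    then have s: "summable (\<lambda>k. (1/2)^k + 2^k * (cmod (f (r (Suc k)) x - f (r k) x))\<^sup>2)"
      by (intro summable_add) auto
    have "summable (\<lambda>k. f (r (Suc k)) x - f (r k) x)"
    proof (rule summable_comparison_test'[OF s, of 0])
      fix k
      define t where "t = cmod (f (r (Suc k)) x - f (r k) x)"
      \<comment> \<open>The arithmetic-geometric mean inequality trades the square for a geometric
        term: \<open>t \<le> (1/2)^k + 2^k * t^2\<close>. This is why the series of squares above
        carries the weight \<open>2^k\<close>.\<close>
      have "0 \<le> (2^k * t - 1)\<^sup>2" by simp
      then have *: "2 * (2^k * t) \<le> (2^k * t)\<^sup>2 + 1" by (simp add: power2_diff)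
      have "2^k * t \<le> (2^k * t)\<^sup>2 + 1"
      proof -
        have "0 \<le> 2^k * t" by (simp add: t_def)
        with * show ?thesis by linarith
      qed
      also have "(2^k * t)\<^sup>2 + 1 = 2^k * ((1/2)^k + 2^k * t\<^sup>2)"
      proof -
        have "2^k * (1/2)^k = (1::real)" by (simp add: power_one_over)
        then show ?thesis
          by (simp only: distrib_left power_mult_distrib) (simp only: power2_eq_square mult_ac add_ac)
      qed
      finally have "2^k * t \<le> 2^k * ((1/2)^k + 2^k * t\<^sup>2)" .
      then show "norm (f (r (Suc k)) x - f (r k) x) \<le> (1/2)^k + 2^k * (cmod (f (r (Suc k)) x - f (r k) x))\<^sup>2"
        unfolding t_def[symmetric] by (rule mult_left_le_imp_le) simp
    qed
    then have "(\<lambda>n. f (r 0) x + (\<Sum>k<n. f (r (Suc k)) x - f (r k) x)) \<longlonglongrightarrow>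
        f (r 0) x + (\<Sum>k. f (r (Suc k)) x - f (r k) x)"
      by (intro tendsto_add tendsto_const summable_LIMSEQ)
    then have "(\<lambda>n. f (r n) x) \<longlonglongrightarrow> f (r 0) x + (\<Sum>k. f (r (Suc k)) x - f (r k) x)"
      by (simp add: sum_lessThan_telescope[where f="\<lambda>k. f (r k) x"])
    then show "convergent (\<lambda>k. f (r k) x)" by (rule convergentI)
  qed
  define g where "g x = lim (\<lambda>k. f (r k) x)" for x
  have [measurable]: "g \<in> borel_measurable M" unfolding g_def by measurable
  have lim: "AE x in M. (\<lambda>k. f (r k) x) \<longlonglongrightarrow> g x"
    using conv by eventually_elim (simp add: g_def convergent_LIMSEQ_iff)
  have dist: "(\<integral>\<^sup>+x. ennreal ((cmod (f n x - g x))\<^sup>2) \<partial>M) \<le> ennreal (((1/2)^k)\<^sup>2)" if n: "n \<ge> N k" for n k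
  proof -
    have "(\<integral>\<^sup>+x. ennreal ((cmod (f n x - g x))\<^sup>2) \<partial>M) =
        (\<integral>\<^sup>+x. liminf (\<lambda>j. ennreal ((cmod (f n x - f (r j) x))\<^sup>2)) \<partial>M)"
    proof (rule nn_integral_cong_AE, use lim in eventually_elim)
      fix x assume "(\<lambda>k. f (r k) x) \<longlonglongrightarrow> g x"
      then have "(\<lambda>j. ennreal ((cmod (f n x - f (r j) x))\<^sup>2)) \<longlonglongrightarrow> ennreal ((cmod (f n x - g x))\<^sup>2)"
        by (intro tendsto_intros tendsto_ennrealI)
      then show "ennreal ((cmod (f n x - g x))\<^sup>2) = liminf (\<lambda>j. ennreal ((cmod (f n x - f (r j) x))\<^sup>2))"
        by (intro lim_imp_Liminf[symmetric]) auto
    qed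
    also have "\<dots> \<le> liminf (\<lambda>j. \<integral>\<^sup>+x. ennreal ((cmod (f n x - f (r j) x))\<^sup>2) \<partial>M)"
      by (intro nn_integral_liminf) auto
    also have "\<dots> \<le> liminf (\<lambda>j::nat. ennreal (((1/2)^k)\<^sup>2))"
    proof (rule Liminf_mono, rule eventually_sequentiallyI)
      fix j assume "k \<le> j"
      then have "L2_norm M (\<lambda>x. f n x - f (r j) x) < (1/2)^k" using n r by (intro N) auto
      then show "(\<integral>\<^sup>+x. ennreal ((cmod (f n x - f (r j) x))\<^sup>2) \<partial>M) \<le> ennreal (((1/2)^k)\<^sup>2)"
        unfolding nn by (intro ennreal_leI power_mono) auto
    qed
    also have "\<dots> = ennreal (((1/2)^k)\<^sup>2)" by (simp add: Liminf_const)
    finally show ?thesis .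
  qed
  have dL2: "(\<lambda>x. f n x - g x) \<in> L2 M" if "n \<ge> N k" for n k
    using dist[OF that] by (intro L2_I_nn_integral) (auto intro: order.strict_trans1)
  have "(\<lambda>x. f (N 0) x - (f (N 0) x - g x)) \<in> L2 M"
    by (intro L2_diff f dL2[of 0]) simp
  then have g: "g \<in> L2 M" by simp
  have le: "L2_norm M (\<lambda>x. f n x - g x) \<le> (1/2)^k" if "n \<ge> N k" for n k
  proof -
    have "ennreal ((L2_norm M (\<lambda>x. f n x - g x))\<^sup>2) \<le> ennreal (((1/2)^k)\<^sup>2)"
      using dist[OF that] nn_integral_L2[OF dL2[OF that]] by simp
    then have "(L2_norm M (\<lambda>x. f n x - g x))\<^sup>2 \<le> ((1/2)^k)\<^sup>2"
      by (subst (asm) ennreal_le_iff) auto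
    then show ?thesis by (rule power2_le_imp_le) simp
  qed
  have "(\<lambda>n. L2_norm M (\<lambda>x. f n x - g x)) \<longlonglongrightarrow> 0"
  proof (rule LIMSEQ_I)
    fix e :: real assume "e > 0"
    then obtain k where "(1/2)^k < e" using real_arch_pow_inv[of e "1/2"] by auto
    then have "\<forall>n\<ge>N k. norm (L2_norm M (\<lambda>x. f n x - g x) - 0) < e"
      using le by (auto intro: order.strict_trans1)
    then show "\<exists>no. \<forall>n\<ge>no. norm (L2_norm M (\<lambda>x. f n x - g x) - 0) < e" by blast
  qed
  with g show ?thesis by (rule that)
qed


lemma L2_inner_tendsto:
  fixes f :: "nat \<Rightarrow> 'a \<Rightarrow> complex"
  assumes "\<And>n. f n \<in> L2 M" "g \<in> L2 M" "h \<in> L2 M"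
    and lim: "(\<lambda>n. L2_norm M (\<lambda>x. f n x - g x)) \<longlonglongrightarrow> 0"
  shows "(\<lambda>n. L2_inner M (f n) h) \<longlonglongrightarrow> L2_inner M g h"
proof (rule Lim_null_comparison[THEN LIM_zero_cancel])
  show "\<forall>\<^sub>F n in sequentially. norm (L2_inner M (f n) h - L2_inner M g h) \<le>
      L2_norm M (\<lambda>x. f n x - g x) * L2_norm M h"
    using L2_Cauchy_Schwarz[of "\<lambda>x. f _ x - g x" M h] assms by (intro always_eventually allI) simp
  show "(\<lambda>n. L2_norm M (\<lambda>x. f n x - g x) * L2_norm M h) \<longlonglongrightarrow> 0"
    using lim by (rule tendsto_mult_left_zero)
qed

text \<open>The space \<open>V\<close> is not assumed closed, so the projection of \<open>f\<close>
  is available only as a limit of elements \<open>v n\<close> of \<open>V\<close>, and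
  \<open>q\<close> is the orthogonal part that is left over. Later \<open>V\<close> is the range of
  a shifted operator, whose closedness is not known in advance.\<close>

theorem L2_projection:
  assumes V: "V \<subseteq> L2 M" "V \<noteq> {}"
    and lin: "\<And>f g a b. f \<in> V \<Longrightarrow> g \<in> V \<Longrightarrow> (\<lambda>x. a * f x + b * g x) \<in> V"
    and f: "f \<in> L2 M"
  obtains q v where "q \<in> L2 M" "\<And>w. w \<in> V \<Longrightarrow> L2_inner M q w = 0"
    "\<And>n. v n \<in> V" "(\<lambda>n. L2_norm M (\<lambda>x. v n x - (f x - q x))) \<longlonglongrightarrow> 0"
proof -
  define \<delta> where "\<delta> = (INF w\<in>V. (L2_norm M (\<lambda>x. f x - w x))\<^sup>2)"
  have bdd: "bdd_below ((\<lambda>w. (L2_norm M (\<lambda>x. f x - w x))\<^sup>2) ` V)"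
    by (rule bdd_belowI[of _ 0]) auto
  have \<delta>: "\<delta> \<le> (L2_norm M (\<lambda>x. f x - w x))\<^sup>2" if "w \<in> V" for w
    unfolding \<delta>_def using bdd that by (rule cINF_lower)
  have "\<exists>w\<in>V. (L2_norm M (\<lambda>x. f x - w x))\<^sup>2 < \<delta> + inverse (real (Suc n))" for n
    using cINF_less_iff[OF V(2) bdd, of "\<delta> + inverse (real (Suc n))"] unfolding \<delta>_def[symmetric] by auto
  then obtain v where v: "\<And>n. v n \<in> V"
    "\<And>n. (L2_norm M (\<lambda>x. f x - v n x))\<^sup>2 < \<delta> + inverse (real (Suc n))"
    by metis
  have vL2 [simp]: "v n \<in> L2 M" for n using v(1) V(1) by auto
  have diff: "(L2_norm M (\<lambda>x. v m x - v n x))\<^sup>2 \<le> 2 * inverse (real (Suc m)) + 2 * inverse (real (Suc n))" for m n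
  proof -
    let ?a = "\<lambda>x. f x - v m x" and ?b = "\<lambda>x. f x - v n x"
    have ab: "?a \<in> L2 M" "?b \<in> L2 M" using f by auto
    \<comment> \<open>Parallelogram law: the midpoint of two approximants lies in \<open>V\<close>,
      so its squared distance to \<open>f\<close> is at least \<open>\<delta>\<close>, and two
      nearly optimal approximants must be close to each other.\<close>
    have "(L2_norm M (\<lambda>x. ?b x - ?a x))\<^sup>2 + (L2_norm M (\<lambda>x. ?b x + ?a x))\<^sup>2 =
        2 * (L2_norm M ?a)\<^sup>2 + 2 * (L2_norm M ?b)\<^sup>2"
      unfolding L2_norm_diff_power2[OF ab(2,1)] L2_norm_add_power2[OF ab(2,1)] by simp
    moreover have "(L2_norm M (\<lambda>x. ?b x - ?a x))\<^sup>2 = (L2_norm M (\<lambda>x. v m x - v n x))\<^sup>2"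
      by (rule arg_cong[where f="\<lambda>h. (L2_norm M h)\<^sup>2"]) auto
    moreover have "(\<lambda>x. ?b x + ?a x) = (\<lambda>x. 2 * (f x - ((1/2) * v m x + (1/2) * v n x)))"
      by (auto simp: field_simps)
    then have "(L2_norm M (\<lambda>x. ?b x + ?a x))\<^sup>2 = 4 * (L2_norm M (\<lambda>x. f x - ((1/2) * v m x + (1/2) * v n x)))\<^sup>2"
      by (simp only: L2_norm_cmult power_mult_distrib) simp
    moreover have "\<delta> \<le> (L2_norm M (\<lambda>x. f x - ((1/2) * v m x + (1/2) * v n x)))\<^sup>2"
      by (rule \<delta>[OF lin[OF v(1) v(1)]])
    ultimately show ?thesis using v(2)[of m] v(2)[of n] by linarith
  qed
  obtain p where p: "p \<in> L2 M" "(\<lambda>n. L2_norm M (\<lambda>x. v n x - p x)) \<longlonglongrightarrow> 0"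
  proof (rule L2_complete[of v M])
    fix e :: real assume e: "e > 0"
    obtain N where N: "inverse (real (Suc N)) < e\<^sup>2 / 4"
      using reals_Archimedean[of "e\<^sup>2 / 4"] e by auto
    have "L2_norm M (\<lambda>x. v m x - v n x) < e" if "m \<ge> N" "n \<ge> N" for m n
    proof (rule power2_less_imp_less)
      have "inverse (real (Suc m)) \<le> inverse (real (Suc N))" "inverse (real (Suc n)) \<le> inverse (real (Suc N))"
        using that by (auto intro!: le_imp_inverse_le)
      then show "(L2_norm M (\<lambda>x. v m x - v n x))\<^sup>2 < e\<^sup>2"
        using diff[of m n] N by linarith
    qed (use e in simp)
    then show "\<exists>N. \<forall>m\<ge>N. \<forall>n\<ge>N. L2_norm M (\<lambda>x. v m x - v n x) < e" by blast
  qed auto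
  have orth: "L2_inner M (\<lambda>x. f x - p x) w = 0" if w: "w \<in> V" for w
  proof -
    have wL2: "w \<in> L2 M" using w V by auto
    \<comment> \<open>A step length with \<open>s * |w|^2 \<le> 1\<close>; the summand 1 covers
      vectors \<open>w\<close> of norm zero without a separate case.\<close>
    define s where "s = inverse ((L2_norm M w)\<^sup>2 + 1)"
    have s: "s > 0" "s\<^sup>2 * (L2_norm M w)\<^sup>2 \<le> s"
    proof -
      show s0: "s > 0" unfolding s_def by (simp add: add_nonneg_pos)
      have "s * (L2_norm M w)\<^sup>2 \<le> s * ((L2_norm M w)\<^sup>2 + 1)" using s0 by (intro mult_left_mono) auto
      also have "\<dots> = 1" unfolding s_def using add_nonneg_pos[of "(L2_norm M w)\<^sup>2" 1] by simp
      finally show "s\<^sup>2 * (L2_norm M w)\<^sup>2 \<le> s"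
        using s0 mult_left_mono[of "s * (L2_norm M w)\<^sup>2" 1 s] by (simp add: power2_eq_square mult.assoc)
    qed
    \<comment> \<open>Moving from \<open>v n\<close> by \<open>s z w\<close> lowers the squared
      distance by at least \<open>s |z|^2\<close>, while \<open>v n\<close> is within
      \<open>1 / (n + 1)\<close> of the infimum.\<close>
    have small: "s * (cmod (L2_inner M (\<lambda>x. f x - v n x) w))\<^sup>2 \<le> inverse (real (Suc n))" for n
    proof -
      define z where "z = L2_inner M (\<lambda>x. f x - v n x) w"
      have "(\<lambda>x. 1 * v n x + (of_real s * z) * w x) \<in> V" using v(1) w by (rule lin)
      from \<delta>[OF this] have "\<delta> \<le> (L2_norm M (\<lambda>x. (f x - v n x) - (of_real s * z) * w x))\<^sup>2"
        by (simp add: algebra_simps)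
      also have "\<dots> = (L2_norm M (\<lambda>x. f x - v n x))\<^sup>2 - 2 * Re (of_real s * (cnj z * z)) +
          s\<^sup>2 * (cmod z)\<^sup>2 * (L2_norm M w)\<^sup>2"
        using f s(1) by (subst L2_norm_diff_power2[OF L2_diff[OF f vL2] L2_cmult[OF wL2]])
          (simp only: L2_inner_cmult_right L2_norm_cmult z_def[symmetric] norm_mult
            power_mult_distrib norm_of_real power2_abs complex_cnj_mult complex_cnj_complex_of_real mult.assoc)
      also have "cnj z * z = of_real ((cmod z)\<^sup>2)" using complex_norm_square[of z] by (simp add: mult.commute)
      also have "Re (of_real s * of_real ((cmod z)\<^sup>2)) = s * (cmod z)\<^sup>2" by simp
      also have "s\<^sup>2 * (cmod z)\<^sup>2 * (L2_norm M w)\<^sup>2 \<le> s * (cmod z)\<^sup>2"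
        using mult_right_mono[OF s(2), of "(cmod z)\<^sup>2"] by (simp add: mult_ac)
      finally show ?thesis using v(2)[of n] unfolding z_def[symmetric] by linarith
    qed
    have "(\<lambda>n. s * (cmod (L2_inner M (\<lambda>x. f x - v n x) w))\<^sup>2) \<longlonglongrightarrow> 0"
      by (rule tendsto_sandwich[OF _ _ tendsto_const LIMSEQ_inverse_real_of_nat])
         (use small s(1) in \<open>auto intro!: always_eventually\<close>)
    moreover have "(\<lambda>n. L2_inner M (\<lambda>x. f x - v n x) w) \<longlonglongrightarrow> L2_inner M (\<lambda>x. f x - p x) w"
    proof (rule L2_inner_tendsto)
      have "L2_norm M (\<lambda>x. f x - v n x - (f x - p x)) = L2_norm M (\<lambda>x. v n x - p x)" for n
        by (subst L2_norm_minus_commute) simp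
      then show "(\<lambda>n. L2_norm M (\<lambda>x. f x - v n x - (f x - p x))) \<longlonglongrightarrow> 0" using p by simp
    qed (use f p wL2 in auto)
    then have "(\<lambda>n. s * (cmod (L2_inner M (\<lambda>x. f x - v n x) w))\<^sup>2) \<longlonglongrightarrow>
        s * (cmod (L2_inner M (\<lambda>x. f x - p x) w))\<^sup>2"
      by (intro tendsto_intros)
    ultimately have "s * (cmod (L2_inner M (\<lambda>x. f x - p x) w))\<^sup>2 = 0"
      using LIMSEQ_unique by blast
    with s(1) show ?thesis by simp
  qed
  show ?thesis
    by (rule that[of "\<lambda>x. f x - p x" v]) (use f p orth v(1) in auto)
qed

section \<open>Orthonormal systems and their expansions\<close>

locale ortho_system =
  fixes M :: "'a measure" and e :: "nat \<Rightarrow> 'a \<Rightarrow> complex" and J :: "nat set"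
  assumes e_L2 [simp]: "e n \<in> L2 M"
    and e_inner: "L2_inner M (e m) (e n) = (if m = n \<and> n \<in> J then 1 else 0)"
begin

text \<open>The vectors outside \<open>J\<close> have norm zero. They pad a system of any countable
  size, finite ones included, to one indexed by all natural numbers, so that every expansion can be
  written as a series.\<close>

lemma inner_eq_0_outside:
  assumes "n \<notin> J" "f \<in> L2 M" shows "L2_inner M f (e n) = 0"
proof -
  have "L2_norm M (e n) = 0"
    using assms L2_inner_self[of M "e n"] e_inner[of n n] by simp
  then show ?thesis using L2_Cauchy_Schwarz[OF assms(2) e_L2[of n]] by simp
qed

lemma inner_sum:
  assumes "finite F" "n \<in> F" "f \<in> L2 M"
  shows "L2_inner M (\<lambda>x. \<Sum>i\<in>F. L2_inner M f (e i) * e i x) (e n) = L2_inner M f (e n)"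
proof -
  have "L2_inner M (\<lambda>x. \<Sum>i\<in>F. L2_inner M f (e i) * e i x) (e n) =
      (\<Sum>i\<in>F. L2_inner M f (e i) * L2_inner M (e i) (e n))"
    by (subst L2_inner_sum_left) auto
  also have "\<dots> = (\<Sum>i\<in>F. if i = n then L2_inner M f (e n) else 0)"
    using inner_eq_0_outside[of n f] assms by (intro sum.cong) (auto simp: e_inner)
  also have "\<dots> = L2_inner M f (e n)" using assms by simp
  finally show ?thesis .
qed

lemma norm_sum_power2:
  assumes "finite F" "f \<in> L2 M"
  shows "(L2_norm M (\<lambda>x. \<Sum>i\<in>F. L2_inner M f (e i) * e i x))\<^sup>2 = (\<Sum>i\<in>F. (cmod (L2_inner M f (e i)))\<^sup>2)"
proof -
  let ?P = "\<lambda>x. \<Sum>i\<in>F. L2_inner M f (e i) * e i x"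
  have "L2_inner M ?P ?P = (\<Sum>i\<in>F. cnj (L2_inner M f (e i)) * L2_inner M ?P (e i))"
    by (subst L2_inner_sum_right) auto
  also have "\<dots> = (\<Sum>i\<in>F. of_real ((cmod (L2_inner M f (e i)))\<^sup>2))"
  proof (intro sum.cong refl)
    fix i assume "i \<in> F"
    then show "cnj (L2_inner M f (e i)) * L2_inner M ?P (e i) = of_real ((cmod (L2_inner M f (e i)))\<^sup>2)"
      unfolding inner_sum[OF assms(1) \<open>i \<in> F\<close> assms(2)] complex_norm_square by (simp only: mult.commute)
  qed
  finally show ?thesis unfolding L2_inner_self by (simp only: of_real_sum[symmetric] of_real_eq_iff)
qed

lemma norm_diff_sum_power2:
  assumes "finite F" "f \<in> L2 M"
  shows "(L2_norm M (\<lambda>x. f x - (\<Sum>i\<in>F. L2_inner M f (e i) * e i x)))\<^sup>2 =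
    (L2_norm M f)\<^sup>2 - (\<Sum>i\<in>F. (cmod (L2_inner M f (e i)))\<^sup>2)"
proof -
  let ?P = "\<lambda>x. \<Sum>i\<in>F. L2_inner M f (e i) * e i x"
  have "L2_inner M f ?P = (\<Sum>i\<in>F. cnj (L2_inner M f (e i)) * L2_inner M f (e i))"
    using assms by (subst L2_inner_sum_right) auto
  also have "\<dots> = of_real (\<Sum>i\<in>F. (cmod (L2_inner M f (e i)))\<^sup>2)"
    unfolding of_real_sum by (intro sum.cong) (auto simp: complex_norm_square mult.commute simp del: of_real_power)
  finally have "Re (L2_inner M f ?P) = (\<Sum>i\<in>F. (cmod (L2_inner M f (e i)))\<^sup>2)" by simp
  then show ?thesis using assms by (subst L2_norm_diff_power2) (auto simp: norm_sum_power2)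
qed

lemma summable_coeff:
  assumes "f \<in> L2 M" shows "summable (\<lambda>n. (cmod (L2_inner M f (e n)))\<^sup>2)"
proof (rule bounded_imp_summable)
  fix n
  show "(\<Sum>k\<le>n. (cmod (L2_inner M f (e k)))\<^sup>2) \<le> (L2_norm M f)\<^sup>2"
    using norm_diff_sum_power2[of "{..n}" f] assms
      zero_le_power2[of "L2_norm M (\<lambda>x. f x - (\<Sum>i\<le>n. L2_inner M f (e i) * e i x))"] by simp
qed simp

lemma norm_tail_power2:
  assumes "m \<le> n" "f \<in> L2 M"
  shows "(L2_norm M (\<lambda>x. (\<Sum>i<n. L2_inner M f (e i) * e i x) - (\<Sum>i<m. L2_inner M f (e i) * e i x)))\<^sup>2 =
    (\<Sum>i=m..<n. (cmod (L2_inner M f (e i)))\<^sup>2)"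
proof -
  have "(\<Sum>i<n. L2_inner M f (e i) * e i x) - (\<Sum>i<m. L2_inner M f (e i) * e i x) =
      (\<Sum>i=m..<n. L2_inner M f (e i) * e i x)" for x
    using assms(1) sum_diff_nat_ivl[of 0 m n "\<lambda>i. L2_inner M f (e i) * e i x"]
    by (simp add: lessThan_atLeast0)
  then show ?thesis using norm_sum_power2[of "{m..<n}" f] assms by simp
qed

text \<open>Bessel's inequality makes the partial sums Cauchy. Without completeness of the system
  the limit \<open>p\<close> is merely the projection of \<open>f\<close>, recognised by its
  coefficients.\<close>

lemma series_converges:
  assumes f: "f \<in> L2 M"
  obtains p where "p \<in> L2 M" "\<And>n. L2_inner M p (e n) = L2_inner M f (e n)"
    "(\<lambda>N. L2_norm M (\<lambda>x. (\<Sum>i<N. L2_inner M f (e i) * e i x) - p x)) \<longlonglongrightarrow> 0"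
proof -
  let ?P = "\<lambda>N x. \<Sum>i<N. L2_inner M f (e i) * e i x"
  have P: "?P N \<in> L2 M" for N by auto
  obtain p where p: "p \<in> L2 M" "(\<lambda>N. L2_norm M (\<lambda>x. ?P N x - p x)) \<longlonglongrightarrow> 0"
  proof (rule L2_complete[of ?P M])
    fix \<epsilon> :: real assume \<epsilon>: "\<epsilon> > 0"
    then have "0 < \<epsilon>\<^sup>2" by simp
    with summable_coeff[OF f] obtain N where
      N: "\<And>m n. m \<ge> N \<Longrightarrow> norm (\<Sum>i=m..<n. (cmod (L2_inner M f (e i)))\<^sup>2) < \<epsilon>\<^sup>2"
      unfolding summable_Cauchy by blast
    have *: "L2_norm M (\<lambda>x. ?P n x - ?P m x) < \<epsilon>" if "m \<ge> N" "m \<le> n" for m n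
    proof (rule power2_less_imp_less)
      show "(L2_norm M (\<lambda>x. ?P n x - ?P m x))\<^sup>2 < \<epsilon>\<^sup>2"
        using N[OF that(1), of n] by (simp add: norm_tail_power2[OF that(2) f] sum_nonneg)
    qed (use \<epsilon> in simp)
    have "L2_norm M (\<lambda>x. ?P m x - ?P n x) < \<epsilon>" if "m \<ge> N" "n \<ge> N" for m n
    proof (cases "m \<le> n")
      case True
      with *[OF that(1) True] show ?thesis by (subst L2_norm_minus_commute)
    next
      case False
      with *[of n m] that show ?thesis by simp
    qed
    then show "\<exists>N. \<forall>m\<ge>N. \<forall>n\<ge>N. L2_norm M (\<lambda>x. ?P m x - ?P n x) < \<epsilon>" by blast
  qed auto
  have "L2_inner M p (e n) = L2_inner M f (e n)" for n
  proof (rule LIMSEQ_unique)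
    show "(\<lambda>N. L2_inner M (?P N) (e n)) \<longlonglongrightarrow> L2_inner M p (e n)"
      by (rule L2_inner_tendsto[OF P p(1) e_L2 p(2)])
    show "(\<lambda>N. L2_inner M (?P N) (e n)) \<longlonglongrightarrow> L2_inner M f (e n)"
      by (rule tendsto_eventually, rule eventually_sequentiallyI[of "Suc n"])
         (use f in \<open>simp add: inner_sum\<close>)
  qed
  with p that show ?thesis by blast
qed

end

locale complete_ortho_system = ortho_system +
  assumes complete: "f \<in> L2 M \<Longrightarrow> (\<And>n. L2_inner M f (e n) = 0) \<Longrightarrow> ae_eq M f (\<lambda>_. 0)"
begin

text \<open>The limit of the expansion has the same coefficients as \<open>f\<close>, so
  completeness of the system identifies the two almost everywhere, and the defect in Bessel's
  inequality tends to 0.\<close>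

lemma Parseval:
  assumes f: "f \<in> L2 M"
  shows "(\<lambda>n. (cmod (L2_inner M f (e n)))\<^sup>2) sums (L2_norm M f)\<^sup>2"
proof -
  let ?P = "\<lambda>N x. \<Sum>i<N. L2_inner M f (e i) * e i x"
  obtain p where p: "p \<in> L2 M" "\<And>n. L2_inner M p (e n) = L2_inner M f (e n)"
    "(\<lambda>N. L2_norm M (\<lambda>x. ?P N x - p x)) \<longlonglongrightarrow> 0"
    using series_converges[OF f] by blast
  have "ae_eq M (\<lambda>x. f x - p x) (\<lambda>_. 0)"
    using f p by (intro complete) auto
  then have fp: "ae_eq M f p" by (simp add: ae_eq_def)
  have "L2_norm M (\<lambda>x. f x - ?P N x) = L2_norm M (\<lambda>x. ?P N x - p x)" for N
  proof -
    have "ae_eq M (\<lambda>x. ?P N x - f x) (\<lambda>x. ?P N x - p x)"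
      using fp unfolding ae_eq_def by eventually_elim simp
    then have "L2_norm M (\<lambda>x. ?P N x - f x) = L2_norm M (\<lambda>x. ?P N x - p x)"
      using f p by (intro L2_norm_cong) auto
    then show ?thesis by (simp add: L2_norm_minus_commute)
  qed
  with p(3) have "(\<lambda>N. (L2_norm M (\<lambda>x. f x - ?P N x))\<^sup>2) \<longlonglongrightarrow> 0\<^sup>2"
    by (intro tendsto_intros) simp
  then have "(\<lambda>N. (L2_norm M f)\<^sup>2 - (\<Sum>i<N. (cmod (L2_inner M f (e i)))\<^sup>2)) \<longlonglongrightarrow> 0"
    using f by (simp add: norm_diff_sum_power2)
  then have "(\<lambda>N. (L2_norm M f)\<^sup>2 - ((L2_norm M f)\<^sup>2 - (\<Sum>i<N. (cmod (L2_inner M f (e i)))\<^sup>2))) \<longlonglongrightarrow> (L2_norm M f)\<^sup>2 - 0"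
    by (intro tendsto_intros)
  then show ?thesis by (simp add: sums_def)
qed

end


section \<open>Completeness of the eigenfunctions\<close>

locale selfadjoint_operator =
  fixes M :: "'a measure" and D :: "('a \<Rightarrow> complex) set" and A :: "('a \<Rightarrow> complex) \<Rightarrow> ('a \<Rightarrow> complex)"
  assumes selfadj: "selfadjoint M D A"
begin

lemma dom_L2 [simp]: "f \<in> D \<Longrightarrow> f \<in> L2 M"
  using selfadj unfolding selfadjoint_def densely_defined_operator_def by blast

lemma op_L2 [simp]: "f \<in> D \<Longrightarrow> A f \<in> L2 M"
  using selfadj unfolding selfadjoint_def densely_defined_operator_def by blast

lemma dom_lincomb: "f \<in> D \<Longrightarrow> g \<in> D \<Longrightarrow> (\<lambda>x. a * f x + b * g x) \<in> D"
  using selfadj unfolding selfadjoint_def densely_defined_operator_def by blast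

lemma op_lincomb:
  "f \<in> D \<Longrightarrow> g \<in> D \<Longrightarrow> ae_eq M (A (\<lambda>x. a * f x + b * g x)) (\<lambda>x. a * A f x + b * A g x)"
  using selfadj unfolding selfadjoint_def densely_defined_operator_def by blast

lemma dom_cmult: "f \<in> D \<Longrightarrow> (\<lambda>x. a * f x) \<in> D"
  using dom_lincomb[of f f a 0] by simp

lemma op_cmult: "f \<in> D \<Longrightarrow> ae_eq M (A (\<lambda>x. a * f x)) (\<lambda>x. a * A f x)"
  using op_lincomb[of f f a 0] by simp

lemma adjointI:
  assumes "g \<in> L2 M" "h \<in> L2 M" "\<And>f. f \<in> D \<Longrightarrow> L2_inner M (A f) g = L2_inner M f h"
  shows "g \<in> D" "ae_eq M (A g) h"
  using selfadj assms unfolding selfadjoint_def by blast+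

lemma symmetric: "f \<in> D \<Longrightarrow> g \<in> D \<Longrightarrow> L2_inner M (A f) g = L2_inner M f (A g)"
  using selfadj dom_L2[of g] op_L2[of g] ae_eq_refl[of M "A g"] unfolding selfadjoint_def by blast

text \<open>The adjoint sees a function only through inner products, and the operator has the same
  graph as its adjoint; hence domain and values are insensitive to null sets.\<close>

lemma dom_ae_closed:
  assumes "g \<in> D" "g' \<in> L2 M" "ae_eq M g g'"
  shows "g' \<in> D" "ae_eq M (A g') (A g)"
proof -
  have "L2_inner M (A f) g' = L2_inner M f (A g)" if "f \<in> D" for f
  proof -
    have "L2_inner M (A f) g' = L2_inner M (A f) g"
      using assms that by (intro L2_inner_cong) (auto intro: ae_eq_sym)
    then show ?thesis using symmetric[OF that assms(1)] by simp
  qed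
  then show "g' \<in> D" "ae_eq M (A g') (A g)" using adjointI[of g' "A g"] assms by auto
qed

lemma op_zero:
  assumes "f \<in> D" "ae_eq M f (\<lambda>_. 0)" shows "ae_eq M (A f) (\<lambda>_. 0)"
proof -
  have "ae_eq M (A (\<lambda>x. 0 * f x)) (\<lambda>x. 0 * A f x)" by (rule op_cmult[OF assms(1)])
  moreover have "ae_eq M (A (\<lambda>x. 0 * f x)) (A f)"
    using assms(2) by (intro dom_ae_closed(2)[OF assms(1)]) (auto intro: ae_eq_sym)
  ultimately show ?thesis using ae_eq_trans ae_eq_sym by fastforce
qed

definition shifted :: "real \<Rightarrow> ('a \<Rightarrow> complex) \<Rightarrow> ('a \<Rightarrow> complex)" where
  "shifted c f x = A f x - of_real c * f x"

lemma shifted_L2 [simp]: "f \<in> D \<Longrightarrow> shifted c f \<in> L2 M"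
  unfolding shifted_def[abs_def] by auto

lemma shifted_lincomb:
  assumes "f \<in> D" "g \<in> D"
  shows "ae_eq M (shifted c (\<lambda>x. a * f x + b * g x)) (\<lambda>x. a * shifted c f x + b * shifted c g x)"
  using op_lincomb[OF assms, of a b] unfolding ae_eq_def
  by eventually_elim (simp add: shifted_def algebra_simps)

lemma shifted_symmetric:
  assumes "f \<in> D" "g \<in> D"
  shows "L2_inner M (shifted c f) g = L2_inner M f (shifted c g)"
  unfolding shifted_def[abs_def] using assms symmetric[OF assms] by simp

end

locale discrete_operator =
  fixes M :: "'a measure" and D :: "('a \<Rightarrow> complex) set" and A :: "('a \<Rightarrow> complex) \<Rightarrow> ('a \<Rightarrow> complex)"
    and I :: "'i set" and lam :: "'i \<Rightarrow> real" and u :: "'i \<Rightarrow> 'a \<Rightarrow> complex"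
  assumes nonneg: "nonnegative_selfadjoint M D A"
    and spec: "purely_discrete_spectrum M D A I lam u"
begin

sublocale selfadjoint_operator M D A
  using nonneg by unfold_locales (simp add: nonnegative_selfadjoint_def)

lemma u_dom [simp]: "m \<in> I \<Longrightarrow> u m \<in> D"
  and op_u: "m \<in> I \<Longrightarrow> ae_eq M (A (u m)) (\<lambda>x. of_real (lam m) * u m x)"
  using spec unfolding purely_discrete_spectrum_def eigenfunction_def by blast+

lemma u_inner: "m \<in> I \<Longrightarrow> n \<in> I \<Longrightarrow> L2_inner M (u m) (u n) = (if m = n then 1 else 0)"
  using spec unfolding purely_discrete_spectrum_def by blast

lemma finite_lam_le: "finite {m \<in> I. lam m \<le> R}"
  using spec unfolding purely_discrete_spectrum_def by blast

lemma inner_op_u: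
  assumes "f \<in> D" "m \<in> I"
  shows "L2_inner M (A f) (u m) = of_real (lam m) * L2_inner M f (u m)"
proof -
  have "L2_inner M (A f) (u m) = L2_inner M f (\<lambda>x. of_real (lam m) * u m x)"
    unfolding symmetric[OF assms(1) u_dom[OF assms(2)]]
    using assms op_u[OF assms(2)] by (intro L2_inner_cong) auto
  then show ?thesis by simp
qed

lemma lam_nonneg: assumes "m \<in> I" shows "0 \<le> lam m"
proof -
  have "0 \<le> Re (L2_inner M (A (u m)) (u m))"
    using nonneg u_dom[OF assms] unfolding nonnegative_selfadjoint_def by blast
  then show ?thesis using assms by (simp add: inner_op_u u_inner)
qed

lemma shifted_onto:
  assumes "c \<notin> lam ` I" "h \<in> L2 M"
  obtains f where "f \<in> D" "ae_eq M (shifted c f) h"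
proof -
  have "complex_of_real c \<notin> op_spectrum M D A"
    using spec assms(1) unfolding purely_discrete_spectrum_def by (auto simp: image_iff)
  then show ?thesis using that assms(2)
    unfolding op_spectrum_def resolvent_set_def shifted_def by fastforce
qed

lemma shifted_bounded_below:
  assumes "c \<notin> lam ` I"
  obtains K where "\<And>f. f \<in> D \<Longrightarrow> L2_norm M f \<le> K * L2_norm M (shifted c f)"
proof -
  have "complex_of_real c \<notin> op_spectrum M D A"
    using spec assms(1) unfolding purely_discrete_spectrum_def by (auto simp: image_iff)
  then show ?thesis using that
    unfolding op_spectrum_def resolvent_set_def shifted_def[abs_def] by fastforce
qed

text \<open>One family serves two purposes: \<open>J = {}\<close> is the whole domain and yields the
  spectral gap, while \<open>J = I\<close> is the subspace that completeness has to show to be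
  trivial.\<close>

definition orth_dom :: "'i set \<Rightarrow> ('a \<Rightarrow> complex) set" where
  "orth_dom J = {f \<in> D. \<forall>m\<in>J. L2_inner M f (u m) = 0}"

lemma orth_dom_D [dest]: "f \<in> orth_dom J \<Longrightarrow> f \<in> D"
  by (simp add: orth_dom_def)

lemma orth_dom_lincomb:
  assumes "J \<subseteq> I" "f \<in> orth_dom J" "g \<in> orth_dom J"
  shows "(\<lambda>x. a * f x + b * g x) \<in> orth_dom J"
  using assms by (auto simp: orth_dom_def dom_lincomb subset_iff)

text \<open>
  The minimum \<open>s\<close> of \<open>\<parallel>(A - c)f\<parallel>\<close> over unit vectors is the distance from \<open>c\<close> to the spectrum: for
  almost minimising \<open>f\<close> and \<open>k = (A - c)\<^sup>-\<^sup>1 f\<close>, the vector \<open>(A - c - s)(A - c + s) k\<close> is small.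
\<close>

lemma distance_to_spectrum:
  assumes c: "c \<notin> lam ` I" and J: "J \<subseteq> I" and f0: "f0 \<in> orth_dom J" "L2_norm M f0 \<noteq> 0"
  obtains s where "s > 0" "\<And>f. f \<in> orth_dom J \<Longrightarrow> s * L2_norm M f \<le> L2_norm M (shifted c f)"
    "\<And>K K'. \<lbrakk>\<And>f. f \<in> orth_dom J \<Longrightarrow> L2_norm M f \<le> K * L2_norm M (shifted (c + s) f);
       \<And>f. f \<in> orth_dom J \<Longrightarrow> L2_norm M f \<le> K' * L2_norm M (shifted (c - s) f)\<rbrakk> \<Longrightarrow> False"
proof -
  define U where "U = {f \<in> orth_dom J. L2_norm M f = 1}"
  define s where "s = (INF f\<in>U. L2_norm M (shifted c f))"
  have norm_cmult_shifted: "L2_norm M (shifted c (\<lambda>x. a * f x)) = cmod a * L2_norm M (shifted c f)"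
    if "f \<in> D" for a f
  proof -
    have "ae_eq M (shifted c (\<lambda>x. a * f x)) (\<lambda>x. a * shifted c f x)"
      using shifted_lincomb[OF that that, of c a 0] by simp
    then have "L2_norm M (shifted c (\<lambda>x. a * f x)) = L2_norm M (\<lambda>x. a * shifted c f x)"
      using that by (intro L2_norm_cong shifted_L2[OF dom_cmult]) auto
    then show ?thesis by simp
  qed
  have normalize: "(\<lambda>x. of_real (inverse (L2_norm M f)) * f x) \<in> U"
    if "f \<in> orth_dom J" "L2_norm M f \<noteq> 0" for f
    using that orth_dom_lincomb[OF J that(1) that(1), of "of_real (inverse (L2_norm M f))" 0]
    by (simp add: U_def norm_inverse)
  have U: "U \<noteq> {}" using normalize[OF f0] by auto
  have bdd: "bdd_below ((\<lambda>f. L2_norm M (shifted c f)) ` U)" by (rule bdd_belowI[of _ 0]) auto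
  obtain K0 where K0: "\<And>f. f \<in> D \<Longrightarrow> L2_norm M f \<le> K0 * L2_norm M (shifted c f)"
    using shifted_bounded_below[OF c] by blast
  \<comment> \<open>The bound \<open>K0\<close> carries no sign of its own; taking the maximum with
    1 gives a positive lower bound for the infimum.\<close>
  have "inverse (max K0 1) \<le> s"
    unfolding s_def
  proof (rule cINF_greatest[OF U])
    fix f assume "f \<in> U"
    then have "1 \<le> K0 * L2_norm M (shifted c f)" using K0[of f] by (auto simp: U_def)
    also have "\<dots> \<le> max K0 1 * L2_norm M (shifted c f)" by (intro mult_right_mono) auto
    finally show "inverse (max K0 1) \<le> L2_norm M (shifted c f)" by (simp add: field_simps)
  qed
  moreover have "0 < inverse (max K0 1)" by simp
  ultimately have s: "s > 0" by linarith
  have min: "s * L2_norm M f \<le> L2_norm M (shifted c f)" if f: "f \<in> orth_dom J" for f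
  proof (cases "L2_norm M f = 0")
    case False
    then have pos: "L2_norm M f > 0" using L2_norm_nonneg[of M f] by linarith
    have "s \<le> L2_norm M (shifted c (\<lambda>x. of_real (inverse (L2_norm M f)) * f x))"
      unfolding s_def by (rule cINF_lower[OF bdd normalize[OF f False]])
    also have "\<dots> = inverse (L2_norm M f) * L2_norm M (shifted c f)"
      using f by (subst norm_cmult_shifted) (auto simp: norm_inverse)
    finally show ?thesis using pos by (simp add: field_simps)
  qed simp
  \<comment> \<open>With \<open>y = f + s k\<close> one has
    \<open>(A - c - s) y = h - s^2 k\<close>, which is small, and \<open>(A - c + s) k = y\<close>.
    The first bound makes \<open>y\<close> small, the second then makes \<open>k\<close> small,
    against \<open>f = y - s k\<close> having norm 1.\<close>
  have False if K: "\<And>f. f \<in> orth_dom J \<Longrightarrow> L2_norm M f \<le> K * L2_norm M (shifted (c + s) f)"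
    and K': "\<And>f. f \<in> orth_dom J \<Longrightarrow> L2_norm M f \<le> K' * L2_norm M (shifted (c - s) f)" for K K'
  proof -
    have main: "1 \<le> (1 + s * \<bar>K'\<bar>) * (\<bar>K\<bar> * sqrt ((s + \<eta>)\<^sup>2 - s\<^sup>2))" if \<eta>: "\<eta> > 0" for \<eta>
    proof -
      obtain f where f: "f \<in> U" "L2_norm M (shifted c f) < s + \<eta>"
        using cINF_less_iff[OF U bdd, of "s + \<eta>"] \<eta> unfolding s_def[symmetric] by auto
      then have fJ: "f \<in> orth_dom J" and f1: "L2_norm M f = 1" by (auto simp: U_def)
      have fD [simp]: "f \<in> D" "f \<in> L2 M" using fJ by auto
      obtain k where kD: "k \<in> D" and k: "ae_eq M (shifted c k) f"
        using shifted_onto[OF c fD(2)] by blast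
      have [simp]: "k \<in> L2 M" using kD by simp
      have "L2_inner M k (u m) = 0" if m: "m \<in> J" for m
      proof -
        have mI: "m \<in> I" using m J by auto
        have "0 = L2_inner M f (u m)" using fJ m by (simp add: orth_dom_def)
        also have "\<dots> = L2_inner M (shifted c k) (u m)"
          using k kD mI by (intro L2_inner_cong) (auto intro: ae_eq_sym)
        also have "\<dots> = of_real (lam m - c) * L2_inner M k (u m)"
          using kD mI unfolding shifted_def[abs_def] by (simp add: inner_op_u algebra_simps)
        finally show ?thesis using c mI by auto
      qed
      then have kJ: "k \<in> orth_dom J" using kD by (simp add: orth_dom_def)
      define h where "h = shifted c f"
      have hL2 [simp]: "h \<in> L2 M" by (simp add: h_def)
      have nk: "L2_norm M (shifted c k) = 1"
        using L2_norm_cong[OF k] kD f1 by simp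
      have sk: "s * L2_norm M k \<le> 1" using min[OF kJ] nk by simp
      have hk: "L2_inner M h k = 1"
      proof -
        have "L2_inner M h k = L2_inner M f (shifted c k)"
          unfolding h_def by (rule shifted_symmetric) (use kD in auto)
        also have "\<dots> = L2_inner M f f" using k kD by (intro L2_inner_cong) auto
        finally show ?thesis using f1 by (simp add: L2_inner_self)
      qed
      \<comment> \<open>Here \<open>|h|\<close> is almost \<open>s\<close>, the inner product of
        \<open>h\<close> and \<open>k\<close> is exactly 1 by symmetry, and
        \<open>s |k| \<le> 1\<close> by minimality of \<open>s\<close>; so the square is at most
        \<open>(s + \<eta>)^2 - 2 s^2 + s^2\<close>.\<close>
      have "(L2_norm M (\<lambda>x. h x - of_real (s\<^sup>2) * k x))\<^sup>2 =
          (L2_norm M h)\<^sup>2 - 2 * s\<^sup>2 + (s * (s * L2_norm M k))\<^sup>2"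
        by (subst L2_norm_diff_power2) (auto simp: hk power_mult_distrib norm_mult simp flip: of_real_power power_mult)
      also have "(s * (s * L2_norm M k))\<^sup>2 \<le> s\<^sup>2"
        using s mult_left_mono[OF sk, of s] by (intro power_mono) auto
      also have "(L2_norm M h)\<^sup>2 \<le> (s + \<eta>)\<^sup>2" using f(2) by (intro power_mono) (auto simp: h_def)
      finally have "(L2_norm M (\<lambda>x. h x - of_real (s\<^sup>2) * k x))\<^sup>2 \<le> (s + \<eta>)\<^sup>2 - s\<^sup>2" by simp
      then have small: "L2_norm M (\<lambda>x. h x - of_real (s\<^sup>2) * k x) \<le> sqrt ((s + \<eta>)\<^sup>2 - s\<^sup>2)"
        by (rule real_le_rsqrt)
      define y where "y = (\<lambda>x. 1 * f x + of_real s * k x)"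
      have yJ: "y \<in> orth_dom J" unfolding y_def by (rule orth_dom_lincomb[OF J fJ kJ])
      have yL2 [simp]: "y \<in> L2 M" using yJ by auto
      have "ae_eq M (shifted (c + s) y) (\<lambda>x. h x - of_real (s\<^sup>2) * k x)"
        using op_lincomb[OF fD(1) kD, of 1 "of_real s"] k unfolding ae_eq_def
        by eventually_elim (simp add: y_def h_def shifted_def power2_eq_square algebra_simps)
      then have "L2_norm M (shifted (c + s) y) = L2_norm M (\<lambda>x. h x - of_real (s\<^sup>2) * k x)"
        using yJ by (intro L2_norm_cong) auto
      then have "L2_norm M y \<le> K * L2_norm M (\<lambda>x. h x - of_real (s\<^sup>2) * k x)" using K[OF yJ] by simp
      also have "\<dots> \<le> \<bar>K\<bar> * sqrt ((s + \<eta>)\<^sup>2 - s\<^sup>2)" using small by (intro mult_mono) auto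
      finally have ny: "L2_norm M y \<le> \<bar>K\<bar> * sqrt ((s + \<eta>)\<^sup>2 - s\<^sup>2)" .
      have "ae_eq M (shifted (c - s) k) y"
        using k unfolding ae_eq_def
        by eventually_elim (simp add: y_def shifted_def algebra_simps)
      then have "L2_norm M (shifted (c - s) k) = L2_norm M y"
        using kD by (intro L2_norm_cong) auto
      then have "L2_norm M k \<le> K' * L2_norm M y" using K'[OF kJ] by simp
      also have "\<dots> \<le> \<bar>K'\<bar> * L2_norm M y" by (intro mult_right_mono) auto
      finally have nk': "s * L2_norm M k \<le> s * (\<bar>K'\<bar> * L2_norm M y)" using s by (intro mult_left_mono) auto
      have "1 = L2_norm M (\<lambda>x. y x - of_real s * k x)" using f1 by (simp add: y_def)
      also have "\<dots> \<le> L2_norm M y + s * L2_norm M k"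
        using L2_norm_triangle[of y M "\<lambda>x. - (of_real s * k x)"] s by simp
      also have "\<dots> \<le> (1 + s * \<bar>K'\<bar>) * L2_norm M y" using nk' by (simp add: algebra_simps)
      also have "\<dots> \<le> (1 + s * \<bar>K'\<bar>) * (\<bar>K\<bar> * sqrt ((s + \<eta>)\<^sup>2 - s\<^sup>2))"
        using ny s by (intro mult_left_mono) auto
      finally show ?thesis .
    qed
    have "(\<lambda>n. (1 + s * \<bar>K'\<bar>) * (\<bar>K\<bar> * sqrt ((s + inverse (real (Suc n)))\<^sup>2 - s\<^sup>2))) \<longlonglongrightarrow>
        (1 + s * \<bar>K'\<bar>) * (\<bar>K\<bar> * sqrt ((s + 0)\<^sup>2 - s\<^sup>2))"
      by (intro tendsto_intros LIMSEQ_inverse_real_of_nat)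
    from LIMSEQ_le_const[OF this, of 1] show False using main by auto
  qed
  with that s min show ?thesis by blast
qed

text \<open>If the infimum \<open>s\<close> were smaller than \<open>\<delta>\<close>, both
  \<open>c + s\<close> and \<open>c - s\<close> would lie off the spectrum and the two shifts would
  be bounded below, which the extremality of \<open>s\<close> excludes.\<close>

lemma spectral_gap:
  assumes \<delta>: "\<delta> > 0" and gap: "\<And>m. m \<in> I \<Longrightarrow> \<delta> \<le> \<bar>lam m - c\<bar>" and f: "f \<in> D"
  shows "\<delta> * L2_norm M f \<le> L2_norm M (shifted c f)"
proof (cases "L2_norm M f = 0")
  case False
  have D: "orth_dom {} = D" by (simp add: orth_dom_def)
  have c: "c \<notin> lam ` I" using gap \<delta> by force
  have "f \<in> orth_dom {}" using f by (simp add: D)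
  from distance_to_spectrum[OF c _ this False] obtain s where
    s: "s > 0" "\<And>f. f \<in> D \<Longrightarrow> s * L2_norm M f \<le> L2_norm M (shifted c f)"
    "\<And>K K'. \<lbrakk>\<And>f. f \<in> D \<Longrightarrow> L2_norm M f \<le> K * L2_norm M (shifted (c + s) f);
       \<And>f. f \<in> D \<Longrightarrow> L2_norm M f \<le> K' * L2_norm M (shifted (c - s) f)\<rbrakk> \<Longrightarrow> False"
    unfolding D by (metis empty_subsetI)
  have "\<delta> \<le> s"
  proof (rule ccontr)
    assume "\<not> \<delta> \<le> s"
    then have "c + s \<notin> lam ` I" "c - s \<notin> lam ` I" using gap s(1) by force+
    then show False using s(3) by (metis shifted_bounded_below)
  qed
  then have "\<delta> * L2_norm M f \<le> s * L2_norm M f" by (intro mult_right_mono) auto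
  then show ?thesis using s(2)[OF f] by linarith
qed simp

text \<open>
  Write \<open>S = A - l\<close>. The spectral gaps on the two sides of \<open>l\<close> give \<open>\<parallel>S f\<parallel>\<^sup>2 \<ge> \<kappa> \<bar>\<langle>S f, f\<rangle>\<bar>\<close>, which
  polarises to a bound for \<open>\<langle>S g, f\<rangle>\<close> in terms of \<open>\<parallel>S g\<parallel>\<close> and \<open>\<parallel>S f\<parallel>\<close>. A vector \<open>g\<close> orthogonal to
  the eigenfunctions is orthogonal to the kernel of \<open>S\<close>, hence a limit of vectors \<open>S f\<close>.
\<close>

lemma shifted_bounded_below_orth:
  assumes \<kappa>: "\<kappa> > 0" and isol: "\<And>m. m \<in> I \<Longrightarrow> lam m \<noteq> l \<Longrightarrow> \<kappa> \<le> \<bar>lam m - l\<bar>"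
    and g: "g \<in> orth_dom I"
  shows "\<kappa> * L2_norm M g \<le> L2_norm M (shifted l g)"
proof -
  have form: "\<kappa> * \<bar>Re (L2_inner M (shifted l f) f)\<bar> \<le> (L2_norm M (shifted l f))\<^sup>2" if f: "f \<in> D" for f
  proof -
    have *: "\<kappa> * (\<sigma> * Re (L2_inner M (shifted l f) f)) \<le> (L2_norm M (shifted l f))\<^sup>2" if \<sigma>: "\<bar>\<sigma>\<bar> = 1" for \<sigma> :: real
    proof -
      \<comment> \<open>The point halfway into the gap on either side of \<open>l\<close> has
        distance at least \<open>\<kappa> / 2\<close> from the spectrum. Squaring cancels the terms
        in \<open>|f|^2\<close> and leaves the quadratic form with the sign
        \<open>\<sigma>\<close>.\<close>
      have "\<kappa> / 2 * L2_norm M f \<le> L2_norm M (shifted (l + \<sigma> * \<kappa> / 2) f)"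
      proof (rule spectral_gap[OF _ _ f])
        fix m assume "m \<in> I"
        then have "lam m = l \<or> \<kappa> \<le> \<bar>lam m - l\<bar>" using isol by blast
        moreover have "\<sigma> = 1 \<or> \<sigma> = -1" using \<sigma> by linarith
        ultimately show "\<kappa> / 2 \<le> \<bar>lam m - (l + \<sigma> * \<kappa> / 2)\<bar>"
          using \<kappa> by (elim disjE) (auto simp: abs_if field_simps split: if_splits)
      qed (use \<kappa> in simp)
      then have "(\<kappa> / 2 * L2_norm M f)\<^sup>2 \<le> (L2_norm M (shifted (l + \<sigma> * \<kappa> / 2) f))\<^sup>2"
        using \<kappa> by (intro power_mono) auto
      also have "shifted (l + \<sigma> * \<kappa> / 2) f = (\<lambda>x. shifted l f x - of_real (\<sigma> * \<kappa> / 2) * f x)"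
        by (auto simp: shifted_def algebra_simps)
      also have "(L2_norm M (\<lambda>x. shifted l f x - of_real (\<sigma> * \<kappa> / 2) * f x))\<^sup>2 =
          (L2_norm M (shifted l f))\<^sup>2 - \<sigma> * \<kappa> * Re (L2_inner M (shifted l f) f) + (\<kappa> / 2 * L2_norm M f)\<^sup>2"
      proof -
        have n: "cmod (complex_of_real (\<sigma> * \<kappa> / 2)) = \<kappa> / 2"
          using \<sigma> \<kappa> by (simp only: norm_of_real abs_mult abs_divide)
        have re: "Re (cnj (complex_of_real (\<sigma> * \<kappa> / 2)) * z) = \<sigma> * \<kappa> / 2 * Re z" for z by simp
        show ?thesis
          unfolding L2_norm_diff_power2[OF shifted_L2[OF f] L2_cmult[OF dom_L2[OF f]]]
            L2_inner_cmult_right L2_norm_cmult n re by simp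
      qed
      finally show ?thesis by (simp add: mult_ac)
    qed
    from *[of 1] *[of "-1"] show ?thesis by (simp add: abs_if split: if_splits)
  qed
  have polar: "2 * \<kappa> * Re (L2_inner M (shifted l f) f') \<le> (L2_norm M (shifted l f))\<^sup>2 + (L2_norm M (shifted l f'))\<^sup>2"
    if f: "f \<in> D" and f': "f' \<in> D" for f f'
  proof -
    \<comment> \<open>The bound \<open>form\<close> is applied to \<open>f + f'\<close> and to
      \<open>f - f'\<close> with opposite signs, so that on addition the diagonal terms of the form
      and the cross terms of the norms both cancel.\<close>
    have *: "\<kappa> * (\<sigma> * (Re (L2_inner M (shifted l f) f) + Re (L2_inner M (shifted l f') f') + 2 * \<sigma> * Re (L2_inner M (shifted l f) f'))) \<le>
        (L2_norm M (shifted l f))\<^sup>2 + (L2_norm M (shifted l f'))\<^sup>2 + 2 * \<sigma> * Re (L2_inner M (shifted l f) (shifted l f'))"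
      if \<sigma>: "\<sigma>\<^sup>2 = 1" for \<sigma> :: real
    proof -
      let ?p = "\<lambda>x. 1 * f x + of_real \<sigma> * f' x" and ?q = "\<lambda>x. 1 * shifted l f x + of_real \<sigma> * shifted l f' x"
      have p: "?p \<in> D" by (rule dom_lincomb[OF f f'])
      have q: "?q \<in> L2 M" by (intro L2_add L2_cmult shifted_L2 f f')
      have pq: "ae_eq M (shifted l ?p) ?q" by (rule shifted_lincomb[OF f f'])
      have "L2_inner M (shifted l ?p) ?p = L2_inner M ?q ?p"
        using p q by (intro L2_inner_cong pq) auto
      also have "\<dots> = L2_inner M (shifted l f) f + of_real \<sigma> * L2_inner M (shifted l f) f' +
          of_real \<sigma> * L2_inner M (shifted l f') f + of_real (\<sigma>\<^sup>2) * L2_inner M (shifted l f') f'"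
        using f f' by (simp add: algebra_simps power2_eq_square)
      also have "L2_inner M (shifted l f') f = cnj (L2_inner M (shifted l f) f')"
        using shifted_symmetric[OF f' f, of l] L2_inner_cnj[of M f' "shifted l f"] by simp
      finally have 1: "Re (L2_inner M (shifted l ?p) ?p) = Re (L2_inner M (shifted l f) f) +
          Re (L2_inner M (shifted l f') f') + 2 * \<sigma> * Re (L2_inner M (shifted l f) f')"
        unfolding \<sigma> by simp
      have "L2_norm M (shifted l ?p) = L2_norm M ?q"
        using p q by (intro L2_norm_cong pq) auto
      then have 2: "(L2_norm M (shifted l ?p))\<^sup>2 = (L2_norm M (shifted l f))\<^sup>2 +
          2 * \<sigma> * Re (L2_inner M (shifted l f) (shifted l f')) + (L2_norm M (shifted l f'))\<^sup>2"
        using L2_norm_add_power2[of "\<lambda>x. 1 * shifted l f x" M "\<lambda>x. of_real \<sigma> * shifted l f' x"] f f' \<sigma>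
        by (simp add: power_mult_distrib)
      have "\<sigma> * r \<le> \<bar>r\<bar>" for r using \<sigma> by (auto simp: power2_eq_1_iff)
      then have "\<kappa> * (\<sigma> * Re (L2_inner M (shifted l ?p) ?p)) \<le> \<kappa> * \<bar>Re (L2_inner M (shifted l ?p) ?p)\<bar>"
        using \<kappa> by (intro mult_left_mono) auto
      also have "\<dots> \<le> (L2_norm M (shifted l ?p))\<^sup>2" by (rule form[OF p])
      finally show ?thesis unfolding 1 2 by simp
    qed
    from *[of 1] *[of "-1"] show ?thesis by (simp add: algebra_simps)
  qed
  \<comment> \<open>The range of \<open>A - l\<close>, saturated under changes on null sets because
    \<open>shifted\<close> is linear only up to such changes.\<close>
  define V where "V = {w \<in> L2 M. \<exists>f\<in>D. ae_eq M w (shifted l f)}"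
  have gD [simp]: "g \<in> D" "g \<in> L2 M" using g by auto
  obtain q v where q: "q \<in> L2 M" "\<And>w. w \<in> V \<Longrightarrow> L2_inner M q w = 0"
    and v: "\<And>n. v n \<in> V" "(\<lambda>n. L2_norm M (\<lambda>x. v n x - (g x - q x))) \<longlonglongrightarrow> 0"
  proof (rule L2_projection[of V M g])
    show "V \<subseteq> L2 M" by (auto simp: V_def)
    have "shifted l g \<in> V" using shifted_L2[OF gD(1)] gD(1) ae_eq_refl unfolding V_def by blast
    then show "V \<noteq> {}" by blast
    show "(\<lambda>x. a * w x + b * w' x) \<in> V" if w: "w \<in> V" and w': "w' \<in> V" for w w' a b
    proof -
      obtain f f' where f: "f \<in> D" "ae_eq M w (shifted l f)" and f': "f' \<in> D" "ae_eq M w' (shifted l f')"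
        using w w' by (auto simp: V_def)
      have "ae_eq M (\<lambda>x. a * w x + b * w' x) (shifted l (\<lambda>x. a * f x + b * f' x))"
        using shifted_lincomb[OF f(1) f'(1), of l a b] f(2) f'(2) unfolding ae_eq_def
        by eventually_elim simp
      then show ?thesis using w w' dom_lincomb[OF f(1) f'(1)] by (auto simp: V_def)
    qed
  qed auto
  have vL2 [simp]: "v n \<in> L2 M" for n using v(1) by (auto simp: V_def)
  \<comment> \<open>Orthogonality to the range says that \<open>q\<close> belongs to the domain of
    the adjoint with value \<open>l q\<close>; self-adjointness then makes \<open>q\<close> an
    eigenfunction for \<open>l\<close>, hence a finite combination of the \<open>u n\<close> and
    orthogonal to \<open>g\<close>.\<close>
  have ker: "L2_inner M (A f) q = L2_inner M f (\<lambda>x. of_real l * q x)" if "f \<in> D" for f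
  proof -
    have "shifted l f \<in> V" using that shifted_L2[OF that] ae_eq_refl unfolding V_def by blast
    then have "L2_inner M (shifted l f) q = 0" using q(2) L2_inner_cnj by (metis complex_cnj_zero)
    then show ?thesis using that q(1) unfolding shifted_def[abs_def] by simp
  qed
  have "eigenfunction M D A l q"
    using adjointI[OF q(1) _ ker] q(1) by (auto simp: eigenfunction_def)
  then have "ae_eq M q (\<lambda>x. \<Sum>n | n \<in> I \<and> lam n = l. L2_inner M q (u n) * u n x)"
    using spec unfolding purely_discrete_spectrum_def by blast
  then have "L2_inner M g q = L2_inner M g (\<lambda>x. \<Sum>n | n \<in> I \<and> lam n = l. L2_inner M q (u n) * u n x)"
    using q(1) by (intro L2_inner_cong) auto
  also have "\<dots> = 0"
    using g by (subst L2_inner_sum_right) (auto simp: orth_dom_def)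
  finally have gq: "L2_inner M g q = 0" .
  have "(\<lambda>n. L2_inner M (v n) q) \<longlonglongrightarrow> L2_inner M (\<lambda>x. g x - q x) q"
    using q(1) v(2) by (intro L2_inner_tendsto) auto
  moreover have "L2_inner M (v n) q = 0" for n using q(2)[OF v(1)] L2_inner_cnj by (metis complex_cnj_zero)
  ultimately have "L2_inner M (\<lambda>x. g x - q x) q = 0" by (simp add: LIMSEQ_const_iff)
  then have "L2_inner M q q = 0" using q(1) gq by simp
  then have "L2_norm M q = 0" by (simp add: L2_inner_self)
  then have q0: "AE x in M. q x = 0" using q(1) by (simp add: L2_norm_eq_0_iff)
  have "L2_norm M (\<lambda>x. v n x - (g x - q x)) = L2_norm M (\<lambda>x. v n x - g x)" for n
  proof (rule L2_norm_cong)
    show "ae_eq M (\<lambda>x. v n x - (g x - q x)) (\<lambda>x. v n x - g x)"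
      using q0 unfolding ae_eq_def by eventually_elim simp
  qed (use q(1) in auto)
  with v(2) have vg: "(\<lambda>n. L2_norm M (\<lambda>x. v n x - g x)) \<longlonglongrightarrow> 0" by simp
  \<comment> \<open>For \<open>v n = (A - l) f\<close> the scaling of \<open>f\<close> by
    \<open>\<kappa>\<close> gives both sides the factor \<open>\<kappa>^2\<close>. In the limit
    \<open>v n\<close> may be replaced by \<open>g\<close>, and half of the left side absorbs the
    last term.\<close>
  have step: "2 * \<kappa>\<^sup>2 * Re (L2_inner M (v n) g) \<le> (L2_norm M (shifted l g))\<^sup>2 + \<kappa>\<^sup>2 * (L2_norm M (v n))\<^sup>2" for n
  proof -
    obtain f where f: "f \<in> D" "ae_eq M (v n) (shifted l f)" using v(1)[of n] by (auto simp: V_def)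
    let ?f = "\<lambda>x. of_real \<kappa> * f x"
    have kf: "?f \<in> D" using f by (intro dom_cmult)
    have eq: "ae_eq M (shifted l ?f) (\<lambda>x. of_real \<kappa> * v n x)"
      using shifted_lincomb[OF f(1) f(1), of l "of_real \<kappa>" 0] f(2) unfolding ae_eq_def
      by eventually_elim simp
    have "2 * \<kappa> * Re (L2_inner M (shifted l ?f) g) \<le> (L2_norm M (shifted l ?f))\<^sup>2 + (L2_norm M (shifted l g))\<^sup>2"
      by (rule polar[OF kf gD(1)])
    moreover have "L2_inner M (shifted l ?f) g = L2_inner M (\<lambda>x. of_real \<kappa> * v n x) g"
      using kf by (intro L2_inner_cong eq) auto
    moreover have "L2_norm M (shifted l ?f) = L2_norm M (\<lambda>x. of_real \<kappa> * v n x)"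
      using kf by (intro L2_norm_cong eq) auto
    ultimately show ?thesis using \<kappa> by (simp add: power_mult_distrib power2_eq_square algebra_simps)
  qed
  have lim1: "(\<lambda>n. L2_inner M (v n) g) \<longlonglongrightarrow> L2_inner M g g"
    using vg by (intro L2_inner_tendsto) auto
  have lim2: "(\<lambda>n. (L2_norm M (v n))\<^sup>2) \<longlonglongrightarrow> (L2_norm M g)\<^sup>2"
  proof -
    have "(L2_norm M (v n))\<^sup>2 = (L2_norm M (\<lambda>x. v n x - g x))\<^sup>2 + 2 * Re (L2_inner M (v n) g) - (L2_norm M g)\<^sup>2" for n
      by (subst L2_norm_diff_power2) auto
    moreover have "(\<lambda>n. (L2_norm M (\<lambda>x. v n x - g x))\<^sup>2 + 2 * Re (L2_inner M (v n) g) - (L2_norm M g)\<^sup>2) \<longlonglongrightarrow>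
        0\<^sup>2 + 2 * Re (L2_inner M g g) - (L2_norm M g)\<^sup>2"
      by (intro tendsto_intros vg lim1)
    ultimately show ?thesis by (simp add: L2_inner_self)
  qed
  have "2 * \<kappa>\<^sup>2 * Re (L2_inner M g g) \<le> (L2_norm M (shifted l g))\<^sup>2 + \<kappa>\<^sup>2 * (L2_norm M g)\<^sup>2"
    by (rule LIMSEQ_le[OF tendsto_mult[OF tendsto_const tendsto_Re[OF lim1]]
          tendsto_add[OF tendsto_const tendsto_mult[OF tendsto_const lim2]]]) (use step in auto)
  then have "(\<kappa> * L2_norm M g)\<^sup>2 \<le> (L2_norm M (shifted l g))\<^sup>2"
    by (simp add: L2_inner_self power_mult_distrib)
  then show ?thesis by (rule power2_le_imp_le) simp
qed

text \<open>On the part of the domain orthogonal to all \<open>u m\<close> every real shift is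
  bounded below, even at an eigenvalue. A shift can then never be extremal, so this part contains
  only null functions. Inverting the shift by -1, a point below the spectrum, carries the conclusion
  from the domain to all of L2.\<close>

theorem eigenfunctions_complete:
  assumes f: "f \<in> L2 M" and orth: "\<And>m. m \<in> I \<Longrightarrow> L2_inner M f (u m) = 0"
  shows "ae_eq M f (\<lambda>_. 0)"
proof -
  have bb: "\<exists>K. \<forall>g\<in>orth_dom I. L2_norm M g \<le> K * L2_norm M (shifted z g)" for z
  proof -
    have "finite (lam ` {m \<in> I. lam m \<le> z + 1})" by (intro finite_imageI finite_lam_le)
    from finite_set_avoid[OF this, of z] obtain d where
      d: "d > 0" "\<And>m. m \<in> I \<Longrightarrow> lam m \<le> z + 1 \<Longrightarrow> lam m \<noteq> z \<Longrightarrow> d \<le> \<bar>lam m - z\<bar>"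
      by (auto simp: dist_real_def abs_minus_commute)
    \<comment> \<open>The radius \<open>d\<close> only separates \<open>z\<close> from the finitely
      many eigenvalues up to \<open>z + 1\<close>; the cap 1 takes care of the others.\<close>
    define \<kappa> where "\<kappa> = min d 1"
    have \<kappa>: "\<kappa> > 0" using d by (simp add: \<kappa>_def)
    have *: "\<kappa> \<le> \<bar>lam m - z\<bar>" if "m \<in> I" "lam m \<noteq> z" for m
      using d(2)[OF that(1) _ that(2)] by (cases "lam m \<le> z + 1") (auto simp: \<kappa>_def)
    have "L2_norm M g \<le> inverse \<kappa> * L2_norm M (shifted z g)" if "g \<in> orth_dom I" for g
      using shifted_bounded_below_orth[OF \<kappa> * that] \<kappa> by (simp add: field_simps)
    then show ?thesis by blast
  qed
  have c: "-1 \<notin> lam ` I" using lam_nonneg by force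
  have trivial: "L2_norm M g = 0" if "g \<in> orth_dom I" for g
  proof (rule ccontr)
    assume "L2_norm M g \<noteq> 0"
    from distance_to_spectrum[OF c order_refl that this] bb show False by metis
  qed
  obtain k where k: "k \<in> D" "ae_eq M (shifted (-1) k) f"
    using shifted_onto[OF c f] by blast
  have "L2_inner M k (u m) = 0" if m: "m \<in> I" for m
  proof -
    have "0 = L2_inner M f (u m)" using orth m by simp
    also have "\<dots> = L2_inner M (shifted (-1) k) (u m)"
      using k m f by (intro L2_inner_cong) (auto intro: ae_eq_sym)
    also have "\<dots> = of_real (lam m + 1) * L2_inner M k (u m)"
      using k m unfolding shifted_def[abs_def] by (simp add: inner_op_u algebra_simps)
    finally have "of_real (lam m + 1) * L2_inner M k (u m) = 0" by simp
    moreover have "complex_of_real (lam m + 1) \<noteq> 0"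
      using lam_nonneg[OF m] by (subst of_real_eq_0_iff) linarith
    ultimately show ?thesis by simp
  qed
  then have "L2_norm M k = 0" using k by (intro trivial) (auto simp: orth_dom_def)
  then have k0: "ae_eq M k (\<lambda>_. 0)" using k by (simp add: L2_norm_eq_0_iff ae_eq_def)
  show ?thesis
    using k0 op_zero[OF k(1) k0] k(2) unfolding ae_eq_def
    by eventually_elim (simp add: shifted_def)
qed

end


section \<open>Calculus of smooth functions\<close>

lemma Ck_on_cong_imp:
  assumes S: "open S"
  shows "(\<And>x. x \<in> S \<Longrightarrow> f x = g x) \<Longrightarrow> Ck_on k S f \<Longrightarrow> Ck_on k S g"
proof (induction k arbitrary: f g)
  case 0
  then show ?case using continuous_on_cong[of S S f g] by simp
next
  case (Suc k)
  have der: "(g has_derivative frechet_derivative f (at x)) (at x)" if x: "x \<in> S" for x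
  proof (rule has_derivative_transform_within_open[OF _ S x])
    show "(f has_derivative frechet_derivative f (at x)) (at x)"
      using Suc.prems x by (simp add: frechet_derivative_works[symmetric])
  qed (use Suc.prems in auto)
  have "Ck_on k S (\<lambda>x. frechet_derivative g (at x) b)" if "b \<in> Basis" for b
    by (rule Suc.IH[of "\<lambda>x. frechet_derivative f (at x) b"])
       (use Suc.prems that frechet_derivative_at[OF der] in auto)
  then show ?case using der by (auto simp: differentiable_def)
qed

lemma Ck_on_cong:
  assumes "open S" "\<And>x. x \<in> S \<Longrightarrow> f x = g x"
  shows "Ck_on k S f \<longleftrightarrow> Ck_on k S g"
  using Ck_on_cong_imp[of S f g k] Ck_on_cong_imp[of S g f k] assms by auto

lemma Ck_on_SucI:
  assumes S: "open S" and der: "\<And>x. x \<in> S \<Longrightarrow> (f has_derivative f' x) (at x)"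
    and k: "\<And>b. b \<in> Basis \<Longrightarrow> Ck_on k S (\<lambda>x. f' x b)"
  shows "Ck_on (Suc k) S f"
proof -
  have "Ck_on k S (\<lambda>x. frechet_derivative f (at x) b)" if "b \<in> Basis" for b
    by (rule Ck_on_cong_imp[OF S _ k[OF that]]) (use frechet_derivative_at[OF der] in auto)
  then show ?thesis using der by (auto simp: differentiable_def)
qed

lemma Ck_on_SucD: "Ck_on (Suc k) S f \<Longrightarrow> Ck_on k S f"
proof (induction k arbitrary: f)
  case 0
  then show ?case
    by (auto intro!: continuous_at_imp_continuous_on differentiable_imp_continuous_within)
next
  case (Suc k)
  then have "Ck_on k S (\<lambda>x. frechet_derivative f (at x) b)" if "b \<in> Basis" for b
    using that by (intro Suc.IH) auto
  with Suc.prems show ?case by auto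
qed

lemma Ck_on_has_derivative:
  "Ck_on (Suc k) S f \<Longrightarrow> x \<in> S \<Longrightarrow> (f has_derivative frechet_derivative f (at x)) (at x)"
  by (simp add: frechet_derivative_works[symmetric])

lemma Ck_on_const [simp]: "open S \<Longrightarrow> Ck_on k S (\<lambda>x. c)"
proof (induction k arbitrary: c)
  case (Suc k)
  show ?case by (rule Ck_on_SucI[OF Suc.prems has_derivative_const]) (use Suc in auto)
qed simp

lemma Ck_on_add:
  "open S \<Longrightarrow> Ck_on k S f \<Longrightarrow> Ck_on k S g \<Longrightarrow> Ck_on k S (\<lambda>x. f x + g x)"
proof (induction k arbitrary: f g)
  case 0
  then show ?case by (auto intro: continuous_on_add)
next
  case (Suc k)
  show ?case
    by (rule Ck_on_SucI[OF Suc.prems(1)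
          has_derivative_add[OF Ck_on_has_derivative[OF Suc.prems(2)] Ck_on_has_derivative[OF Suc.prems(3)]]])
       (use Suc in auto)
qed

lemma Ck_on_sum:
  assumes "open S" "\<And>i. i \<in> F \<Longrightarrow> Ck_on k S (f i)"
  shows "Ck_on k S (\<lambda>x. \<Sum>i\<in>F. f i x)"
  using assms(2) by (induction F rule: infinite_finite_induct) (auto intro!: Ck_on_add Ck_on_const assms(1))

lemma Ck_on_bilinear:
  assumes "bounded_bilinear p" "open S"
  shows "Ck_on k S f \<Longrightarrow> Ck_on k S g \<Longrightarrow> Ck_on k S (\<lambda>x. p (f x) (g x))"
proof (induction k arbitrary: f g)
  case 0
  then show ?case using assms(1) by (auto intro: bounded_bilinear.continuous_on)
next
  case (Suc k)
  have "Ck_on k S (\<lambda>x. p (f x) (frechet_derivative g (at x) b) + p (frechet_derivative f (at x) b) (g x))"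
    if "b \<in> Basis" for b
    using Suc.prems that by (intro Ck_on_add assms(2) Suc.IH Ck_on_SucD[OF Suc.prems(1)] Ck_on_SucD[OF Suc.prems(2)]) auto
  note der = this
  show ?case
    by (rule Ck_on_SucI[OF assms(2) bounded_bilinear.FDERIV[OF assms(1)
          Ck_on_has_derivative[OF Suc.prems(1)] Ck_on_has_derivative[OF Suc.prems(2)]]]) (use der in auto)
qed

lemma Ck_on_linear:
  assumes "bounded_linear L" "open S"
  shows "Ck_on k S f \<Longrightarrow> Ck_on k S (\<lambda>x. L (f x))"
proof (induction k arbitrary: f)
  case 0
  then show ?case using assms(1) by (auto intro: bounded_linear.continuous_on)
next
  case (Suc k)
  show ?case
    by (rule Ck_on_SucI[OF assms(2) bounded_linear.has_derivative[OF assms(1) Ck_on_has_derivative[OF Suc.prems]]])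
       (use Suc in auto)
qed

lemma Ck_on_id: "open S \<Longrightarrow> Ck_on k S (\<lambda>x. x)"
  by (cases k) (auto intro!: Ck_on_SucI[where f'="\<lambda>x h. h"])

text \<open>The inner function is real-valued, so the derivative of the composition is a scalar
  multiple of the single partial derivative of \<open>f\<close>, and the induction stays within
  products and compositions of the same kind.\<close>

lemma Ck_on_compose:
  fixes f :: "real \<Rightarrow> 'b::real_normed_vector" and \<phi> :: "'a::euclidean_space \<Rightarrow> real"
  assumes S: "open S" and T: "open T" and sub: "\<phi> ` S \<subseteq> T"
  shows "Ck_on k T f \<Longrightarrow> Ck_on k S \<phi> \<Longrightarrow> Ck_on k S (\<lambda>x. f (\<phi> x))"
proof (induction k arbitrary: f)
  case 0
  then show ?case using sub by (auto intro: continuous_on_compose2)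
next
  case (Suc k)
  show ?case
  proof (rule Ck_on_SucI[OF S])
    fix x assume x: "x \<in> S"
    then have f: "(f has_derivative frechet_derivative f (at (\<phi> x))) (at (\<phi> x))"
      by (intro Ck_on_has_derivative[OF Suc.prems(1)]) (use sub in auto)
    from has_derivative_compose[OF Ck_on_has_derivative[OF Suc.prems(2) x] f]
    have *: "((\<lambda>x. f (\<phi> x)) has_derivative
        (\<lambda>h. frechet_derivative f (at (\<phi> x)) (frechet_derivative \<phi> (at x) h))) (at x)" .
    have eq: "frechet_derivative f (at (\<phi> x)) t = t *\<^sub>R frechet_derivative f (at (\<phi> x)) 1" for t
      using linear_cmul[OF has_derivative_linear[OF f], of t 1] by simp
    have "(\<lambda>h. frechet_derivative f (at (\<phi> x)) (frechet_derivative \<phi> (at x) h)) =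
        (\<lambda>h. frechet_derivative \<phi> (at x) h *\<^sub>R frechet_derivative f (at (\<phi> x)) 1)"
      by (rule ext) (rule eq)
    with * show "((\<lambda>x. f (\<phi> x)) has_derivative
        (\<lambda>h. frechet_derivative \<phi> (at x) h *\<^sub>R frechet_derivative f (at (\<phi> x)) 1)) (at x)"
      by (simp only:)
  next
    fix b :: 'a assume b: "b \<in> Basis"
    show "Ck_on k S (\<lambda>x. frechet_derivative \<phi> (at x) b *\<^sub>R frechet_derivative f (at (\<phi> x)) 1)"
    proof (intro Ck_on_bilinear[OF bounded_bilinear_scaleR S])
      show "Ck_on k S (\<lambda>x. frechet_derivative \<phi> (at x) b)" using Suc.prems b by auto
      show "Ck_on k S (\<lambda>x. frechet_derivative f (at (\<phi> x)) 1)"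
        by (rule Suc.IH[OF _ Ck_on_SucD[OF Suc.prems(2)]]) (use Suc.prems in auto)
    qed
  qed
qed

lemma Ck_on_powr: "Ck_on k {0<..} (\<lambda>r::real. r powr a)"
proof (induction k arbitrary: a)
  case 0
  show ?case by (auto intro!: continuous_intros)
next
  case (Suc k)
  show ?case
  proof (rule Ck_on_SucI)
    fix x :: real assume "x \<in> {0<..}"
    then have "((\<lambda>r. r powr a) has_real_derivative (a * x powr (a - 1))) (at x)"
      by (intro has_real_derivative_powr) auto
    then show "((\<lambda>r. r powr a) has_derivative (\<lambda>h. a * x powr (a - 1) * h)) (at x)"
      by (simp add: has_field_derivative_def)
  next
    fix b :: real
    have "Ck_on k {0<..} (\<lambda>x. (a * b) * x powr (a - 1))"
      by (rule Ck_on_linear[OF bounded_linear_mult_right _ Suc]) simp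
    then show "Ck_on k {0<..} (\<lambda>x. a * x powr (a - 1) * b)" by (simp add: mult_ac)
  qed simp
qed

text \<open>The gradient of the norm is \<open>x\<close> times \<open>norm x powr (-1)\<close>, so
  each order of smoothness follows from the previous one through composition with a power.\<close>

lemma Ck_on_norm: "Ck_on k (- {0}) (norm :: 'a::euclidean_space \<Rightarrow> real)"
proof (induction k)
  case 0
  show ?case by (auto intro!: continuous_intros)
next
  case (Suc k)
  show ?case
  proof (rule Ck_on_SucI)
    fix x :: 'a assume "x \<in> - {0}"
    then show "(norm has_derivative (\<lambda>h. (h \<bullet> x) * norm x powr (-1))) (at x)"
      using has_derivative_norm[of x]
      by (simp add: powr_minus_divide sgn_div_norm inner_commute divide_inverse mult.commute)
  next
    fix b :: 'a
    have "Ck_on k (- {0}) (\<lambda>x::'a. norm x powr (-1))"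
      by (rule Ck_on_compose[where f="\<lambda>r. r powr (-1)" and \<phi>=norm, OF _ _ _ Ck_on_powr Suc]) auto
    then show "Ck_on k (- {0}) (\<lambda>x. (b \<bullet> x) * norm x powr (-1))"
      by (intro Ck_on_bilinear[OF bounded_bilinear_mult] Ck_on_linear[OF bounded_linear_inner_right] Ck_on_id) auto
  qed (auto intro: open_Compl)
qed

lemma smooth_on_cong:
  "open S \<Longrightarrow> (\<And>x. x \<in> S \<Longrightarrow> f x = g x) \<Longrightarrow> smooth_on S f \<longleftrightarrow> smooth_on S g"
  unfolding smooth_on_def using Ck_on_cong by blast

lemma smooth_on_sum:
  "open S \<Longrightarrow> (\<And>i. i \<in> F \<Longrightarrow> smooth_on S (h i)) \<Longrightarrow> smooth_on S (\<lambda>x. \<Sum>i\<in>F. h i x)"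
  unfolding smooth_on_def by (auto intro: Ck_on_sum)

lemma smooth_on_bilinear:
  "bounded_bilinear p \<Longrightarrow> open S \<Longrightarrow> smooth_on S f \<Longrightarrow> smooth_on S g \<Longrightarrow> smooth_on S (\<lambda>x. p (f x) (g x))"
  unfolding smooth_on_def by (auto intro: Ck_on_bilinear)

lemmas smooth_on_mult = smooth_on_bilinear[OF bounded_bilinear_mult]
lemmas smooth_on_scaleR = smooth_on_bilinear[OF bounded_bilinear_scaleR]

lemma smooth_on_linear:
  "bounded_linear L \<Longrightarrow> open S \<Longrightarrow> smooth_on S f \<Longrightarrow> smooth_on S (\<lambda>x. L (f x))"
  unfolding smooth_on_def by (auto intro: Ck_on_linear)

lemma smooth_on_id: "open S \<Longrightarrow> smooth_on S (\<lambda>x. x)"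
  unfolding smooth_on_def by (auto intro: Ck_on_id)

lemma smooth_on_compose:
  fixes f :: "real \<Rightarrow> 'b::real_normed_vector" and \<phi> :: "'a::euclidean_space \<Rightarrow> real"
  shows "open S \<Longrightarrow> open T \<Longrightarrow> \<phi> ` S \<subseteq> T \<Longrightarrow> smooth_on T f \<Longrightarrow> smooth_on S \<phi> \<Longrightarrow> smooth_on S (\<lambda>x. f (\<phi> x))"
  unfolding smooth_on_def by (auto intro: Ck_on_compose)

lemma smooth_on_powr: "smooth_on {0<..} (\<lambda>r::real. r powr a)"
  unfolding smooth_on_def by (auto intro: Ck_on_powr)

lemma smooth_on_norm: "smooth_on (- {0}) (norm :: 'a::euclidean_space \<Rightarrow> real)"
  unfolding smooth_on_def by (auto intro: Ck_on_norm)

lemma smooth_on_radial: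
  fixes f :: "real \<Rightarrow> 'b::real_normed_vector"
  assumes "smooth_on {0<..} f"
  shows "smooth_on (- {0}) (\<lambda>x::'a::euclidean_space. f (norm x))"
  by (rule smooth_on_compose[OF _ _ _ assms smooth_on_norm]) auto

lemma smooth_on_continuous: "smooth_on S f \<Longrightarrow> continuous_on S f"
  unfolding smooth_on_def using Ck_on.simps(1) by blast

lemma smooth_on_has_derivative:
  "smooth_on S f \<Longrightarrow> x \<in> S \<Longrightarrow> (f has_derivative frechet_derivative f (at x)) (at x)"
  unfolding smooth_on_def using Ck_on_has_derivative by blast

lemma smooth_on_frechet_derivative:
  "smooth_on S f \<Longrightarrow> b \<in> Basis \<Longrightarrow> smooth_on S (\<lambda>x. frechet_derivative f (at x) b)"
  unfolding smooth_on_def by (metis Ck_on.simps(2))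

lemma smooth_on_has_real_derivative:
  fixes f :: "real \<Rightarrow> real"
  assumes "smooth_on S f" "x \<in> S"
  shows "(f has_real_derivative deriv f x) (at x)"
  using smooth_on_has_derivative[OF assms]
  by (metis DERIV_imp_deriv differentiable_def real_differentiableE)

lemma smooth_on_SucI:
  fixes f f' :: "real \<Rightarrow> real"
  assumes S: "open S" and der: "\<And>x. x \<in> S \<Longrightarrow> (f has_real_derivative f' x) (at x)" and f': "smooth_on S f'"
  shows "smooth_on S f"
  unfolding smooth_on_def
proof
  fix k
  have "Ck_on (Suc k) S f"
  proof (rule Ck_on_SucI[OF S])
    show "(f has_derivative (\<lambda>h. f' x * h)) (at x)" if "x \<in> S" for x
      using der[OF that] by (simp add: has_field_derivative_def)
    show "Ck_on k S (\<lambda>x. f' x * b)" if "b \<in> Basis" for b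
      using that f' by (simp add: smooth_on_def)
  qed
  then show "Ck_on k S f" by (rule Ck_on_SucD)
qed

lemma smooth_on_deriv:
  fixes f :: "real \<Rightarrow> real"
  assumes S: "open S" and f: "smooth_on S f"
  shows "smooth_on S (deriv f)"
proof -
  have "frechet_derivative f (at x) 1 = deriv f x" if "x \<in> S" for x
    using frechet_derivative_at[OF smooth_on_has_real_derivative[OF f that, unfolded has_field_derivative_def]]
    by (metis mult.right_neutral)
  then show ?thesis
    using smooth_on_frechet_derivative[OF f, of 1] smooth_on_cong[OF S, of "\<lambda>x. frechet_derivative f (at x) 1" "deriv f"]
    by simp
qed

section \<open>Radial derivatives\<close>

lemma has_vector_derivative_ray:
  fixes \<psi> :: "'a::euclidean_space \<Rightarrow> complex"
  assumes \<psi>: "smooth_on (- {0}) \<psi>" and r: "r > 0" and \<omega>: "\<omega> \<noteq> 0"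
  shows "((\<lambda>s. \<psi> (s *\<^sub>R \<omega>)) has_vector_derivative frechet_derivative \<psi> (at (r *\<^sub>R \<omega>)) \<omega>) (at r)"
proof -
  have d: "(\<psi> has_derivative frechet_derivative \<psi> (at (r *\<^sub>R \<omega>))) (at (r *\<^sub>R \<omega>))"
    using smooth_on_has_derivative[OF \<psi>] r \<omega> by simp
  have "((\<lambda>s. s *\<^sub>R \<omega>) has_derivative (\<lambda>h. h *\<^sub>R \<omega>)) (at r)"
    by (intro derivative_eq_intros) auto
  from has_derivative_compose[OF this d]
  show ?thesis
    unfolding has_vector_derivative_def
    using linear_cmul[OF has_derivative_linear[OF d]] by simp
qed

lemma radial_deriv_eq:
  fixes \<psi> :: "'a::euclidean_space \<Rightarrow> complex"
  assumes "smooth_on (- {0}) \<psi>" "x \<noteq> 0"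
  shows "radial_deriv \<psi> x = frechet_derivative \<psi> (at x) (sgn x)"
proof -
  have "norm x *\<^sub>R sgn x = x" using assms(2) by (simp add: sgn_div_norm)
  then show ?thesis
    unfolding radial_deriv_def
    using vector_derivative_at[OF has_vector_derivative_ray[OF assms(1), of "norm x" "sgn x"]] assms(2)
    by (simp add: sgn_zero_iff)
qed

lemma has_vector_derivative_radial_deriv:
  fixes \<psi> :: "'a::euclidean_space \<Rightarrow> complex"
  assumes "smooth_on (- {0}) \<psi>" "r > 0" "norm \<omega> = 1"
  shows "((\<lambda>s. \<psi> (s *\<^sub>R \<omega>)) has_vector_derivative radial_deriv \<psi> (r *\<^sub>R \<omega>)) (at r)"
proof -
  have "\<omega> \<noteq> 0" using assms by auto
  moreover have "sgn (r *\<^sub>R \<omega>) = \<omega>" using assms by (simp add: sgn_div_norm)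
  ultimately show ?thesis
    using has_vector_derivative_ray[OF assms(1,2)] radial_deriv_eq[OF assms(1), of "r *\<^sub>R \<omega>"] assms(2) by simp
qed

lemma smooth_on_radial_deriv:
  fixes \<psi> :: "'a::euclidean_space \<Rightarrow> complex"
  assumes \<psi>: "smooth_on (- {0}) \<psi>"
  shows "smooth_on (- {0}) (radial_deriv \<psi>)"
proof -
  have "smooth_on (- {0}) (\<lambda>x::'a. \<Sum>b\<in>Basis. ((x \<bullet> b) * norm x powr (-1)) *\<^sub>R frechet_derivative \<psi> (at x) b)"
    by (intro smooth_on_sum smooth_on_scaleR smooth_on_mult smooth_on_frechet_derivative \<psi>
        smooth_on_linear[OF bounded_linear_inner_left] smooth_on_id smooth_on_radial[OF smooth_on_powr]) auto
  moreover have "radial_deriv \<psi> x = (\<Sum>b\<in>Basis. ((x \<bullet> b) * norm x powr (-1)) *\<^sub>R frechet_derivative \<psi> (at x) b)"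
    if "x \<in> - {0}" for x
  proof -
    have lin: "linear (frechet_derivative \<psi> (at x))"
      using smooth_on_has_derivative[OF \<psi> that] by (rule has_derivative_linear)
    have "frechet_derivative \<psi> (at x) (sgn x) = frechet_derivative \<psi> (at x) (\<Sum>b\<in>Basis. (sgn x \<bullet> b) *\<^sub>R b)"
      by (subst euclidean_representation) (rule refl)
    also have "\<dots> = (\<Sum>b\<in>Basis. (sgn x \<bullet> b) *\<^sub>R frechet_derivative \<psi> (at x) b)"
      by (simp only: linear_sum[OF lin] linear_cmul[OF lin])
    finally have "frechet_derivative \<psi> (at x) (sgn x) = (\<Sum>b\<in>Basis. (sgn x \<bullet> b) *\<^sub>R frechet_derivative \<psi> (at x) b)" .
    moreover have "sgn x \<bullet> b = (x \<bullet> b) * norm x powr (-1)" for b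
      using that by (simp add: sgn_div_norm powr_minus_divide divide_inverse)
    ultimately show ?thesis using radial_deriv_eq[OF \<psi>, of x] that by simp
  qed
  ultimately show ?thesis by (subst smooth_on_cong) auto
qed

lemma test_function_annulus:
  fixes \<psi> :: "'a::euclidean_space \<Rightarrow> complex"
  assumes "test_function_away0 \<psi>"
  obtains a b where "0 < a" "a < b" "\<And>x. \<psi> x \<noteq> 0 \<Longrightarrow> a < norm x \<and> norm x < b"
proof -
  let ?S = "closure {x. \<psi> x \<noteq> 0}"
  have S: "compact ?S" "0 \<notin> ?S" using assms by (auto simp: test_function_away0_def)
  obtain B where B: "\<And>x. x \<in> ?S \<Longrightarrow> norm x \<le> B"
    using compact_imp_bounded[OF S(1)] by (auto simp: bounded_iff)
  have "open (- ?S)" "0 \<in> - ?S" using S by auto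
  then obtain e where e: "e > 0" "ball 0 e \<subseteq> - ?S" using open_contains_ball by blast
  show ?thesis
  proof (rule that[of "e / 2" "max B e + 1"])
    fix x assume "\<psi> x \<noteq> 0"
    then have x: "x \<in> ?S" by (intro subsetD[OF closure_subset]) simp
    have "x \<notin> ball 0 e" using e(2) x by blast
    then have "norm x \<ge> e" by simp
    then show "e / 2 < norm x \<and> norm x < max B e + 1" using B[OF x] e(1) by auto
  qed (use e in auto)
qed

lemma test_function_away0I:
  fixes \<psi> :: "'a::euclidean_space \<Rightarrow> complex"
  assumes "smooth_on (- {0}) \<psi>" "0 < a" "\<And>x. \<psi> x \<noteq> 0 \<Longrightarrow> a \<le> norm x \<and> norm x \<le> b"
  shows "test_function_away0 \<psi>"
proof -
  let ?K = "cball 0 b - ball 0 a :: 'a set"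
  have "closed ?K" by (intro closed_Diff) auto
  moreover have "{x. \<psi> x \<noteq> 0} \<subseteq> ?K" using assms(3) by force
  ultimately have sub: "closure {x. \<psi> x \<noteq> 0} \<subseteq> ?K" by (rule closure_minimal[rotated])
  have "compact ?K" by (intro compact_diff) auto
  then have "compact (closure {x. \<psi> x \<noteq> 0})"
    using sub by (metis closed_closure compact_Int_closed inf.absorb_iff2)
  moreover have "0 \<notin> closure {x. \<psi> x \<noteq> 0}" using sub assms(2) by auto
  ultimately show ?thesis using assms(1) by (simp add: test_function_away0_def)
qed

lemma radial_deriv_eq_0:
  fixes \<psi> :: "'a::euclidean_space \<Rightarrow> complex"
  assumes "open U" "norm x \<in> U" "\<And>s. s \<in> U \<Longrightarrow> \<psi> (s *\<^sub>R sgn x) = 0"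
  shows "radial_deriv \<psi> x = 0"
proof -
  have "((\<lambda>s. \<psi> (s *\<^sub>R sgn x)) has_vector_derivative 0) (at (norm x))"
    by (rule has_vector_derivative_transform_within_open[of "\<lambda>_. 0" _ _ U]) (use assms in auto)
  then show ?thesis unfolding radial_deriv_def by (rule vector_derivative_at)
qed

lemma radial_deriv_support:
  fixes \<psi> :: "'a::euclidean_space \<Rightarrow> complex"
  assumes supp: "\<And>x. \<psi> x \<noteq> 0 \<Longrightarrow> a < norm x \<and> norm x < b" and "0 < a" and "radial_deriv \<psi> x \<noteq> 0"
  shows "a \<le> norm x \<and> norm x \<le> b"
proof (rule ccontr)
  assume *: "\<not> (a \<le> norm x \<and> norm x \<le> b)"
  have "radial_deriv \<psi> x = 0"
  proof (cases "x = 0")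
    \<comment> \<open>At the origin \<open>sgn x = 0\<close>, so the ray through it is a single
      point.\<close>
    case True
    have "\<psi> 0 = 0" using supp[of 0] \<open>0 < a\<close> by auto
    then show ?thesis using True by (intro radial_deriv_eq_0[of UNIV]) auto
  next
    case False
    then have n: "norm (sgn x) = 1" by (simp add: norm_sgn)
    have zero: "\<psi> (s *\<^sub>R sgn x) = 0" if "\<not> (a < \<bar>s\<bar> \<and> \<bar>s\<bar> < b)" for s
      using supp[of "s *\<^sub>R sgn x"] that n by auto
    show ?thesis
    proof (cases "norm x < a")
      case True
      have "- a < norm x" using \<open>0 < a\<close> norm_ge_zero[of x] by linarith
      with True show ?thesis by (intro radial_deriv_eq_0[of "{-a<..<a}"] zero) auto
    next
      case False
      then show ?thesis using * by (intro radial_deriv_eq_0[of "{b<..}"] zero) auto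
    qed
  qed
  with assms show False by simp
qed

lemma test_function_radial_deriv:
  fixes \<psi> :: "'a::euclidean_space \<Rightarrow> complex"
  assumes "test_function_away0 \<psi>"
  shows "test_function_away0 (radial_deriv \<psi>)"
proof -
  obtain a b where ab: "0 < a" "a < b" "\<And>x. \<psi> x \<noteq> 0 \<Longrightarrow> a < norm x \<and> norm x < b"
    using test_function_annulus[OF assms] by blast
  show ?thesis
    by (rule test_function_away0I[of _ a b])
       (use assms ab radial_deriv_support[OF ab(3,1)] in \<open>auto simp: test_function_away0_def intro: smooth_on_radial_deriv\<close>)
qed


section \<open>Polar coordinates\<close>

lemma space_sphere_measure [simp]: "space sphere_measure = sphere 0 1"
  by (simp add: sphere_measure_def space_scale_measure space_restrict_space)

lemma sets_sphere_measure [measurable_cong]: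
  "sets (sphere_measure :: 'a::euclidean_space measure) = sets (restrict_space borel (sphere 0 1))"
  by (simp add: sphere_measure_def)

lemma measurable_sphere_ident [measurable]:
  "(\<lambda>\<omega>. \<omega>) \<in> sphere_measure \<rightarrow>\<^sub>M (borel :: 'a::euclidean_space measure)"
  unfolding measurable_cong_sets[OF sets_sphere_measure refl]
  by (rule measurable_restrict_space1) simp

lemma measurable_sgn_sphere:
  "sgn \<in> restrict_space borel (- {0}) \<rightarrow>\<^sub>M (sphere_measure :: 'a::euclidean_space measure)"
  unfolding measurable_cong_sets[OF refl sets_sphere_measure]
  by (intro measurable_restrict_space2 measurable_restrict_space1)
     (auto simp: space_restrict_space norm_sgn)

lemma cone_in_borel:
  fixes B :: "'a::euclidean_space set"
  assumes "B \<in> sets sphere_measure"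
  shows "{x. x \<noteq> 0 \<and> sgn x \<in> B} \<in> sets borel"
proof -
  have "sgn -` B \<inter> space (restrict_space borel (- {0::'a})) \<in> sets (restrict_space borel (- {0}))"
    by (rule measurable_sets[OF measurable_sgn_sphere assms])
  then have "sgn -` B \<inter> - {0} \<in> sets borel"
    by (auto simp: sets_restrict_space space_restrict_space)
  moreover have "sgn -` B \<inter> - {0} = {x. x \<noteq> 0 \<and> sgn x \<in> B}" by auto
  ultimately show ?thesis by simp
qed

lemma emeasure_sphere_measure:
  fixes B :: "'a::euclidean_space set"
  assumes B: "B \<in> sets sphere_measure"
  shows "emeasure sphere_measure B = of_nat DIM('a) * emeasure lborel ({x. x \<noteq> 0 \<and> sgn x \<in> B} \<inter> ball 0 1)"
proof -
  have "(sgn :: 'a \<Rightarrow> 'a) \<in> restrict_space lborel (ball 0 1 - {0}) \<rightarrow>\<^sub>M restrict_space borel (sphere 0 1)"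
    by (intro measurable_restrict_space2 measurable_restrict_space1)
       (auto simp: space_restrict_space norm_sgn)
  then have "emeasure sphere_measure B =
      of_nat DIM('a) * emeasure (restrict_space lborel (ball 0 1 - {0})) (sgn -` B \<inter> (ball 0 1 - {0}))"
    using B by (simp add: sphere_measure_def emeasure_distr space_restrict_space)
  also have "emeasure (restrict_space lborel (ball 0 1 - {0})) (sgn -` B \<inter> (ball 0 1 - {0})) =
      emeasure lborel (sgn -` B \<inter> (ball 0 1 - {0}))"
    by (rule emeasure_restrict_space) auto
  also have "sgn -` B \<inter> (ball 0 1 - {0}) = {x. x \<noteq> 0 \<and> sgn x \<in> B} \<inter> ball 0 1" by auto
  finally show ?thesis .
qed

lemma finite_measure_sphere: "finite_measure (sphere_measure :: 'a::euclidean_space measure)"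
proof (rule finite_measureI)
  have "emeasure lborel ({x::'a. x \<noteq> 0 \<and> sgn x \<in> sphere 0 1} \<inter> ball 0 1) \<le> emeasure lborel (ball (0::'a) 1)"
    by (rule emeasure_mono) auto
  also have "\<dots> < \<infinity>" by (rule emeasure_lborel_ball_finite)
  finally have "of_nat DIM('a) * emeasure lborel ({x::'a. x \<noteq> 0 \<and> sgn x \<in> sphere 0 1} \<inter> ball 0 1) < \<infinity>"
    by (auto simp: ennreal_mult_less_top of_nat_less_top)
  moreover have "sphere (0::'a) 1 \<in> sets sphere_measure"
    using sets.top[of "sphere_measure :: 'a measure"] by simp
  ultimately show "emeasure (sphere_measure :: 'a measure) (space sphere_measure) \<noteq> \<infinity>"
    by (simp add: emeasure_sphere_measure)
qed

lemma emeasure_sphere_measure_pos: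
  "emeasure (sphere_measure :: 'a::euclidean_space measure) (sphere 0 1) > 0"
proof -
  have "sphere (0::'a) 1 \<in> sets sphere_measure"
    using sets.top[of "sphere_measure :: 'a measure"] by simp
  moreover have "{x::'a. x \<noteq> 0 \<and> sgn x \<in> sphere 0 1} \<inter> ball 0 1 = ball 0 1 - {0}"
    by (auto simp: norm_sgn)
  moreover have "emeasure lborel (ball (0::'a) 1 - {0}) \<noteq> 0"
  proof
    assume "emeasure lborel (ball (0::'a) 1 - {0}) = 0"
    then have "emeasure lborel (ball (0::'a) 1) = 0"
      by (subst (asm) emeasure_Diff_null_set) auto
    then have "measure lborel (ball (0::'a) 1) = 0" by (simp add: measure_def)
    then show False using content_ball_pos[of 1 "0::'a"] by simp
  qed
  ultimately show ?thesis by (simp add: emeasure_sphere_measure ennreal_zero_less_mult_iff zero_less_iff_neq_zero)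
qed

lemma emeasure_cone_scale:
  fixes B :: "'a::euclidean_space set"
  assumes B: "B \<in> sets sphere_measure" and R: "R > 0"
  shows "emeasure lborel ({x. x \<noteq> 0 \<and> sgn x \<in> B} \<inter> ball 0 R) =
    ennreal (R ^ DIM('a)) * emeasure lborel ({x. x \<noteq> 0 \<and> sgn x \<in> B} \<inter> ball 0 1)"
proof -
  let ?S = "\<lambda>R. {x. x \<noteq> 0 \<and> sgn x \<in> B} \<inter> ball 0 R"
  have S [measurable]: "?S R \<in> sets borel" for R using cone_in_borel[OF B] by auto
  have "emeasure lborel (?S R) =
      emeasure (density (distr lborel borel (\<lambda>x. 0 + R *\<^sub>R x)) (\<lambda>_. ennreal (\<bar>R\<bar> ^ DIM('a)))) (?S R)"
    using R by (subst lborel_affine[of R 0]) auto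
  also have "\<dots> = ennreal (R ^ DIM('a)) * emeasure (distr lborel borel (\<lambda>x. R *\<^sub>R x)) (?S R)"
    using R by (subst emeasure_density_const) auto
  also have "emeasure (distr lborel borel (\<lambda>x. R *\<^sub>R x)) (?S R) = emeasure lborel ((\<lambda>x. R *\<^sub>R x) -` ?S R)"
    by (subst emeasure_distr) auto
  also have "(\<lambda>x. R *\<^sub>R x) -` ?S R = ?S 1"
    using R by (auto simp: sgn_scaleR)
  finally show ?thesis .
qed

definition radial_measure :: "nat \<Rightarrow> real measure" where
  "radial_measure n = density lborel (\<lambda>r. indicator {0<..} r * ennreal (r ^ n))"

lemma sets_radial_measure [simp, measurable_cong]: "sets (radial_measure n) = sets borel"
  by (simp add: radial_measure_def)

lemma sigma_finite_radial_measure: "sigma_finite_measure (radial_measure n)"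
  unfolding radial_measure_def
  by (subst sigma_finite_measure.sigma_finite_iff_density_finite[OF sigma_finite_lborel]) (auto simp: ennreal_mult_eq_top_iff split: split_indicator)

lemma emeasure_radial_measure:
  assumes "R > 0"
  shows "emeasure (radial_measure n) {..<R} = ennreal (R ^ Suc n / Suc n)"
proof -
  have "emeasure (radial_measure n) {..<R} = (\<integral>\<^sup>+r. (indicator {0<..} r * ennreal (r ^ n)) * indicator {..<R} r \<partial>lborel)"
    by (simp add: radial_measure_def emeasure_density)
  also have "\<dots> = (\<integral>\<^sup>+r. ennreal (r ^ n) * indicator {0..R} r \<partial>lborel)"
  proof (rule nn_integral_cong_AE)
    show "AE r in lborel. indicator {0<..} r * ennreal (r ^ n) * indicator {..<R} r =
        ennreal (r ^ n) * indicator {0..R} r"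
      using AE_lborel_singleton[of 0] AE_lborel_singleton[of R]
      by eventually_elim (auto split: split_indicator)
  qed
  also have "\<dots> = ennreal (R ^ Suc n / Suc n - 0 ^ Suc n / Suc n)"
  proof (rule nn_integral_FTC_Icc[where F="\<lambda>r. r ^ Suc n / Suc n"])
    show "((\<lambda>r. r ^ Suc n / Suc n) has_real_derivative x ^ n) (at x)" for x :: real
      using DERIV_cdivide[OF DERIV_pow[of "Suc n" x UNIV], of "Suc n"] by simp
  qed (use assms in auto)
  finally show ?thesis by simp
qed

lemma emeasure_radial_measure_nonpos: "R \<le> 0 \<Longrightarrow> emeasure (radial_measure n) {..<R} = 0"
  unfolding radial_measure_def
  by (subst emeasure_density) (auto simp: nn_integral_0_iff_AE split: split_indicator)

text \<open>For fixed \<open>B\<close> both sides are measures in \<open>A\<close>. They agree on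
  the half-lines \<open>{..<R}\<close> by the homogeneity of Lebesgue measure on cones, and the
  half-lines are an intersection-stable generator.\<close>

lemma emeasure_polar_rectangle:
  fixes B :: "'a::euclidean_space set"
  assumes B: "B \<in> sets sphere_measure" and A: "A \<in> sets borel"
  shows "emeasure (radial_measure (DIM('a) - 1)) A * emeasure sphere_measure B =
    emeasure lborel {x. x \<noteq> 0 \<and> sgn x \<in> B \<and> norm x \<in> A}"
proof -
  let ?K = "{x. x \<noteq> 0 \<and> sgn x \<in> B}"
  have K [measurable]: "?K \<in> sets borel" by (rule cone_in_borel[OF B])
  have fin: "emeasure sphere_measure B < \<infinity>"
    using finite_measure.emeasure_finite[OF finite_measure_sphere, of B] by (simp add: less_top)
  define N1 where "N1 = scale_measure (emeasure sphere_measure B) (radial_measure (DIM('a) - 1))"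
  define N2 where "N2 = distr (restrict_space lborel ?K) borel (norm :: 'a \<Rightarrow> real)"
  have N2: "emeasure N2 X = emeasure lborel {x. x \<noteq> 0 \<and> sgn x \<in> B \<and> norm x \<in> X}" if "X \<in> sets borel" for X
  proof -
    have "emeasure N2 X = emeasure (restrict_space lborel ?K) (norm -` X \<inter> ?K)"
      unfolding N2_def using that
      by (subst emeasure_distr) (auto intro: measurable_restrict_space1 simp: space_restrict_space)
    also have "\<dots> = emeasure lborel (norm -` X \<inter> ?K)"
      using K by (intro emeasure_restrict_space) auto
    also have "norm -` X \<inter> ?K = {x. x \<noteq> 0 \<and> sgn x \<in> B \<and> norm x \<in> X}" by auto
    finally show ?thesis .
  qed
  have eq: "emeasure N1 {..<R} = emeasure N2 {..<R}" for R
  proof (cases "R > 0")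
    case True
    have "emeasure N1 {..<R} = emeasure sphere_measure B * ennreal (R ^ DIM('a) / DIM('a))"
      using emeasure_radial_measure[OF True, of "DIM('a) - 1"] by (simp add: N1_def)
    also have "\<dots> = (ennreal (real DIM('a)) * ennreal (R ^ DIM('a) / DIM('a))) * emeasure lborel (?K \<inter> ball 0 1)"
      by (simp add: emeasure_sphere_measure[OF B] mult_ac ennreal_of_nat_eq_real_of_nat)
    also have "ennreal (real DIM('a)) * ennreal (R ^ DIM('a) / DIM('a)) = ennreal (R ^ DIM('a))"
      using True by (subst ennreal_mult[symmetric]) auto
    also have "\<dots> * emeasure lborel (?K \<inter> ball 0 1) = emeasure lborel (?K \<inter> ball 0 R)"
      by (rule emeasure_cone_scale[OF B True, symmetric])
    also have "?K \<inter> ball 0 R = {x. x \<noteq> 0 \<and> sgn x \<in> B \<and> norm x \<in> {..<R}}" by auto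
    finally show ?thesis by (simp add: N2)
  next
    case False
    then have "{x::'a. x \<noteq> 0 \<and> sgn x \<in> B \<and> norm x \<in> {..<R}} = {}"
      by (auto simp: not_less) (meson norm_ge_zero order_trans not_less)
    then have "emeasure N2 {..<R} = 0" by (subst N2) (simp_all only: emeasure_empty, simp)
    then show ?thesis using False emeasure_radial_measure_nonpos[of R] by (simp add: N1_def)
  qed
  have "N1 = N2"
  proof (rule measure_eqI_generator_eq[where E="range lessThan" and \<Omega>=UNIV and A="\<lambda>n. {..<real n + 1}"])
    show "Int_stable (range (lessThan :: real \<Rightarrow> real set))"
    proof (clarsimp simp: Int_stable_def)
      fix a b :: real
      have "{..<a} \<inter> {..<b} = {..<min a b}" by auto
      then show "{..<a} \<inter> {..<b} \<in> range lessThan" by blast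
    qed
    show "sets N1 = sigma_sets UNIV (range lessThan)" "sets N2 = sigma_sets UNIV (range lessThan)"
      unfolding N1_def N2_def by (auto simp: borel_Iio)
    show "(\<Union>i. {..<real i + 1}) = UNIV"
    proof -
      have "\<exists>n. x < real n + 1" for x :: real
        using reals_Archimedean2[of x] by (metis less_add_one order.strict_trans)
      then show ?thesis by auto
    qed
    show "emeasure N1 {..<real i + 1} \<noteq> \<infinity>" for i
      using fin emeasure_radial_measure[of "real i + 1" "DIM('a) - 1"]
      by (auto simp: N1_def ennreal_mult_eq_top_iff)
  qed (auto simp: eq)
  then have "emeasure N1 A = emeasure N2 A" by simp
  then show ?thesis using N2[OF A] by (simp add: N1_def mult.commute)
qed

lemma measurable_polar_map [measurable]:
  "(\<lambda>p. fst p *\<^sub>R snd p) \<in> borel \<Otimes>\<^sub>M sphere_measure \<rightarrow>\<^sub>M (borel :: 'a::euclidean_space measure)"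
proof -
  have "(\<lambda>p. snd p) \<in> borel \<Otimes>\<^sub>M sphere_measure \<rightarrow>\<^sub>M (borel :: 'a measure)"
    by (rule measurable_compose[OF measurable_snd measurable_sphere_ident])
  then show ?thesis by measurable
qed

text \<open>The product of the radial and the surface measure is determined by its rectangles, hence
  is the image of Lebesgue measure under \<open>T\<close>; what remains is Tonelli's
  theorem.\<close>

theorem nn_integral_polar:
  fixes f :: "'a::euclidean_space \<Rightarrow> ennreal"
  assumes f [measurable]: "f \<in> borel_measurable borel"
  shows "(\<integral>\<^sup>+x. f x \<partial>lborel) = (\<integral>\<^sup>+r. indicator {0<..} r * ennreal (r ^ (DIM('a) - 1)) *
    (\<integral>\<^sup>+\<omega>. f (r *\<^sub>R \<omega>) \<partial>sphere_measure) \<partial>lborel)"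
proof -
  interpret S: finite_measure "sphere_measure :: 'a measure" by (rule finite_measure_sphere)
  interpret R: sigma_finite_measure "radial_measure (DIM('a) - 1)" by (rule sigma_finite_radial_measure)
  obtain b :: 'a where b: "b \<in> Basis" using nonempty_Basis by blast
  \<comment> \<open>An arbitrary unit vector stands for the direction of the origin, so that
    \<open>T\<close> takes values on the sphere everywhere.\<close>
  define T where "T x = (norm x, if x = 0 then b else sgn x)" for x :: 'a
  have T2: "(\<lambda>x. if x = 0 then b else sgn x) \<in> borel \<rightarrow>\<^sub>M sphere_measure"
    unfolding measurable_cong_sets[OF refl sets_sphere_measure]
    by (intro measurable_restrict_space2) (use b in \<open>auto simp: norm_sgn\<close>)
  have T [measurable]: "T \<in> borel \<rightarrow>\<^sub>M borel \<Otimes>\<^sub>M sphere_measure"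
    unfolding T_def by (intro measurable_Pair T2) auto
  have P: "radial_measure (DIM('a) - 1) \<Otimes>\<^sub>M sphere_measure = distr lborel (borel \<Otimes>\<^sub>M sphere_measure) T"
  proof (rule pair_measure_eqI)
    fix A :: "real set" and B :: "'a set"
    assume A: "A \<in> sets (radial_measure (DIM('a) - 1))" and B: "B \<in> sets sphere_measure"
    have "emeasure (distr lborel (borel \<Otimes>\<^sub>M sphere_measure) T) (A \<times> B) = emeasure lborel (T -` (A \<times> B))"
      using A B by (subst emeasure_distr) auto
    also have "\<dots> = emeasure lborel {x. x \<noteq> 0 \<and> sgn x \<in> B \<and> norm x \<in> A}"
    proof (rule emeasure_eq_AE)
      show "AE x in lborel. x \<in> T -` (A \<times> B) \<longleftrightarrow> x \<in> {x. x \<noteq> 0 \<and> sgn x \<in> B \<and> norm x \<in> A}"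
        using AE_lborel_singleton[of "0::'a"] by eventually_elim (auto simp: T_def)
      show "T -` (A \<times> B) \<in> sets lborel" using measurable_sets[OF T, of "A \<times> B"] A B by auto
      have "norm -` A \<inter> space borel \<in> sets (borel :: 'a measure)"
        using A by (intro measurable_sets[OF borel_measurable_norm]) auto
      moreover have "{x. x \<noteq> 0 \<and> sgn x \<in> B \<and> norm x \<in> A} = {x. x \<noteq> 0 \<and> sgn x \<in> B} \<inter> (norm -` A \<inter> space borel)"
        by auto
      ultimately show "{x. x \<noteq> 0 \<and> sgn x \<in> B \<and> norm x \<in> A} \<in> sets lborel"
        using cone_in_borel[OF B] by (metis sets.Int sets_lborel)
    qed
    finally show "emeasure (radial_measure (DIM('a) - 1)) A * emeasure sphere_measure B =
        emeasure (distr lborel (borel \<Otimes>\<^sub>M sphere_measure) T) (A \<times> B)"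
      using emeasure_polar_rectangle[OF B, of A] A by simp
  qed (auto intro: sigma_finite_radial_measure S.sigma_finite_measure_axioms sets_pair_measure_cong)
  have F [measurable]: "(\<lambda>p. f (fst p *\<^sub>R snd p)) \<in> borel_measurable (borel \<Otimes>\<^sub>M sphere_measure)"
    by (rule measurable_compose[OF measurable_polar_map f])
  have "(\<integral>\<^sup>+x. f x \<partial>lborel) = (\<integral>\<^sup>+x. f (fst (T x) *\<^sub>R snd (T x)) \<partial>lborel)"
  proof (rule nn_integral_cong_AE)
    show "AE x in lborel. f x = f (fst (T x) *\<^sub>R snd (T x))"
      using AE_lborel_singleton[of "0::'a"] by eventually_elim (simp add: T_def sgn_div_norm)
  qed
  also have "\<dots> = (\<integral>\<^sup>+p. f (fst p *\<^sub>R snd p) \<partial>distr lborel (borel \<Otimes>\<^sub>M sphere_measure) T)"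
    by (subst nn_integral_distr) auto
  also have "\<dots> = (\<integral>\<^sup>+p. f (fst p *\<^sub>R snd p) \<partial>(radial_measure (DIM('a) - 1) \<Otimes>\<^sub>M sphere_measure))"
    by (simp only: P)
  also have "\<dots> = (\<integral>\<^sup>+r. (\<integral>\<^sup>+\<omega>. f (r *\<^sub>R \<omega>) \<partial>sphere_measure) \<partial>radial_measure (DIM('a) - 1))"
    by (subst S.nn_integral_fst[symmetric]) auto
  also have "\<dots> = (\<integral>\<^sup>+r. indicator {0<..} r * ennreal (r ^ (DIM('a) - 1)) *
      (\<integral>\<^sup>+\<omega>. f (r *\<^sub>R \<omega>) \<partial>sphere_measure) \<partial>lborel)"
    unfolding radial_measure_def
  proof (rule nn_integral_density)
    have "(\<lambda>r. \<integral>\<^sup>+\<omega>. (\<lambda>p. f (fst p *\<^sub>R snd p)) (r, \<omega>) \<partial>sphere_measure) \<in> borel_measurable borel"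
      by (rule S.borel_measurable_nn_integral_fst[OF F])
    then show "(\<lambda>r. \<integral>\<^sup>+\<omega>. f (r *\<^sub>R \<omega>) \<partial>sphere_measure) \<in> borel_measurable lborel" by simp
  qed auto
  finally show ?thesis .
qed

lemma borel_measurable_nn_integral_sphere:
  fixes f :: "'a::euclidean_space \<Rightarrow> ennreal"
  assumes f: "f \<in> borel_measurable borel"
  shows "(\<lambda>r. \<integral>\<^sup>+\<omega>. f (r *\<^sub>R \<omega>) \<partial>sphere_measure) \<in> borel_measurable borel"
proof -
  interpret S: finite_measure "sphere_measure :: 'a measure" by (rule finite_measure_sphere)
  have "(\<lambda>p. f (fst p *\<^sub>R snd p)) \<in> borel_measurable (borel \<Otimes>\<^sub>M sphere_measure)"
    by (rule measurable_compose[OF measurable_polar_map f])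
  from S.borel_measurable_nn_integral_fst[OF this] show ?thesis by simp
qed

text \<open>The integral formula applied to the indicator of the exceptional set. It moves
  exceptional sets between the whole space and almost every sphere, the form in which angular
  versions are specified.\<close>

lemma AE_polar:
  fixes P :: "'a::euclidean_space \<Rightarrow> bool"
  assumes P: "Measurable.pred borel P"
  shows "(AE x in lborel. P x) \<longleftrightarrow> (AE r in lborel. 0 < r \<longrightarrow> (AE \<omega> in sphere_measure. P (r *\<^sub>R \<omega>)))"
proof -
  let ?f = "\<lambda>x. indicator {x. \<not> P x} x :: ennreal"
  have f [measurable]: "?f \<in> borel_measurable borel" using P by measurable
  have fr: "(\<lambda>\<omega>. ?f (r *\<^sub>R \<omega>)) \<in> borel_measurable sphere_measure" for r
  proof (rule measurable_compose[OF _ f])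
    show "(\<lambda>\<omega>. r *\<^sub>R \<omega>) \<in> sphere_measure \<rightarrow>\<^sub>M borel" by measurable
  qed
  have [measurable]: "(\<lambda>r. \<integral>\<^sup>+\<omega>. ?f (r *\<^sub>R \<omega>) \<partial>sphere_measure) \<in> borel_measurable borel"
    by (rule borel_measurable_nn_integral_sphere[OF f])
  have "(AE x in lborel. P x) \<longleftrightarrow> (\<integral>\<^sup>+x. ?f x \<partial>lborel) = 0"
    by (subst nn_integral_0_iff_AE) (auto simp: indicator_eq_0_iff)
  also have "\<dots> \<longleftrightarrow> (AE r in lborel. indicator {0<..} r * ennreal (r ^ (DIM('a) - 1)) *
      (\<integral>\<^sup>+\<omega>. ?f (r *\<^sub>R \<omega>) \<partial>sphere_measure) = 0)"
    by (subst nn_integral_polar[OF f], subst nn_integral_0_iff_AE) auto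
  also have "\<dots> \<longleftrightarrow> (AE r in lborel. 0 < r \<longrightarrow> (\<integral>\<^sup>+\<omega>. ?f (r *\<^sub>R \<omega>) \<partial>sphere_measure) = 0)"
  proof (intro AE_cong)
    fix r :: real
    have "0 < r \<Longrightarrow> ennreal (r ^ (DIM('a) - 1)) \<noteq> 0" by (simp add: ennreal_eq_0_iff not_le)
    then show "indicator {0<..} r * ennreal (r ^ (DIM('a) - 1)) * (\<integral>\<^sup>+\<omega>. ?f (r *\<^sub>R \<omega>) \<partial>sphere_measure) = 0 \<longleftrightarrow>
        (0 < r \<longrightarrow> (\<integral>\<^sup>+\<omega>. ?f (r *\<^sub>R \<omega>) \<partial>sphere_measure) = 0)"
      by (auto split: split_indicator)
  qed
  also have "\<dots> \<longleftrightarrow> (AE r in lborel. 0 < r \<longrightarrow> (AE \<omega> in sphere_measure. P (r *\<^sub>R \<omega>)))"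
    by (subst nn_integral_0_iff_AE[OF fr]) (simp add: indicator_eq_0_iff)
  finally show ?thesis .
qed

lemma measurable_sphere_scaleR [measurable]:
  "(\<lambda>\<omega>. r *\<^sub>R \<omega>) \<in> sphere_measure \<rightarrow>\<^sub>M (borel :: 'a::euclidean_space measure)"
  by measurable

lemma borel_measurable_compose_sgn:
  fixes u :: "'a::euclidean_space \<Rightarrow> complex"
  assumes u: "u \<in> borel_measurable sphere_measure"
  shows "(\<lambda>x. u (sgn x)) \<in> borel_measurable borel"
proof -
  obtain b :: 'a where b: "b \<in> Basis" using nonempty_Basis by blast
  have "(\<lambda>x::'a. if x = 0 then b else sgn x) \<in> borel \<rightarrow>\<^sub>M sphere_measure"
    unfolding measurable_cong_sets[OF refl sets_sphere_measure]
    by (intro measurable_restrict_space2) (use b in \<open>auto simp: norm_sgn\<close>)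
  from measurable_compose[OF this u]
  have "(\<lambda>x. u (if x = 0 then b else sgn x)) \<in> borel_measurable borel" .
  then show ?thesis
    by (rule measurable_discrete_difference[of _ _ _ "{0}"]) auto
qed


section \<open>The one-dimensional identity\<close>

text \<open>Integration by parts in the only form required: the two integrands differ by a total
  derivative without boundary contribution.\<close>

lemma integral_cancel_boundary:
  fixes F f g :: "real \<Rightarrow> real"
  assumes ab: "a \<le> b" and F: "\<And>r. r \<in> {a..b} \<Longrightarrow> (F has_vector_derivative f r - g r) (at r)"
    and bdry: "F a = 0" "F b = 0"
    and cont: "continuous_on {a..b} f" "continuous_on {a..b} g"
  shows "integral {a..b} f = integral {a..b} g"
proof -
  have "((\<lambda>r. f r - g r) has_integral F b - F a) {a..b}"
    using F by (intro fundamental_theorem_of_calculus ab) (auto intro: has_vector_derivative_at_within)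
  then have "integral {a..b} (\<lambda>r. f r - g r) = 0" using bdry by (simp add: integral_unique)
  then show ?thesis using cont by (simp add: integral_diff integrable_continuous_real)
qed

text \<open>
  Here \<open>v1\<close> and \<open>v2\<close> are the first and second derivatives of \<open>v\<close> with respect to \<open>ln r\<close>. Boundary values of \<open>v\<close>
  itself are not prescribed, because the radial trial functions do not vanish at the ends.
\<close>

locale log_derivatives =
  fixes v v1 v2 :: "real \<Rightarrow> complex" and a b :: real
  assumes ab: "0 < a" "a < b"
    and v: "\<And>r. r \<in> {a..b} \<Longrightarrow> (v has_vector_derivative inverse r *\<^sub>R v1 r) (at r)"
    and v1: "\<And>r. r \<in> {a..b} \<Longrightarrow> (v1 has_vector_derivative inverse r *\<^sub>R v2 r) (at r)"
    and v2: "continuous_on {a..b} v2"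
    and bdry1: "v1 a = 0" "v1 b = 0"
begin

lemma cont_v [continuous_intros]: "continuous_on {a..b} v"
  using v by (intro continuous_at_imp_continuous_on) (blast intro: has_vector_derivative_continuous)

lemma cont_v1 [continuous_intros]: "continuous_on {a..b} v1"
  using v1 by (intro continuous_at_imp_continuous_on) (blast intro: has_vector_derivative_continuous)

lemmas [continuous_intros] = v2

lemma nz: "r \<in> {a..b} \<Longrightarrow> r \<noteq> 0"
  using ab by auto

text \<open>The cross terms of the expanded square, apart from the \<open>2 A |v1|^2\<close>
  released by the product of \<open>v2\<close> and \<open>v\<close>, are the derivative of
  \<open>?F\<close>. Of its boundary terms those containing \<open>v1\<close> vanish by
  \<open>bdry1\<close>; only \<open>A \<beta> |v|^2\<close> calls for the alternative in the
  hypothesis.\<close>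

lemma integral_num:
  assumes "A = 0 \<or> v a = 0 \<and> v b = 0"
  shows "integral {a..b} (\<lambda>r. (cmod (v2 r + \<beta> *\<^sub>R v1 r - A *\<^sub>R v r))\<^sup>2 / r) =
    integral {a..b} (\<lambda>r. ((cmod (v2 r))\<^sup>2 + (\<beta>\<^sup>2 + 2 * A) * (cmod (v1 r))\<^sup>2 + A\<^sup>2 * (cmod (v r))\<^sup>2) / r)"
proof (rule integral_cancel_boundary)
  let ?F = "\<lambda>r. \<beta> * (v1 r \<bullet> v1 r) - 2 * A * (v1 r \<bullet> v r) - A * \<beta> * (v r \<bullet> v r)"
  fix r assume r: "r \<in> {a..b}"
  note inner = bounded_bilinear.has_vector_derivative[OF bounded_bilinear_inner]
  have "(?F has_vector_derivative
      \<beta> * (v1 r \<bullet> (inverse r *\<^sub>R v2 r) + (inverse r *\<^sub>R v2 r) \<bullet> v1 r) -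
      2 * A * (v1 r \<bullet> (inverse r *\<^sub>R v1 r) + (inverse r *\<^sub>R v2 r) \<bullet> v r) -
      A * \<beta> * (v r \<bullet> (inverse r *\<^sub>R v1 r) + (inverse r *\<^sub>R v1 r) \<bullet> v r)) (at r)"
    by (intro has_vector_derivative_diff has_vector_derivative_mult_right inner v[OF r] v1[OF r])
  moreover have "\<beta> * (v1 r \<bullet> (inverse r *\<^sub>R v2 r) + (inverse r *\<^sub>R v2 r) \<bullet> v1 r) -
      2 * A * (v1 r \<bullet> (inverse r *\<^sub>R v1 r) + (inverse r *\<^sub>R v2 r) \<bullet> v r) -
      A * \<beta> * (v r \<bullet> (inverse r *\<^sub>R v1 r) + (inverse r *\<^sub>R v1 r) \<bullet> v r) =
      (cmod (v2 r + \<beta> *\<^sub>R v1 r - A *\<^sub>R v r))\<^sup>2 / r -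
      ((cmod (v2 r))\<^sup>2 + (\<beta>\<^sup>2 + 2 * A) * (cmod (v1 r))\<^sup>2 + A\<^sup>2 * (cmod (v r))\<^sup>2) / r"
    using nz[OF r] unfolding power2_norm_eq_inner
    by (simp add: inner_simps inner_commute field_simps power2_eq_square)
  ultimately show "(?F has_vector_derivative (cmod (v2 r + \<beta> *\<^sub>R v1 r - A *\<^sub>R v r))\<^sup>2 / r -
      ((cmod (v2 r))\<^sup>2 + (\<beta>\<^sup>2 + 2 * A) * (cmod (v1 r))\<^sup>2 + A\<^sup>2 * (cmod (v r))\<^sup>2) / r) (at r)" by metis
qed (use ab assms bdry1 nz in \<open>auto intro!: continuous_intros\<close>)

lemma integral_den:
  assumes "\<gamma> = 0 \<or> v a = 0 \<and> v b = 0"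
  shows "integral {a..b} (\<lambda>r. ((cmod (v1 r - \<gamma> *\<^sub>R v r))\<^sup>2 + l * (cmod (v r))\<^sup>2) / r) =
    integral {a..b} (\<lambda>r. ((cmod (v1 r))\<^sup>2 + (l + \<gamma>\<^sup>2) * (cmod (v r))\<^sup>2) / r)"
proof (rule integral_cancel_boundary)
  let ?F = "\<lambda>r. - \<gamma> * (v r \<bullet> v r)"
  fix r assume r: "r \<in> {a..b}"
  have "(?F has_vector_derivative - \<gamma> * (v r \<bullet> (inverse r *\<^sub>R v1 r) + (inverse r *\<^sub>R v1 r) \<bullet> v r)) (at r)"
    by (intro has_vector_derivative_mult_right bounded_bilinear.has_vector_derivative[OF bounded_bilinear_inner] v[OF r])
  moreover have "- \<gamma> * (v r \<bullet> (inverse r *\<^sub>R v1 r) + (inverse r *\<^sub>R v1 r) \<bullet> v r) =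
      ((cmod (v1 r - \<gamma> *\<^sub>R v r))\<^sup>2 + l * (cmod (v r))\<^sup>2) / r - ((cmod (v1 r))\<^sup>2 + (l + \<gamma>\<^sup>2) * (cmod (v r))\<^sup>2) / r"
    using nz[OF r] unfolding power2_norm_eq_inner
    by (simp add: inner_simps inner_commute field_simps power2_eq_square)
  ultimately show "(?F has_vector_derivative ((cmod (v1 r - \<gamma> *\<^sub>R v r))\<^sup>2 + l * (cmod (v r))\<^sup>2) / r -
      ((cmod (v1 r))\<^sup>2 + (l + \<gamma>\<^sup>2) * (cmod (v r))\<^sup>2) / r) (at r)" by metis
qed (use ab assms nz in \<open>auto intro!: continuous_intros\<close>)

lemma integral_num_minus_den:
  assumes "A = 0 \<or> v a = 0 \<and> v b = 0" "\<gamma> = 0 \<or> v a = 0 \<and> v b = 0" and K: "K * (l + \<gamma>\<^sup>2) = A\<^sup>2"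
  shows "integral {a..b} (\<lambda>r. (cmod (v2 r + \<beta> *\<^sub>R v1 r - A *\<^sub>R v r))\<^sup>2 / r) -
    K * integral {a..b} (\<lambda>r. ((cmod (v1 r - \<gamma> *\<^sub>R v r))\<^sup>2 + l * (cmod (v r))\<^sup>2) / r) =
    integral {a..b} (\<lambda>r. ((cmod (v2 r))\<^sup>2 + (\<beta>\<^sup>2 + 2 * A - K) * (cmod (v1 r))\<^sup>2) / r)"
proof -
  have "integral {a..b} (\<lambda>r. ((cmod (v2 r))\<^sup>2 + (\<beta>\<^sup>2 + 2 * A) * (cmod (v1 r))\<^sup>2 + A\<^sup>2 * (cmod (v r))\<^sup>2) / r) -
      K * integral {a..b} (\<lambda>r. ((cmod (v1 r))\<^sup>2 + (l + \<gamma>\<^sup>2) * (cmod (v r))\<^sup>2) / r) =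
      integral {a..b} (\<lambda>r. ((cmod (v2 r))\<^sup>2 + (\<beta>\<^sup>2 + 2 * A) * (cmod (v1 r))\<^sup>2 + A\<^sup>2 * (cmod (v r))\<^sup>2) / r -
        K * (((cmod (v1 r))\<^sup>2 + (l + \<gamma>\<^sup>2) * (cmod (v r))\<^sup>2) / r))"
    unfolding integral_mult_right[symmetric]
    by (intro Henstock_Kurzweil_Integration.integral_diff[symmetric] integrable_continuous_real)
       (use nz ab in \<open>auto intro!: continuous_intros\<close>)
  also have "\<dots> = integral {a..b} (\<lambda>r. ((cmod (v2 r))\<^sup>2 + (\<beta>\<^sup>2 + 2 * A - K) * (cmod (v1 r))\<^sup>2) / r)"
    by (intro integral_cong) (use nz ab in \<open>simp add: K[symmetric] field_simps\<close>)
  finally show ?thesis using integral_num[OF assms(1), of \<beta>] integral_den[OF assms(2), of l] by simp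
qed

text \<open>If the integral vanished, \<open>v2\<close> would be zero, so \<open>v1\<close> would be
  constant and zero by its boundary values, and \<open>v\<close> would keep its value 0 from the
  left end. The second derivative alone suffices, which matters because \<open>\<kappa> = 0\<close>
  occurs for zero modes.\<close>

lemma remainder_pos:
  assumes \<kappa>: "\<kappa> \<ge> 0" and v0: "v a = 0" and nz': "r0 \<in> {a..b}" "v r0 \<noteq> 0"
  shows "integral {a..b} (\<lambda>r. ((cmod (v2 r))\<^sup>2 + \<kappa> * (cmod (v1 r))\<^sup>2) / r) > 0"
proof (rule ccontr)
  let ?f = "\<lambda>r. ((cmod (v2 r))\<^sup>2 + \<kappa> * (cmod (v1 r))\<^sup>2) / r"
  assume "\<not> integral {a..b} ?f > 0"
  moreover have nonneg: "?f r \<ge> 0" if "r \<in> {a..b}" for r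
    using that ab \<kappa> by (auto intro!: divide_nonneg_nonneg add_nonneg_nonneg)
  then have "integral {a..b} ?f \<ge> 0" by (intro integral_nonneg integrable_continuous_real)
      (use nz ab in \<open>auto intro!: continuous_intros\<close>)
  ultimately have "integral {a..b} ?f = 0" by linarith
  moreover have "continuous_on {a..b} ?f" using nz ab by (auto intro!: continuous_intros)
  ultimately have zero: "?f r = 0" if "r \<in> {a..b}" for r
    using integral_eq_0_iff[of a b ?f] nonneg that ab by auto
  have v2_0: "v2 r = 0" if "r \<in> {a..b}" for r
  proof -
    have "(cmod (v2 r))\<^sup>2 + \<kappa> * (cmod (v1 r))\<^sup>2 = 0" using zero[OF that] nz[OF that] by simp
    moreover have "\<kappa> * (cmod (v1 r))\<^sup>2 \<ge> 0" using \<kappa> by simp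
    ultimately have "(cmod (v2 r))\<^sup>2 = 0" using zero_le_power2[of "cmod (v2 r)"] by linarith
    then show ?thesis by simp
  qed
  have const: "f r = f a" if "\<And>r. r \<in> {a..b} \<Longrightarrow> (f has_vector_derivative inverse r *\<^sub>R f' r) (at r)"
    "\<And>r. r \<in> {a..b} \<Longrightarrow> f' r = 0" "r \<in> {a..b}" for f f' :: "real \<Rightarrow> complex" and r
  proof -
    have "\<exists>c. \<forall>x\<in>{a..b}. f x = c"
    proof (rule has_vector_derivative_zero_constant[of "{a..b}" f])
      show "(f has_vector_derivative 0) (at x within {a..b})" if "x \<in> {a..b}" for x
        using \<open>\<And>r. r \<in> {a..b} \<Longrightarrow> (f has_vector_derivative inverse r *\<^sub>R f' r) (at r)\<close>[OF that]
          \<open>\<And>r. r \<in> {a..b} \<Longrightarrow> f' r = 0\<close>[OF that]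
        by (auto intro: has_vector_derivative_at_within)
    qed auto
    then show ?thesis using that(3) ab by auto
  qed
  have "v1 r = 0" if "r \<in> {a..b}" for r using const[OF v1 v2_0 that] bdry1 by simp
  then have "v r0 = v a" using const[OF v _ nz'(1)] by blast
  with v0 nz' show False by simp
qed

end

text \<open>The share of one angular coefficient in the radial integrand of the numerator:
  \<open>c\<close>, \<open>c1\<close>, \<open>c2\<close> are the values of the coefficient and of
  its derivatives in \<open>r\<close> (not in \<open>ln r\<close>), \<open>l\<close> is the
  eigenvalue, and \<open>r ^ (d - 1)\<close> is the Jacobian of polar coordinates.\<close>

definition num_density :: "nat \<Rightarrow> real \<Rightarrow> real \<Rightarrow> complex \<Rightarrow> complex \<Rightarrow> complex \<Rightarrow> real \<Rightarrow> real" where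
  "num_density d \<alpha> l c c1 c2 r = r ^ (d - 1) / r powr \<alpha> *
     (cmod (- c2 - of_real ((real d - 1) / r) * c1 + of_real (1 / r\<^sup>2) * (of_real l * c)))\<^sup>2"

definition den_density :: "nat \<Rightarrow> real \<Rightarrow> real \<Rightarrow> complex \<Rightarrow> complex \<Rightarrow> real \<Rightarrow> real" where
  "den_density d \<alpha> l c c1 r = r ^ (d - 1) / r powr (\<alpha> + 2) * ((cmod c1)\<^sup>2 + 1 / r\<^sup>2 * (l * (cmod c)\<^sup>2))"

text \<open>
  The power \<open>r powr \<gamma>\<close> is the one that makes both weights scale invariant, that is, turns both
  integrals into integrals against \<open>dr / r\<close> with constant coefficients.
\<close>

lemma densities_log:
  fixes v v1 v2 c c1 c2 :: complex
  assumes d: "d \<ge> 1" and \<gamma>: "\<gamma> = (real d - 4 - \<alpha>) / 2" and r: "r > 0"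
    and v: "v = (r powr \<gamma>) *\<^sub>R c" and v1: "v1 = \<gamma> *\<^sub>R v + (r powr \<gamma> * r) *\<^sub>R c1"
    and v2: "v2 = \<gamma> *\<^sub>R v1 + ((\<gamma> + 1) * (r powr \<gamma> * r)) *\<^sub>R c1 + (r powr \<gamma> * r\<^sup>2) *\<^sub>R c2"
  shows "num_density d \<alpha> l c c1 c2 r = (cmod (v2 + (\<alpha> + 2) *\<^sub>R v1 - (l + \<gamma>\<^sup>2 + \<gamma> * (\<alpha> + 2)) *\<^sub>R v))\<^sup>2 / r"
    and "den_density d \<alpha> l c c1 r = ((cmod (v1 - \<gamma> *\<^sub>R v))\<^sup>2 + l * (cmod v)\<^sup>2) / r"
proof -
  define p where "p = r powr \<gamma>"
  have p: "p > 0" using r by (simp add: p_def)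
  have \<alpha>: "\<alpha> = real d - 4 - 2 * \<gamma>" using \<gamma> by (simp add: field_simps)
  have rd: "r ^ (d - 1) = r powr (real d - 1)" using powr_realpow[OF r, of "d - 1"] d by (simp add: of_nat_diff)
  have "r powr (2 * \<gamma>) = p\<^sup>2" by (simp add: p_def power2_eq_square powr_add[symmetric])
  moreover have "r powr 3 = r ^ 3" using powr_realpow[OF r, of 3] by simp
  ultimately have w1: "r ^ (d - 1) / r powr \<alpha> = p\<^sup>2 * r ^ 3"
    unfolding rd powr_diff[symmetric] \<alpha> by (simp add: powr_add algebra_simps)
  have w2: "r ^ (d - 1) / r powr (\<alpha> + 2) = p\<^sup>2 * r"
  proof -
    have "r powr (\<alpha> + 2) = r powr \<alpha> * r\<^sup>2" using r by (simp add: powr_add)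
    then have "r ^ (d - 1) / r powr (\<alpha> + 2) = (r ^ (d - 1) / r powr \<alpha>) / r\<^sup>2" by (simp only: divide_divide_eq_left)
    then show ?thesis unfolding w1 using r by (simp add: power2_eq_square power3_eq_cube)
  qed
  have "v2 + (\<alpha> + 2) *\<^sub>R v1 - (l + \<gamma>\<^sup>2 + \<gamma> * (\<alpha> + 2)) *\<^sub>R v =
      (- (p * r\<^sup>2)) *\<^sub>R (- c2 - of_real ((real d - 1) / r) * c1 + of_real (1 / r\<^sup>2) * (of_real l * c))"
    using r unfolding v2 v1 v \<alpha> p_def[symmetric] scaleR_conv_of_real
    by (simp add: field_simps power2_eq_square)
  then have "cmod (v2 + (\<alpha> + 2) *\<^sub>R v1 - (l + \<gamma>\<^sup>2 + \<gamma> * (\<alpha> + 2)) *\<^sub>R v) =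
      p * r\<^sup>2 * cmod (- c2 - of_real ((real d - 1) / r) * c1 + of_real (1 / r\<^sup>2) * (of_real l * c))"
    using p by (simp only: norm_scaleR) simp
  then show "num_density d \<alpha> l c c1 c2 r = (cmod (v2 + (\<alpha> + 2) *\<^sub>R v1 - (l + \<gamma>\<^sup>2 + \<gamma> * (\<alpha> + 2)) *\<^sub>R v))\<^sup>2 / r"
    unfolding num_density_def w1 using r by (simp add: power_mult_distrib power2_eq_square power3_eq_cube)
  have "v1 - \<gamma> *\<^sub>R v = (p * r) *\<^sub>R c1" "v = p *\<^sub>R c" by (simp_all add: v1 v p_def)
  then show "den_density d \<alpha> l c c1 r = ((cmod (v1 - \<gamma> *\<^sub>R v))\<^sup>2 + l * (cmod v)\<^sup>2) / r"
    unfolding den_density_def w2 using r p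
    by (simp add: power_mult_distrib field_simps power2_eq_square)
qed

lemma nn_integral_compact_support:
  fixes f :: "real \<Rightarrow> real"
  assumes "0 < a" "continuous_on {a..b} f" "\<And>r. r \<in> {a..b} \<Longrightarrow> 0 \<le> f r" "\<And>r. 0 < r \<Longrightarrow> r \<notin> {a..b} \<Longrightarrow> f r = 0"
  shows "(\<integral>\<^sup>+r. indicator {0<..} r * ennreal (f r) \<partial>lborel) = ennreal (integral {a..b} f)"
proof -
  let ?g = "\<lambda>r. indicator {a..b} r * f r"
  have "(\<integral>\<^sup>+r. indicator {0<..} r * ennreal (f r) \<partial>lborel) = (\<integral>\<^sup>+r. ennreal (?g r) \<partial>lborel)"
    by (intro nn_integral_cong) (use assms in \<open>auto split: split_indicator\<close>)
  also have "\<dots> = ennreal (integral {a..b} f)"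
  proof (rule nn_integral_has_integral_lborel)
    have "(\<lambda>r. indicator {a..b} r *\<^sub>R f r) \<in> borel_measurable borel"
      using assms(2) by (intro borel_measurable_continuous_on_indicator) auto
    then show "?g \<in> borel_measurable borel" by simp
    have "((\<lambda>r. if r \<in> {a..b} then f r else 0) has_integral integral {a..b} f) UNIV"
      using assms(2) by (subst has_integral_restrict_UNIV) (auto intro: integrable_integral integrable_continuous_real)
    moreover have "(\<lambda>r. if r \<in> {a..b} then f r else 0) = ?g" by (auto split: split_indicator)
    ultimately show "(?g has_integral integral {a..b} f) UNIV" by simp
    show "0 \<le> ?g r" for r using assms(3) by (auto split: split_indicator)
  qed
  finally show ?thesis .
qed


section \<open>Angular coefficients\<close>

lemma L2_sphere_continuous:
  fixes f :: "'a::euclidean_space \<Rightarrow> complex"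
  assumes "continuous_on (sphere 0 1) f"
  shows "f \<in> L2 sphere_measure"
proof -
  interpret S: finite_measure "sphere_measure :: 'a measure" by (rule finite_measure_sphere)
  have f [measurable]: "f \<in> borel_measurable sphere_measure"
    unfolding measurable_cong_sets[OF sets_sphere_measure refl]
    by (rule borel_measurable_continuous_on_restrict[OF assms])
  have "compact (f ` sphere 0 1)" by (intro compact_continuous_image assms) auto
  then obtain B where B: "\<And>\<omega>. \<omega> \<in> sphere 0 1 \<Longrightarrow> cmod (f \<omega>) \<le> B"
    by (meson bounded_iff compact_imp_bounded imageI)
  have "integrable sphere_measure (\<lambda>\<omega>. (cmod (f \<omega>))\<^sup>2)"
  proof (rule S.integrable_const_bound[where B="B\<^sup>2"])
    show "AE \<omega> in sphere_measure. norm ((cmod (f \<omega>))\<^sup>2) \<le> B\<^sup>2"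
      using B by (intro AE_I2) (auto intro!: power_mono)
  qed simp
  then show ?thesis by (simp add: L2_def)
qed

lemma continuous_on_sphere_scaled:
  fixes \<psi> :: "'a::euclidean_space \<Rightarrow> complex"
  assumes "continuous_on (- {0}) \<psi>" "r > 0"
  shows "continuous_on (sphere 0 1) (\<lambda>\<omega>. \<psi> (r *\<^sub>R \<omega>))"
  by (rule continuous_on_compose2[OF assms(1)]) (use assms(2) in \<open>auto intro!: continuous_intros\<close>)

lemma L2_norm_sphere_bound:
  fixes f :: "'a::euclidean_space \<Rightarrow> complex"
  assumes f: "f \<in> L2 sphere_measure" and le: "\<And>\<omega>. norm \<omega> = 1 \<Longrightarrow> cmod (f \<omega>) \<le> \<eta>" and "\<eta> \<ge> 0"
  shows "L2_norm sphere_measure f \<le> \<eta> * sqrt (measure (sphere_measure :: 'a measure) (sphere 0 1))"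
proof -
  interpret S: finite_measure "sphere_measure :: 'a measure" by (rule finite_measure_sphere)
  have "(LINT \<omega>|sphere_measure. (cmod (f \<omega>))\<^sup>2) \<le> (LINT \<omega>|(sphere_measure :: 'a measure). \<eta>\<^sup>2)"
    by (intro integral_mono L2_integrable f) (auto intro!: power_mono le)
  also have "\<dots> = \<eta>\<^sup>2 * measure (sphere_measure :: 'a measure) (sphere 0 1)" by simp
  finally have "sqrt (LINT \<omega>|sphere_measure. (cmod (f \<omega>))\<^sup>2) \<le>
      sqrt (\<eta>\<^sup>2 * measure (sphere_measure :: 'a measure) (sphere 0 1))" by (rule real_sqrt_le_mono)
  then show ?thesis using \<open>\<eta> \<ge> 0\<close> by (simp add: L2_norm_def real_sqrt_mult)
qed

text \<open>On a compact annulus around the sphere of radius \<open>r\<close> the radial derivative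
  is uniformly continuous, so the linearisation error is uniformly small in \<open>\<omega>\<close>.
  The surface measure is finite, hence the error is small in L2 as well and passes through the inner
  product.\<close>

lemma has_vector_derivative_L2_inner_sphere:
  fixes \<psi> w :: "'a::euclidean_space \<Rightarrow> complex"
  assumes \<psi>: "smooth_on (- {0}) \<psi>" and w: "w \<in> L2 sphere_measure" and r: "r > 0"
  shows "((\<lambda>r. L2_inner sphere_measure (\<lambda>\<omega>. \<psi> (r *\<^sub>R \<omega>)) w) has_vector_derivative
    L2_inner sphere_measure (\<lambda>\<omega>. radial_deriv \<psi> (r *\<^sub>R \<omega>)) w) (at r)"
proof -
  let ?\<psi>1 = "radial_deriv \<psi>"
  let ?c = "\<lambda>r. L2_inner sphere_measure (\<lambda>\<omega>. \<psi> (r *\<^sub>R \<omega>)) w"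
  let ?c1 = "L2_inner sphere_measure (\<lambda>\<omega>. ?\<psi>1 (r *\<^sub>R \<omega>)) w"
  have cont1: "continuous_on (- {0}) ?\<psi>1"
    by (rule smooth_on_continuous[OF smooth_on_radial_deriv[OF \<psi>]])
  have L2\<psi>: "(\<lambda>\<omega>. \<psi> (s *\<^sub>R \<omega>)) \<in> L2 sphere_measure" if "s > 0" for s
    by (intro L2_sphere_continuous continuous_on_sphere_scaled smooth_on_continuous[OF \<psi>] that)
  have L2\<psi>1: "(\<lambda>\<omega>. ?\<psi>1 (r *\<^sub>R \<omega>)) \<in> L2 sphere_measure"
    by (intro L2_sphere_continuous continuous_on_sphere_scaled cont1 r)
  define K where "K = cball (0::'a) (2 * r) - ball 0 (r / 2)"
  have "compact K" unfolding K_def by (intro compact_diff) auto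
  moreover have "K \<subseteq> - {0}" using r by (auto simp: K_def)
  ultimately have unif: "uniformly_continuous_on K ?\<psi>1"
    by (intro compact_uniformly_continuous continuous_on_subset[OF cont1])
  define W where "W = sqrt (measure (sphere_measure :: 'a measure) (sphere 0 1)) * L2_norm sphere_measure w"
  have W: "W \<ge> 0" by (simp add: W_def)
  have "\<exists>d>0. \<forall>y. norm (y - r) < d \<longrightarrow> norm (?c y - ?c r - (y - r) *\<^sub>R ?c1) \<le> e * norm (y - r)" if e: "e > 0" for e
  proof -
    \<comment> \<open>The summand 1 keeps the quotient meaningful when \<open>W = 0\<close>.\<close>
    define e' where "e' = e / (W + 1)"
    have e': "e' > 0" using e W by (simp add: e'_def)
    obtain \<delta>0 where \<delta>0: "\<delta>0 > 0" "\<And>x x'. x \<in> K \<Longrightarrow> x' \<in> K \<Longrightarrow> dist x' x < \<delta>0 \<Longrightarrow> dist (?\<psi>1 x') (?\<psi>1 x) < e'"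
      using unif e' unfolding uniformly_continuous_on_def by metis
    \<comment> \<open>The bound \<open>r / 2\<close> keeps the segment from \<open>r\<close> to
      \<open>y\<close> inside the annulus \<open>K\<close>, in particular away from the
      origin.\<close>
    define \<delta> where "\<delta> = min \<delta>0 (r / 2)"
    have \<delta>: "\<delta> > 0" using \<delta>0 r by (simp add: \<delta>_def)
    have "norm (?c y - ?c r - (y - r) *\<^sub>R ?c1) \<le> e * norm (y - r)" if y: "norm (y - r) < \<delta>" for y
    proof -
      have y0: "y > 0" using y r by (auto simp: \<delta>_def abs_if split: if_splits)
      let ?f = "\<lambda>\<omega>. \<psi> (y *\<^sub>R \<omega>) - \<psi> (r *\<^sub>R \<omega>) - of_real (y - r) * ?\<psi>1 (r *\<^sub>R \<omega>)"
      have fL2: "?f \<in> L2 sphere_measure" by (intro L2_diff L2_cmult L2\<psi> L2\<psi>1 y0 r)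
      have "?c y - ?c r - (y - r) *\<^sub>R ?c1 = L2_inner sphere_measure ?f w"
        using L2_inner_diff_left[OF L2_diff[OF L2\<psi>[OF y0] L2\<psi>[OF r]] L2_cmult[OF L2\<psi>1] w]
          L2_inner_diff_left[OF L2\<psi>[OF y0] L2\<psi>[OF r] w]
        by (simp only: L2_inner_cmult_left scaleR_conv_of_real)
      also have "norm \<dots> \<le> L2_norm sphere_measure ?f * L2_norm sphere_measure w"
        by (rule L2_Cauchy_Schwarz[OF fL2 w])
      also have "L2_norm sphere_measure ?f \<le>
          (e' * norm (y - r)) * sqrt (measure (sphere_measure :: 'a measure) (sphere 0 1))"
      proof (rule L2_norm_sphere_bound[OF fL2])
        fix \<omega> :: 'a assume \<omega>: "norm \<omega> = 1"
        let ?S = "{r - \<delta><..<r + \<delta>}"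
        have pos: "t > 0" if "t \<in> ?S" for t using that r by (auto simp: \<delta>_def min_def split: if_splits)
        have "norm (\<psi> (y *\<^sub>R \<omega>) - \<psi> (r *\<^sub>R \<omega>) - (y - r) *\<^sub>R ?\<psi>1 (r *\<^sub>R \<omega>)) \<le> norm (y - r) * e'"
        proof (rule vector_differentiable_bound_linearization[where S="?S" and f'="\<lambda>t. ?\<psi>1 (t *\<^sub>R \<omega>)"])
          show "((\<lambda>t. \<psi> (t *\<^sub>R \<omega>)) has_vector_derivative ?\<psi>1 (t *\<^sub>R \<omega>)) (at t within ?S)" if "t \<in> ?S" for t
            by (rule has_vector_derivative_at_within[OF has_vector_derivative_radial_deriv[OF \<psi> pos[OF that] \<omega>]])
          show "closed_segment r y \<subseteq> ?S"
            using y \<delta> by (auto simp: closed_segment_eq_real_ivl abs_if split: if_splits)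
          show "norm (?\<psi>1 (t *\<^sub>R \<omega>) - ?\<psi>1 (r *\<^sub>R \<omega>)) \<le> e'" if t: "t \<in> ?S" for t
          proof -
            have "t *\<^sub>R \<omega> \<in> K" "r *\<^sub>R \<omega> \<in> K"
              using t r \<omega> pos[OF t] by (auto simp: K_def \<delta>_def min_def split: if_splits)
            moreover have "dist (t *\<^sub>R \<omega>) (r *\<^sub>R \<omega>) < \<delta>0"
            proof -
              have "dist (t *\<^sub>R \<omega>) (r *\<^sub>R \<omega>) = \<bar>t - r\<bar>"
                using \<omega> by (simp add: dist_norm scaleR_left_diff_distrib[symmetric])
              then show ?thesis using t by (auto simp: \<delta>_def abs_if min_def split: if_splits)
            qed
            ultimately show ?thesis using \<delta>0(2)[of "r *\<^sub>R \<omega>" "t *\<^sub>R \<omega>"] by (simp add: dist_norm)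
          qed
          show "r \<in> ?S" using \<delta> by simp
        qed
        then show "cmod (?f \<omega>) \<le> e' * norm (y - r)" by (simp add: scaleR_conv_of_real mult.commute)
      qed (use e' in simp)
      then have "L2_norm sphere_measure ?f * L2_norm sphere_measure w \<le> e' * norm (y - r) * W"
        unfolding W_def mult.assoc[symmetric] by (rule mult_right_mono) simp
      also have "\<dots> \<le> e * norm (y - r)"
      proof -
        have "e' * W \<le> e" using W e by (simp add: e'_def field_simps)
        then have "(e' * W) * norm (y - r) \<le> e * norm (y - r)" by (rule mult_right_mono) simp
        then show ?thesis by (simp add: mult_ac)
      qed
      finally show ?thesis by simp
    qed
    with \<delta> show ?thesis by blast
  qed
  then show ?thesis
    unfolding has_vector_derivative_def has_derivative_at_alt
    by (auto intro: bounded_linear_scaleR_left)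
qed

section \<open>Jointly measurable versions of angular operators\<close>

lemma borel_measurable_if_continuous_away_0:
  fixes f :: "'a::euclidean_space \<Rightarrow> complex"
  assumes "continuous_on (- {0}) f" shows "f \<in> borel_measurable borel"
  by (rule borel_measurable_continuous_countable_exceptions[of "{0}"]) (use assms in auto)

context complete_ortho_system
begin

lemma suminf_coeff_ennreal:
  assumes f: "f \<in> L2 M"
  shows "(\<integral>\<^sup>+x. ennreal ((cmod (f x))\<^sup>2) \<partial>M) = (\<Sum>n. ennreal ((cmod (L2_inner M f (e n)))\<^sup>2))"
proof -
  note P = Parseval[OF f]
  have "(\<Sum>n. ennreal ((cmod (L2_inner M f (e n)))\<^sup>2)) = ennreal (\<Sum>n. (cmod (L2_inner M f (e n)))\<^sup>2)"
    using sums_summable[OF P] by (intro suminf_ennreal2) auto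
  then show ?thesis using sums_unique[OF P] by (simp add: nn_integral_L2[OF f])
qed

end

text \<open>
  The expansion in the functions \<open>e n\<close> converges in \<open>L\<^sup>2\<close> on every sphere. Truncating it at a measurably
  chosen index \<open>sel j r\<close>, where the tail is at most \<open>(1/2)\<^sup>j\<close>, makes it converge almost everywhere as well.
\<close>

lemma exists_angular_version:
  fixes G :: "real \<Rightarrow> 'a::euclidean_space \<Rightarrow> complex"
  assumes e: "complete_ortho_system sphere_measure e J"
    and G: "\<And>r. r > 0 \<Longrightarrow> G r \<in> L2 sphere_measure"
    and k [measurable]: "\<And>n. k n \<in> borel_measurable borel"
    and k_eq: "\<And>n r. r > 0 \<Longrightarrow> k n r = L2_inner sphere_measure (G r) (e n)"
  obtains F where "F \<in> borel_measurable borel"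
    "\<And>r. r > 0 \<Longrightarrow> ae_eq sphere_measure (\<lambda>\<omega>. F (r *\<^sub>R \<omega>)) (G r)"
proof -
  interpret complete_ortho_system sphere_measure e J by (rule e)
  define T where "T N r = (\<Sum>n. (cmod (k (n + N) r))\<^sup>2)" for N r
  define sel where "sel j r = (LEAST N. T N r \<le> (1/2)^j)" for j r
  define S where "S j x = (\<Sum>n<sel j (norm x). k n (norm x) * e n (sgn x))" for j and x :: 'a
  have [measurable]: "T N \<in> borel_measurable borel" for N unfolding T_def[abs_def] by measurable
  have [measurable]: "sel j \<in> borel \<rightarrow>\<^sub>M count_space UNIV" for j unfolding sel_def[abs_def] by measurable
  have [measurable]: "(\<lambda>x. e n (sgn x)) \<in> borel_measurable borel" for n
    by (intro borel_measurable_compose_sgn L2_measurable) simp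
  have [measurable]: "S j \<in> borel_measurable borel" for j
    unfolding S_def[abs_def]
    \<comment> \<open>The cut-off index takes countably many values, and for each fixed value the
      expression is a finite measurable sum.\<close>
    by (rule measurable_compose_countable[where g="\<lambda>x. sel j (norm x)"]) measurable
  have "ae_eq sphere_measure (\<lambda>\<omega>. lim (\<lambda>j. S j (r *\<^sub>R \<omega>))) (G r)" if r: "r > 0" for r
  proof -
    have sums: "(\<lambda>n. (cmod (k n r))\<^sup>2) sums (L2_norm sphere_measure (G r))\<^sup>2"
      using Parseval[OF G[OF r]] by (simp add: k_eq[OF r])
    have T: "T N r = (L2_norm sphere_measure (G r))\<^sup>2 - (\<Sum>n<N. (cmod (k n r))\<^sup>2)" for N
      unfolding T_def using suminf_minus_initial_segment[OF sums_summable[OF sums]] sums_unique[OF sums] by simp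
    have "(\<lambda>N. (L2_norm sphere_measure (G r))\<^sup>2 - (\<Sum>n<N. (cmod (k n r))\<^sup>2)) \<longlonglongrightarrow> 0"
      using sums unfolding sums_def by (simp add: LIM_zero_iff tendsto_diff[OF tendsto_const, of _ "(L2_norm sphere_measure (G r))\<^sup>2" _ "(L2_norm sphere_measure (G r))\<^sup>2", simplified])
    then have T0: "(\<lambda>N. T N r) \<longlonglongrightarrow> 0" by (simp add: T)
    have sel: "T (sel j r) r \<le> (1/2)^j" for j
    proof -
      have "\<exists>N. T N r < (1/2)^j"
        using order_tendstoD(2)[OF T0, of "(1/2)^j"] by (auto simp: eventually_sequentially)
      then show ?thesis unfolding sel_def by (metis LeastI_ex less_imp_le)
    qed
    have "AE \<omega> in sphere_measure. (\<lambda>j. S j (r *\<^sub>R \<omega>)) \<longlonglongrightarrow> G r \<omega>"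
    proof (rule AE_tendsto_if_summable_L2_dist)
      show "(\<lambda>\<omega>. S j (r *\<^sub>R \<omega>)) \<in> borel_measurable sphere_measure" for j by measurable
      show "G r \<in> borel_measurable sphere_measure" using G[OF r] by (rule L2_measurable)
      fix j
      let ?P = "\<lambda>\<omega>. \<Sum>n<sel j r. L2_inner sphere_measure (G r) (e n) * e n \<omega>"
      have "(\<integral>\<^sup>+\<omega>. ennreal ((cmod (S j (r *\<^sub>R \<omega>) - G r \<omega>))\<^sup>2) \<partial>sphere_measure) =
          (\<integral>\<^sup>+\<omega>. ennreal ((cmod (G r \<omega> - ?P \<omega>))\<^sup>2) \<partial>sphere_measure)"
      proof (rule nn_integral_cong)
        fix \<omega> :: 'a assume "\<omega> \<in> space sphere_measure"
        then have "norm (r *\<^sub>R \<omega>) = r" "sgn (r *\<^sub>R \<omega>) = \<omega>" using r by (auto simp: sgn_div_norm)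
        then have "S j (r *\<^sub>R \<omega>) = ?P \<omega>" unfolding S_def by (simp add: k_eq[OF r])
        then show "ennreal ((cmod (S j (r *\<^sub>R \<omega>) - G r \<omega>))\<^sup>2) = ennreal ((cmod (G r \<omega> - ?P \<omega>))\<^sup>2)"
          by (simp add: norm_minus_commute)
      qed
      also have "\<dots> = ennreal ((L2_norm sphere_measure (\<lambda>\<omega>. G r \<omega> - ?P \<omega>))\<^sup>2)"
        using G[OF r] by (intro nn_integral_L2) auto
      also have "(L2_norm sphere_measure (\<lambda>\<omega>. G r \<omega> - ?P \<omega>))\<^sup>2 = T (sel j r) r"
        using G[OF r] by (subst norm_diff_sum_power2) (auto simp: T k_eq[OF r])
      also have "ennreal \<dots> \<le> ennreal ((1/2)^j)" by (intro ennreal_leI sel)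
      finally show "(\<integral>\<^sup>+\<omega>. ennreal ((cmod (S j (r *\<^sub>R \<omega>) - G r \<omega>))\<^sup>2) \<partial>sphere_measure) \<le> ennreal ((1/2)^j)" .
    qed
    then show ?thesis unfolding ae_eq_def by eventually_elim (rule limI)
  qed
  with that[of "\<lambda>x. lim (\<lambda>j. S j x)"] show ?thesis by auto
qed

section \<open>Separation of variables\<close>

locale angular_operator =
  discrete_operator "sphere_measure :: 'a::euclidean_space measure" dom\<Lambda> \<Lambda> I lam u
  for dom\<Lambda> \<Lambda> and I :: "'i set" and lam u +
  fixes dom_sqrt\<Lambda> and sqrt\<Lambda> :: "('a \<Rightarrow> complex) \<Rightarrow> ('a \<Rightarrow> complex)"
  assumes sqrt: "selfadjoint_sqrt sphere_measure dom\<Lambda> \<Lambda> dom_sqrt\<Lambda> sqrt\<Lambda>"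
begin

sublocale sqrt: selfadjoint_operator sphere_measure dom_sqrt\<Lambda> sqrt\<Lambda>
  using sqrt by unfold_locales (simp add: selfadjoint_sqrt_def nonnegative_selfadjoint_def)

lemma dom_sqrt:
  assumes "f \<in> dom\<Lambda>"
  shows "f \<in> dom_sqrt\<Lambda>" "sqrt\<Lambda> f \<in> dom_sqrt\<Lambda>" "ae_eq sphere_measure (sqrt\<Lambda> (sqrt\<Lambda> f)) (\<Lambda> f)"
  using sqrt assms unfolding selfadjoint_sqrt_def by blast+

text \<open>Write \<open>B\<close> for the square root and \<open>s = sqrt l\<close>. From
  \<open>B^2 - l = (B + s) (B - s)\<close> the vector \<open>y = (B - s) w\<close> satisfies
  \<open>B y = - s y\<close>, which non-negativity of \<open>B\<close> allows only for
  \<open>y = 0\<close> if \<open>s > 0\<close>. If \<open>l = 0\<close>, symmetry gives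
  \<open>|B w|^2 = 0\<close> directly.\<close>

lemma sqrt_eigenfunction:
  assumes w: "eigenfunction sphere_measure dom\<Lambda> \<Lambda> l w" and l: "l \<ge> 0"
  shows "ae_eq sphere_measure (sqrt\<Lambda> w) (\<lambda>\<omega>. of_real (sqrt l) * w \<omega>)"
proof -
  have wD: "w \<in> dom\<Lambda>" and Lw: "ae_eq sphere_measure (\<Lambda> w) (\<lambda>\<omega>. of_real l * w \<omega>)"
    using w by (auto simp: eigenfunction_def)
  note E = dom_sqrt[OF wD]
  have BB: "ae_eq sphere_measure (sqrt\<Lambda> (sqrt\<Lambda> w)) (\<lambda>\<omega>. of_real l * w \<omega>)"
    using E(3) Lw by (rule ae_eq_trans)
  let ?s = "complex_of_real (sqrt l)"
  define y where "y = (\<lambda>\<omega>. 1 * sqrt\<Lambda> w \<omega> + (- ?s) * w \<omega>)"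
  have y: "y \<in> dom_sqrt\<Lambda>" unfolding y_def by (rule sqrt.dom_lincomb[OF E(2,1)])
  have ss: "?s * ?s = of_real l" using l by (simp flip: of_real_mult)
  have "ae_eq sphere_measure (sqrt\<Lambda> y) (\<lambda>\<omega>. (- ?s) * y \<omega>)"
    using sqrt.op_lincomb[OF E(2,1), of 1 "- ?s"] BB unfolding ae_eq_def y_def[symmetric]
    by eventually_elim (simp add: y_def ss[symmetric] algebra_simps)
  then have By: "L2_inner sphere_measure (sqrt\<Lambda> y) y = - ?s * of_real ((L2_norm sphere_measure y)\<^sup>2)"
  proof -
    assume "ae_eq sphere_measure (sqrt\<Lambda> y) (\<lambda>\<omega>. (- ?s) * y \<omega>)"
    then have "L2_inner sphere_measure (sqrt\<Lambda> y) y = L2_inner sphere_measure (\<lambda>\<omega>. (- ?s) * y \<omega>) y"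
      by (rule L2_inner_cong) (use y in \<open>auto intro!: L2_cmult simp del: L2_uminus mult_minus_left\<close>)
    then show ?thesis by (simp only: L2_inner_cmult_left L2_inner_self)
  qed
  have "0 \<le> Re (L2_inner sphere_measure (sqrt\<Lambda> y) y)"
    using sqrt y unfolding selfadjoint_sqrt_def nonnegative_selfadjoint_def by blast
  then have *: "sqrt l * (L2_norm sphere_measure y)\<^sup>2 \<le> 0" unfolding By by simp
  have "L2_norm sphere_measure y = 0"
  proof (cases "l = 0")
    case True
    have "L2_inner sphere_measure (sqrt\<Lambda> w) (sqrt\<Lambda> w) = L2_inner sphere_measure w (sqrt\<Lambda> (sqrt\<Lambda> w))"
      by (rule sqrt.symmetric[OF E(1,2)])
    also have "\<dots> = L2_inner sphere_measure w (\<lambda>\<omega>. of_real l * w \<omega>)"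
      using E by (intro L2_inner_cong BB) (auto intro: dom_L2[OF wD])
    also have "\<dots> = 0" using True by simp
    finally have "L2_norm sphere_measure (sqrt\<Lambda> w) = 0" by (simp add: L2_inner_self)
    then show ?thesis using True by (simp add: y_def)
  next
    case False
    then have "sqrt l > 0" using l by simp
    then have "(L2_norm sphere_measure y)\<^sup>2 \<le> 0" using * by (simp add: mult_le_0_iff)
    then show ?thesis by simp
  qed
  then have "AE \<omega> in sphere_measure. y \<omega> = 0" using y by (simp add: L2_norm_eq_0_iff)
  then show ?thesis unfolding ae_eq_def by eventually_elim (simp add: y_def)
qed

text \<open>The eigenfunctions re-indexed by natural numbers; the unused indices get the zero function.\<close>

definition J :: "nat set" where "J = to_nat_on I ` I"

definition e :: "nat \<Rightarrow> 'a \<Rightarrow> complex" where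
  "e n = (if n \<in> J then u (from_nat_into I n) else (\<lambda>_. 0))"

text \<open>The default 0 keeps the densities formed with \<open>L n\<close> non-negative at every
  index.\<close>

definition L :: "nat \<Rightarrow> real" where
  "L n = (if n \<in> J then lam (from_nat_into I n) else 0)"

lemma countable_I: "countable I"
  using spec by (simp add: purely_discrete_spectrum_def)

lemma J_cases:
  assumes "n \<in> J" obtains m where "m \<in> I" "n = to_nat_on I m" "e n = u m" "L n = lam m"
  using assms countable_I unfolding e_def L_def by (auto simp: J_def)

lemma L_nonneg: "0 \<le> L n"
proof (cases "n \<in> J")
  case True
  then show ?thesis by (metis J_cases lam_nonneg)
qed (simp add: L_def)

lemma e_to_nat_on: "m \<in> I \<Longrightarrow> e (to_nat_on I m) = u m"
  using countable_I by (simp add: e_def J_def)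

sublocale complete_ortho_system sphere_measure e J
proof
  show "e n \<in> L2 sphere_measure" for n
  proof (cases "n \<in> J")
    case True
    then show ?thesis by (metis J_cases u_dom dom_L2)
  qed (simp add: e_def)
  show "L2_inner sphere_measure (e m) (e n) = (if m = n \<and> n \<in> J then 1 else 0)" for m n
  proof (cases "m \<in> J \<and> n \<in> J")
    case True
    then obtain m' n' where "m' \<in> I" "m = to_nat_on I m'" "e m = u m'" "n' \<in> I" "n = to_nat_on I n'" "e n = u n'"
      by (metis J_cases)
    then show ?thesis using True countable_I by (simp add: u_inner inj_on_eq_iff[OF inj_on_to_nat_on])
  qed (auto simp: e_def)
  show "ae_eq sphere_measure f (\<lambda>_. 0)"
    if "f \<in> L2 sphere_measure" "\<And>n. L2_inner sphere_measure f (e n) = 0" for f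
    using eigenfunctions_complete[OF that(1)] that(2) by (metis e_to_nat_on)
qed

lemma inner_op_e: "f \<in> dom\<Lambda> \<Longrightarrow> L2_inner sphere_measure (\<Lambda> f) (e n) = of_real (L n) * L2_inner sphere_measure f (e n)"
proof (cases "n \<in> J")
  case True
  assume "f \<in> dom\<Lambda>"
  with True show ?thesis by (auto elim!: J_cases simp: inner_op_u)
qed (simp add: e_def)

text \<open>Symmetry moves the square root onto the eigenfunction. Squared moduli of these
  coefficients then carry exactly the weight \<open>L n\<close> that \<open>den_density\<close>
  expects.\<close>

lemma inner_sqrt_e:
  assumes f: "f \<in> dom\<Lambda>"
  shows "L2_inner sphere_measure (sqrt\<Lambda> f) (e n) = of_real (sqrt (L n)) * L2_inner sphere_measure f (e n)"
proof (cases "n \<in> J")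
  case True
  then obtain m where m: "m \<in> I" "e n = u m" "L n = lam m" by (metis J_cases)
  have "eigenfunction sphere_measure dom\<Lambda> \<Lambda> (lam m) (u m)"
    using m by (simp add: eigenfunction_def op_u)
  then have "ae_eq sphere_measure (sqrt\<Lambda> (u m)) (\<lambda>\<omega>. of_real (sqrt (lam m)) * u m \<omega>)"
    using lam_nonneg[OF m(1)] by (rule sqrt_eigenfunction)
  then have "L2_inner sphere_measure f (sqrt\<Lambda> (u m)) = L2_inner sphere_measure f (\<lambda>\<omega>. of_real (sqrt (lam m)) * u m \<omega>)"
    using f m dom_sqrt[OF u_dom[OF m(1)]] by (intro L2_inner_cong) auto
  moreover have "L2_inner sphere_measure (sqrt\<Lambda> f) (u m) = L2_inner sphere_measure f (sqrt\<Lambda> (u m))"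
    using dom_sqrt[OF f] dom_sqrt[OF u_dom[OF m(1)]] by (intro sqrt.symmetric)
  ultimately show ?thesis using m by simp
qed (simp add: e_def)

end


section \<open>Algebra of the constant and its minimisers\<close>

lemma rellich_quot_eq:
  assumes \<gamma>: "\<gamma> = (real d - 4 - \<alpha>) / 2" and pos: "l + \<gamma>\<^sup>2 > 0"
  shows "rellich_quot d \<alpha> l * (l + \<gamma>\<^sup>2) = (l + \<gamma>\<^sup>2 + \<gamma> * (\<alpha> + 2))\<^sup>2"
proof -
  have d: "real d = 2 * \<gamma> + 4 + \<alpha>" using \<gamma> by (simp add: field_simps)
  \<comment> \<open>Eliminating \<open>d\<close> in favour of \<open>\<gamma>\<close> exhibits the
    base of the numerator as \<open>4 A\<close> and the denominator as \<open>16 B\<close>, in the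
    notation \<open>A\<close>, \<open>B\<close> of the logarithmic variables.\<close>
  have 1: "4 * l + (d + \<alpha>) * (d - \<alpha> - 4) = 4 * (l + \<gamma>\<^sup>2 + \<gamma> * (\<alpha> + 2))"
    and 2: "4 * (4 * l + (d - \<alpha> - 4)\<^sup>2) = 16 * (l + \<gamma>\<^sup>2)"
    by (simp_all add: d power2_eq_square algebra_simps)
  have "(4 * x)\<^sup>2 / (16 * y) * y = x\<^sup>2" if "y > 0" for x y :: real
    using that by (simp add: power_mult_distrib)
  from this[OF pos] show ?thesis unfolding rellich_quot_def 1 2 .
qed

text \<open>Multiplied by \<open>B = l + \<gamma>^2\<close>, the coefficient becomes the visibly
  non-negative number \<open>B^2 + \<beta>^2 l\<close>.\<close>

lemma remainder_coeff_nonneg: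
  fixes \<gamma> :: real
  assumes "l \<ge> 0" "l + \<gamma>\<^sup>2 > 0" and K: "K * (l + \<gamma>\<^sup>2) = (l + \<gamma>\<^sup>2 + \<gamma> * \<beta>)\<^sup>2"
  shows "0 \<le> \<beta>\<^sup>2 + 2 * (l + \<gamma>\<^sup>2 + \<gamma> * \<beta>) - K"
proof -
  have "(\<beta>\<^sup>2 + 2 * (l + \<gamma>\<^sup>2 + \<gamma> * \<beta>) - K) * (l + \<gamma>\<^sup>2) = (l + \<gamma>\<^sup>2)\<^sup>2 + \<beta>\<^sup>2 * l"
    unfolding left_diff_distrib K by (simp add: power2_eq_square algebra_simps)
  also have "\<dots> \<ge> 0" using assms(1) by simp
  finally show ?thesis using assms(2) by (simp add: zero_le_mult_iff)
qed

lemma Least_arg_min: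
  fixes f :: "'i \<Rightarrow> real"
  assumes "is_arg_min f P m"
  shows "(LEAST c. c \<in> f ` {m. P m}) = f m"
  using assms unfolding is_arg_min_def by (intro Least_equality) (auto simp: not_less)

lemma rellich_const_cases:
  fixes \<alpha> :: real
  assumes m0: "minimizing_index d \<alpha> I lam m0" and \<gamma>: "\<gamma> = (real d - 4 - \<alpha>) / 2"
  shows "\<gamma> \<noteq> 0 \<Longrightarrow> m0 \<in> I \<and> rellich_const d \<alpha> I lam = rellich_quot d \<alpha> (lam m0) \<and>
      (\<forall>m\<in>I. rellich_quot d \<alpha> (lam m0) \<le> rellich_quot d \<alpha> (lam m))"
    and "\<gamma> = 0 \<Longrightarrow> m0 \<in> I \<and> lam m0 \<noteq> 0 \<and> rellich_const d \<alpha> I lam = min ((real d - 2)\<^sup>2) (lam m0) \<and>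
      (\<forall>m\<in>I. lam m \<noteq> 0 \<longrightarrow> lam m0 \<le> lam m)"
proof -
  assume "\<gamma> \<noteq> 0"
  then have nz: "d - \<alpha> - 4 \<noteq> 0" using \<gamma> by auto
  then have *: "is_arg_min (\<lambda>m. rellich_quot d \<alpha> (lam m)) (\<lambda>m. m \<in> I) m0"
    using m0 by (simp add: minimizing_index_def)
  from Least_arg_min[OF this] * show "m0 \<in> I \<and> rellich_const d \<alpha> I lam = rellich_quot d \<alpha> (lam m0) \<and>
      (\<forall>m\<in>I. rellich_quot d \<alpha> (lam m0) \<le> rellich_quot d \<alpha> (lam m))"
    using nz by (auto simp: rellich_const_def is_arg_min_def not_less)
next
  assume "\<gamma> = 0"
  then have z: "d - \<alpha> - 4 = 0" using \<gamma> by auto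
  then have *: "is_arg_min lam (\<lambda>m. m \<in> I \<and> lam m \<noteq> 0) m0"
    using m0 by (simp add: minimizing_index_def)
  from Least_arg_min[OF this] * show "m0 \<in> I \<and> lam m0 \<noteq> 0 \<and> rellich_const d \<alpha> I lam = min ((real d - 2)\<^sup>2) (lam m0) \<and>
      (\<forall>m\<in>I. lam m \<noteq> 0 \<longrightarrow> lam m0 \<le> lam m)"
    using z by (auto simp: rellich_const_def is_arg_min_def not_less)
qed

text \<open>Supplies every mode with a \<open>K\<close> for which the remainder has a sign. If
  \<open>\<gamma> = 0\<close> and the mode has eigenvalue 0, the equation for \<open>K\<close> reads
  \<open>0 = 0\<close>; the largest \<open>K\<close> with non-negative remainder coefficient is then
  \<open>(\<alpha> + 2)^2 = (d - 2)^2\<close>, which is the origin of the additional candidate in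
  the constant.\<close>

lemma rellich_const_le:
  fixes \<alpha> :: real
  assumes m0: "minimizing_index d \<alpha> I lam m0" and \<gamma>: "\<gamma> = (real d - 4 - \<alpha>) / 2"
    and lam: "\<And>m. m \<in> I \<Longrightarrow> 0 \<le> lam m" and m: "m \<in> I"
  obtains K where "K * (lam m + \<gamma>\<^sup>2) = (lam m + \<gamma>\<^sup>2 + \<gamma> * (\<alpha> + 2))\<^sup>2" "rellich_const d \<alpha> I lam \<le> K"
    "0 \<le> (\<alpha> + 2)\<^sup>2 + 2 * (lam m + \<gamma>\<^sup>2 + \<gamma> * (\<alpha> + 2)) - K"
proof (cases "lam m + \<gamma>\<^sup>2 > 0")
  case True
  note q = rellich_quot_eq[OF \<gamma> True]
  have "rellich_const d \<alpha> I lam \<le> rellich_quot d \<alpha> (lam m)"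
  proof (cases "\<gamma> = 0")
    case False
    then show ?thesis using rellich_const_cases(1)[OF m0 \<gamma>] m by auto
  next
    case 0: True
    then have "lam m > 0" using True by simp
    then have "rellich_quot d \<alpha> (lam m) = lam m" using q 0 by (simp add: power2_eq_square)
    then show ?thesis using rellich_const_cases(2)[OF m0 \<gamma> 0] m \<open>lam m > 0\<close> by auto
  qed
  then show ?thesis using that[OF q] remainder_coeff_nonneg[OF lam[OF m] True q] by blast
next
  case False
  then have z: "lam m = 0" "\<gamma> = 0"
    using lam[OF m] zero_le_power2[of \<gamma>] by (smt (verit) zero_less_power2)+
  have \<alpha>: "\<alpha> + 2 = real d - 2" using z \<gamma> by simp
  show ?thesis
  proof (rule that[of "(\<alpha> + 2)\<^sup>2"])
    show "rellich_const d \<alpha> I lam \<le> (\<alpha> + 2)\<^sup>2"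
      unfolding \<alpha> using rellich_const_cases(2)[OF m0 \<gamma> z(2)] by auto
  qed (use z in auto)
qed

lemma rellich_const_nonneg:
  fixes \<alpha> :: real
  assumes m0: "minimizing_index d \<alpha> I lam m0" and lam: "\<And>m. m \<in> I \<Longrightarrow> 0 \<le> lam m"
  shows "0 \<le> rellich_const d \<alpha> I lam"
proof (cases "(real d - 4 - \<alpha>) / 2 = 0")
  case True
  then show ?thesis using rellich_const_cases(2)[OF m0 refl True] lam by auto
next
  case False
  then show ?thesis using rellich_const_cases(1)[OF m0 refl False] lam by (auto simp: rellich_quot_def)
qed

section \<open>The inequality for a single angular mode\<close>

lemma log_derivatives_of:
  fixes c c1 c2 :: "real \<Rightarrow> complex"
  assumes ab: "0 < a" "a < b"
    and c: "\<And>r. r > 0 \<Longrightarrow> (c has_vector_derivative c1 r) (at r)"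
    and c1: "\<And>r. r > 0 \<Longrightarrow> (c1 has_vector_derivative c2 r) (at r)"
    and c2: "continuous_on {0<..} c2"
    and v: "v = (\<lambda>r. (r powr \<gamma>) *\<^sub>R c r)" and v1: "v1 = (\<lambda>r. \<gamma> *\<^sub>R v r + (r powr \<gamma> * r) *\<^sub>R c1 r)"
    and v2: "v2 = (\<lambda>r. \<gamma> *\<^sub>R v1 r + ((\<gamma> + 1) * (r powr \<gamma> * r)) *\<^sub>R c1 r + (r powr \<gamma> * r\<^sup>2) *\<^sub>R c2 r)"
    and bdry: "v1 a = 0" "v1 b = 0"
  shows "log_derivatives v v1 v2 a b"
proof
  have dp: "((\<lambda>r. r powr \<gamma>) has_real_derivative \<gamma> * r powr \<gamma> / r) (at r)" if "r > 0" for r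
    using has_real_derivative_powr[OF that, of \<gamma>] that by (simp add: powr_diff)
  have dv: "(v has_vector_derivative inverse r *\<^sub>R v1 r) (at r)" if r: "r > 0" for r
    using has_vector_derivative_scaleR[OF dp[OF r] c[OF r]] r unfolding v v1
    by (simp add: scaleR_conv_of_real field_simps)
  then show "(v has_vector_derivative inverse r *\<^sub>R v1 r) (at r)" if "r \<in> {a..b}" for r
    using that ab by auto
  have dpr: "((\<lambda>r. r powr \<gamma> * r) has_real_derivative (\<gamma> + 1) * r powr \<gamma>) (at r)" if "r > 0" for r
    using DERIV_mult[OF dp[OF that] DERIV_ident] that by (simp add: algebra_simps)
  have dv1: "(v1 has_vector_derivative inverse r *\<^sub>R v2 r) (at r)" if r: "r > 0" for r
  proof -
    have "(v1 has_vector_derivative \<gamma> *\<^sub>R (inverse r *\<^sub>R v1 r) + ((r powr \<gamma> * r) *\<^sub>R c2 r + ((\<gamma> + 1) * r powr \<gamma>) *\<^sub>R c1 r)) (at r)"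
      unfolding v1
      by (rule has_vector_derivative_add[OF bounded_linear.has_vector_derivative[OF bounded_linear_scaleR_right dv[OF r, unfolded v1]]
            has_vector_derivative_scaleR[OF dpr[OF r] c1[OF r]]])
    moreover have "\<gamma> *\<^sub>R (inverse r *\<^sub>R v1 r) + ((r powr \<gamma> * r) *\<^sub>R c2 r + ((\<gamma> + 1) * r powr \<gamma>) *\<^sub>R c1 r) = inverse r *\<^sub>R v2 r"
      unfolding v2 using r by (simp add: scaleR_conv_of_real field_simps power2_eq_square)
    ultimately show ?thesis by simp
  qed
  then show "(v1 has_vector_derivative inverse r *\<^sub>R v2 r) (at r)" if "r \<in> {a..b}" for r
    using that ab by auto
  have "continuous_on {0<..} v1"
    using dv1 by (intro continuous_at_imp_continuous_on) (auto intro: has_vector_derivative_continuous)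
  moreover have "continuous_on {0<..} c1"
    using c1 by (intro continuous_at_imp_continuous_on) (auto intro: has_vector_derivative_continuous)
  ultimately have "continuous_on {0<..} v2" unfolding v2 using c2
    by (auto intro!: continuous_intros)
  then show "continuous_on {a..b} v2" by (rule continuous_on_subset) (use ab in auto)
qed (use ab bdry in auto)

text \<open>The support condition is strict, so \<open>c\<close> and \<open>c1\<close>, and with
  them \<open>v\<close> and \<open>v1\<close>, vanish at both ends, which disposes of all boundary
  terms. One nonzero value of the coefficient is enough to make the remainder positive.\<close>

lemma rellich_one_dim:
  fixes c c1 c2 :: "real \<Rightarrow> complex" and \<alpha> :: real
  assumes d: "d \<ge> 1" and \<gamma>: "\<gamma> = (real d - 4 - \<alpha>) / 2" and ab: "0 < a" "a < b"
    and c: "\<And>r. r > 0 \<Longrightarrow> (c has_vector_derivative c1 r) (at r)"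
    and c1: "\<And>r. r > 0 \<Longrightarrow> (c1 has_vector_derivative c2 r) (at r)"
    and c2: "continuous_on {0<..} c2"
    and supp: "\<And>r. r > 0 \<Longrightarrow> c r \<noteq> 0 \<or> c1 r \<noteq> 0 \<Longrightarrow> a < r \<and> r < b"
    and K: "K * (l + \<gamma>\<^sup>2) = (l + \<gamma>\<^sup>2 + \<gamma> * (\<alpha> + 2))\<^sup>2"
      "0 \<le> (\<alpha> + 2)\<^sup>2 + 2 * (l + \<gamma>\<^sup>2 + \<gamma> * (\<alpha> + 2)) - K"
  defines "N \<equiv> integral {a..b} (\<lambda>r. num_density d \<alpha> l (c r) (c1 r) (c2 r) r)"
    and "E \<equiv> integral {a..b} (\<lambda>r. den_density d \<alpha> l (c r) (c1 r) r)"
  shows "K * E \<le> N" and "r0 > 0 \<Longrightarrow> c r0 \<noteq> 0 \<Longrightarrow> K * E < N"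
proof -
  define v where "v = (\<lambda>r. (r powr \<gamma>) *\<^sub>R c r)"
  define v1 where "v1 = (\<lambda>r. \<gamma> *\<^sub>R v r + (r powr \<gamma> * r) *\<^sub>R c1 r)"
  define v2 where "v2 = (\<lambda>r. \<gamma> *\<^sub>R v1 r + ((\<gamma> + 1) * (r powr \<gamma> * r)) *\<^sub>R c1 r + (r powr \<gamma> * r\<^sup>2) *\<^sub>R c2 r)"
  have bd: "c a = 0" "c1 a = 0" "c b = 0" "c1 b = 0" using supp[of a] supp[of b] ab by auto
  have v0: "v a = 0" "v b = 0" using bd by (simp_all add: v_def)
  have v10: "v1 a = 0" "v1 b = 0" using bd v0 by (simp_all add: v1_def)
  interpret log_derivatives v v1 v2 a b
    by (rule log_derivatives_of[OF ab c c1 c2 v_def v1_def v2_def v10])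
  let ?A = "l + \<gamma>\<^sup>2 + \<gamma> * (\<alpha> + 2)"
  have N: "N = integral {a..b} (\<lambda>r. (cmod (v2 r + (\<alpha> + 2) *\<^sub>R v1 r - ?A *\<^sub>R v r))\<^sup>2 / r)"
    unfolding N_def
    by (intro integral_cong densities_log(1)[OF d \<gamma>]) (use ab in \<open>auto simp: v_def v1_def v2_def\<close>)
  have E: "E = integral {a..b} (\<lambda>r. ((cmod (v1 r - \<gamma> *\<^sub>R v r))\<^sup>2 + l * (cmod (v r))\<^sup>2) / r)"
    unfolding E_def
    by (intro integral_cong densities_log(2)[OF d \<gamma>, of _ "v _" "c _" "v1 _" _ "v2 _" "c2 _"])
       (use ab in \<open>auto simp: v_def v1_def v2_def\<close>)
  let ?R = "\<lambda>r. ((cmod (v2 r))\<^sup>2 + ((\<alpha> + 2)\<^sup>2 + 2 * ?A - K) * (cmod (v1 r))\<^sup>2) / r"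
  have eq: "N - K * E = integral {a..b} ?R"
    unfolding N E by (rule integral_num_minus_den) (use v0 K in auto)
  have "?R r \<ge> 0" if "r \<in> {a..b}" for r
    using that ab K(2) by (intro divide_nonneg_nonneg add_nonneg_nonneg mult_nonneg_nonneg) auto
  moreover have "?R integrable_on {a..b}"
    by (intro integrable_continuous_real) (use nz ab in \<open>auto intro!: continuous_intros\<close>)
  ultimately have "integral {a..b} ?R \<ge> 0" by (intro integral_nonneg) auto
  then show "K * E \<le> N" using eq by linarith
  show "K * E < N" if r0: "r0 > 0" "c r0 \<noteq> 0"
  proof -
    have "v r0 \<noteq> 0" using r0 by (simp add: v_def)
    moreover have "r0 \<in> {a..b}" using supp[OF r0(1)] r0(2) by auto
    ultimately have "integral {a..b} ?R > 0" using remainder_pos[OF K(2) v0(1)] by blast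
    then show ?thesis using eq by linarith
  qed
qed

text \<open>All terms are non-negative, so sum and radial integral may be interchanged in
  \<open>[0, \<infinity>]\<close> before any convergence is known.\<close>

lemma nn_integral_polar_suminf:
  fixes f :: "'a::euclidean_space \<Rightarrow> ennreal" and q :: "nat \<Rightarrow> real \<Rightarrow> real"
  assumes f: "f \<in> borel_measurable borel" and a: "0 < a"
    and q: "\<And>n. continuous_on {0<..} (q n)" "\<And>n r. 0 < r \<Longrightarrow> 0 \<le> q n r" "\<And>n r. 0 < r \<Longrightarrow> r \<notin> {a..b} \<Longrightarrow> q n r = 0"
    and eq: "AE r in lborel. 0 < r \<longrightarrow>
      ennreal (r ^ (DIM('a) - 1)) * (\<integral>\<^sup>+\<omega>. f (r *\<^sub>R \<omega>) \<partial>sphere_measure) = (\<Sum>n. ennreal (q n r))"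
  shows "(\<integral>\<^sup>+x. f x \<partial>lborel) = (\<Sum>n. ennreal (integral {a..b} (q n)))"
proof -
  have meas: "(\<lambda>r. indicator {0<..} r * ennreal (q n r)) \<in> borel_measurable borel" for n
  proof -
    have "(\<lambda>r. indicator {0<..} r *\<^sub>R q n r) \<in> borel_measurable borel"
      using q(1) by (intro borel_measurable_continuous_on_indicator) auto
    then have "(\<lambda>r. ennreal (indicator {0<..} r *\<^sub>R q n r)) \<in> borel_measurable borel" by measurable
    moreover have "(\<lambda>r. ennreal (indicator {0<..} r *\<^sub>R q n r)) = (\<lambda>r. indicator {0<..} r * ennreal (q n r))"
      by (auto split: split_indicator)
    ultimately show ?thesis by simp
  qed
  have "(\<integral>\<^sup>+x. f x \<partial>lborel) = (\<integral>\<^sup>+r. indicator {0<..} r * ennreal (r ^ (DIM('a) - 1)) *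
      (\<integral>\<^sup>+\<omega>. f (r *\<^sub>R \<omega>) \<partial>sphere_measure) \<partial>lborel)"
    by (rule nn_integral_polar[OF f])
  also have "\<dots> = (\<integral>\<^sup>+r. (\<Sum>n. indicator {0<..} r * ennreal (q n r)) \<partial>lborel)"
  proof (rule nn_integral_cong_AE)
    show "AE r in lborel. indicator {0<..} r * ennreal (r ^ (DIM('a) - 1)) *
      (\<integral>\<^sup>+\<omega>. f (r *\<^sub>R \<omega>) \<partial>sphere_measure) = (\<Sum>n. indicator {0<..} r * ennreal (q n r))"
      using eq by eventually_elim (auto split: split_indicator)
  qed
  also have "\<dots> = (\<Sum>n. \<integral>\<^sup>+r. indicator {0<..} r * ennreal (q n r) \<partial>lborel)"
    using meas by (intro nn_integral_suminf) auto
  also have "\<dots> = (\<Sum>n. ennreal (integral {a..b} (q n)))"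
    by (intro suminf_cong nn_integral_compact_support a q continuous_on_subset[OF q(1)]) (use a in auto)
  finally show ?thesis .
qed

section \<open>Expansion of an element of the domain on spheres\<close>

context angular_operator
begin

definition coeff :: "('a \<Rightarrow> complex) \<Rightarrow> nat \<Rightarrow> real \<Rightarrow> complex" where
  "coeff \<psi> n r = L2_inner sphere_measure (\<lambda>\<omega>. \<psi> (r *\<^sub>R \<omega>)) (e n)"

lemma coeff_has_vector_derivative:
  assumes "smooth_on (- {0}) \<psi>" "r > 0"
  shows "(coeff \<psi> n has_vector_derivative coeff (radial_deriv \<psi>) n r) (at r)"
  unfolding coeff_def by (rule has_vector_derivative_L2_inner_sphere[OF assms(1) e_L2 assms(2)])

lemma continuous_on_coeff:
  assumes "smooth_on (- {0}) \<psi>" shows "continuous_on {0<..} (coeff \<psi> n)"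
  using coeff_has_vector_derivative[OF assms]
  by (intro continuous_at_imp_continuous_on) (auto intro: has_vector_derivative_continuous)

lemma coeff_eq_0:
  assumes "r > 0" "\<And>x. norm x = r \<Longrightarrow> \<psi> x = 0"
  shows "coeff \<psi> n r = 0"
proof -
  have "coeff \<psi> n r = L2_inner sphere_measure (\<lambda>\<omega>. 0) (e n)"
    unfolding coeff_def L2_inner_def using assms by (intro Bochner_Integration.integral_cong) auto
  then show ?thesis by simp
qed

lemma angular_version_op: "\<exists>F. angular_version A \<psi> F \<Longrightarrow> angular_version A \<psi> (angular_op A \<psi>)"
  unfolding angular_op_def by (rule someI_ex[where P="angular_version A \<psi>"])

text \<open>Membership in the domain provides a jointly measurable version for
  \<open>\<Lambda>\<close> only. For the square root one is assembled from its coefficients, which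
  are continuous in \<open>r\<close> because they are multiples of those of
  \<open>\<psi>\<close>.\<close>

lemma angular_version_sqrt:
  assumes \<psi>: "smooth_on (- {0}) \<psi>" and dom: "\<And>r. r > 0 \<Longrightarrow> (\<lambda>\<omega>. \<psi> (r *\<^sub>R \<omega>)) \<in> dom\<Lambda>"
  shows "angular_version sqrt\<Lambda> \<psi> (angular_op sqrt\<Lambda> \<psi>)"
proof (rule angular_version_op)
  define k where "k n r = of_real (indicator {0<..} r) * (of_real (sqrt (L n)) * coeff \<psi> n r)" for n r
  have "k n \<in> borel_measurable borel" for n
  proof -
    have "(\<lambda>r. indicator {0<..} r *\<^sub>R (of_real (sqrt (L n)) * coeff \<psi> n r)) \<in> borel_measurable borel"
      by (intro borel_measurable_continuous_on_indicator continuous_intros continuous_on_coeff[OF \<psi>]) auto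
    then show ?thesis unfolding k_def[abs_def] by (simp add: scaleR_conv_of_real)
  qed
  note k = this
  obtain F where "F \<in> borel_measurable borel"
    "\<And>r. r > 0 \<Longrightarrow> ae_eq sphere_measure (\<lambda>\<omega>. F (r *\<^sub>R \<omega>)) (sqrt\<Lambda> (\<lambda>\<omega>. \<psi> (r *\<^sub>R \<omega>)))"
  proof (rule exists_angular_version[OF complete_ortho_system_axioms, where G="\<lambda>r. sqrt\<Lambda> (\<lambda>\<omega>. \<psi> (r *\<^sub>R \<omega>))" and k=k, rotated 2])
    show "k n r = L2_inner sphere_measure (sqrt\<Lambda> (\<lambda>\<omega>. \<psi> (r *\<^sub>R \<omega>))) (e n)" if "r > 0" for n r
      using that by (simp add: k_def coeff_def inner_sqrt_e[OF dom])
  qed (use dom_sqrt[OF dom] k in auto)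
  then show "\<exists>F. angular_version sqrt\<Lambda> \<psi> F" unfolding angular_version_def by auto
qed

text \<open>A single open annulus for \<open>\<psi>\<close> and its first two radial derivatives
  makes all coefficients vanish at the endpoints \<open>a\<close> and \<open>b\<close> as well as
  outside.\<close>

context
  fixes \<psi> :: "'a \<Rightarrow> complex" and a b :: real
  assumes \<psi>: "\<psi> \<in> dom_calL dom\<Lambda> \<Lambda>" and a: "0 < a"
    and supp: "\<And>x. \<psi> x \<noteq> 0 \<or> radial_deriv \<psi> x \<noteq> 0 \<or> radial_deriv (radial_deriv \<psi>) x \<noteq> 0 \<Longrightarrow> a < norm x \<and> norm x < b"
begin

lemma smooth: "smooth_on (- {0}) \<psi>"
  "smooth_on (- {0}) (radial_deriv \<psi>)" "smooth_on (- {0}) (radial_deriv (radial_deriv \<psi>))"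
  using \<psi> by (auto simp: dom_calL_def test_function_away0_def intro!: smooth_on_radial_deriv)

lemma slice_dom: "r > 0 \<Longrightarrow> (\<lambda>\<omega>. \<psi> (r *\<^sub>R \<omega>)) \<in> dom\<Lambda>"
  using \<psi> by (auto simp: dom_calL_def calL_in_L2_def)

lemma slice_L2: "r > 0 \<Longrightarrow> smooth_on (- {0}) \<phi> \<Longrightarrow> (\<lambda>\<omega>. \<phi> (r *\<^sub>R \<omega>)) \<in> L2 sphere_measure"
  by (intro L2_sphere_continuous continuous_on_sphere_scaled smooth_on_continuous)

abbreviation "num n \<alpha> r \<equiv> num_density DIM('a) \<alpha> (L n) (coeff \<psi> n r) (coeff (radial_deriv \<psi>) n r)
  (coeff (radial_deriv (radial_deriv \<psi>)) n r) r"

abbreviation "den n \<alpha> r \<equiv> den_density DIM('a) \<alpha> (L n) (coeff \<psi> n r) (coeff (radial_deriv \<psi>) n r) r"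

lemma coeff_supp:
  assumes "r > 0" "\<not> (a < r \<and> r < b)"
  shows "coeff \<psi> n r = 0" "coeff (radial_deriv \<psi>) n r = 0" "coeff (radial_deriv (radial_deriv \<psi>)) n r = 0"
  using assms supp by (auto intro!: coeff_eq_0)

lemma calL_measurable: "calL \<Lambda> \<psi> \<in> borel_measurable borel"
  using \<psi> L2_measurable[of "calL \<Lambda> \<psi>" lborel] by (simp add: dom_calL_def calL_in_L2_def)

text \<open>Parseval's identity on almost every sphere: \<open>\<Lambda>\<close> multiplies the
  coefficients by \<open>L n\<close> and the radial derivatives commute with taking coefficients, so
  each coefficient of \<open>\<L>\<psi>\<close> is an ordinary differential expression in one
  coefficient of \<open>\<psi>\<close>.\<close>

lemma nn_integral_num:
  "(\<integral>\<^sup>+x. ennreal ((cmod (calL \<Lambda> \<psi> x))\<^sup>2 / norm x powr \<alpha>) \<partial>lborel) =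
    (\<Sum>n. ennreal (integral {a..b} (num n \<alpha>)))"
proof (rule nn_integral_polar_suminf)
  note [measurable] = calL_measurable
  show "(\<lambda>x. ennreal ((cmod (calL \<Lambda> \<psi> x))\<^sup>2 / norm x powr \<alpha>)) \<in> borel_measurable borel" by measurable
  show "continuous_on {0<..} (num n \<alpha>)" for n
    unfolding num_density_def by (auto intro!: continuous_intros continuous_on_coeff smooth)
  show "0 \<le> num n \<alpha> r" if "0 < r" for n r using that by (simp add: num_density_def)
  show "num n \<alpha> r = 0" if "0 < r" "r \<notin> {a..b}" for n r
    using coeff_supp[OF that(1), of n] that by (auto simp: num_density_def)
  let ?F = "angular_op \<Lambda> \<psi>"
  have "angular_version \<Lambda> \<psi> ?F" using \<psi> by (intro angular_version_op) (simp add: dom_calL_def calL_in_L2_def)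
  then have "AE r in lborel. 0 < r \<longrightarrow> ae_eq sphere_measure (\<lambda>\<omega>. ?F (r *\<^sub>R \<omega>)) (\<Lambda> (\<lambda>\<omega>. \<psi> (r *\<^sub>R \<omega>)))"
    by (simp add: angular_version_def)
  then show "AE r in lborel. 0 < r \<longrightarrow> ennreal (r ^ (DIM('a) - 1)) *
      (\<integral>\<^sup>+\<omega>. ennreal ((cmod (calL \<Lambda> \<psi> (r *\<^sub>R \<omega>)))\<^sup>2 / norm (r *\<^sub>R \<omega>) powr \<alpha>) \<partial>sphere_measure) =
      (\<Sum>n. ennreal (num n \<alpha> r))"
  proof (rule AE_mp, intro AE_I2 impI)
    fix r :: real assume r: "0 < r"
      and "0 < r \<longrightarrow> ae_eq sphere_measure (\<lambda>\<omega>. ?F (r *\<^sub>R \<omega>)) (\<Lambda> (\<lambda>\<omega>. \<psi> (r *\<^sub>R \<omega>)))"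
    then have F: "AE \<omega> in sphere_measure. ?F (r *\<^sub>R \<omega>) = \<Lambda> (\<lambda>\<omega>. \<psi> (r *\<^sub>R \<omega>)) \<omega>" by (simp add: ae_eq_def)
    let ?c = "complex_of_real ((real DIM('a) - 1) / r)" and ?d = "complex_of_real (1 / r\<^sup>2)"
    \<comment> \<open>On this sphere \<open>G\<close> agrees almost everywhere with
      \<open>calL \<Lambda> \<psi>\<close>, the chosen angular version being replaced by
      \<open>\<Lambda>\<close> applied to the slice, for which coefficients can be computed.\<close>
    define G where "G \<omega> = (- 1) * radial_deriv (radial_deriv \<psi>) (r *\<^sub>R \<omega>) - ?c * radial_deriv \<psi> (r *\<^sub>R \<omega>) +
      ?d * \<Lambda> (\<lambda>\<omega>. \<psi> (r *\<^sub>R \<omega>)) \<omega>" for \<omega>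
    note L2s = slice_L2[OF r smooth(2)] slice_L2[OF r smooth(3)] op_L2[OF slice_dom[OF r]]
    have G: "G \<in> L2 sphere_measure"
      unfolding G_def[abs_def] by (intro L2_add L2_diff L2_cmult L2s)
    have "L2_inner sphere_measure G (e n) = - coeff (radial_deriv (radial_deriv \<psi>)) n r -
        ?c * coeff (radial_deriv \<psi>) n r + ?d * (of_real (L n) * coeff \<psi> n r)" for n
      unfolding G_def[abs_def] coeff_def
      by (subst L2_inner_add_left, (intro L2_add L2_diff L2_cmult L2s e_L2)+,
          subst L2_inner_diff_left, (intro L2_add L2_diff L2_cmult L2s e_L2)+)
         (simp only: L2_inner_cmult_left inner_op_e[OF slice_dom[OF r]], simp)
    then have num: "num n \<alpha> r = r ^ (DIM('a) - 1) / r powr \<alpha> * (cmod (L2_inner sphere_measure G (e n)))\<^sup>2" for n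
      by (simp add: num_density_def)
    have "(\<integral>\<^sup>+\<omega>. ennreal ((cmod (calL \<Lambda> \<psi> (r *\<^sub>R \<omega>)))\<^sup>2 / norm (r *\<^sub>R \<omega>) powr \<alpha>) \<partial>sphere_measure) =
        (\<integral>\<^sup>+\<omega>. ennreal (1 / r powr \<alpha>) * ennreal ((cmod (G \<omega>))\<^sup>2) \<partial>sphere_measure)"
    proof (rule nn_integral_cong_AE)
      show "AE \<omega> in sphere_measure. ennreal ((cmod (calL \<Lambda> \<psi> (r *\<^sub>R \<omega>)))\<^sup>2 / norm (r *\<^sub>R \<omega>) powr \<alpha>) =
          ennreal (1 / r powr \<alpha>) * ennreal ((cmod (G \<omega>))\<^sup>2)"
        using F AE_space
      proof eventually_elim
        case (elim \<omega>)
        then have "norm (r *\<^sub>R \<omega>) = r" using r by simp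
        moreover have "calL \<Lambda> \<psi> (r *\<^sub>R \<omega>) = G \<omega>"
          unfolding calL_def L_rad_def G_def elim(1) calculation by simp
        ultimately show ?case by (simp add: ennreal_mult'[symmetric])
      qed
    qed
    also have "\<dots> = ennreal (1 / r powr \<alpha>) * (\<Sum>n. ennreal ((cmod (L2_inner sphere_measure G (e n)))\<^sup>2))"
      using L2_measurable[OF G] by (subst nn_integral_cmult) (auto simp: suminf_coeff_ennreal[OF G])
    also have "ennreal (r ^ (DIM('a) - 1)) * \<dots> = (\<Sum>n. ennreal (num n \<alpha> r))"
      unfolding num mult.assoc[symmetric] ennreal_suminf_cmult[symmetric] using r
      by (simp add: ennreal_mult'[symmetric])
    finally show "ennreal (r ^ (DIM('a) - 1)) *
      (\<integral>\<^sup>+\<omega>. ennreal ((cmod (calL \<Lambda> \<psi> (r *\<^sub>R \<omega>)))\<^sup>2 / norm (r *\<^sub>R \<omega>) powr \<alpha>) \<partial>sphere_measure) =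
      (\<Sum>n. ennreal (num n \<alpha> r))" .
  qed
qed (rule a)

lemma sqrt_version: "angular_version sqrt\<Lambda> \<psi> (angular_op sqrt\<Lambda> \<psi>)"
  by (rule angular_version_sqrt[OF smooth(1) slice_dom])

lemma calD_measurable: "calD sqrt\<Lambda> \<psi> \<in> borel_measurable borel"
proof -
  have [measurable]: "radial_deriv \<psi> \<in> borel_measurable borel"
    by (intro borel_measurable_if_continuous_away_0 smooth_on_continuous smooth)
  have [measurable]: "angular_op sqrt\<Lambda> \<psi> \<in> borel_measurable borel"
    using sqrt_version by (simp add: angular_version_def)
  show ?thesis unfolding calD_def[abs_def] by measurable
qed

lemma nn_integral_den:
  "(\<integral>\<^sup>+x. ennreal (calD sqrt\<Lambda> \<psi> x / norm x powr (\<alpha> + 2)) \<partial>lborel) =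
    (\<Sum>n. ennreal (integral {a..b} (den n \<alpha>)))"
proof (rule nn_integral_polar_suminf)
  note [measurable] = calD_measurable
  show "(\<lambda>x. ennreal (calD sqrt\<Lambda> \<psi> x / norm x powr (\<alpha> + 2))) \<in> borel_measurable borel" by measurable
  show "continuous_on {0<..} (den n \<alpha>)" for n
    unfolding den_density_def by (auto intro!: continuous_intros continuous_on_coeff smooth)
  show "0 \<le> den n \<alpha> r" if "0 < r" for n r using that L_nonneg[of n] by (simp add: den_density_def)
  show "den n \<alpha> r = 0" if "0 < r" "r \<notin> {a..b}" for n r
    using coeff_supp[OF that(1), of n] that by (auto simp: den_density_def)
  let ?F = "angular_op sqrt\<Lambda> \<psi>"
  have "AE r in lborel. 0 < r \<longrightarrow> ae_eq sphere_measure (\<lambda>\<omega>. ?F (r *\<^sub>R \<omega>)) (sqrt\<Lambda> (\<lambda>\<omega>. \<psi> (r *\<^sub>R \<omega>)))"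
    using sqrt_version by (simp add: angular_version_def)
  then show "AE r in lborel. 0 < r \<longrightarrow> ennreal (r ^ (DIM('a) - 1)) *
      (\<integral>\<^sup>+\<omega>. ennreal (calD sqrt\<Lambda> \<psi> (r *\<^sub>R \<omega>) / norm (r *\<^sub>R \<omega>) powr (\<alpha> + 2)) \<partial>sphere_measure) =
      (\<Sum>n. ennreal (den n \<alpha> r))"
  proof (rule AE_mp, intro AE_I2 impI)
    fix r :: real assume r: "0 < r"
      and "0 < r \<longrightarrow> ae_eq sphere_measure (\<lambda>\<omega>. ?F (r *\<^sub>R \<omega>)) (sqrt\<Lambda> (\<lambda>\<omega>. \<psi> (r *\<^sub>R \<omega>)))"
    then have F: "AE \<omega> in sphere_measure. ?F (r *\<^sub>R \<omega>) = sqrt\<Lambda> (\<lambda>\<omega>. \<psi> (r *\<^sub>R \<omega>)) \<omega>" by (simp add: ae_eq_def)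
    let ?\<psi>1 = "\<lambda>\<omega>. radial_deriv \<psi> (r *\<^sub>R \<omega>)" and ?G = "sqrt\<Lambda> (\<lambda>\<omega>. \<psi> (r *\<^sub>R \<omega>))"
    have L2s: "?\<psi>1 \<in> L2 sphere_measure" "?G \<in> L2 sphere_measure"
      using slice_L2[OF r smooth(2)] dom_sqrt[OF slice_dom[OF r]] by auto
    note [measurable] = L2s[THEN L2_measurable]
    have c1: "(cmod (L2_inner sphere_measure ?\<psi>1 (e n)))\<^sup>2 = (cmod (coeff (radial_deriv \<psi>) n r))\<^sup>2" for n
      by (simp add: coeff_def)
    have c: "(cmod (L2_inner sphere_measure ?G (e n)))\<^sup>2 = L n * (cmod (coeff \<psi> n r))\<^sup>2" for n
      using L_nonneg[of n] by (simp add: inner_sqrt_e[OF slice_dom[OF r]] coeff_def norm_mult power_mult_distrib)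
    have "(\<integral>\<^sup>+\<omega>. ennreal (calD sqrt\<Lambda> \<psi> (r *\<^sub>R \<omega>) / norm (r *\<^sub>R \<omega>) powr (\<alpha> + 2)) \<partial>sphere_measure) =
        (\<integral>\<^sup>+\<omega>. ennreal (1 / r powr (\<alpha> + 2)) * (ennreal ((cmod (?\<psi>1 \<omega>))\<^sup>2) +
          ennreal (1 / r\<^sup>2) * ennreal ((cmod (?G \<omega>))\<^sup>2)) \<partial>sphere_measure)"
    proof (rule nn_integral_cong_AE)
      show "AE \<omega> in sphere_measure. ennreal (calD sqrt\<Lambda> \<psi> (r *\<^sub>R \<omega>) / norm (r *\<^sub>R \<omega>) powr (\<alpha> + 2)) =
          ennreal (1 / r powr (\<alpha> + 2)) * (ennreal ((cmod (?\<psi>1 \<omega>))\<^sup>2) + ennreal (1 / r\<^sup>2) * ennreal ((cmod (?G \<omega>))\<^sup>2))"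
        using F AE_space
      proof eventually_elim
        case (elim \<omega>)
        then have n: "norm (r *\<^sub>R \<omega>) = r" using r by simp
        show ?case unfolding calD_def elim(1) n
          by (simp add: ennreal_mult'[symmetric] ennreal_plus[symmetric] del: ennreal_plus)
      qed
    qed
    also have "\<dots> = ennreal (1 / r powr (\<alpha> + 2)) * ((\<Sum>n. ennreal ((cmod (coeff (radial_deriv \<psi>) n r))\<^sup>2)) +
        ennreal (1 / r\<^sup>2) * (\<Sum>n. ennreal (L n * (cmod (coeff \<psi> n r))\<^sup>2)))"
      by (subst nn_integral_cmult, measurable, subst nn_integral_add, measurable, subst nn_integral_cmult, measurable)
         (simp only: suminf_coeff_ennreal[OF L2s(1)] suminf_coeff_ennreal[OF L2s(2)] c c1)
    also have "\<dots> = (\<Sum>n. ennreal (1 / r powr (\<alpha> + 2)) * (ennreal ((cmod (coeff (radial_deriv \<psi>) n r))\<^sup>2) +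
        ennreal (1 / r\<^sup>2) * ennreal (L n * (cmod (coeff \<psi> n r))\<^sup>2)))"
      by (simp only: ennreal_suminf_cmult suminf_add[OF summableI summableI, symmetric])
    also have "ennreal (r ^ (DIM('a) - 1)) * \<dots> = (\<Sum>n. ennreal (den n \<alpha> r))"
    proof -
      have "ennreal (r ^ (DIM('a) - 1)) * (ennreal (1 / r powr (\<alpha> + 2)) * (ennreal ((cmod (coeff (radial_deriv \<psi>) n r))\<^sup>2) +
          ennreal (1 / r\<^sup>2) * ennreal (L n * (cmod (coeff \<psi> n r))\<^sup>2))) = ennreal (den n \<alpha> r)" for n
        using r L_nonneg[of n] unfolding den_density_def
        by (simp add: ennreal_mult'[symmetric] ennreal_plus[symmetric] del: ennreal_plus)
      then show ?thesis unfolding ennreal_suminf_cmult[symmetric] by simp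
    qed
    finally show "ennreal (r ^ (DIM('a) - 1)) *
      (\<integral>\<^sup>+\<omega>. ennreal (calD sqrt\<Lambda> \<psi> (r *\<^sub>R \<omega>) / norm (r *\<^sub>R \<omega>) powr (\<alpha> + 2)) \<partial>sphere_measure) =
      (\<Sum>n. ennreal (den n \<alpha> r))" .
  qed
qed (rule a)

text \<open>For exponent 0 this is the squared L2 norm of \<open>\<L>\<psi>\<close>, finite by
  definition of the domain. The weights are compared mode by mode, where everything lives on the
  annulus; this avoids discussing where the chosen version of \<open>\<Lambda>\<psi>\<close> is
  supported.\<close>

lemma nn_integral_num_finite:
  "(\<integral>\<^sup>+x. ennreal ((cmod (calL \<Lambda> \<psi> x))\<^sup>2 / norm x powr \<alpha>) \<partial>lborel) < \<infinity>"
proof -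
  obtain K where K: "K > 0" "\<And>r. r \<in> {a..b} \<Longrightarrow> 1 / r powr \<alpha> \<le> K"
  proof -
    have "continuous_on {a..b} (\<lambda>r. 1 / r powr \<alpha>)" using a by (auto intro!: continuous_intros)
    then have "compact ((\<lambda>r. 1 / r powr \<alpha>) ` {a..b})" by (intro compact_continuous_image) auto
    then obtain B where "\<And>x. x \<in> (\<lambda>r. 1 / r powr \<alpha>) ` {a..b} \<Longrightarrow> norm x \<le> B"
      by (meson bounded_iff compact_imp_bounded)
    then show ?thesis by (intro that[of "max B 1"]) (force simp: le_max_iff_disj)+
  qed
  have le: "integral {a..b} (num n \<alpha>) \<le> K * integral {a..b} (num n 0)" for n
  proof -
    have "integral {a..b} (num n \<alpha>) \<le> integral {a..b} (\<lambda>r. K * num n 0 r)"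
    proof (intro integral_le integrable_continuous_real)
      show "continuous_on {a..b} (num n \<alpha>)" "continuous_on {a..b} (\<lambda>r. K * num n 0 r)"
        unfolding num_density_def using a
        by (auto simp del: powr_zero_eq_one intro!: continuous_intros continuous_on_subset[OF continuous_on_coeff[OF smooth(1)]]
            continuous_on_subset[OF continuous_on_coeff[OF smooth(2)]] continuous_on_subset[OF continuous_on_coeff[OF smooth(3)]])
      show "num n \<alpha> r \<le> K * num n 0 r" if r: "r \<in> {a..b}" for r
      proof -
        let ?X = "r ^ (DIM('a) - 1) * (cmod (- coeff (radial_deriv (radial_deriv \<psi>)) n r -
            of_real ((real DIM('a) - 1) / r) * coeff (radial_deriv \<psi>) n r +
            of_real (1 / r\<^sup>2) * (of_real (L n) * coeff \<psi> n r)))\<^sup>2"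
        have "1 / r powr \<alpha> * ?X \<le> K * ?X" using r a by (intro mult_right_mono K) auto
        then show ?thesis using r a by (simp add: num_density_def)
      qed
    qed
    then show ?thesis by simp
  qed
  have "(\<integral>\<^sup>+x. ennreal ((cmod (calL \<Lambda> \<psi> x))\<^sup>2 / norm x powr \<alpha>) \<partial>lborel) \<le>
      (\<Sum>n. ennreal K * ennreal (integral {a..b} (num n 0)))"
    unfolding nn_integral_num using K(1) le
    by (intro suminf_le) (auto simp: ennreal_mult'[symmetric] intro!: ennreal_leI)
  also have "\<dots> = ennreal K * (\<integral>\<^sup>+x. ennreal ((cmod (calL \<Lambda> \<psi> x))\<^sup>2 / norm x powr 0) \<partial>lborel)"
    unfolding nn_integral_num by simp
  also have "(\<integral>\<^sup>+x. ennreal ((cmod (calL \<Lambda> \<psi> x))\<^sup>2 / norm x powr 0) \<partial>lborel) =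
      (\<integral>\<^sup>+x. ennreal ((cmod (calL \<Lambda> \<psi> x))\<^sup>2) \<partial>lborel)"
  proof (rule nn_integral_cong_AE)
    \<comment> \<open>The origin is exceptional because \<open>0 powr 0 = 0\<close>.\<close>
    show "AE x in lborel. ennreal ((cmod (calL \<Lambda> \<psi> x))\<^sup>2 / norm x powr 0) = ennreal ((cmod (calL \<Lambda> \<psi> x))\<^sup>2)"
      using AE_lborel_singleton[of "0::'a"] by eventually_elim simp
  qed
  also have "\<dots> = ennreal ((L2_norm lborel (calL \<Lambda> \<psi>))\<^sup>2)"
    using \<psi> by (intro nn_integral_L2) (simp add: dom_calL_def calL_in_L2_def)
  also have "ennreal K * \<dots> < \<infinity>" by (simp add: ennreal_mult_less_top)
  finally show ?thesis .
qed

text \<open>Completeness on the spheres yields vanishing only almost everywhere; continuity away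
  from the origin turns one nonzero value of \<open>\<psi>\<close> into a ball of positive
  measure.\<close>

lemma exists_coeff_nonzero:
  assumes "\<psi> \<noteq> (\<lambda>_. 0)"
  obtains n r where "r > 0" "coeff \<psi> n r \<noteq> 0"
proof (rule ccontr)
  note witness = that
  assume "\<not> thesis"
  then have zero: "coeff \<psi> n r = 0" if "r > 0" for n r using witness that by blast
  have meas [measurable]: "\<psi> \<in> borel_measurable borel"
    by (intro borel_measurable_if_continuous_away_0 smooth_on_continuous smooth)
  have zero_AE: "AE x in lborel. \<psi> x = 0"
  proof (subst AE_polar)
    show "Measurable.pred borel (\<lambda>x. \<psi> x = 0)" by measurable
    have "AE \<omega> in sphere_measure. \<psi> (r *\<^sub>R \<omega>) = 0" if r: "r > 0" for r
      using complete[OF slice_L2[OF r smooth(1)]] zero[OF r] by (simp add: coeff_def ae_eq_def)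
    then show "AE r in lborel. 0 < r \<longrightarrow> (AE \<omega> in sphere_measure. \<psi> (r *\<^sub>R \<omega>) = 0)" by simp
  qed
  obtain x where x: "\<psi> x \<noteq> 0" using assms by auto
  have "x \<noteq> 0" using supp[of x] x a by auto
  then have "isCont \<psi> x"
    using smooth_on_continuous[OF smooth(1)] by (auto simp: continuous_on_eq_continuous_at open_Compl)
  from continuous_at_avoid[OF this x] obtain d where d: "d > 0" "\<And>y. dist x y < d \<Longrightarrow> \<psi> y \<noteq> 0"
    by auto
  have "AE y in lborel. y \<notin> ball x d"
    using zero_AE by eventually_elim (use d(2) in auto)
  then have "emeasure lborel (ball x d) = 0"
    by (subst (asm) AE_iff_measurable[of "ball x d"]) auto
  then have "measure lborel (ball x d) = 0" by (simp add: measure_def)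
  then show False using content_ball_pos[OF d(1), of x] by simp
qed

text \<open>Every mode satisfies \<open>C E \<le> N\<close>, and one of them strictly. Strictness
  survives summation once both series are known to converge, and this convergence is what most of
  the argument is about.\<close>

theorem not_attained:
  fixes \<alpha> :: real
  assumes m0: "minimizing_index DIM('a) \<alpha> I lam m0" and C: "C = rellich_const DIM('a) \<alpha> I lam"
    and nz: "\<psi> \<noteq> (\<lambda>_. 0)"
  shows "rellich_num \<alpha> \<Lambda> \<psi> \<noteq> C * rellich_den \<alpha> sqrt\<Lambda> \<psi>"
proof -
  define \<gamma> where "\<gamma> = (real DIM('a) - 4 - \<alpha>) / 2"
  define N where "N n = integral {a..b} (num n \<alpha>)" for n
  define E where "E n = integral {a..b} (den n \<alpha>)" for n
  obtain x where "\<psi> x \<noteq> 0" using nz by auto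
  then have ab: "a < b" using supp[of x] by auto
  have C0: "C \<ge> 0" unfolding C by (rule rellich_const_nonneg[OF m0 lam_nonneg])
  have E0: "0 \<le> E n" for n unfolding E_def
  proof (intro integral_nonneg integrable_continuous_real)
    show "continuous_on {a..b} (den n \<alpha>)"
      unfolding den_density_def using a
      by (auto intro!: continuous_intros continuous_on_subset[OF continuous_on_coeff[OF smooth(1)]]
            continuous_on_subset[OF continuous_on_coeff[OF smooth(2)]])
    show "0 \<le> den n \<alpha> r" if "r \<in> {a..b}" for r using that a L_nonneg[of n] by (simp add: den_density_def)
  qed
  have main: "C * E n \<le> N n \<and> (\<forall>r>0. coeff \<psi> n r \<noteq> 0 \<longrightarrow> C * E n < N n)" for n
  proof (cases "n \<in> J")
    case True
    then obtain m where m: "m \<in> I" "L n = lam m" by (metis J_cases)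
    obtain K where K: "K * (L n + \<gamma>\<^sup>2) = (L n + \<gamma>\<^sup>2 + \<gamma> * (\<alpha> + 2))\<^sup>2" "C \<le> K"
      "0 \<le> (\<alpha> + 2)\<^sup>2 + 2 * (L n + \<gamma>\<^sup>2 + \<gamma> * (\<alpha> + 2)) - K"
      using rellich_const_le[OF m0 \<gamma>_def lam_nonneg m(1)] unfolding C m(2) by metis
    have "DIM('a) \<ge> 1" by (simp add: Suc_leI)
    note bounds = rellich_one_dim[OF this \<gamma>_def a ab]
    have s: "a < r \<and> r < b" if "r > 0" "coeff \<psi> n r \<noteq> 0 \<or> coeff (radial_deriv \<psi>) n r \<noteq> 0" for r
      using coeff_supp[OF that(1), of n] that(2) by auto
    have le: "K * E n \<le> N n" unfolding E_def N_def
      by (intro bounds(1) coeff_has_vector_derivative continuous_on_coeff smooth s K(1,3))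
    have less: "K * E n < N n" if "r > 0" "coeff \<psi> n r \<noteq> 0" for r unfolding E_def N_def
      by (intro bounds(2)[where ?r0.0=r] coeff_has_vector_derivative continuous_on_coeff smooth s K(1,3) that)
    have "C * E n \<le> K * E n" using K(2) E0 by (rule mult_right_mono)
    then show ?thesis using le less by fastforce
  next
    case False
    then have e0: "e n = (\<lambda>_. 0)" "L n = 0" by (simp_all add: e_def L_def)
    then have "coeff \<phi> n r = 0" for \<phi> r by (simp add: coeff_def)
    then show ?thesis by (simp add: N_def E_def num_density_def den_density_def)
  qed
  have N0: "0 \<le> N n" for n using main[of n] mult_nonneg_nonneg[OF C0 E0[of n]] by linarith
  obtain n0 r0 where n0: "r0 > 0" "coeff \<psi> n0 r0 \<noteq> 0" using exists_coeff_nonzero[OF nz] by metis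
  have sN: "summable N"
    using nn_integral_num_finite[of \<alpha>] N0 unfolding nn_integral_num N_def[symmetric]
    by (intro summable_suminf_not_top) auto
  have num: "rellich_num \<alpha> \<Lambda> \<psi> = suminf N"
    unfolding rellich_num_def
  proof (subst integral_eq_nn_integral)
    note [measurable] = calL_measurable
    have "(\<lambda>x. (cmod (calL \<Lambda> \<psi> x))\<^sup>2 / norm x powr \<alpha>) \<in> borel_measurable borel" by measurable
    then show "(\<lambda>x. (cmod (calL \<Lambda> \<psi> x))\<^sup>2 / norm x powr \<alpha>) \<in> borel_measurable lborel" by simp
    show "enn2real (\<integral>\<^sup>+x. ennreal ((cmod (calL \<Lambda> \<psi> x))\<^sup>2 / norm x powr \<alpha>) \<partial>lborel) = suminf N"
      unfolding nn_integral_num N_def[symmetric] using sN N0 by (simp add: suminf_ennreal2 suminf_nonneg)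
  qed simp
  show ?thesis
  \<comment> \<open>For \<open>C = 0\<close> the modes give no bound on the denominator; the claim
    then reduces to positivity of the numerator.\<close>
  proof (cases "C = 0")
    case True
    have "0 < N n0" using main[of n0] n0 True by auto
    then have "suminf N > 0" using suminf_pos2[OF sN N0] by blast
    then show ?thesis using num True by simp
  next
    case False
    with C0 have Cpos: "C > 0" by simp
    \<comment> \<open>Finiteness of the denominator is not part of the domain; it comes from the
      mode inequality itself, as \<open>E n \<le> N n / C\<close>.\<close>
    have sE: "summable E"
    proof (rule summable_comparison_test'[of "\<lambda>n. N n / C" 0])
      show "summable (\<lambda>n. N n / C)" using sN by (rule summable_divide)
      show "norm (E n) \<le> N n / C" for n using main[of n] E0[of n] Cpos by (simp add: field_simps)
    qed
    have den: "rellich_den \<alpha> sqrt\<Lambda> \<psi> = suminf E"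
      unfolding rellich_den_def
    proof (subst integral_eq_nn_integral)
      note [measurable] = calD_measurable
      have "(\<lambda>x. calD sqrt\<Lambda> \<psi> x / norm x powr (\<alpha> + 2)) \<in> borel_measurable borel" by measurable
      then show "(\<lambda>x. calD sqrt\<Lambda> \<psi> x / norm x powr (\<alpha> + 2)) \<in> borel_measurable lborel" by simp
      show "enn2real (\<integral>\<^sup>+x. ennreal (calD sqrt\<Lambda> \<psi> x / norm x powr (\<alpha> + 2)) \<partial>lborel) = suminf E"
        unfolding nn_integral_den E_def[symmetric] using sE E0 by (simp add: suminf_ennreal2 suminf_nonneg)
    qed (simp add: calD_def)
    have "0 < (\<Sum>n. N n - C * E n)"
    proof (rule suminf_pos2)
      show "summable (\<lambda>n. N n - C * E n)" by (intro summable_diff summable_mult sN sE)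
      show "0 \<le> N n - C * E n" for n using main[of n] by simp
      show "0 < N n0 - C * E n0" using main[of n0] n0 by auto
    qed
    also have "\<dots> = suminf N - C * suminf E"
      using suminf_diff[OF sN summable_mult[OF sE, of C]] suminf_mult[OF sE, of C] by simp
    finally show ?thesis using num den by simp
  qed
qed

end

end


section \<open>Separated functions\<close>

lemma radial_deriv_separated:
  fixes \<psi> w :: "'a::euclidean_space \<Rightarrow> complex"
  assumes \<psi>: "\<And>x. x \<noteq> 0 \<Longrightarrow> \<psi> x = of_real (f (norm x)) * w (sgn x)"
    and f: "\<And>r. r > 0 \<Longrightarrow> (f has_real_derivative f1 r) (at r)" and x: "x \<noteq> 0"
  shows "radial_deriv \<psi> x = of_real (f1 (norm x)) * w (sgn x)"
proof -
  have "((\<lambda>s. of_real (f s) * w (sgn x)) has_vector_derivative of_real (f1 (norm x)) * w (sgn x)) (at (norm x))"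
    using x by (intro has_vector_derivative_mult_left has_vector_derivative_of_real f) auto
  then have "((\<lambda>s. \<psi> (s *\<^sub>R sgn x)) has_vector_derivative of_real (f1 (norm x)) * w (sgn x)) (at (norm x))"
  proof (rule has_vector_derivative_transform_within_open[of _ _ _ "{0<..}"])
    fix s :: real assume "s \<in> {0<..}"
    moreover have "sgn (sgn x) = sgn x" using x by (simp add: sgn_div_norm[of "sgn x"] norm_sgn)
    ultimately show "of_real (f s) * w (sgn x) = \<psi> (s *\<^sub>R sgn x)"
      using x \<psi>[of "s *\<^sub>R sgn x"] by (simp add: sgn_scaleR norm_sgn sgn_zero_iff)
  qed (use x in auto)
  then show ?thesis unfolding radial_deriv_def by (rule vector_derivative_at)
qed

lemma borel_measurable_separated:
  fixes w :: "'a::euclidean_space \<Rightarrow> complex" and f :: "real \<Rightarrow> real"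
  assumes "continuous_on {0<..} f" "w \<in> borel_measurable sphere_measure"
    and \<psi>: "\<And>x. x \<noteq> 0 \<Longrightarrow> \<psi> x = of_real (f (norm x)) * w (sgn x)"
  shows "\<psi> \<in> borel_measurable borel"
proof -
  have "(\<lambda>x::'a. complex_of_real (f (norm x))) \<in> borel_measurable borel"
    by (intro borel_measurable_if_continuous_away_0 continuous_on_of_real continuous_on_compose2[OF assms(1)])
       (auto intro!: continuous_intros)
  with borel_measurable_compose_sgn[OF assms(2)]
  have "(\<lambda>x. of_real (f (norm x)) * w (sgn x)) \<in> borel_measurable borel" by measurable
  then show ?thesis by (rule measurable_discrete_difference[of _ _ _ "{0}"]) (use \<psi> in auto)
qed

text \<open>This makes the choice inside \<open>angular_op\<close> harmless: any explicit version
  may replace it under an integral.\<close>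

lemma angular_version_unique:
  fixes F F' :: "'a::euclidean_space \<Rightarrow> complex"
  assumes "angular_version A \<psi> F" "angular_version A \<psi> F'"
  shows "AE x in lborel. F x = F' x"
proof (subst AE_polar)
  note [measurable] = assms[unfolded angular_version_def, THEN conjunct1]
  show "Measurable.pred borel (\<lambda>x. F x = F' x)" by measurable
  show "AE r in lborel. 0 < r \<longrightarrow> (AE \<omega> in sphere_measure. F (r *\<^sub>R \<omega>) = F' (r *\<^sub>R \<omega>))"
    using assms[unfolded angular_version_def, THEN conjunct2]
  proof eventually_elim
    case (elim r)
    show ?case
    proof
      assume "0 < r"
      with elim have "AE \<omega> in sphere_measure. F (r *\<^sub>R \<omega>) = A (\<lambda>\<omega>. \<psi> (r *\<^sub>R \<omega>)) \<omega>"
        "AE \<omega> in sphere_measure. F' (r *\<^sub>R \<omega>) = A (\<lambda>\<omega>. \<psi> (r *\<^sub>R \<omega>)) \<omega>"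
        by (auto simp: ae_eq_def)
      then show "AE \<omega> in sphere_measure. F (r *\<^sub>R \<omega>) = F' (r *\<^sub>R \<omega>)"
        by eventually_elim simp
    qed
  qed
qed

text \<open>Stated for a general self-adjoint \<open>A\<close> because it serves both
  \<open>\<Lambda>\<close> and its square root. A slice of \<open>\<psi>\<close> equals a multiple
  of \<open>w\<close> on the sphere but possibly not off it, and \<open>dom_ae_closed\<close>
  bridges this difference.\<close>

lemma angular_version_separated:
  fixes A :: "('a::euclidean_space \<Rightarrow> complex) \<Rightarrow> ('a \<Rightarrow> complex)"
  assumes A: "selfadjoint_operator sphere_measure D A"
    and w: "w \<in> D" "ae_eq sphere_measure (A w) (\<lambda>\<omega>. of_real l * w \<omega>)"
    and \<psi>: "\<And>x. x \<noteq> 0 \<Longrightarrow> \<psi> x = of_real (f (norm x)) * w (sgn x)"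
    and f: "continuous_on {0<..} f"
  shows "angular_version A \<psi> (\<lambda>x. of_real (f (norm x) * l) * w (sgn x))"
    and "r > 0 \<Longrightarrow> (\<lambda>\<omega>. \<psi> (r *\<^sub>R \<omega>)) \<in> D"
proof -
  interpret selfadjoint_operator sphere_measure D A by (rule A)
  have wm: "w \<in> borel_measurable sphere_measure" using w(1) by (intro L2_measurable) simp
  have main: "(\<lambda>\<omega>. \<psi> (r *\<^sub>R \<omega>)) \<in> D \<and>
      ae_eq sphere_measure (\<lambda>\<omega>. of_real (f r * l) * w \<omega>) (A (\<lambda>\<omega>. \<psi> (r *\<^sub>R \<omega>)))"
    if r: "r > 0" for r
  proof -
    have eq: "of_real (f r) * w \<omega> = \<psi> (r *\<^sub>R \<omega>)" if "\<omega> \<in> space sphere_measure" for \<omega>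
    proof -
      have "norm \<omega> = 1" "\<omega> \<noteq> 0" using that by auto
      then show ?thesis using r \<psi>[of "r *\<^sub>R \<omega>"] by (simp add: sgn_div_norm)
    qed
    have fw: "(\<lambda>\<omega>. of_real (f r) * w \<omega>) \<in> D" by (rule dom_cmult[OF w(1)])
    have "(\<lambda>\<omega>. \<psi> (r *\<^sub>R \<omega>)) \<in> L2 sphere_measure \<longleftrightarrow> (\<lambda>\<omega>. of_real (f r) * w \<omega>) \<in> L2 sphere_measure"
      unfolding L2_def mem_Collect_eq
      by (intro arg_cong2[where f="(\<and>)"] measurable_cong Bochner_Integration.integrable_cong) (auto simp: eq)
    then have L2: "(\<lambda>\<omega>. \<psi> (r *\<^sub>R \<omega>)) \<in> L2 sphere_measure" using fw by simp
    have "ae_eq sphere_measure (\<lambda>\<omega>. of_real (f r) * w \<omega>) (\<lambda>\<omega>. \<psi> (r *\<^sub>R \<omega>))"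
      unfolding ae_eq_def by (intro AE_I2 eq)
    note ae = dom_ae_closed[OF fw L2 this]
    have "ae_eq sphere_measure (\<lambda>\<omega>. of_real (f r * l) * w \<omega>) (A (\<lambda>\<omega>. \<psi> (r *\<^sub>R \<omega>)))"
      using ae(2) op_cmult[OF w(1), of "of_real (f r)"] w(2) unfolding ae_eq_def
      by eventually_elim (simp add: mult_ac)
    with ae(1) show ?thesis by simp
  qed
  then show "r > 0 \<Longrightarrow> (\<lambda>\<omega>. \<psi> (r *\<^sub>R \<omega>)) \<in> D" by simp
  show "angular_version A \<psi> (\<lambda>x. of_real (f (norm x) * l) * w (sgn x))"
    unfolding angular_version_def
  proof (intro conjI AE_I2 impI)
    show "(\<lambda>x. of_real (f (norm x) * l) * w (sgn x)) \<in> borel_measurable borel"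
      by (rule borel_measurable_separated[of "\<lambda>r. f r * l" w]) (auto intro!: continuous_intros f wm)
    fix r :: real assume r: "0 < r"
    have "ae_eq sphere_measure (\<lambda>\<omega>. of_real (f (norm (r *\<^sub>R \<omega>)) * l) * w (sgn (r *\<^sub>R \<omega>))) (\<lambda>\<omega>. of_real (f r * l) * w \<omega>)"
      unfolding ae_eq_def using r by (intro AE_I2) (auto simp: sgn_div_norm)
    then show "ae_eq sphere_measure (\<lambda>\<omega>. of_real (f (norm (r *\<^sub>R \<omega>)) * l) * w (sgn (r *\<^sub>R \<omega>))) (A (\<lambda>\<omega>. \<psi> (r *\<^sub>R \<omega>)))"
      using main[OF r] by (blast intro: ae_eq_trans)
  qed
qed

lemma nn_integral_separated:
  fixes w :: "'a::euclidean_space \<Rightarrow> complex" and q :: "real \<Rightarrow> real"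
  assumes w: "w \<in> L2 sphere_measure" and q: "continuous_on {0<..} q" "\<And>r. r > 0 \<Longrightarrow> 0 \<le> q r"
  shows "(\<integral>\<^sup>+x. ennreal (q (norm x) * (cmod (w (sgn x)))\<^sup>2) \<partial>lborel) =
    ennreal ((L2_norm sphere_measure w)\<^sup>2) * (\<integral>\<^sup>+r. indicator {0<..} r * ennreal (r ^ (DIM('a) - 1) * q r) \<partial>lborel)"
proof -
  have [measurable]: "(\<lambda>x. w (sgn x)) \<in> borel_measurable borel"
    by (intro borel_measurable_compose_sgn L2_measurable w)
  have [measurable]: "(\<lambda>x::'a. q (norm x)) \<in> borel_measurable borel"
    by (intro borel_measurable_continuous_countable_exceptions[of "{0}"] continuous_on_compose2[OF q(1)])
       (auto intro!: continuous_intros)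
  have "(\<integral>\<^sup>+x. ennreal (q (norm x) * (cmod (w (sgn x)))\<^sup>2) \<partial>lborel) =
      (\<integral>\<^sup>+r. indicator {0<..} r * ennreal (r ^ (DIM('a) - 1)) *
        (\<integral>\<^sup>+\<omega>. ennreal (q (norm (r *\<^sub>R \<omega>)) * (cmod (w (sgn (r *\<^sub>R \<omega>))))\<^sup>2) \<partial>sphere_measure) \<partial>lborel)"
    by (rule nn_integral_polar) measurable
  also have "\<dots> = (\<integral>\<^sup>+r. ennreal ((L2_norm sphere_measure w)\<^sup>2) * (indicator {0<..} r * ennreal (r ^ (DIM('a) - 1) * q r)) \<partial>lborel)"
  proof (rule nn_integral_cong)
    fix r :: real
    show "indicator {0<..} r * ennreal (r ^ (DIM('a) - 1)) *
        (\<integral>\<^sup>+\<omega>. ennreal (q (norm (r *\<^sub>R \<omega>)) * (cmod (w (sgn (r *\<^sub>R \<omega>))))\<^sup>2) \<partial>sphere_measure) =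
        ennreal ((L2_norm sphere_measure w)\<^sup>2) * (indicator {0<..} r * ennreal (r ^ (DIM('a) - 1) * q r))"
    proof (cases "r > 0")
      case True
      have "(\<integral>\<^sup>+\<omega>. ennreal (q (norm (r *\<^sub>R \<omega>)) * (cmod (w (sgn (r *\<^sub>R \<omega>))))\<^sup>2) \<partial>sphere_measure) =
          (\<integral>\<^sup>+\<omega>. ennreal (q r) * ennreal ((cmod (w \<omega>))\<^sup>2) \<partial>sphere_measure)"
      proof (rule nn_integral_cong)
        fix \<omega> :: 'a assume "\<omega> \<in> space sphere_measure"
        then have "norm (r *\<^sub>R \<omega>) = r" "sgn (r *\<^sub>R \<omega>) = \<omega>" using True by (auto simp: sgn_div_norm)
        then show "ennreal (q (norm (r *\<^sub>R \<omega>)) * (cmod (w (sgn (r *\<^sub>R \<omega>))))\<^sup>2) = ennreal (q r) * ennreal ((cmod (w \<omega>))\<^sup>2)"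
          using q(2)[OF True] by (simp only: ennreal_mult' zero_le_power2 ennreal_mult)
      qed
      also have "\<dots> = ennreal (q r) * ennreal ((L2_norm sphere_measure w)\<^sup>2)"
        using L2_measurable[OF w] by (subst nn_integral_cmult) (auto simp: nn_integral_L2[OF w])
      finally show ?thesis using True q(2)[OF True] by (simp add: ennreal_mult mult_ac)
    qed simp
  qed
  also have "\<dots> = ennreal ((L2_norm sphere_measure w)\<^sup>2) * (\<integral>\<^sup>+r. indicator {0<..} r * ennreal (r ^ (DIM('a) - 1) * q r) \<partial>lborel)"
  proof (rule nn_integral_cmult)
    have "(\<lambda>r. indicator {0<..} r *\<^sub>R (r ^ (DIM('a) - 1) * q r)) \<in> borel_measurable borel"
      using q(1) by (intro borel_measurable_continuous_on_indicator continuous_intros) auto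
    then have "(\<lambda>r. ennreal (indicator {0<..} r *\<^sub>R (r ^ (DIM('a) - 1) * q r))) \<in> borel_measurable borel" by measurable
    moreover have "(\<lambda>r. ennreal (indicator {0<..} r *\<^sub>R (r ^ (DIM('a) - 1) * q r))) =
        (\<lambda>r. indicator {0<..} r * ennreal (r ^ (DIM('a) - 1) * q r))" by (auto split: split_indicator)
    ultimately show "(\<lambda>r. indicator {0<..} r * ennreal (r ^ (DIM('a) - 1) * q r)) \<in> borel_measurable lborel" by simp
  qed
  finally show ?thesis .
qed

text \<open>The eigenfunction \<open>w\<close> is arbitrary, neither normalised nor necessarily
  among the \<open>u m\<close>: the power-type trial functions take \<open>u m0\<close>, the radial
  ones the constant 1.\<close>

locale separated = angular_operator dom\<Lambda> \<Lambda> I lam u dom_sqrt\<Lambda> sqrt\<Lambda>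
  for dom\<Lambda> :: "('a::euclidean_space \<Rightarrow> complex) set" and \<Lambda> and I :: "'i set" and lam u dom_sqrt\<Lambda> sqrt\<Lambda> +
  fixes w :: "'a \<Rightarrow> complex" and l :: real and f f1 f2 :: "real \<Rightarrow> real" and \<psi> :: "'a \<Rightarrow> complex"
  assumes w: "eigenfunction sphere_measure dom\<Lambda> \<Lambda> l w" and l: "0 \<le> l"
    and f: "\<And>r. r > 0 \<Longrightarrow> (f has_real_derivative f1 r) (at r)"
    and f1: "\<And>r. r > 0 \<Longrightarrow> (f1 has_real_derivative f2 r) (at r)"
    and f2: "continuous_on {0<..} f2"
    and \<psi>: "\<And>x. x \<noteq> 0 \<Longrightarrow> \<psi> x = of_real (f (norm x)) * w (sgn x)"
begin

definition L_radial :: "real \<Rightarrow> real" where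
  "L_radial r = - f2 r - (real DIM('a) - 1) / r * f1 r + 1 / r\<^sup>2 * (l * f r)"

lemma continuous: "continuous_on {0<..} f" "continuous_on {0<..} f1" "continuous_on {0<..} f2"
  using f f1 f2 by (auto intro!: continuous_at_imp_continuous_on DERIV_isCont)

lemma w_L2: "w \<in> L2 sphere_measure"
  using w by (simp add: eigenfunction_def)

lemma L_rad: "x \<noteq> 0 \<Longrightarrow> L_rad \<psi> x = of_real (- f2 (norm x) - (real DIM('a) - 1) / norm x * f1 (norm x)) * w (sgn x)"
  unfolding L_rad_def
  by (simp add: radial_deriv_separated[of "radial_deriv \<psi>" f1 w f2, OF radial_deriv_separated[OF \<psi> f] f1]
      radial_deriv_separated[OF \<psi> f] algebra_simps)

lemma version: "angular_version \<Lambda> \<psi> (\<lambda>x. of_real (f (norm x) * l) * w (sgn x))"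
  and dom: "r > 0 \<Longrightarrow> (\<lambda>\<omega>. \<psi> (r *\<^sub>R \<omega>)) \<in> dom\<Lambda>"
  using w angular_version_separated[OF selfadjoint_operator_axioms _ _ \<psi> continuous(1)]
  by (auto simp: eigenfunction_def)

lemma version_sqrt: "angular_version sqrt\<Lambda> \<psi> (\<lambda>x. of_real (f (norm x) * sqrt l) * w (sgn x))"
  using w dom_sqrt(1)[of w] sqrt_eigenfunction[OF w l]
    angular_version_separated(1)[OF sqrt.selfadjoint_operator_axioms _ _ \<psi> continuous(1)]
  by (auto simp: eigenfunction_def)

lemma calL_eq: "AE x in lborel. calL \<Lambda> \<psi> x = of_real (L_radial (norm x)) * w (sgn x)"
proof -
  have "AE x in lborel. angular_op \<Lambda> \<psi> x = of_real (f (norm x) * l) * w (sgn x)"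
    by (rule angular_version_unique[OF angular_version_op version]) (use version in blast)
  then show ?thesis using AE_lborel_singleton[of "0::'a"]
  proof eventually_elim
    case (elim x)
    then show ?case by (simp add: calL_def L_rad L_radial_def algebra_simps)
  qed
qed

lemma calD_eq: "AE x in lborel. calD sqrt\<Lambda> \<psi> x =
  ((f1 (norm x))\<^sup>2 + 1 / (norm x)\<^sup>2 * (l * (f (norm x))\<^sup>2)) * (cmod (w (sgn x)))\<^sup>2"
proof -
  have "AE x in lborel. angular_op sqrt\<Lambda> \<psi> x = of_real (f (norm x) * sqrt l) * w (sgn x)"
    by (rule angular_version_unique[OF angular_version_op version_sqrt]) (use version_sqrt in blast)
  then show ?thesis using AE_lborel_singleton[of "0::'a"]
  proof eventually_elim
    case (elim x)
    then show ?case using l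
      by (simp add: calD_def radial_deriv_separated[OF \<psi> f] norm_mult power_mult_distrib algebra_simps)
  qed
qed

lemma calL_measurable: "calL \<Lambda> \<psi> \<in> borel_measurable borel"
proof -
  have "L_rad \<psi> \<in> borel_measurable borel"
  proof (rule borel_measurable_separated[OF _ L2_measurable[OF w_L2] L_rad])
    show "continuous_on {0<..} (\<lambda>r. - f2 r - (real DIM('a) - 1) / r * f1 r)"
      by (auto intro!: continuous_intros continuous)
  qed
  moreover have "angular_version \<Lambda> \<psi> (angular_op \<Lambda> \<psi>)"
    by (rule angular_version_op) (use version in blast)
  then have "angular_op \<Lambda> \<psi> \<in> borel_measurable borel" by (simp add: angular_version_def)
  ultimately show ?thesis unfolding calL_def[abs_def] by measurable
qed

lemma calD_measurable: "calD sqrt\<Lambda> \<psi> \<in> borel_measurable borel"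
proof -
  have "radial_deriv \<psi> \<in> borel_measurable borel"
    by (rule borel_measurable_separated[OF continuous(2) L2_measurable[OF w_L2] radial_deriv_separated[OF \<psi> f]])
  moreover have "angular_version sqrt\<Lambda> \<psi> (angular_op sqrt\<Lambda> \<psi>)"
    by (rule angular_version_op) (use version_sqrt in blast)
  then have "angular_op sqrt\<Lambda> \<psi> \<in> borel_measurable borel" by (simp add: angular_version_def)
  ultimately show ?thesis unfolding calD_def[abs_def] by measurable
qed

lemma nn_integral_num:
  "(\<integral>\<^sup>+x. ennreal ((cmod (calL \<Lambda> \<psi> x))\<^sup>2 / norm x powr \<alpha>) \<partial>lborel) = ennreal ((L2_norm sphere_measure w)\<^sup>2) *
    (\<integral>\<^sup>+r. indicator {0<..} r * ennreal (num_density DIM('a) \<alpha> l (of_real (f r)) (of_real (f1 r)) (of_real (f2 r)) r) \<partial>lborel)"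
proof -
  have eq: "num_density DIM('a) \<alpha> l (of_real (f r)) (of_real (f1 r)) (of_real (f2 r)) r =
      r ^ (DIM('a) - 1) * ((L_radial r)\<^sup>2 / r powr \<alpha>)" for r
  proof -
    have "- complex_of_real (f2 r) - of_real ((real DIM('a) - 1) / r) * of_real (f1 r) + of_real (1 / r\<^sup>2) * (of_real l * of_real (f r)) =
        of_real (L_radial r)"
      by (simp add: L_radial_def)
    then show ?thesis unfolding num_density_def by (simp only: norm_of_real power2_abs) simp
  qed
  have "(\<integral>\<^sup>+x. ennreal ((cmod (calL \<Lambda> \<psi> x))\<^sup>2 / norm x powr \<alpha>) \<partial>lborel) =
      (\<integral>\<^sup>+x. ennreal ((L_radial (norm x))\<^sup>2 / norm x powr \<alpha> * (cmod (w (sgn x)))\<^sup>2) \<partial>lborel)"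
  proof (rule nn_integral_cong_AE)
    show "AE x in lborel. ennreal ((cmod (calL \<Lambda> \<psi> x))\<^sup>2 / norm x powr \<alpha>) =
        ennreal ((L_radial (norm x))\<^sup>2 / norm x powr \<alpha> * (cmod (w (sgn x)))\<^sup>2)"
      using calL_eq by eventually_elim (simp add: norm_mult power_mult_distrib)
  qed
  also have "\<dots> = ennreal ((L2_norm sphere_measure w)\<^sup>2) *
      (\<integral>\<^sup>+r. indicator {0<..} r * ennreal (r ^ (DIM('a) - 1) * ((L_radial r)\<^sup>2 / r powr \<alpha>)) \<partial>lborel)"
    by (rule nn_integral_separated[OF w_L2, where q="\<lambda>r. (L_radial r)\<^sup>2 / r powr \<alpha>"])
       (auto simp: L_radial_def intro!: continuous_intros continuous)
  finally show ?thesis unfolding eq .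
qed

lemma nn_integral_den:
  "(\<integral>\<^sup>+x. ennreal (calD sqrt\<Lambda> \<psi> x / norm x powr (\<alpha> + 2)) \<partial>lborel) = ennreal ((L2_norm sphere_measure w)\<^sup>2) *
    (\<integral>\<^sup>+r. indicator {0<..} r * ennreal (den_density DIM('a) \<alpha> l (of_real (f r)) (of_real (f1 r)) r) \<partial>lborel)"
proof -
  let ?q = "\<lambda>r. ((f1 r)\<^sup>2 + 1 / r\<^sup>2 * (l * (f r)\<^sup>2)) / r powr (\<alpha> + 2)"
  have eq: "den_density DIM('a) \<alpha> l (of_real (f r)) (of_real (f1 r)) r = r ^ (DIM('a) - 1) * ?q r" for r
    by (simp add: den_density_def)
  have "(\<integral>\<^sup>+x. ennreal (calD sqrt\<Lambda> \<psi> x / norm x powr (\<alpha> + 2)) \<partial>lborel) =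
      (\<integral>\<^sup>+x. ennreal (?q (norm x) * (cmod (w (sgn x)))\<^sup>2) \<partial>lborel)"
  proof (rule nn_integral_cong_AE)
    show "AE x in lborel. ennreal (calD sqrt\<Lambda> \<psi> x / norm x powr (\<alpha> + 2)) = ennreal (?q (norm x) * (cmod (w (sgn x)))\<^sup>2)"
      using calD_eq by eventually_elim simp
  qed
  also have "\<dots> = ennreal ((L2_norm sphere_measure w)\<^sup>2) *
      (\<integral>\<^sup>+r. indicator {0<..} r * ennreal (r ^ (DIM('a) - 1) * ?q r) \<partial>lborel)"
    by (rule nn_integral_separated[OF w_L2]) (use l in \<open>auto intro!: continuous_intros continuous\<close>)
  finally show ?thesis unfolding eq .
qed

text \<open>The support condition concerns \<open>l * f\<close> instead of \<open>f\<close>: for the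
  radial trial functions \<open>l = 0\<close>, while the profile itself need not vanish outside the
  interval.\<close>

lemma rellich_num_eq:
  assumes "0 < a" "\<And>r. 0 < r \<Longrightarrow> r \<notin> {a..b} \<Longrightarrow> f1 r = 0 \<and> f2 r = 0 \<and> l * f r = 0"
  shows "rellich_num \<alpha> \<Lambda> \<psi> = (L2_norm sphere_measure w)\<^sup>2 *
    integral {a..b} (\<lambda>r. num_density DIM('a) \<alpha> l (of_real (f r)) (of_real (f1 r)) (of_real (f2 r)) r)"
    and "(\<integral>\<^sup>+x. ennreal ((cmod (calL \<Lambda> \<psi> x))\<^sup>2 / norm x powr \<alpha>) \<partial>lborel) < \<infinity>"
proof -
  let ?q = "\<lambda>r. num_density DIM('a) \<alpha> l (of_real (f r)) (of_real (f1 r)) (of_real (f2 r)) r"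
  have cont: "continuous_on {a..b} ?q"
  proof -
    have "continuous_on {0<..} ?q" unfolding num_density_def
      by (auto intro!: continuous_intros continuous)
    then show ?thesis by (rule continuous_on_subset) (use assms(1) in auto)
  qed
  have "(\<integral>\<^sup>+r. indicator {0<..} r * ennreal (?q r) \<partial>lborel) = ennreal (integral {a..b} ?q)"
  proof (rule nn_integral_compact_support[OF assms(1) cont])
    show "?q r = 0" if "0 < r" "r \<notin> {a..b}" for r
      using assms(2)[OF that] by (simp add: num_density_def flip: of_real_mult)
  qed (use assms(1) in \<open>auto simp: num_density_def\<close>)
  then have nn: "(\<integral>\<^sup>+x. ennreal ((cmod (calL \<Lambda> \<psi> x))\<^sup>2 / norm x powr \<alpha>) \<partial>lborel) =
      ennreal ((L2_norm sphere_measure w)\<^sup>2 * integral {a..b} ?q)"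
    unfolding nn_integral_num by (simp add: ennreal_mult')
  then show "(\<integral>\<^sup>+x. ennreal ((cmod (calL \<Lambda> \<psi> x))\<^sup>2 / norm x powr \<alpha>) \<partial>lborel) < \<infinity>" by simp
  have "0 \<le> integral {a..b} ?q"
    by (intro integral_nonneg integrable_continuous_real cont) (use assms(1) in \<open>auto simp: num_density_def\<close>)
  show "rellich_num \<alpha> \<Lambda> \<psi> = (L2_norm sphere_measure w)\<^sup>2 * integral {a..b} ?q"
    unfolding rellich_num_def
  proof (subst integral_eq_nn_integral)
    note [measurable] = calL_measurable
    have "(\<lambda>x. (cmod (calL \<Lambda> \<psi> x))\<^sup>2 / norm x powr \<alpha>) \<in> borel_measurable borel" by measurable
    then show "(\<lambda>x. (cmod (calL \<Lambda> \<psi> x))\<^sup>2 / norm x powr \<alpha>) \<in> borel_measurable lborel" by simp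
    show "enn2real (\<integral>\<^sup>+x. ennreal ((cmod (calL \<Lambda> \<psi> x))\<^sup>2 / norm x powr \<alpha>) \<partial>lborel) =
        (L2_norm sphere_measure w)\<^sup>2 * integral {a..b} ?q"
      unfolding nn using \<open>0 \<le> integral {a..b} ?q\<close> by (intro enn2real_ennreal) simp
  qed simp
qed

lemma rellich_den_eq:
  assumes "0 < a" "\<And>r. 0 < r \<Longrightarrow> r \<notin> {a..b} \<Longrightarrow> f1 r = 0 \<and> f2 r = 0 \<and> l * f r = 0"
  shows "rellich_den \<alpha> sqrt\<Lambda> \<psi> = (L2_norm sphere_measure w)\<^sup>2 *
    integral {a..b} (\<lambda>r. den_density DIM('a) \<alpha> l (of_real (f r)) (of_real (f1 r)) r)"
proof -
  let ?q = "\<lambda>r. den_density DIM('a) \<alpha> l (of_real (f r)) (of_real (f1 r)) r"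
  have cont: "continuous_on {a..b} ?q"
  proof -
    have "continuous_on {0<..} ?q" unfolding den_density_def
      by (auto intro!: continuous_intros continuous)
    then show ?thesis by (rule continuous_on_subset) (use assms(1) in auto)
  qed
  have "(\<integral>\<^sup>+r. indicator {0<..} r * ennreal (?q r) \<partial>lborel) = ennreal (integral {a..b} ?q)"
  proof (rule nn_integral_compact_support[OF assms(1) cont])
    show "?q r = 0" if "0 < r" "r \<notin> {a..b}" for r
      using assms(2)[OF that] by (auto simp: den_density_def)
  qed (use assms(1) l in \<open>auto simp: den_density_def\<close>)
  then have nn: "(\<integral>\<^sup>+x. ennreal (calD sqrt\<Lambda> \<psi> x / norm x powr (\<alpha> + 2)) \<partial>lborel) =
      ennreal ((L2_norm sphere_measure w)\<^sup>2 * integral {a..b} ?q)"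
    unfolding nn_integral_den by (simp add: ennreal_mult')
  have "0 \<le> integral {a..b} ?q"
    by (intro integral_nonneg integrable_continuous_real cont) (use assms(1) l in \<open>auto simp: den_density_def\<close>)
  show ?thesis
    unfolding rellich_den_def
  proof (subst integral_eq_nn_integral)
    note [measurable] = calD_measurable
    have "(\<lambda>x. calD sqrt\<Lambda> \<psi> x / norm x powr (\<alpha> + 2)) \<in> borel_measurable borel" by measurable
    then show "(\<lambda>x. calD sqrt\<Lambda> \<psi> x / norm x powr (\<alpha> + 2)) \<in> borel_measurable lborel" by simp
    show "enn2real (\<integral>\<^sup>+x. ennreal (calD sqrt\<Lambda> \<psi> x / norm x powr (\<alpha> + 2)) \<partial>lborel) =
        (L2_norm sphere_measure w)\<^sup>2 * integral {a..b} ?q"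
      unfolding nn using \<open>0 \<le> integral {a..b} ?q\<close> by (intro enn2real_ennreal) simp
  qed (simp add: calD_def)
qed

lemma calL_in_L2:
  assumes "0 < a" "\<And>r. 0 < r \<Longrightarrow> r \<notin> {a..b} \<Longrightarrow> f1 r = 0 \<and> f2 r = 0 \<and> l * f r = 0"
  shows "calL_in_L2 dom\<Lambda> \<Lambda> \<psi>"
proof -
  have "(\<integral>\<^sup>+x. ennreal ((cmod (calL \<Lambda> \<psi> x))\<^sup>2) \<partial>lborel) =
      (\<integral>\<^sup>+x. ennreal ((cmod (calL \<Lambda> \<psi> x))\<^sup>2 / norm x powr 0) \<partial>lborel)"
  proof (rule nn_integral_cong_AE)
    show "AE x in lborel. ennreal ((cmod (calL \<Lambda> \<psi> x))\<^sup>2) = ennreal ((cmod (calL \<Lambda> \<psi> x))\<^sup>2 / norm x powr 0)"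
      using AE_lborel_singleton[of "0::'a"] by eventually_elim simp
  qed
  also have "\<dots> < \<infinity>" by (rule rellich_num_eq(2)[OF assms])
  finally have "calL \<Lambda> \<psi> \<in> L2 lborel"
    using calL_measurable by (intro L2_I_nn_integral) auto
  then show ?thesis unfolding calL_in_L2_def using dom version by blast
qed

end


section \<open>Cut-off functions\<close>

lemma deriv_eq_0_on_open:
  fixes G :: "real \<Rightarrow> real"
  assumes U: "open U" "r \<in> U" and G: "\<And>s. s \<in> U \<Longrightarrow> G s = k"
  shows "deriv G r = 0" "deriv (deriv G) r = 0"
proof -
  have d: "deriv G s = 0" if "s \<in> U" for s
  proof (rule DERIV_imp_deriv)
    show "(G has_real_derivative 0) (at s)"
      by (rule has_field_derivative_transform_within_open[of "\<lambda>_. k" _ _ U]) (use U(1) that G in auto)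
  qed
  then show "deriv G r = 0" using U(2) .
  show "deriv (deriv G) r = 0"
  proof (rule DERIV_imp_deriv)
    show "(deriv G has_real_derivative 0) (at r)"
      by (rule has_field_derivative_transform_within_open[of "\<lambda>_. 0" _ _ U]) (use U d in auto)
  qed
qed

locale cutoff =
  fixes G :: "real \<Rightarrow> real" and \<epsilon> c :: real
  assumes \<epsilon>: "0 < \<epsilon>" "\<epsilon> < 1/2" and c: "c > 0"
    and smooth: "smooth_on {0<..} G"
    and zero: "\<And>r. 0 \<le> r \<Longrightarrow> r \<le> \<epsilon> \<or> 1 / \<epsilon> \<le> r \<Longrightarrow> G r = 0"
    and one: "\<And>r. 2 * \<epsilon> \<le> r \<Longrightarrow> r \<le> 1 / (2 * \<epsilon>) \<Longrightarrow> G r = 1"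
    and low: "\<And>r. \<epsilon> \<le> r \<Longrightarrow> r \<le> 2 * \<epsilon> \<Longrightarrow> \<bar>deriv G r\<bar> \<le> c / \<epsilon> \<and> \<bar>deriv (deriv G) r\<bar> \<le> c / \<epsilon>\<^sup>2"
    and high: "\<And>r. 1 / (2 * \<epsilon>) \<le> r \<Longrightarrow> r \<le> 1 / \<epsilon> \<Longrightarrow> \<bar>deriv G r\<bar> \<le> c * \<epsilon> \<and> \<bar>deriv (deriv G) r\<bar> \<le> c * \<epsilon>\<^sup>2"

lemma cutoff_familyE:
  assumes "cutoff_family g"
  obtains c where "\<And>\<epsilon>. \<epsilon> \<in> {0<..<1/2} \<Longrightarrow> cutoff (g \<epsilon>) \<epsilon> c"
proof -
  obtain c where c: "c > 0" and g: "\<forall>\<epsilon>\<in>{0<..<1/2}.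
     smooth_on {0<..} (g \<epsilon>) \<and>
     (\<forall>r\<ge>0. 0 \<le> g \<epsilon> r \<and> g \<epsilon> r \<le> 1) \<and>
     (\<forall>r. 0 \<le> r \<and> r \<le> \<epsilon> \<or> 1 / \<epsilon> \<le> r \<longrightarrow> g \<epsilon> r = 0) \<and>
     (\<forall>r. 2 * \<epsilon> \<le> r \<and> r \<le> 1 / (2 * \<epsilon>) \<longrightarrow> g \<epsilon> r = 1) \<and>
     (\<forall>r. \<epsilon> \<le> r \<and> r \<le> 2 * \<epsilon> \<longrightarrow>
        \<bar>deriv (g \<epsilon>) r\<bar> \<le> c / \<epsilon> \<and> \<bar>deriv (deriv (g \<epsilon>)) r\<bar> \<le> c / \<epsilon>\<^sup>2) \<and>
     (\<forall>r. 1 / (2 * \<epsilon>) \<le> r \<and> r \<le> 1 / \<epsilon> \<longrightarrow>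
        \<bar>deriv (g \<epsilon>) r\<bar> \<le> c * \<epsilon> \<and> \<bar>deriv (deriv (g \<epsilon>)) r\<bar> \<le> c * \<epsilon>\<^sup>2)"
    using assms unfolding cutoff_family_def by blast
  show ?thesis
  proof (rule that[of c], unfold_locales)
    fix \<epsilon> :: real assume \<epsilon>: "\<epsilon> \<in> {0<..<1/2}"
    note * = bspec[OF g \<epsilon>]
    show "0 < \<epsilon>" "\<epsilon> < 1/2" using \<epsilon> by auto
    show "smooth_on {0<..} (g \<epsilon>)" using * by blast
    show "g \<epsilon> r = 0" if "0 \<le> r" "r \<le> \<epsilon> \<or> 1 / \<epsilon> \<le> r" for r using * that by blast
    show "g \<epsilon> r = 1" if "2 * \<epsilon> \<le> r" "r \<le> 1 / (2 * \<epsilon>)" for r using * that by blast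
    show "\<bar>deriv (g \<epsilon>) r\<bar> \<le> c / \<epsilon> \<and> \<bar>deriv (deriv (g \<epsilon>)) r\<bar> \<le> c / \<epsilon>\<^sup>2" if "\<epsilon> \<le> r" "r \<le> 2 * \<epsilon>" for r
      using * that by blast
    show "\<bar>deriv (g \<epsilon>) r\<bar> \<le> c * \<epsilon> \<and> \<bar>deriv (deriv (g \<epsilon>)) r\<bar> \<le> c * \<epsilon>\<^sup>2" if "1 / (2 * \<epsilon>) \<le> r" "r \<le> 1 / \<epsilon>" for r
      using * that by blast
  qed (rule c)
qed

context cutoff
begin

definition transition :: "real set" where
  "transition = {\<epsilon>..2 * \<epsilon>} \<union> {1 / (2 * \<epsilon>)..1 / \<epsilon>}"

text \<open>\<open>G1\<close> and \<open>G2\<close> are the first and second derivatives of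
  \<open>G\<close> with respect to \<open>ln r\<close>, the quantities in which the remainder is
  expressed.\<close>

definition G1 :: "real \<Rightarrow> real" where "G1 r = r * deriv G r"

definition G2 :: "real \<Rightarrow> real" where "G2 r = r * deriv G r + r\<^sup>2 * deriv (deriv G) r"

lemma order: "\<epsilon> < 2 * \<epsilon>" "2 * \<epsilon> < 1 / (2 * \<epsilon>)" "1 / (2 * \<epsilon>) < 1 / \<epsilon>" "\<epsilon> / 2 < \<epsilon>" "1 / \<epsilon> < 2 / \<epsilon>"
proof -
  have "2 * \<epsilon> * (2 * \<epsilon>) < 1 * 1" using \<epsilon> by (intro mult_strict_mono) auto
  then show "2 * \<epsilon> < 1 / (2 * \<epsilon>)" using \<epsilon> by (simp add: field_simps)
qed (use \<epsilon> in \<open>auto simp: field_simps\<close>)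

lemma deriv_G: "r > 0 \<Longrightarrow> (G has_real_derivative G1 r / r) (at r)"
  using smooth_on_has_real_derivative[OF smooth, of r] by (simp add: G1_def)

lemma deriv_G1: "r > 0 \<Longrightarrow> (G1 has_real_derivative G2 r / r) (at r)"
proof -
  assume r: "r > 0"
  have "smooth_on {0<..} (deriv G)" by (rule smooth_on_deriv[OF _ smooth]) simp
  then have "(deriv G has_real_derivative deriv (deriv G) r) (at r)"
    using r by (intro smooth_on_has_real_derivative) auto
  then have "(G1 has_real_derivative 1 * deriv G r + deriv (deriv G) r * r) (at r)"
    unfolding G1_def[abs_def] by (intro DERIV_mult DERIV_ident)
  moreover have "1 * deriv G r + deriv (deriv G) r * r = G2 r / r"
    using r by (simp add: G2_def field_simps power2_eq_square)
  ultimately show ?thesis by simp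
qed

lemma continuous_G: "continuous_on {0<..} G" "continuous_on {0<..} G1" "continuous_on {0<..} G2"
proof -
  have "smooth_on {0<..} (deriv G)" "smooth_on {0<..} (deriv (deriv G))"
    by (intro smooth_on_deriv smooth; simp)+
  then show "continuous_on {0<..} G" "continuous_on {0<..} G1" "continuous_on {0<..} G2"
    using smooth_on_continuous[OF smooth] unfolding G1_def[abs_def] G2_def[abs_def]
    by (auto intro!: continuous_intros dest!: smooth_on_continuous)
qed

lemma derivs_outside:
  assumes "r > 0" "r \<notin> transition"
  shows "deriv G r = 0" "deriv (deriv G) r = 0"
proof -
  consider "r \<in> {0<..<\<epsilon>}" | "r \<in> {2 * \<epsilon><..<1 / (2 * \<epsilon>)}" | "r \<in> {1 / \<epsilon><..}"
    using assms by (force simp: transition_def)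
  then have "deriv G r = 0 \<and> deriv (deriv G) r = 0"
  proof cases
    case 1
    then show ?thesis using deriv_eq_0_on_open[of "{0<..<\<epsilon>}" r G 0] zero by auto
  next
    case 2
    then show ?thesis using deriv_eq_0_on_open[of "{2 * \<epsilon><..<1 / (2 * \<epsilon>)}" r G 1] one by auto
  next
    case 3
    have "0 \<le> s" if "1 / \<epsilon> < s" for s using \<epsilon> that by (meson less_imp_le order.strict_trans zero_less_divide_1_iff)
    with 3 show ?thesis using deriv_eq_0_on_open[of "{1 / \<epsilon><..}" r G 0] zero by auto
  qed
  then show "deriv G r = 0" "deriv (deriv G) r = 0" by auto
qed

lemma G12_outside:
  assumes "r > 0" "r \<notin> transition" shows "G1 r = 0" "G2 r = 0"
  using derivs_outside[OF assms] by (simp_all add: G1_def G2_def)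

text \<open>Since \<open>r \<le> 2 * \<epsilon>\<close> on the inner transition interval and
  \<open>r \<le> 1 / \<epsilon>\<close> on the outer one, the factors \<open>r\<close> and
  \<open>r^2\<close> absorb the powers of \<open>\<epsilon>\<close> in the cut-off bounds, leaving
  constants independent of \<open>\<epsilon>\<close>.\<close>

lemma G1_bound: "r > 0 \<Longrightarrow> \<bar>G1 r\<bar> \<le> 2 * c"
  and G2_bound: "r > 0 \<Longrightarrow> \<bar>G2 r\<bar> \<le> 6 * c"
proof -
  assume r: "r > 0"
  have "r * \<bar>deriv G r\<bar> \<le> 2 * c \<and> r\<^sup>2 * \<bar>deriv (deriv G) r\<bar> \<le> 4 * c"
  proof (cases "r \<in> transition")
    case False
    then show ?thesis using derivs_outside[OF r] c by simp
  next
    case True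
    then consider "\<epsilon> \<le> r" "r \<le> 2 * \<epsilon>" | "1 / (2 * \<epsilon>) \<le> r" "r \<le> 1 / \<epsilon>" by (auto simp: transition_def)
    then show ?thesis
    proof cases
      case 1
      have "r * \<bar>deriv G r\<bar> \<le> (2 * \<epsilon>) * (c / \<epsilon>)" using low[OF 1] 1 \<epsilon> by (intro mult_mono) auto
      moreover have "r\<^sup>2 * \<bar>deriv (deriv G) r\<bar> \<le> (2 * \<epsilon>)\<^sup>2 * (c / \<epsilon>\<^sup>2)"
        using low[OF 1] 1 \<epsilon> r by (intro mult_mono power_mono) auto
      ultimately show ?thesis using \<epsilon> by (simp add: power_mult_distrib)
    next
      case 2
      have "r * \<bar>deriv G r\<bar> \<le> (1 / \<epsilon>) * (c * \<epsilon>)" using high[OF 2] 2 \<epsilon> by (intro mult_mono) auto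
      moreover have "r\<^sup>2 * \<bar>deriv (deriv G) r\<bar> \<le> (1 / \<epsilon>)\<^sup>2 * (c * \<epsilon>\<^sup>2)"
        using high[OF 2] 2 \<epsilon> r by (intro mult_mono power_mono) auto
      ultimately show ?thesis using \<epsilon> c by (simp add: power_divide)
    qed
  qed
  then have "\<bar>r * deriv G r\<bar> \<le> 2 * c" "\<bar>r\<^sup>2 * deriv (deriv G) r\<bar> \<le> 4 * c" using r by (simp_all add: abs_mult)
  then show "\<bar>G1 r\<bar> \<le> 2 * c" "\<bar>G2 r\<bar> \<le> 6 * c" unfolding G1_def G2_def by linarith+
qed

text \<open>Each of the two transition intervals contributes at most \<open>M\<close>: the inner one
  has length \<open>\<epsilon>\<close> and \<open>M / r \<le> M / \<epsilon>\<close>, the outer one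
  has length \<open>1 / (2 * \<epsilon>)\<close> and
  \<open>M / r \<le> 2 * \<epsilon> * M\<close>.\<close>

lemma integral_transition_le:
  fixes q :: "real \<Rightarrow> real"
  assumes q: "continuous_on {\<epsilon> / 2..2 / \<epsilon>} q" and M: "M \<ge> 0"
    and le: "\<And>r. r \<in> {\<epsilon> / 2..2 / \<epsilon>} \<Longrightarrow> r \<in> transition \<Longrightarrow> q r \<le> M / r"
    and out: "\<And>r. r \<in> {\<epsilon> / 2..2 / \<epsilon>} \<Longrightarrow> r \<notin> transition \<Longrightarrow> q r = 0"
  shows "integral {\<epsilon> / 2..2 / \<epsilon>} q \<le> 2 * M"
proof -
  let ?f = "\<lambda>r. if r \<in> {\<epsilon>..2 * \<epsilon>} then M / \<epsilon> else 0"
  let ?g = "\<lambda>r. if r \<in> {1 / (2 * \<epsilon>)..1 / \<epsilon>} then 2 * \<epsilon> * M else 0"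
  have "((\<lambda>r. M / \<epsilon>) has_integral measure lborel {\<epsilon>..2 * \<epsilon>} *\<^sub>R (M / \<epsilon>)) {\<epsilon>..2 * \<epsilon>}"
    by (rule has_integral_const_real)
  then have f: "(?f has_integral M) {\<epsilon> / 2..2 / \<epsilon>}"
    using order \<epsilon> by (subst has_integral_restrict) auto
  have "((\<lambda>r. 2 * \<epsilon> * M) has_integral measure lborel {1 / (2 * \<epsilon>)..1 / \<epsilon>} *\<^sub>R (2 * \<epsilon> * M)) {1 / (2 * \<epsilon>)..1 / \<epsilon>}"
    by (rule has_integral_const_real)
  moreover have "measure lborel {1 / (2 * \<epsilon>)..1 / \<epsilon>} *\<^sub>R (2 * \<epsilon> * M) = M"
    using \<epsilon> order by (subst content_real) (auto simp: field_simps)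
  ultimately have g: "(?g has_integral M) {\<epsilon> / 2..2 / \<epsilon>}"
    using order \<epsilon> by (subst has_integral_restrict) auto
  have "integral {\<epsilon> / 2..2 / \<epsilon>} q \<le> M + M"
  proof (rule has_integral_le[OF integrable_integral has_integral_add[OF f g]])
    show "q integrable_on {\<epsilon> / 2..2 / \<epsilon>}" by (rule integrable_continuous_real[OF q])
    fix r assume r: "r \<in> {\<epsilon> / 2..2 / \<epsilon>}"
    then have r0: "r > 0" using \<epsilon> by (auto intro: less_le_trans[of _ "\<epsilon> / 2"])
    have nn: "0 \<le> ?f r" "0 \<le> ?g r" using M \<epsilon> by auto
    show "q r \<le> ?f r + ?g r"
    proof (cases "r \<in> transition")
      case False
      then show ?thesis using out[OF r False] nn by linarith
    next
      case True
      then consider "r \<in> {\<epsilon>..2 * \<epsilon>}" | "r \<in> {1 / (2 * \<epsilon>)..1 / \<epsilon>}" by (auto simp: transition_def)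
      then show ?thesis
      proof cases
        case 1
        then have "M / r \<le> M / \<epsilon>" using M \<epsilon> by (intro divide_left_mono) (auto intro: mult_pos_pos less_le_trans)
        then have "q r \<le> ?f r" using le[OF r True] 1 by simp
        then show ?thesis using nn(2) by linarith
      next
        case 2
        then have "M / r \<le> M / (1 / (2 * \<epsilon>))" using M \<epsilon> r0 by (intro divide_left_mono) auto
        then have "q r \<le> ?g r" using le[OF r True] 2 by (simp add: mult_ac)
        then show ?thesis using nn(1) by linarith
      qed
    qed
  qed
  then show ?thesis by simp
qed

text \<open>The bracket is the logarithmic length of the plateau; its divergence as
  \<open>\<epsilon>\<close> tends to 0 drives the energy to infinity.\<close>

lemma integral_plateau_ge:
  fixes q :: "real \<Rightarrow> real"
  assumes q: "continuous_on {\<epsilon> / 2..2 / \<epsilon>} q" and nonneg: "\<And>r. r \<in> {\<epsilon> / 2..2 / \<epsilon>} \<Longrightarrow> 0 \<le> q r"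
    and ge: "\<And>r. 2 * \<epsilon> \<le> r \<Longrightarrow> r \<le> 1 / (2 * \<epsilon>) \<Longrightarrow> B / r \<le> q r"
  shows "B * (ln (1 / (2 * \<epsilon>)) - ln (2 * \<epsilon>)) \<le> integral {\<epsilon> / 2..2 / \<epsilon>} q"
proof -
  let ?f = "\<lambda>r. if r \<in> {2 * \<epsilon>..1 / (2 * \<epsilon>)} then B / r else 0"
  have "((\<lambda>r. B / r) has_integral B * ln (1 / (2 * \<epsilon>)) - B * ln (2 * \<epsilon>)) {2 * \<epsilon>..1 / (2 * \<epsilon>)}"
  proof (rule fundamental_theorem_of_calculus)
    fix r assume r: "r \<in> {2 * \<epsilon>..1 / (2 * \<epsilon>)}"
    have "((\<lambda>r. B * ln r) has_real_derivative B / r) (at r)"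
      using r \<epsilon> by (auto intro!: derivative_eq_intros)
    then show "((\<lambda>r. B * ln r) has_vector_derivative B / r) (at r within {2 * \<epsilon>..1 / (2 * \<epsilon>)})"
      using has_real_derivative_iff_has_vector_derivative has_vector_derivative_at_within by blast
  qed (use order in simp)
  then have "(?f has_integral B * ln (1 / (2 * \<epsilon>)) - B * ln (2 * \<epsilon>)) {\<epsilon> / 2..2 / \<epsilon>}"
    using order \<epsilon> by (subst has_integral_restrict) auto
  then have "B * ln (1 / (2 * \<epsilon>)) - B * ln (2 * \<epsilon>) \<le> integral {\<epsilon> / 2..2 / \<epsilon>} q"
    by (rule has_integral_le[OF _ integrable_integral[OF integrable_continuous_real[OF q]]])
       (use nonneg ge in auto)
  then show ?thesis by (simp add: right_diff_distrib)
qed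

end

text \<open>The excess \<open>N - C E\<close> stays bounded while \<open>E\<close> grows at least
  like a multiple of \<open>ln (1 / \<epsilon>)\<close>, so the quotient tends to \<open>C\<close>.
  Positivity of the excess keeps it above \<open>C\<close>, which is what the filter
  \<open>at_right C\<close> records.\<close>

lemma filterlim_quotient_at_right:
  fixes N E :: "real \<Rightarrow> real"
  assumes B: "B > 0"
    and diff: "\<And>\<epsilon>. \<epsilon> \<in> {0<..<1/2} \<Longrightarrow> 0 < N \<epsilon> - C * E \<epsilon>" "\<And>\<epsilon>. \<epsilon> \<in> {0<..<1/2} \<Longrightarrow> N \<epsilon> - C * E \<epsilon> \<le> M"
    and E: "\<And>\<epsilon>. \<epsilon> \<in> {0<..<1/2} \<Longrightarrow> B * (ln (1 / (2 * \<epsilon>)) - ln (2 * \<epsilon>)) \<le> E \<epsilon>"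
  shows "filterlim (\<lambda>\<epsilon>. N \<epsilon> / E \<epsilon>) (at_right C) (at_right 0)"
proof -
  let ?l = "\<lambda>\<epsilon>::real. ln (1 / (2 * \<epsilon>)) - ln (2 * \<epsilon>)"
  have ev: "\<forall>\<^sub>F \<epsilon> in at_right 0. \<epsilon> \<in> {0<..<1/2::real}"
    by (rule eventually_at_right_real) simp
  have l: "?l \<epsilon> = - 2 * ln (2 * \<epsilon>)" if "\<epsilon> > 0" for \<epsilon> using that by (simp add: ln_div)
  have pos: "?l \<epsilon> > 0" if "\<epsilon> \<in> {0<..<1/2}" for \<epsilon>
  proof -
    have "ln (2 * \<epsilon>) < 0" using that by (intro ln_less_zero) auto
    then show ?thesis using that by (subst l) auto
  qed
  have Epos: "E \<epsilon> > 0" if "\<epsilon> \<in> {0<..<1/2}" for \<epsilon>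
    using E[OF that] pos[OF that] B by (meson less_le_trans mult_pos_pos)
  have quot: "N \<epsilon> / E \<epsilon> - C = (N \<epsilon> - C * E \<epsilon>) / E \<epsilon>" if "\<epsilon> \<in> {0<..<1/2}" for \<epsilon>
    using Epos[OF that] by (simp add: field_simps)
  have ltop: "filterlim ?l at_top (at_right 0)"
    unfolding filterlim_at_top
  proof
    fix Z :: real
    show "\<forall>\<^sub>F \<epsilon> in at_right 0. Z \<le> ?l \<epsilon>"
      unfolding eventually_at_right_field
    proof (intro exI[of _ "exp (- \<bar>Z\<bar>) / 2"] conjI allI impI)
      fix \<epsilon> :: real assume \<epsilon>: "0 < \<epsilon>" "\<epsilon> < exp (- \<bar>Z\<bar>) / 2"
      then have "ln (2 * \<epsilon>) \<le> ln (exp (- \<bar>Z\<bar>))" by (subst ln_le_cancel_iff) auto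
      then show "Z \<le> ?l \<epsilon>" using l[OF \<epsilon>(1)] by simp
    qed simp
  qed
  have "((\<lambda>\<epsilon>. M / (B * ?l \<epsilon>)) \<longlongrightarrow> 0) (at_right 0)"
    by (intro tendsto_divide_0[OF tendsto_const] filterlim_at_top_imp_at_infinity
        filterlim_tendsto_pos_mult_at_top[OF tendsto_const B ltop])
  then have "((\<lambda>\<epsilon>. N \<epsilon> / E \<epsilon> - C) \<longlongrightarrow> 0) (at_right 0)"
  proof (rule Lim_null_comparison[rotated])
    show "\<forall>\<^sub>F \<epsilon> in at_right 0. norm (N \<epsilon> / E \<epsilon> - C) \<le> M / (B * ?l \<epsilon>)"
      using ev
    proof eventually_elim
      case (elim \<epsilon>)
      have "norm (N \<epsilon> / E \<epsilon> - C) = (N \<epsilon> - C * E \<epsilon>) / E \<epsilon>"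
        unfolding quot[OF elim] using diff(1)[OF elim] Epos[OF elim] by simp
      also have "\<dots> \<le> M / (B * ?l \<epsilon>)"
        using diff[OF elim] E[OF elim] pos[OF elim] B by (intro frac_le) auto
      finally show ?case .
    qed
  qed
  then have "((\<lambda>\<epsilon>. N \<epsilon> / E \<epsilon>) \<longlongrightarrow> C) (at_right 0)" by (rule LIM_zero_cancel)
  moreover have "\<forall>\<^sub>F \<epsilon> in at_right 0. N \<epsilon> / E \<epsilon> \<in> {C<..} \<and> N \<epsilon> / E \<epsilon> \<noteq> C"
    using ev
  proof eventually_elim
    case (elim \<epsilon>)
    have "N \<epsilon> / E \<epsilon> - C > 0" unfolding quot[OF elim] using diff(1)[OF elim] Epos[OF elim] by simp
    then show ?case by simp
  qed
  ultimately show ?thesis by (simp add: filterlim_at)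
qed

section \<open>The power-type trial functions\<close>

text \<open>The exponent is chosen so that multiplying the profile by \<open>r powr \<gamma>\<close>
  returns the cut-off itself; the derivatives in \<open>r\<close> are accordingly written through
  the logarithmic derivatives of the cut-off.\<close>

lemma power_profile_derivatives:
  fixes \<gamma> :: real
  assumes "cutoff G \<epsilon> c" and r: "r > 0"
  defines "f \<equiv> \<lambda>r. r powr (- \<gamma>) * G r"
    and "f1 \<equiv> \<lambda>r. r powr (- \<gamma> - 1) * (cutoff.G1 G r - \<gamma> * G r)"
    and "f2 \<equiv> \<lambda>r. r powr (- \<gamma> - 2) *
      (cutoff.G2 G r - \<gamma> * cutoff.G1 G r - (\<gamma> + 1) * (cutoff.G1 G r - \<gamma> * G r))"
  shows "(f has_real_derivative f1 r) (at r)" "(f1 has_real_derivative f2 r) (at r)"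
proof -
  interpret cutoff G \<epsilon> c by fact
  have p1: "r powr (- \<gamma>) = r powr (- \<gamma> - 2) * r\<^sup>2"
  proof -
    have "r powr (- \<gamma> - 2) * r powr 2 = r powr (- \<gamma>)" using r by (simp only: powr_add[symmetric]) simp
    then show ?thesis using r by simp
  qed
  have p2: "r powr (- \<gamma> - 1) = r powr (- \<gamma> - 2) * r"
  proof -
    have "r powr (- \<gamma> - 2) * r powr 1 = r powr (- \<gamma> - 1)"
      unfolding powr_add[symmetric] by (rule arg_cong[where f="(powr) r"]) simp
    then show ?thesis using r by simp
  qed
  have dp: "((\<lambda>r. r powr a) has_real_derivative a * r powr (a - 1)) (at r)" for a
    using r by (rule has_real_derivative_powr)
  show "(f has_real_derivative f1 r) (at r)"
    unfolding f_def f1_def using r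
    by (rule DERIV_cong[OF DERIV_mult[OF dp deriv_G]]) (simp add: p1 p2 field_simps power2_eq_square)
  have d2: "((\<lambda>r. G1 r - \<gamma> * G r) has_real_derivative G2 r / r - \<gamma> * (G1 r / r)) (at r)"
    by (intro DERIV_diff DERIV_cmult deriv_G deriv_G1 r)
  have e: "- \<gamma> - 1 - 1 = - \<gamma> - 2" by simp
  show "(f1 has_real_derivative f2 r) (at r)"
    unfolding f1_def f2_def
    by (rule DERIV_cong[OF DERIV_mult[OF dp d2]]) (use r in \<open>simp add: e p2 field_simps power2_eq_square\<close>)
qed

context angular_operator
begin

text \<open>With \<open>v\<close> equal to the cut-off, the excess is the remainder and lives on the
  transition set. The numbers \<open>6 * c\<close> and \<open>2 * c\<close> are the bounds of
  \<open>G2\<close> and \<open>G1\<close>, the outer factor 2 counts the transition intervals, and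
  \<open>l + \<gamma>^2\<close> is the energy density on the plateau.\<close>

lemma power_trial_estimates:
  assumes cut: "cutoff (g \<epsilon>) \<epsilon> c"
    and w: "eigenfunction sphere_measure dom\<Lambda> \<Lambda> l w" "0 \<le> l" "L2_norm sphere_measure w = 1"
    and \<gamma>: "\<gamma> = (real DIM('a) - 4 - \<alpha>) / 2" and B: "l + \<gamma>\<^sup>2 > 0"
    and C: "C * (l + \<gamma>\<^sup>2) = (l + \<gamma>\<^sup>2 + \<gamma> * (\<alpha> + 2))\<^sup>2"
  defines "\<kappa> \<equiv> (\<alpha> + 2)\<^sup>2 + 2 * (l + \<gamma>\<^sup>2 + \<gamma> * (\<alpha> + 2)) - C"
    and "\<psi> \<equiv> power_trial \<alpha> g w \<epsilon>"
  shows "calL_in_L2 dom\<Lambda> \<Lambda> \<psi>"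
    and "0 < rellich_num \<alpha> \<Lambda> \<psi> - C * rellich_den \<alpha> sqrt\<Lambda> \<psi>"
    and "rellich_num \<alpha> \<Lambda> \<psi> - C * rellich_den \<alpha> sqrt\<Lambda> \<psi> \<le> 2 * ((6 * c)\<^sup>2 + \<kappa> * (2 * c)\<^sup>2)"
    and "(l + \<gamma>\<^sup>2) * (ln (1 / (2 * \<epsilon>)) - ln (2 * \<epsilon>)) \<le> rellich_den \<alpha> sqrt\<Lambda> \<psi>"
proof -
  let ?G = "g \<epsilon>"
  interpret cutoff ?G \<epsilon> c by (rule cut)
  let ?f = "\<lambda>r. r powr (- \<gamma>) * ?G r"
  let ?f1 = "\<lambda>r. r powr (- \<gamma> - 1) * (G1 r - \<gamma> * ?G r)"
  let ?f2 = "\<lambda>r. r powr (- \<gamma> - 2) * (G2 r - \<gamma> * G1 r - (\<gamma> + 1) * (G1 r - \<gamma> * ?G r))"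
  interpret sep: separated dom\<Lambda> \<Lambda> I lam u dom_sqrt\<Lambda> sqrt\<Lambda> w l ?f ?f1 ?f2 \<psi>
  proof
    show "(?f has_real_derivative ?f1 r) (at r)" "(?f1 has_real_derivative ?f2 r) (at r)" if "r > 0" for r
      using power_profile_derivatives[OF cut that] by auto
    show "continuous_on {0<..} ?f2" by (auto intro!: continuous_intros continuous_G)
    have "(- (real DIM('a) - 4) + \<alpha>) / 2 = - \<gamma>" using \<gamma> by (simp add: field_simps)
    then show "\<psi> x = of_real (norm x powr (- \<gamma>) * ?G (norm x)) * w (sgn x)" for x
      unfolding \<psi>_def power_trial_def by simp
  qed (use w in auto)
  \<comment> \<open>The interval is wider than the support, so that its endpoints have
    neighbourhoods on which the cut-off is zero and all boundary values vanish.\<close>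
  let ?a = "\<epsilon> / 2" and ?b = "2 / \<epsilon>"
  have ab: "0 < ?a" "?a < ?b" using \<epsilon> order by auto
  have out: "?G r = 0 \<and> G1 r = 0 \<and> G2 r = 0" if "0 < r" "\<not> (\<epsilon> \<le> r \<and> r \<le> 1 / \<epsilon>)" for r
  proof -
    have "r \<notin> transition" using that order by (auto simp: transition_def)
    then show ?thesis using G12_outside[OF that(1)] zero[of r] that by auto
  qed
  have supp: "?f1 r = 0 \<and> ?f2 r = 0 \<and> l * ?f r = 0" if "0 < r" "r \<notin> {?a..?b}" for r
    using out[OF that(1)] that order by auto
  show "calL_in_L2 dom\<Lambda> \<Lambda> \<psi>" by (rule sep.calL_in_L2[OF ab(1) supp])
  have bd: "?G ?a = 0" "G1 ?a = 0" "?G ?b = 0" "G1 ?b = 0"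
    using out[of ?a] out[of ?b] ab order by auto
  have cG: "continuous_on {?a..?b} ?G" "continuous_on {?a..?b} G1" "continuous_on {?a..?b} G2"
    using ab by (auto intro: continuous_on_subset[OF continuous_G(1)] continuous_on_subset[OF continuous_G(2)]
        continuous_on_subset[OF continuous_G(3)])
  let ?v = "\<lambda>r. complex_of_real (?G r)" and ?v1 = "\<lambda>r. complex_of_real (G1 r)" and ?v2 = "\<lambda>r. complex_of_real (G2 r)"
  interpret log_derivatives ?v ?v1 ?v2 ?a ?b
  proof
    show "(?v has_vector_derivative inverse r *\<^sub>R ?v1 r) (at r)" if "r \<in> {?a..?b}" for r
    proof -
      have "r > 0" using that ab by auto
      then have "(?v has_vector_derivative complex_of_real (G1 r / r)) (at r)"
        by (intro has_vector_derivative_of_real deriv_G)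
      then show ?thesis
        by (simp add: scaleR_conv_of_real divide_inverse mult.commute)
    qed
    show "(?v1 has_vector_derivative inverse r *\<^sub>R ?v2 r) (at r)" if "r \<in> {?a..?b}" for r
    proof -
      have "r > 0" using that ab by auto
      then have "(?v1 has_vector_derivative complex_of_real (G2 r / r)) (at r)"
        by (intro has_vector_derivative_of_real deriv_G1)
      then show ?thesis
        by (simp add: scaleR_conv_of_real divide_inverse mult.commute)
    qed
    show "continuous_on {?a..?b} ?v2"
      by (intro continuous_on_of_real continuous_on_subset[OF continuous_G(3)]) (use ab in auto)
  qed (use ab bd in auto)
  let ?A = "l + \<gamma>\<^sup>2 + \<gamma> * (\<alpha> + 2)"
  have dim: "DIM('a) \<ge> 1" by (simp add: Suc_leI)
  have rel: "?v r = (r powr \<gamma>) *\<^sub>R complex_of_real (?f r)"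
    "?v1 r = \<gamma> *\<^sub>R ?v r + (r powr \<gamma> * r) *\<^sub>R complex_of_real (?f1 r)"
    "?v2 r = \<gamma> *\<^sub>R ?v1 r + ((\<gamma> + 1) * (r powr \<gamma> * r)) *\<^sub>R complex_of_real (?f1 r) + (r powr \<gamma> * r\<^sup>2) *\<^sub>R complex_of_real (?f2 r)"
    if r: "r > 0" for r
  proof -
    have p0: "r powr \<gamma> * r powr (- \<gamma>) = 1" using r by (simp add: powr_add[symmetric])
    have p1: "r powr \<gamma> * r * r powr (- \<gamma> - 1) = 1"
    proof -
      have "r powr \<gamma> * r powr 1 * r powr (- \<gamma> - 1) = 1" using r by (simp only: powr_add[symmetric]) simp
      then show ?thesis using r by simp
    qed
    have p2: "r powr \<gamma> * r\<^sup>2 * r powr (- \<gamma> - 2) = 1"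
    proof -
      have "r powr \<gamma> * r powr 2 * r powr (- \<gamma> - 2) = 1" using r by (simp only: powr_add[symmetric]) simp
      then show ?thesis using r by simp
    qed
    have s0: "r powr \<gamma> * ?f r = ?G r" by (simp only: mult.assoc[symmetric] p0 mult_1_left)
    have s1: "r powr \<gamma> * r * ?f1 r = G1 r - \<gamma> * ?G r" by (simp only: mult.assoc[symmetric] p1 mult_1_left)
    have s2: "r powr \<gamma> * r\<^sup>2 * ?f2 r = G2 r - \<gamma> * G1 r - (\<gamma> + 1) * (G1 r - \<gamma> * ?G r)"
      by (simp only: mult.assoc[symmetric] p2 mult_1_left)
    show "?v r = (r powr \<gamma>) *\<^sub>R complex_of_real (?f r)"
      unfolding scaleR_conv_of_real of_real_mult[symmetric] s0 ..
    show "?v1 r = \<gamma> *\<^sub>R ?v r + (r powr \<gamma> * r) *\<^sub>R complex_of_real (?f1 r)"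
      unfolding scaleR_conv_of_real of_real_mult[symmetric] s1 by simp
    show "?v2 r = \<gamma> *\<^sub>R ?v1 r + ((\<gamma> + 1) * (r powr \<gamma> * r)) *\<^sub>R complex_of_real (?f1 r) + (r powr \<gamma> * r\<^sup>2) *\<^sub>R complex_of_real (?f2 r)"
      unfolding scaleR_conv_of_real of_real_mult[symmetric] mult.assoc[of "\<gamma> + 1"] s1 s2 of_real_add[symmetric]
      by (simp add: algebra_simps)
  qed
  have num: "rellich_num \<alpha> \<Lambda> \<psi> = integral {?a..?b} (\<lambda>r. (cmod (?v2 r + (\<alpha> + 2) *\<^sub>R ?v1 r - ?A *\<^sub>R ?v r))\<^sup>2 / r)"
  proof -
    have "rellich_num \<alpha> \<Lambda> \<psi> = (L2_norm sphere_measure w)\<^sup>2 * integral {?a..?b}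
        (\<lambda>r. num_density DIM('a) \<alpha> l (of_real (?f r)) (of_real (?f1 r)) (of_real (?f2 r)) r)"
      by (rule sep.rellich_num_eq(1)[OF ab(1) supp])
    also have "integral {?a..?b} (\<lambda>r. num_density DIM('a) \<alpha> l (of_real (?f r)) (of_real (?f1 r)) (of_real (?f2 r)) r) =
        integral {?a..?b} (\<lambda>r. (cmod (?v2 r + (\<alpha> + 2) *\<^sub>R ?v1 r - ?A *\<^sub>R ?v r))\<^sup>2 / r)"
      by (intro integral_cong densities_log(1)[OF dim \<gamma>] rel) (use ab in auto)
    finally show ?thesis unfolding w(3) by simp
  qed
  have den: "rellich_den \<alpha> sqrt\<Lambda> \<psi> = integral {?a..?b} (\<lambda>r. ((cmod (?v1 r - \<gamma> *\<^sub>R ?v r))\<^sup>2 + l * (cmod (?v r))\<^sup>2) / r)"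
  proof -
    have "rellich_den \<alpha> sqrt\<Lambda> \<psi> = (L2_norm sphere_measure w)\<^sup>2 * integral {?a..?b}
        (\<lambda>r. den_density DIM('a) \<alpha> l (of_real (?f r)) (of_real (?f1 r)) r)"
      by (rule sep.rellich_den_eq[OF ab(1) supp])
    also have "integral {?a..?b} (\<lambda>r. den_density DIM('a) \<alpha> l (of_real (?f r)) (of_real (?f1 r)) r) =
        integral {?a..?b} (\<lambda>r. ((cmod (?v1 r - \<gamma> *\<^sub>R ?v r))\<^sup>2 + l * (cmod (?v r))\<^sup>2) / r)"
      by (intro integral_cong densities_log(2)[OF dim \<gamma> _ rel]) (use ab in auto)
    finally show ?thesis unfolding w(3) by simp
  qed
  have v0: "?v ?a = 0" "?v ?b = 0" using bd by simp_all
  let ?R = "\<lambda>r. ((cmod (?v2 r))\<^sup>2 + \<kappa> * (cmod (?v1 r))\<^sup>2) / r"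
  have eq: "rellich_num \<alpha> \<Lambda> \<psi> - C * rellich_den \<alpha> sqrt\<Lambda> \<psi> = integral {?a..?b} ?R"
    unfolding num den \<kappa>_def by (rule integral_num_minus_den) (use v0 C in auto)
  have \<kappa>: "\<kappa> \<ge> 0" unfolding \<kappa>_def by (rule remainder_coeff_nonneg[OF w(2) B C])
  have "?v (2 * \<epsilon>) \<noteq> 0" using one[of "2 * \<epsilon>"] order by simp
  then show "0 < rellich_num \<alpha> \<Lambda> \<psi> - C * rellich_den \<alpha> sqrt\<Lambda> \<psi>"
    unfolding eq using remainder_pos[OF \<kappa> v0(1), of "2 * \<epsilon>"] order \<epsilon> by auto
  show "rellich_num \<alpha> \<Lambda> \<psi> - C * rellich_den \<alpha> sqrt\<Lambda> \<psi> \<le> 2 * ((6 * c)\<^sup>2 + \<kappa> * (2 * c)\<^sup>2)"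
    unfolding eq
  proof (rule integral_transition_le)
    show "continuous_on {?a..?b} ?R" using cG ab by (auto intro!: continuous_intros)
    show "0 \<le> (6 * c)\<^sup>2 + \<kappa> * (2 * c)\<^sup>2" using \<kappa> by simp
    fix r assume r: "r \<in> {?a..?b}"
    then have r0: "r > 0" using ab by auto
    have "(cmod (?v2 r))\<^sup>2 \<le> (6 * c)\<^sup>2" by (rule power_mono) (use G2_bound[OF r0] in simp_all)
    moreover have "(cmod (?v1 r))\<^sup>2 \<le> (2 * c)\<^sup>2" by (rule power_mono) (use G1_bound[OF r0] in simp_all)
    ultimately show "?R r \<le> ((6 * c)\<^sup>2 + \<kappa> * (2 * c)\<^sup>2) / r"
      using \<kappa> r0 by (intro divide_right_mono add_mono mult_left_mono) auto
    show "?R r = 0" if "r \<notin> transition" using G12_outside[OF r0 that] by simp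
  qed
  show "(l + \<gamma>\<^sup>2) * (ln (1 / (2 * \<epsilon>)) - ln (2 * \<epsilon>)) \<le> rellich_den \<alpha> sqrt\<Lambda> \<psi>"
  proof -
    have "rellich_den \<alpha> sqrt\<Lambda> \<psi> = integral {?a..?b} (\<lambda>r. ((cmod (?v1 r))\<^sup>2 + (l + \<gamma>\<^sup>2) * (cmod (?v r))\<^sup>2) / r)"
      unfolding den by (rule integral_den) (use v0 in auto)
    also have "\<dots> \<ge> (l + \<gamma>\<^sup>2) * (ln (1 / (2 * \<epsilon>)) - ln (2 * \<epsilon>))"
    proof (rule integral_plateau_ge)
      show "continuous_on {?a..?b} (\<lambda>r. ((cmod (?v1 r))\<^sup>2 + (l + \<gamma>\<^sup>2) * (cmod (?v r))\<^sup>2) / r)"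
        using cG ab by (auto intro!: continuous_intros)
      fix r
      show "0 \<le> ((cmod (?v1 r))\<^sup>2 + (l + \<gamma>\<^sup>2) * (cmod (?v r))\<^sup>2) / r" if "r \<in> {?a..?b}"
        using that ab w(2) by (intro divide_nonneg_nonneg add_nonneg_nonneg mult_nonneg_nonneg) auto
      show "(l + \<gamma>\<^sup>2) / r \<le> ((cmod (?v1 r))\<^sup>2 + (l + \<gamma>\<^sup>2) * (cmod (?v r))\<^sup>2) / r" if "2 * \<epsilon> \<le> r" "r \<le> 1 / (2 * \<epsilon>)"
        using one[OF that] that \<epsilon> by (intro divide_right_mono) auto
    qed
    finally show ?thesis .
  qed
qed

text \<open>An abstract \<open>\<Lambda>\<close> provides eigenfunctions merely in L2, so smoothness
  of the angular factor has to be assumed in order to obtain a test function.\<close>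

lemma power_trial_test_function:
  assumes cut: "cutoff (g \<epsilon>) \<epsilon> c" and w: "smooth_on (- {0}) (\<lambda>x. w (sgn x))"
  shows "test_function_away0 (power_trial \<alpha> g w \<epsilon> :: 'a \<Rightarrow> complex)"
proof -
  interpret cutoff "g \<epsilon>" \<epsilon> c by (rule cut)
  show ?thesis
  proof (rule test_function_away0I[of _ \<epsilon> "1 / \<epsilon>"])
    have "smooth_on {0<..} (\<lambda>r. complex_of_real (r powr ((- (real DIM('a) - 4) + \<alpha>) / 2) * g \<epsilon> r))"
      by (intro smooth_on_linear[OF bounded_linear_of_real] smooth_on_mult smooth_on_powr smooth) simp_all
    then show "smooth_on (- {0}) (power_trial \<alpha> g w \<epsilon> :: 'a \<Rightarrow> complex)"
      unfolding power_trial_def[abs_def] by (intro smooth_on_mult smooth_on_radial w) auto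
    fix x :: 'a assume "power_trial \<alpha> g w \<epsilon> x \<noteq> 0"
    then have "g \<epsilon> (norm x) \<noteq> 0" by (auto simp: power_trial_def)
    then show "\<epsilon> \<le> norm x \<and> norm x \<le> 1 / \<epsilon>" using zero[of "norm x"] by force
  qed (rule \<epsilon>)
qed

end


section \<open>The radial trial functions\<close>

lemma of_real_has_vector_derivative:
  assumes "(f has_real_derivative y / r) (at r)"
  shows "((\<lambda>r. complex_of_real (f r)) has_vector_derivative inverse r *\<^sub>R complex_of_real y) (at r)"
proof -
  have "((\<lambda>r. complex_of_real (f r)) has_vector_derivative of_real (y / r)) (at r)"
    using assms by (rule has_vector_derivative_of_real)
  then show ?thesis by (simp add: scaleR_conv_of_real divide_inverse mult.commute)
qed

context angular_operator
begin

text \<open>Here \<open>\<gamma> = 0\<close> and the mode has eigenvalue 0, so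
  \<open>A = B = 0\<close> and the energy involves only \<open>v1\<close>. Taking
  \<open>v = h\<close> makes the cut-off appear one derivative later: \<open>v1 = G\<close> spans
  the plateau and \<open>v2 = G1\<close> is confined to the transition set. The factor
  \<open>W\<close> enters because the constant 1 is not normalised.\<close>

lemma radial_trial_estimates:
  assumes cut: "cutoff G \<epsilon> c" and const_eig: "eigenfunction sphere_measure dom\<Lambda> \<Lambda> 0 (\<lambda>_. 1)"
    and \<alpha>: "\<alpha> = real DIM('a) - 4" and h: "\<And>r. r > 0 \<Longrightarrow> (h \<epsilon> has_real_derivative G r / r) (at r)"
  defines "W \<equiv> (L2_norm (sphere_measure :: 'a measure) (\<lambda>_. 1))\<^sup>2"
    and "\<psi> \<equiv> radial_trial h \<epsilon>"
  shows "calL_in_L2 dom\<Lambda> \<Lambda> \<psi>"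
    and "0 < rellich_num \<alpha> \<Lambda> \<psi> - (\<alpha> + 2)\<^sup>2 * rellich_den \<alpha> sqrt\<Lambda> \<psi>"
    and "rellich_num \<alpha> \<Lambda> \<psi> - (\<alpha> + 2)\<^sup>2 * rellich_den \<alpha> sqrt\<Lambda> \<psi> \<le> W * (2 * (2 * c)\<^sup>2)"
    and "W * (ln (1 / (2 * \<epsilon>)) - ln (2 * \<epsilon>)) \<le> rellich_den \<alpha> sqrt\<Lambda> \<psi>"
    and "W > 0"
proof -
  interpret cutoff G \<epsilon> c by (rule cut)
  let ?f1 = "\<lambda>r. G r / r" and ?f2 = "\<lambda>r. (G1 r - G r) / r\<^sup>2"
  interpret sep: separated dom\<Lambda> \<Lambda> I lam u dom_sqrt\<Lambda> sqrt\<Lambda> "\<lambda>_. 1" 0 "h \<epsilon>" ?f1 ?f2 \<psi>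
  proof
    show "(h \<epsilon> has_real_derivative ?f1 r) (at r)" if "r > 0" for r by (rule h[OF that])
    show "(?f1 has_real_derivative ?f2 r) (at r)" if "r > 0" for r
      by (rule DERIV_cong[OF DERIV_divide[OF deriv_G[OF that] DERIV_ident]])
         (use that in \<open>auto simp: field_simps power2_eq_square\<close>)
    show "continuous_on {0<..} ?f2" by (auto intro!: continuous_intros continuous_G)
  qed (auto simp: const_eig \<psi>_def radial_trial_def)
  have "measure (sphere_measure :: 'a measure) (sphere 0 1) > 0"
    using emeasure_sphere_measure_pos[where 'a='a] finite_measure.emeasure_eq_measure[OF finite_measure_sphere, of "sphere (0::'a) 1"]
    by simp
  then show W: "W > 0" unfolding W_def L2_norm_power2 by simp
  let ?a = "\<epsilon> / 2" and ?b = "2 / \<epsilon>"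
  have ab: "0 < ?a" "?a < ?b" using \<epsilon> order by auto
  have out: "G r = 0 \<and> G1 r = 0 \<and> G2 r = 0" if "0 < r" "\<not> (\<epsilon> \<le> r \<and> r \<le> 1 / \<epsilon>)" for r
  proof -
    have "r \<notin> transition" using that order by (auto simp: transition_def)
    then show ?thesis using G12_outside[OF that(1)] zero[of r] that by auto
  qed
  have supp: "?f1 r = 0 \<and> ?f2 r = 0 \<and> 0 * h \<epsilon> r = 0" if "0 < r" "r \<notin> {?a..?b}" for r
    using out[OF that(1)] that order by auto
  show "calL_in_L2 dom\<Lambda> \<Lambda> \<psi>" by (rule sep.calL_in_L2[OF ab(1) supp])
  have bd: "G ?a = 0" "G1 ?a = 0" "G ?b = 0" "G1 ?b = 0"
    using out[of ?a] out[of ?b] ab order by auto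
  have cG: "continuous_on {?a..?b} G" "continuous_on {?a..?b} G1"
    using ab by (auto intro: continuous_on_subset[OF continuous_G(1)] continuous_on_subset[OF continuous_G(2)])
  let ?v1 = "\<lambda>r. complex_of_real (G r)" and ?v2 = "\<lambda>r. complex_of_real (G1 r)"
  \<comment> \<open>The shift by \<open>k\<close> leaves \<open>v1\<close> and \<open>v2\<close>
    unchanged. Subtracting the value at the left end produces the zero boundary value that
    \<open>remainder_pos\<close> asks for, while \<open>k = 0\<close> serves the integral
    identities.\<close>
  have log: "log_derivatives (\<lambda>r. complex_of_real (h \<epsilon> r - k)) ?v1 ?v2 ?a ?b" for k
  proof
    fix r assume "r \<in> {?a..?b}"
    then have r: "r > 0" using ab by auto
    have "((\<lambda>r. h \<epsilon> r - k) has_real_derivative G r / r) (at r)"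
      using DERIV_diff[OF h[OF r] DERIV_const[of k]] by simp
    then show "((\<lambda>r. complex_of_real (h \<epsilon> r - k)) has_vector_derivative inverse r *\<^sub>R ?v1 r) (at r)"
      by (rule of_real_has_vector_derivative)
    show "(?v1 has_vector_derivative inverse r *\<^sub>R ?v2 r) (at r)"
      by (rule of_real_has_vector_derivative[OF deriv_G[OF r]])
  next
    show "continuous_on {?a..?b} ?v2"
      by (intro continuous_on_of_real continuous_on_subset[OF continuous_G(2)]) (use ab in auto)
  qed (use ab bd in auto)
  let ?v = "\<lambda>r. complex_of_real (h \<epsilon> r - 0)"
  interpret log_derivatives ?v ?v1 ?v2 ?a ?b by (rule log)
  have dim: "DIM('a) \<ge> 1" by (simp add: Suc_leI)
  have \<gamma>: "0 = (real DIM('a) - 4 - \<alpha>) / 2" using \<alpha> by simp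
  have rel: "?v r = (r powr 0) *\<^sub>R complex_of_real (h \<epsilon> r)"
    "?v1 r = 0 *\<^sub>R ?v r + (r powr 0 * r) *\<^sub>R complex_of_real (?f1 r)"
    "?v2 r = 0 *\<^sub>R ?v1 r + ((0 + 1) * (r powr 0 * r)) *\<^sub>R complex_of_real (?f1 r) + (r powr 0 * r\<^sup>2) *\<^sub>R complex_of_real (?f2 r)"
    if r: "r > 0" for r
    using r by (simp_all add: scaleR_conv_of_real)
  have num: "rellich_num \<alpha> \<Lambda> \<psi> = W * integral {?a..?b}
      (\<lambda>r. (cmod (?v2 r + (\<alpha> + 2) *\<^sub>R ?v1 r - (0 + 0\<^sup>2 + 0 * (\<alpha> + 2)) *\<^sub>R ?v r))\<^sup>2 / r)"
  proof -
    have "rellich_num \<alpha> \<Lambda> \<psi> = W * integral {?a..?b}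
        (\<lambda>r. num_density DIM('a) \<alpha> 0 (of_real (h \<epsilon> r)) (of_real (?f1 r)) (of_real (?f2 r)) r)"
      unfolding W_def by (rule sep.rellich_num_eq(1)[OF ab(1) supp])
    also have "integral {?a..?b} (\<lambda>r. num_density DIM('a) \<alpha> 0 (of_real (h \<epsilon> r)) (of_real (?f1 r)) (of_real (?f2 r)) r) =
        integral {?a..?b} (\<lambda>r. (cmod (?v2 r + (\<alpha> + 2) *\<^sub>R ?v1 r - (0 + 0\<^sup>2 + 0 * (\<alpha> + 2)) *\<^sub>R ?v r))\<^sup>2 / r)"
      by (intro integral_cong densities_log(1)[OF dim \<gamma>] rel) (use ab in auto)
    finally show ?thesis .
  qed
  have den: "rellich_den \<alpha> sqrt\<Lambda> \<psi> = W * integral {?a..?b}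
      (\<lambda>r. ((cmod (?v1 r - 0 *\<^sub>R ?v r))\<^sup>2 + 0 * (cmod (?v r))\<^sup>2) / r)"
  proof -
    have "rellich_den \<alpha> sqrt\<Lambda> \<psi> = W * integral {?a..?b}
        (\<lambda>r. den_density DIM('a) \<alpha> 0 (of_real (h \<epsilon> r)) (of_real (?f1 r)) r)"
      unfolding W_def by (rule sep.rellich_den_eq[OF ab(1) supp])
    also have "integral {?a..?b} (\<lambda>r. den_density DIM('a) \<alpha> 0 (of_real (h \<epsilon> r)) (of_real (?f1 r)) r) =
        integral {?a..?b} (\<lambda>r. ((cmod (?v1 r - 0 *\<^sub>R ?v r))\<^sup>2 + 0 * (cmod (?v r))\<^sup>2) / r)"
      by (intro integral_cong densities_log(2)[OF dim \<gamma> _ rel]) (use ab in auto)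
    finally show ?thesis .
  qed
  let ?R = "\<lambda>r. ((cmod (?v2 r))\<^sup>2 + 0 * (cmod (?v1 r))\<^sup>2) / r"
  have "integral {?a..?b} (\<lambda>r. (cmod (?v2 r + (\<alpha> + 2) *\<^sub>R ?v1 r - (0 + 0\<^sup>2 + 0 * (\<alpha> + 2)) *\<^sub>R ?v r))\<^sup>2 / r) -
      (\<alpha> + 2)\<^sup>2 * integral {?a..?b} (\<lambda>r. ((cmod (?v1 r - 0 *\<^sub>R ?v r))\<^sup>2 + 0 * (cmod (?v r))\<^sup>2) / r) =
      integral {?a..?b} (\<lambda>r. ((cmod (?v2 r))\<^sup>2 + ((\<alpha> + 2)\<^sup>2 + 2 * (0 + 0\<^sup>2 + 0 * (\<alpha> + 2)) - (\<alpha> + 2)\<^sup>2) * (cmod (?v1 r))\<^sup>2) / r)"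
    by (rule integral_num_minus_den) auto
  also have "(\<alpha> + 2)\<^sup>2 + 2 * (0 + 0\<^sup>2 + 0 * (\<alpha> + 2)) - (\<alpha> + 2)\<^sup>2 = 0" by simp
  finally have diff: "integral {?a..?b} (\<lambda>r. (cmod (?v2 r + (\<alpha> + 2) *\<^sub>R ?v1 r - (0 + 0\<^sup>2 + 0 * (\<alpha> + 2)) *\<^sub>R ?v r))\<^sup>2 / r) -
      (\<alpha> + 2)\<^sup>2 * integral {?a..?b} (\<lambda>r. ((cmod (?v1 r - 0 *\<^sub>R ?v r))\<^sup>2 + 0 * (cmod (?v r))\<^sup>2) / r) =
      integral {?a..?b} ?R" .
  have "W * x - (\<alpha> + 2)\<^sup>2 * (W * y) = W * (x - (\<alpha> + 2)\<^sup>2 * y)" for x y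
    by (simp add: right_diff_distrib)
  then have eq: "rellich_num \<alpha> \<Lambda> \<psi> - (\<alpha> + 2)\<^sup>2 * rellich_den \<alpha> sqrt\<Lambda> \<psi> = W * integral {?a..?b} ?R"
    unfolding num den diff[symmetric] .
  \<comment> \<open>The function \<open>h \<epsilon>\<close> is not constant, because its derivative
    at \<open>2 * \<epsilon>\<close> is \<open>1 / (2 * \<epsilon>)\<close>.\<close>
  have "\<exists>r\<in>{?a..?b}. h \<epsilon> r - h \<epsilon> ?a \<noteq> 0"
  proof (rule ccontr)
    assume no: "\<not> ?thesis"
    have const: "h \<epsilon> r = h \<epsilon> ?a" if "r \<in> {?a<..<?b}" for r
    proof -
      have "r \<in> {?a..?b}" using that by auto
      with no have "\<not> (h \<epsilon> r - h \<epsilon> ?a \<noteq> 0)" by blast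
      then show ?thesis by simp
    qed
    have mem: "2 * \<epsilon> \<in> {?a<..<?b}" using order \<epsilon> by auto
    have "(h \<epsilon> has_real_derivative 0) (at (2 * \<epsilon>))"
      by (rule has_field_derivative_transform_within_open[OF DERIV_const[of "h \<epsilon> ?a"] _ mem const[symmetric]]) auto
    moreover have "(h \<epsilon> has_real_derivative G (2 * \<epsilon>) / (2 * \<epsilon>)) (at (2 * \<epsilon>))" using \<epsilon> by (intro h) simp
    ultimately have "G (2 * \<epsilon>) / (2 * \<epsilon>) = 0" using DERIV_unique by blast
    then show False using cutoff.one[OF cut, of "2 * \<epsilon>"] order \<epsilon> by simp
  qed
  then obtain r0 where r0: "r0 \<in> {?a..?b}" "h \<epsilon> r0 - h \<epsilon> ?a \<noteq> 0" by blast
  have "integral {?a..?b} ?R > 0"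
    by (rule log_derivatives.remainder_pos[OF log[of "h \<epsilon> ?a"] _ _ r0(1)])
       (use r0(2) in \<open>simp_all del: of_real_diff\<close>)
  then show "0 < rellich_num \<alpha> \<Lambda> \<psi> - (\<alpha> + 2)\<^sup>2 * rellich_den \<alpha> sqrt\<Lambda> \<psi>"
    unfolding eq using W by simp
  have "integral {?a..?b} ?R \<le> 2 * (2 * c)\<^sup>2"
  proof (rule integral_transition_le)
    show "continuous_on {?a..?b} ?R" using cG ab by (auto intro!: continuous_intros)
    fix r assume r: "r \<in> {?a..?b}"
    then have r0: "r > 0" using ab by auto
    have "(cmod (?v2 r))\<^sup>2 \<le> (2 * c)\<^sup>2" by (rule power_mono) (use G1_bound[OF r0] in simp_all)
    then show "?R r \<le> (2 * c)\<^sup>2 / r" using r0 by (intro divide_right_mono) auto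
    show "?R r = 0" if "r \<notin> transition" using G12_outside[OF r0 that] by simp
  qed simp
  then show "rellich_num \<alpha> \<Lambda> \<psi> - (\<alpha> + 2)\<^sup>2 * rellich_den \<alpha> sqrt\<Lambda> \<psi> \<le> W * (2 * (2 * c)\<^sup>2)"
    unfolding eq using W by (intro mult_left_mono) auto
  have "1 * (ln (1 / (2 * \<epsilon>)) - ln (2 * \<epsilon>)) \<le>
      integral {?a..?b} (\<lambda>r. ((cmod (?v1 r - 0 *\<^sub>R ?v r))\<^sup>2 + 0 * (cmod (?v r))\<^sup>2) / r)"
  proof (rule integral_plateau_ge)
    show "continuous_on {?a..?b} (\<lambda>r. ((cmod (?v1 r - 0 *\<^sub>R ?v r))\<^sup>2 + 0 * (cmod (?v r))\<^sup>2) / r)"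
      using cG ab by (auto intro!: continuous_intros)
    fix r
    show "0 \<le> ((cmod (?v1 r - 0 *\<^sub>R ?v r))\<^sup>2 + 0 * (cmod (?v r))\<^sup>2) / r" if "r \<in> {?a..?b}"
      using that ab by auto
    show "1 / r \<le> ((cmod (?v1 r - 0 *\<^sub>R ?v r))\<^sup>2 + 0 * (cmod (?v r))\<^sup>2) / r" if "2 * \<epsilon> \<le> r" "r \<le> 1 / (2 * \<epsilon>)"
      using cutoff.one[OF cut that] by simp
  qed
  then show "W * (ln (1 / (2 * \<epsilon>)) - ln (2 * \<epsilon>)) \<le> rellich_den \<alpha> sqrt\<Lambda> \<psi>"
    unfolding den using W by (intro mult_left_mono) auto
qed

text \<open>
  The radial trial function is cut off on the logarithmic scale, by \<open>H (r powr \<tau>)\<close> with a fixed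
  cut-off \<open>H\<close>: every logarithmic derivative of the cut-off gains a factor \<open>\<tau>\<close>, while the
  logarithmic length of the transition region is only of order \<open>1 / \<tau>\<close>.
\<close>

lemma radial_trial_energy_closure:
  assumes cut: "cutoff G \<epsilon> c" and cut': "cutoff H \<delta> c'"
    and one: "eigenfunction sphere_measure dom\<Lambda> \<Lambda> 0 (\<lambda>_. 1)"
    and \<alpha>: "\<alpha> = real DIM('a) - 4" and h: "\<And>r. r > 0 \<Longrightarrow> (h \<epsilon> has_real_derivative G r / r) (at r)"
  shows "radial_trial h \<epsilon> \<in> dom_calL_energy_closure \<alpha> dom\<Lambda> \<Lambda> sqrt\<Lambda>"
proof -
  interpret g: cutoff G \<epsilon> c by (rule cut)
  interpret H: cutoff H \<delta> c' by (rule cut')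
  note \<epsilon> = g.\<epsilon> and \<delta> = H.\<epsilon>
  define W where "W = (L2_norm (sphere_measure :: 'a measure) (\<lambda>_. 1))\<^sup>2"
  have W: "W \<ge> 0" by (simp add: W_def)
  have smooth_h: "smooth_on {0<..} (h \<epsilon>)"
  proof (rule smooth_on_SucI[OF _ h])
    have "smooth_on {0<..} (\<lambda>r. G r * r powr (-1))" by (intro smooth_on_mult g.smooth smooth_on_powr) simp
    then show "smooth_on {0<..} (\<lambda>r. G r / r)"
      by (subst smooth_on_cong[of _ _ "\<lambda>r. G r * r powr (-1)"]) (auto simp: powr_minus_divide)
  qed auto
  \<comment> \<open>Below \<open>\<epsilon>\<close> and above \<open>1 / \<epsilon>\<close> the
    derivative of \<open>h \<epsilon>\<close> vanishes, so the bound on the compact interval in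
    between extends to all radii.\<close>
  obtain Q0 where Q0: "\<And>r. r > 0 \<Longrightarrow> \<bar>h \<epsilon> r\<bar> \<le> Q0"
  proof -
    have "continuous_on {0<..} (h \<epsilon>)" using smooth_on_continuous[OF smooth_h] .
    then have "continuous_on {\<epsilon>..1 / \<epsilon>} (h \<epsilon>)" by (rule continuous_on_subset) (use \<epsilon> in auto)
    then have "compact (h \<epsilon> ` {\<epsilon>..1 / \<epsilon>})" by (intro compact_continuous_image) auto
    then obtain B where B: "\<And>r. r \<in> {\<epsilon>..1 / \<epsilon>} \<Longrightarrow> \<bar>h \<epsilon> r\<bar> \<le> B"
      by (metis bounded_iff compact_imp_bounded imageI real_norm_def)
    have \<epsilon>le: "\<epsilon> \<le> 1 / \<epsilon>" using g.order by linarith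
    have "\<exists>k. \<forall>r\<in>{0<..\<epsilon>}. h \<epsilon> r = k"
    proof (rule has_field_derivative_zero_constant)
      show "(h \<epsilon> has_real_derivative 0) (at r within {0<..\<epsilon>})" if "r \<in> {0<..\<epsilon>}" for r
        using h[of r] g.zero[of r] that by (auto intro: has_field_derivative_at_within)
    qed auto
    then have low: "h \<epsilon> r = h \<epsilon> \<epsilon>" if "0 < r" "r \<le> \<epsilon>" for r using that \<epsilon> by (metis greaterThanAtMost_iff order_refl)
    have "\<exists>k. \<forall>r\<in>{1 / \<epsilon>..}. h \<epsilon> r = k"
    proof (rule has_field_derivative_zero_constant)
      show "(h \<epsilon> has_real_derivative 0) (at r within {1 / \<epsilon>..})" if "r \<in> {1 / \<epsilon>..}" for r
      proof -
        have "r > 0" using that \<epsilon> by (auto intro: less_le_trans[of _ "1 / \<epsilon>"])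
        then show ?thesis using h[of r] g.zero[of r] that by (auto intro: has_field_derivative_at_within)
      qed
    qed auto
    then have high: "h \<epsilon> r = h \<epsilon> (1 / \<epsilon>)" if "1 / \<epsilon> \<le> r" for r using that by (metis atLeast_iff order_refl)
    have "\<bar>h \<epsilon> r\<bar> \<le> B" if "r > 0" for r
      using that B[of r] B[of \<epsilon>] B[of "1 / \<epsilon>"] low[of r] high[of r] \<epsilon>le by (cases "r \<le> \<epsilon>"; cases "1 / \<epsilon> \<le> r") auto
    then show ?thesis by (rule that)
  qed
  \<comment> \<open>Up to the factor \<open>\<tau>\<close>, this bounds
    \<open>v2 + (\<alpha> + 2) v1\<close> for the truncation error; \<open>6 * c'\<close> serves as
    a common bound for the first and second logarithmic derivatives of the fixed cut-off.\<close>
  define Q where "Q = Q0 * (6 * c') * (1 + \<bar>\<alpha> + 2\<bar>)"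
  have Q00: "Q0 \<ge> 0" using Q0[of 1] by linarith
  \<comment> \<open>\<open>Z * \<tau>\<close> will be the final bound: the squared amplitude
    \<open>(\<tau> * Q)^2\<close> times the logarithmic length
    \<open>2 * ln (1 / \<delta>) / \<tau>\<close> times the norm \<open>W\<close>.\<close>
  define Z where "Z = 2 * ln (1 / \<delta>) * Q\<^sup>2 * W"
  have "ln (1 / \<delta>) > 0" using \<delta> by (intro ln_gt_zero) (auto simp: field_simps)
  then have Z: "Z \<ge> 0" unfolding Z_def using W by (intro mult_nonneg_nonneg) auto
  have approx: "\<exists>\<phi>\<in>dom_calL dom\<Lambda> \<Lambda>.
      (\<integral>\<^sup>+x. ennreal ((cmod (calL \<Lambda> (\<lambda>y. radial_trial h \<epsilon> y - \<phi> y) x))\<^sup>2 / norm x powr \<alpha>) \<partial>lborel) < ennreal e \<and>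
      (\<integral>\<^sup>+x. ennreal (calD sqrt\<Lambda> (\<lambda>y. radial_trial h \<epsilon> y - \<phi> y) x / norm x powr (\<alpha> + 2)) \<partial>lborel) < ennreal e"
    if e: "e > 0" for e
  proof -
    have lne: "ln \<epsilon> < 0" using \<epsilon> by (intro ln_less_zero) auto
    have lnd: "ln (2 * \<delta>) < 0" using \<delta> by (intro ln_less_zero) auto
    \<comment> \<open>Three demands: at most 1, so that \<open>\<tau>^2 \<le> \<tau>\<close>; below
      the quotient of logarithms, so that the plateau of \<open>H (r powr \<tau>)\<close> contains
      the support of \<open>G\<close>; below \<open>e / (Z + 1)\<close> for the final estimate.
      Halving makes the last two strict.\<close>
    define \<tau> where "\<tau> = min 1 (min (ln (2 * \<delta>) / ln \<epsilon>) (e / (Z + 1))) / 2"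
    have "ln (2 * \<delta>) / ln \<epsilon> > 0" using lne lnd by (simp add: zero_less_divide_iff)
    moreover have "e / (Z + 1) > 0" using e Z by simp
    ultimately have \<tau>: "\<tau> > 0" "\<tau> \<le> 1" "\<tau> < ln (2 * \<delta>) / ln \<epsilon>" "\<tau> < e / (Z + 1)"
    proof -
      have *: "0 < min 1 (min x y) / 2 \<and> min 1 (min x y) / 2 \<le> 1 \<and> min 1 (min x y) / 2 < x \<and> min 1 (min x y) / 2 < y"
        if "0 < x" "0 < y" for x y :: real using that by (auto simp: min_def)
      assume "0 < ln (2 * \<delta>) / ln \<epsilon>" "0 < e / (Z + 1)"
      from *[OF this] show "\<tau> > 0" "\<tau> \<le> 1" "\<tau> < ln (2 * \<delta>) / ln \<epsilon>" "\<tau> < e / (Z + 1)"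
        unfolding \<tau>_def by blast+
    qed
    have small: "2 * \<delta> < r powr \<tau> \<and> r powr \<tau> < 1 / (2 * \<delta>)" if r: "\<epsilon> \<le> r" "r \<le> 1 / \<epsilon>" for r
    proof -
      have r0: "r > 0" using r \<epsilon> by linarith
      have "ln \<epsilon> \<le> ln r" using r r0 \<epsilon> by simp
      moreover have "ln r \<le> - ln \<epsilon>"
      proof -
        have "ln r \<le> ln (1 / \<epsilon>)" using r r0 \<epsilon> by (subst ln_le_cancel_iff) auto
        then show ?thesis using \<epsilon> by (simp add: ln_div)
      qed
      ultimately have "\<tau> * ln \<epsilon> \<le> \<tau> * ln r" "\<tau> * ln r \<le> \<tau> * (- ln \<epsilon>)" using \<tau>(1) by (intro mult_left_mono; simp)+
      moreover have "\<tau> * ln \<epsilon> > ln (2 * \<delta>)" using \<tau>(3) lne by (simp add: neg_less_divide_eq mult.commute)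
      ultimately have b: "ln (2 * \<delta>) < \<tau> * ln r" "\<tau> * ln r < - ln (2 * \<delta>)" by auto
      have "exp (ln (2 * \<delta>)) < exp (\<tau> * ln r)" "exp (\<tau> * ln r) < exp (- ln (2 * \<delta>))" using b by simp_all
      then show ?thesis using r0 \<delta> by (simp add: powr_def exp_minus inverse_eq_divide)
    qed
    \<comment> \<open>The preimages of \<open>\<delta>\<close> and \<open>1 / \<delta>\<close> under
      \<open>r powr \<tau>\<close>: the endpoints between which the stretched cut-off can be
      nonzero.\<close>
    define p where "p = \<delta> powr (1 / \<tau>)"
    define q where "q = (1 / \<delta>) powr (1 / \<tau>)"
    have pq: "0 < p" "p \<le> q"
      using \<delta> \<tau> by (auto simp: p_def q_def intro!: powr_mono2 simp: field_simps mult_le_one)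
    have pt: "p powr \<tau> = \<delta>" "q powr \<tau> = 1 / \<delta>" using \<tau>(1) \<delta> by (simp_all add: p_def q_def powr_powr)
    have range: "\<delta> \<le> r powr \<tau> \<and> r powr \<tau> \<le> 1 / \<delta> \<longleftrightarrow> r \<in> {p..q}" if r: "r > 0" for r
    proof -
      have mono: "x \<le> y \<longleftrightarrow> x powr \<tau> \<le> y powr \<tau>" if "x > 0" "y > 0" for x y
      proof (cases "x \<le> y")
        case True
        then show ?thesis using powr_mono2[of \<tau> x y] that \<tau>(1) by simp
      next
        case False
        then show ?thesis using powr_less_mono2[of \<tau> y x] that \<tau>(1) by simp
      qed
      have "p \<le> r \<longleftrightarrow> \<delta> \<le> r powr \<tau>" "r \<le> q \<longleftrightarrow> r powr \<tau> \<le> 1 / \<delta>"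
        using mono[of p r] mono[of r q] pq r unfolding pt by auto
      then show ?thesis by auto
    qed
    let ?k = "\<lambda>r. H (r powr \<tau>)"
    let ?K1 = "\<lambda>r. \<tau> * H.G1 (r powr \<tau>)" and ?K2 = "\<lambda>r. \<tau>\<^sup>2 * H.G2 (r powr \<tau>)"
    have dpow: "((\<lambda>r. r powr \<tau>) has_real_derivative \<tau> * r powr \<tau> / r) (at r)" if "r > 0" for r
      using has_real_derivative_powr[OF that, of \<tau>] that by (simp add: powr_diff)
    have chain: "((\<lambda>r. X (r powr \<tau>)) has_real_derivative \<tau> * X' (r powr \<tau>) / r) (at r)"
      if "\<And>\<rho>. \<rho> > 0 \<Longrightarrow> (X has_real_derivative X' \<rho> / \<rho>) (at \<rho>)" "r > 0" for X X' r
      using DERIV_chain2[OF that(1) dpow[OF that(2)]] that(2) by (simp add: field_simps)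
    have dk: "(?k has_real_derivative ?K1 r / r) (at r)" if "r > 0" for r
      by (rule chain[OF H.deriv_G that])
    have dK1: "(?K1 has_real_derivative ?K2 r / r) (at r)" if "r > 0" for r
      using DERIV_cmult[OF chain[OF H.deriv_G1 that], of \<tau>] by (simp add: power2_eq_square mult.assoc)
    have cK: "continuous_on {0<..} (\<lambda>r. X (r powr \<tau>))" if "continuous_on {0<..} X" for X :: "real \<Rightarrow> real"
      by (rule continuous_on_compose2[OF that]) (auto intro!: continuous_intros)
    have G0: "G r = 0" if "r > 0" "\<not> (\<epsilon> \<le> r \<and> r \<le> 1 / \<epsilon>)" for r using g.zero[of r] that by auto
    \<comment> \<open>Where \<open>G\<close> is nonzero the stretched cut-off is identically 1. Thus
      the terms in which the derivative of \<open>h\<close> meets the cut-off disappear, and the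
      truncation error has derivatives that come from the cut-off alone.\<close>
    have GK: "G r * (1 - ?k r) = 0" "G r * ?K1 r = 0" if r: "r > 0" for r
    proof -
      show "G r * (1 - ?k r) = 0"
        using G0[OF r] small[of r] H.one[of "r powr \<tau>"] by (cases "\<epsilon> \<le> r \<and> r \<le> 1 / \<epsilon>") auto
      show "G r * ?K1 r = 0"
      proof (cases "\<epsilon> \<le> r \<and> r \<le> 1 / \<epsilon>")
        case True
        then have "r powr \<tau> \<notin> H.transition" using small[of r] by (auto simp: H.transition_def)
        then show ?thesis using H.G12_outside[of "r powr \<tau>"] r by simp
      qed (use G0[OF r] in simp)
    qed
    let ?\<eta> = "\<lambda>r. h \<epsilon> r * (1 - ?k r)" and ?\<eta>1 = "\<lambda>r. - (h \<epsilon> r * ?K1 r) / r"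
      and ?\<eta>2 = "\<lambda>r. (h \<epsilon> r * ?K1 r - h \<epsilon> r * ?K2 r) / r\<^sup>2"
    let ?\<phi> = "\<lambda>x::'a. complex_of_real (h \<epsilon> (norm x) * ?k (norm x))"
    \<comment> \<open>The truncation error is itself a separated function, so both of its energies
      reduce to radial integrals.\<close>
    interpret eta: separated dom\<Lambda> \<Lambda> I lam u dom_sqrt\<Lambda> sqrt\<Lambda> "\<lambda>_. 1" 0 ?\<eta> ?\<eta>1 ?\<eta>2 "\<lambda>y. radial_trial h \<epsilon> y - ?\<phi> y"
    proof
      show "(?\<eta> has_real_derivative ?\<eta>1 r) (at r)" if r: "r > 0" for r
      proof (rule DERIV_cong)
        show "(?\<eta> has_real_derivative G r / r * (1 - ?k r) + (0 - ?K1 r / r) * h \<epsilon> r) (at r)"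
          by (intro DERIV_mult DERIV_diff DERIV_const h dk r)
        show "G r / r * (1 - ?k r) + (0 - ?K1 r / r) * h \<epsilon> r = ?\<eta>1 r"
          using GK(1)[OF r] by (simp add: field_simps)
      qed
      show "(?\<eta>1 has_real_derivative ?\<eta>2 r) (at r)" if r: "r > 0" for r
      proof (rule DERIV_cong)
        show "(?\<eta>1 has_real_derivative (- (G r / r * ?K1 r + ?K2 r / r * h \<epsilon> r) * r - - (h \<epsilon> r * ?K1 r) * 1) / (r * r)) (at r)"
          using r by (intro DERIV_divide DERIV_minus DERIV_mult h dK1 DERIV_ident) auto
        show "(- (G r / r * ?K1 r + ?K2 r / r * h \<epsilon> r) * r - - (h \<epsilon> r * ?K1 r) * 1) / (r * r) = ?\<eta>2 r"
          using GK(2)[OF r] r by (simp add: field_simps power2_eq_square)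
      qed
      show "continuous_on {0<..} ?\<eta>2"
        using smooth_on_continuous[OF smooth_h] cK[OF H.continuous_G(2)] cK[OF H.continuous_G(3)]
        by (auto intro!: continuous_intros)
    qed (auto simp: one radial_trial_def algebra_simps)
    have K_out: "?K1 r = 0 \<and> ?K2 r = 0" if "r > 0" "r \<notin> {p..q}" for r
    proof -
      have "r powr \<tau> \<notin> H.transition" using range[OF that(1)] that(2) H.order by (auto simp: H.transition_def)
      then show ?thesis using H.G12_outside[of "r powr \<tau>"] that(1) by simp
    qed
    have dim: "DIM('a) \<ge> 1" by (simp add: Suc_leI)
    have \<gamma>: "0 = (real DIM('a) - 4 - \<alpha>) / 2" using \<alpha> by simp
    let ?v = "\<lambda>r. complex_of_real (?\<eta> r)" and ?v1 = "\<lambda>r. complex_of_real (- (h \<epsilon> r * ?K1 r))"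
      and ?v2 = "\<lambda>r. complex_of_real (- (h \<epsilon> r * ?K2 r))"
    have rel: "?v r = (r powr 0) *\<^sub>R complex_of_real (?\<eta> r)"
      "?v1 r = 0 *\<^sub>R ?v r + (r powr 0 * r) *\<^sub>R complex_of_real (?\<eta>1 r)"
      "?v2 r = 0 *\<^sub>R ?v1 r + ((0 + 1) * (r powr 0 * r)) *\<^sub>R complex_of_real (?\<eta>1 r) + (r powr 0 * r\<^sup>2) *\<^sub>R complex_of_real (?\<eta>2 r)"
      if r: "r > 0" for r
    proof -
      have "r * ?\<eta>1 r = - (h \<epsilon> r * ?K1 r)" "r\<^sup>2 * ?\<eta>2 r = h \<epsilon> r * ?K1 r - h \<epsilon> r * ?K2 r" using r by simp_all
      then have "complex_of_real r * of_real (?\<eta>1 r) = of_real (- (h \<epsilon> r * ?K1 r))"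
        "complex_of_real (r\<^sup>2) * of_real (?\<eta>2 r) = of_real (h \<epsilon> r * ?K1 r - h \<epsilon> r * ?K2 r)"
        by (metis of_real_mult)+
      then show "?v r = (r powr 0) *\<^sub>R complex_of_real (?\<eta> r)"
        "?v1 r = 0 *\<^sub>R ?v r + (r powr 0 * r) *\<^sub>R complex_of_real (?\<eta>1 r)"
        "?v2 r = 0 *\<^sub>R ?v1 r + ((0 + 1) * (r powr 0 * r)) *\<^sub>R complex_of_real (?\<eta>1 r) + (r powr 0 * r\<^sup>2) *\<^sub>R complex_of_real (?\<eta>2 r)"
        using r by (simp_all only: scaleR_conv_of_real powr_zero_eq_one if_False less_imp_neq[symmetric] mult_1_left add_0_left of_real_0 mult_zero_left)
           (simp_all)
    qed
    have vbound: "cmod (?v1 r) \<le> \<tau> * (Q0 * (6 * c'))" "cmod (?v2 r) \<le> \<tau> * (Q0 * (6 * c'))" if r: "r > 0" for r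
    proof -
      have \<rho>: "r powr \<tau> > 0" using r by simp
      have "\<bar>H.G1 (r powr \<tau>)\<bar> \<le> 6 * c'" using H.G1_bound[OF \<rho>] H.c by linarith
      then have "\<bar>h \<epsilon> r\<bar> * \<bar>H.G1 (r powr \<tau>)\<bar> \<le> Q0 * (6 * c')" using Q0[OF r] Q00 by (intro mult_mono) auto
      then have "\<tau> * (\<bar>h \<epsilon> r\<bar> * \<bar>H.G1 (r powr \<tau>)\<bar>) \<le> \<tau> * (Q0 * (6 * c'))" using \<tau>(1) by (intro mult_left_mono) auto
      then show "cmod (?v1 r) \<le> \<tau> * (Q0 * (6 * c'))" using \<tau>(1) unfolding norm_of_real by (simp add: abs_mult mult_ac)
      have h2: "\<bar>h \<epsilon> r\<bar> * \<bar>H.G2 (r powr \<tau>)\<bar> \<le> Q0 * (6 * c')" using Q0[OF r] Q00 H.G2_bound[OF \<rho>] by (intro mult_mono) auto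
      have t2: "\<tau>\<^sup>2 \<le> \<tau>" using \<tau>(1,2) by (simp add: power2_eq_square mult_left_le)
      have "\<tau>\<^sup>2 * (\<bar>h \<epsilon> r\<bar> * \<bar>H.G2 (r powr \<tau>)\<bar>) \<le> \<tau> * (Q0 * (6 * c'))"
        by (rule mult_mono[OF t2 h2]) (use \<tau>(1) in auto)
      then show "cmod (?v2 r) \<le> \<tau> * (Q0 * (6 * c'))" unfolding norm_of_real by (simp add: abs_mult mult_ac)
    qed
    have qq: "Q0 * (6 * c') \<ge> 0" using Q00 H.c by simp
    have Qle: "Q0 * (6 * c') \<le> Q" unfolding Q_def using qq by (simp add: mult_le_cancel_left1)
    have num_le: "num_density DIM('a) \<alpha> 0 (of_real (?\<eta> r)) (of_real (?\<eta>1 r)) (of_real (?\<eta>2 r)) r \<le> (\<tau> * Q)\<^sup>2 * (1 / r)"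
      and den_le: "den_density DIM('a) \<alpha> 0 (of_real (?\<eta> r)) (of_real (?\<eta>1 r)) r \<le> (\<tau> * Q)\<^sup>2 * (1 / r)"
      and out: "r \<notin> {p..q} \<Longrightarrow> num_density DIM('a) \<alpha> 0 (of_real (?\<eta> r)) (of_real (?\<eta>1 r)) (of_real (?\<eta>2 r)) r = 0"
        "r \<notin> {p..q} \<Longrightarrow> den_density DIM('a) \<alpha> 0 (of_real (?\<eta> r)) (of_real (?\<eta>1 r)) r = 0"
      if r: "r > 0" for r
    proof -
      have n: "num_density DIM('a) \<alpha> 0 (of_real (?\<eta> r)) (of_real (?\<eta>1 r)) (of_real (?\<eta>2 r)) r =
          (cmod (?v2 r + (\<alpha> + 2) *\<^sub>R ?v1 r))\<^sup>2 / r"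
        using densities_log(1)[OF dim \<gamma> r rel[OF r], of 0] by simp
      have d: "den_density DIM('a) \<alpha> 0 (of_real (?\<eta> r)) (of_real (?\<eta>1 r)) r = (cmod (?v1 r))\<^sup>2 / r"
        using densities_log(2)[OF dim \<gamma> r rel[OF r], of 0] by simp
      have "cmod (?v2 r + (\<alpha> + 2) *\<^sub>R ?v1 r) \<le> cmod (?v2 r) + \<bar>\<alpha> + 2\<bar> * cmod (?v1 r)"
        using norm_triangle_ineq[of "?v2 r" "(\<alpha> + 2) *\<^sub>R ?v1 r"] by (simp only: norm_scaleR)
      also have "\<dots> \<le> \<tau> * (Q0 * (6 * c')) + \<bar>\<alpha> + 2\<bar> * (\<tau> * (Q0 * (6 * c')))"
        by (intro add_mono mult_left_mono vbound[OF r]) simp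
      also have "\<dots> = \<tau> * Q" by (simp add: Q_def algebra_simps)
      finally have "(cmod (?v2 r + (\<alpha> + 2) *\<^sub>R ?v1 r))\<^sup>2 \<le> (\<tau> * Q)\<^sup>2" by (intro power_mono) auto
      then show "num_density DIM('a) \<alpha> 0 (of_real (?\<eta> r)) (of_real (?\<eta>1 r)) (of_real (?\<eta>2 r)) r \<le> (\<tau> * Q)\<^sup>2 * (1 / r)"
        unfolding n using r by (simp add: divide_right_mono)
      have "cmod (?v1 r) \<le> \<tau> * Q" using vbound(1)[OF r] mult_left_mono[OF Qle, of \<tau>] \<tau>(1) by linarith
      then have "(cmod (?v1 r))\<^sup>2 \<le> (\<tau> * Q)\<^sup>2" by (intro power_mono) auto
      then show "den_density DIM('a) \<alpha> 0 (of_real (?\<eta> r)) (of_real (?\<eta>1 r)) r \<le> (\<tau> * Q)\<^sup>2 * (1 / r)"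
        unfolding d using r by (simp add: divide_right_mono)
      show "num_density DIM('a) \<alpha> 0 (of_real (?\<eta> r)) (of_real (?\<eta>1 r)) (of_real (?\<eta>2 r)) r = 0"
        "den_density DIM('a) \<alpha> 0 (of_real (?\<eta> r)) (of_real (?\<eta>1 r)) r = 0" if "r \<notin> {p..q}"
        unfolding n d using K_out[OF r that] \<tau>(1) by auto
    qed
    \<comment> \<open>The density \<open>1 / r\<close> turns the amplitude bound into the
      logarithmic length of \<open>{p..q}\<close>, which costs a factor \<open>1 / \<tau>\<close>
      against the \<open>\<tau>^2\<close> from the amplitude.\<close>
    have bound: "ennreal W * (\<integral>\<^sup>+r. indicator {0<..} r * ennreal (X r) \<partial>lborel) < ennreal e"
      if "\<And>r. r > 0 \<Longrightarrow> X r \<le> (\<tau> * Q)\<^sup>2 * (1 / r)" "\<And>r. r > 0 \<Longrightarrow> r \<notin> {p..q} \<Longrightarrow> X r = 0" for X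
    proof -
      have "(\<integral>\<^sup>+r. indicator {0<..} r * ennreal (X r) \<partial>lborel) \<le>
          (\<integral>\<^sup>+r. ennreal ((\<tau> * Q)\<^sup>2) * (ennreal (1 / r) * indicator {p..q} r) \<partial>lborel)"
      proof (rule nn_integral_mono)
        fix r :: real
        show "indicator {0<..} r * ennreal (X r) \<le> ennreal ((\<tau> * Q)\<^sup>2) * (ennreal (1 / r) * indicator {p..q} r)"
        proof (cases "r > 0 \<and> r \<in> {p..q}")
          case True
          then have "ennreal (X r) \<le> ennreal ((\<tau> * Q)\<^sup>2 * (1 / r))" using that(1) by (intro ennreal_leI) auto
          also have "\<dots> = ennreal ((\<tau> * Q)\<^sup>2) * ennreal (1 / r)" by (rule ennreal_mult') simp
          finally show ?thesis using True by simp
        next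
          case False
          then have "r > 0 \<Longrightarrow> X r = 0" using that(2) by auto
          then show ?thesis by (auto split: split_indicator)
        qed
      qed
      also have "\<dots> = ennreal ((\<tau> * Q)\<^sup>2) * ennreal (ln q - ln p)"
      proof (subst nn_integral_cmult)
        have "(\<integral>\<^sup>+r. ennreal (1 / r) * indicator {p..q} r \<partial>lborel) = ennreal (ln q - ln p)"
          by (rule nn_integral_FTC_Icc) (use pq in \<open>auto intro!: derivative_eq_intros\<close>)
        then show "ennreal ((\<tau> * Q)\<^sup>2) * (\<integral>\<^sup>+r. ennreal (1 / r) * indicator {p..q} r \<partial>lborel) =
            ennreal ((\<tau> * Q)\<^sup>2) * ennreal (ln q - ln p)" by simp
      qed auto
      also have "ln q - ln p = 2 * ln (1 / \<delta>) / \<tau>"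
        using \<delta> by (simp add: p_def q_def ln_powr ln_div field_simps)
      finally have "ennreal W * (\<integral>\<^sup>+r. indicator {0<..} r * ennreal (X r) \<partial>lborel) \<le>
          ennreal W * (ennreal ((\<tau> * Q)\<^sup>2) * ennreal (2 * ln (1 / \<delta>) / \<tau>))" by (rule mult_left_mono) simp
      also have "\<dots> = ennreal (Z * \<tau>)"
      proof -
        have "W * ((\<tau> * Q)\<^sup>2 * (2 * ln (1 / \<delta>) / \<tau>)) = Z * \<tau>"
          using \<tau>(1) by (simp add: Z_def field_simps power2_eq_square)
        then show ?thesis using W by (simp only: ennreal_mult'[symmetric] zero_le_power2)
      qed
      also have "\<dots> < ennreal e"
      proof (rule ennreal_lessI[OF e])
        have "Z * \<tau> \<le> (Z + 1) * \<tau>" using \<tau>(1) by simp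
        also have "\<dots> < e" using \<tau>(4) Z by (simp add: field_simps)
        finally show "Z * \<tau> < e" .
      qed
      finally show ?thesis .
    qed
    have smooth_\<phi>: "smooth_on {0<..} (\<lambda>r. h \<epsilon> r * ?k r)"
      by (intro smooth_on_mult smooth_h smooth_on_compose[OF _ _ _ H.smooth smooth_on_powr]) auto
    have k0: "?k r = 0" if "r > 0" "\<not> (p < r \<and> r < q)" for r
    proof -
      have "r \<le> p \<or> q \<le> r" using that(2) by auto
      then have "r powr \<tau> \<le> p powr \<tau> \<or> q powr \<tau> \<le> r powr \<tau>"
        using powr_mono2[of \<tau> r p] powr_mono2[of \<tau> q r] that(1) \<tau>(1) pq by auto
      then show ?thesis unfolding pt by (intro H.zero) auto
    qed
    have \<phi>: "?\<phi> \<in> dom_calL dom\<Lambda> \<Lambda>"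
      unfolding dom_calL_def mem_Collect_eq
    proof
      show "test_function_away0 ?\<phi>"
      proof (rule test_function_away0I[OF _ pq(1)])
        show "smooth_on (- {0}) ?\<phi>"
          by (intro smooth_on_radial smooth_on_linear[OF bounded_linear_of_real] smooth_\<phi>) simp
        fix x :: 'a assume x: "?\<phi> x \<noteq> 0"
        have "x \<noteq> 0" using x H.zero[of 0] \<delta> by auto
        then have "norm x > 0" by simp
        moreover have "?k (norm x) \<noteq> 0" using x by auto
        ultimately have "p < norm x \<and> norm x < q" using k0[of "norm x"] by blast
        then show "p \<le> norm x \<and> norm x \<le> q" by simp
      qed
      let ?f = "\<lambda>r. h \<epsilon> r * ?k r"
      \<comment> \<open>Only membership in the domain is at stake for the truncated function, so its
        derivatives are kept abstract; their vanishing outside \<open>{p..q}\<close> is all that has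
        to be known about them.\<close>
      interpret phi: separated dom\<Lambda> \<Lambda> I lam u dom_sqrt\<Lambda> sqrt\<Lambda> "\<lambda>_. 1" 0 ?f "deriv ?f" "deriv (deriv ?f)" ?\<phi>
      proof
        have s1: "smooth_on {0<..} (deriv ?f)" by (rule smooth_on_deriv[OF _ smooth_\<phi>]) simp
        have s2: "smooth_on {0<..} (deriv (deriv ?f))" by (rule smooth_on_deriv[OF _ s1]) simp
        show "(?f has_real_derivative deriv ?f r) (at r)" if "r > 0" for r
          using that by (intro smooth_on_has_real_derivative[OF smooth_\<phi>]) simp
        show "(deriv ?f has_real_derivative deriv (deriv ?f) r) (at r)" if "r > 0" for r
          using that by (intro smooth_on_has_real_derivative[OF s1]) simp
        show "continuous_on {0<..} (deriv (deriv ?f))" by (rule smooth_on_continuous[OF s2])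
      qed (auto simp: one)
      show "calL_in_L2 dom\<Lambda> \<Lambda> ?\<phi>"
      proof (rule phi.calL_in_L2[OF pq(1), of q])
        fix r assume r: "0 < r" "r \<notin> {p..q}"
        have "open ({0<..} - {p..q})" by auto
        then have "deriv ?f r = 0" "deriv (deriv ?f) r = 0"
          using r k0 by (intro deriv_eq_0_on_open[of "{0<..} - {p..q}" r ?f 0]; force)+
        then show "deriv ?f r = 0 \<and> deriv (deriv ?f) r = 0 \<and> 0 * ?f r = 0" by simp
      qed
    qed
    have num_small: "(\<integral>\<^sup>+x. ennreal ((cmod (calL \<Lambda> (\<lambda>y. radial_trial h \<epsilon> y - ?\<phi> y) x))\<^sup>2 / norm x powr \<alpha>) \<partial>lborel) < ennreal e"
      unfolding eta.nn_integral_num W_def[symmetric] by (rule bound[OF num_le out(1)])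
    have den_small: "(\<integral>\<^sup>+x. ennreal (calD sqrt\<Lambda> (\<lambda>y. radial_trial h \<epsilon> y - ?\<phi> y) x / norm x powr (\<alpha> + 2)) \<partial>lborel) < ennreal e"
      unfolding eta.nn_integral_den W_def[symmetric] by (rule bound[OF den_le out(2)])
    show ?thesis by (intro bexI[OF _ \<phi>] conjI num_small den_small)
  qed
  have "smooth_on (- {0}) (radial_trial h \<epsilon> :: 'a \<Rightarrow> complex)"
    unfolding radial_trial_def[abs_def]
    by (intro smooth_on_radial smooth_on_linear[OF bounded_linear_of_real] smooth_h) simp
  then show ?thesis
    unfolding dom_calL_energy_closure_def
    using radial_trial_estimates(1)[of G \<epsilon> c \<alpha> h, OF cut one \<alpha> h] approx by blast
qed

end


text \<open>For an abstract angular operator neither smoothness of \<open>u m0\<close> nor the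
  constant 1 being a zero mode is automatic, and each is assumed exactly where it enters. The radial
  trial functions are placed in the energy closure because they are not compactly supported away
  from the origin.\<close>

theorem theorem1p3:
  fixes \<alpha> :: real
    and dom\<Lambda> dom_sqrt\<Lambda> :: "('a::euclidean_space \<Rightarrow> complex) set"
    and \<Lambda> sqrt\<Lambda> :: "('a \<Rightarrow> complex) \<Rightarrow> ('a \<Rightarrow> complex)"
    and I :: "'i set" and lam :: "'i \<Rightarrow> real" and u :: "'i \<Rightarrow> 'a \<Rightarrow> complex" and m0 :: 'i
    and g h :: "real \<Rightarrow> real \<Rightarrow> real"
    and d :: nat and C :: real
  assumes d: "d = DIM('a)" "d \<ge> 2"
    and \<Lambda>: "nonnegative_selfadjoint sphere_measure dom\<Lambda> \<Lambda>"
    and sqrt: "selfadjoint_sqrt sphere_measure dom\<Lambda> \<Lambda> dom_sqrt\<Lambda> sqrt\<Lambda>"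
    and spec: "purely_discrete_spectrum sphere_measure dom\<Lambda> \<Lambda> I lam u"
    and C: "C = rellich_const d \<alpha> I lam"
    and m0: "minimizing_index d \<alpha> I lam m0"
    and g: "cutoff_family g"
    and h: "\<forall>\<epsilon>\<in>{0<..<1/2}. \<forall>r>0. (h \<epsilon> has_real_derivative g \<epsilon> r / r) (at r)"
  shows
    "(d - \<alpha> - 4 \<noteq> 0 \<or> C = lam m0 \<longrightarrow>
       (smooth_on (- {0}) (\<lambda>x. u m0 (sgn x)) \<longrightarrow>
          (\<forall>\<epsilon>\<in>{0<..<1/2}. power_trial \<alpha> g (u m0) \<epsilon> \<in> dom_calL dom\<Lambda> \<Lambda>)) \<and>
       filterlim (\<lambda>\<epsilon>. rellich_num \<alpha> \<Lambda> (power_trial \<alpha> g (u m0) \<epsilon>) /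
                      rellich_den \<alpha> sqrt\<Lambda> (power_trial \<alpha> g (u m0) \<epsilon>))
         (at_right C) (at_right 0)) \<and>
     (d - \<alpha> - 4 = 0 \<and> C = (real d - 2)\<^sup>2 \<and> eigenfunction sphere_measure dom\<Lambda> \<Lambda> 0 (\<lambda>_. 1) \<longrightarrow>
       (\<forall>\<epsilon>\<in>{0<..<1/2}. radial_trial h \<epsilon> \<in> dom_calL_energy_closure \<alpha> dom\<Lambda> \<Lambda> sqrt\<Lambda>) \<and>
       filterlim (\<lambda>\<epsilon>. rellich_num \<alpha> \<Lambda> (radial_trial h \<epsilon>) / rellich_den \<alpha> sqrt\<Lambda> (radial_trial h \<epsilon>))
         (at_right C) (at_right 0)) \<and>
     \<not> (\<exists>\<psi>\<in>dom_calL dom\<Lambda> \<Lambda>. \<psi> \<noteq> (\<lambda>_. 0) \<and>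
          rellich_num \<alpha> \<Lambda> \<psi> = C * rellich_den \<alpha> sqrt\<Lambda> \<psi>)"
proof -
  define \<gamma> where "\<gamma> = (real DIM('a) - 4 - \<alpha>) / 2"
  have "discrete_operator sphere_measure dom\<Lambda> \<Lambda> I lam u" using \<Lambda> spec by unfold_locales
  moreover have "angular_operator_axioms dom\<Lambda> \<Lambda> dom_sqrt\<Lambda> sqrt\<Lambda>" using sqrt by unfold_locales
  ultimately interpret angular_operator dom\<Lambda> \<Lambda> I lam u dom_sqrt\<Lambda> sqrt\<Lambda>
    by (rule angular_operator.intro)
  have m0': "minimizing_index DIM('a) \<alpha> I lam m0" and C': "C = rellich_const DIM('a) \<alpha> I lam"
    using m0 C d(1) by simp_all
  obtain c where cut: "\<And>\<epsilon>. \<epsilon> \<in> {0<..<1/2} \<Longrightarrow> cutoff (g \<epsilon>) \<epsilon> c"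
    using cutoff_familyE[OF g] by blast
  have power: "(smooth_on (- {0}) (\<lambda>x. u m0 (sgn x)) \<longrightarrow>
          (\<forall>\<epsilon>\<in>{0<..<1/2}. power_trial \<alpha> g (u m0) \<epsilon> \<in> dom_calL dom\<Lambda> \<Lambda>)) \<and>
       filterlim (\<lambda>\<epsilon>. rellich_num \<alpha> \<Lambda> (power_trial \<alpha> g (u m0) \<epsilon>) /
                      rellich_den \<alpha> sqrt\<Lambda> (power_trial \<alpha> g (u m0) \<epsilon>))
         (at_right C) (at_right 0)"
    if nondeg: "d - \<alpha> - 4 \<noteq> 0 \<or> C = lam m0"
  proof -
    have m0I: "m0 \<in> I" and B: "lam m0 + \<gamma>\<^sup>2 > 0"
      and K: "C * (lam m0 + \<gamma>\<^sup>2) = (lam m0 + \<gamma>\<^sup>2 + \<gamma> * (\<alpha> + 2))\<^sup>2"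
    proof -
      have "m0 \<in> I \<and> lam m0 + \<gamma>\<^sup>2 > 0 \<and> C * (lam m0 + \<gamma>\<^sup>2) = (lam m0 + \<gamma>\<^sup>2 + \<gamma> * (\<alpha> + 2))\<^sup>2"
      proof (cases "\<gamma> = 0")
        case False
        note r = rellich_const_cases(1)[OF m0' \<gamma>_def False]
        then have "lam m0 + \<gamma>\<^sup>2 > 0" using lam_nonneg[of m0] False by (auto intro: add_nonneg_pos)
        then show ?thesis using r rellich_quot_eq[OF \<gamma>_def, of "lam m0"] C' by simp
      next
        \<comment> \<open>With \<open>\<gamma> = 0\<close> the assumption leaves only
          \<open>C = lam m0\<close>, and the minimiser ranges over nonzero eigenvalues, so
          \<open>B = lam m0\<close> is positive and \<open>K = lam m0\<close>.\<close>
        case True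
        note r = rellich_const_cases(2)[OF m0' \<gamma>_def True]
        then have "lam m0 > 0" using lam_nonneg[of m0] by auto
        moreover have "C = lam m0" using nondeg True d(1) by (auto simp: \<gamma>_def)
        ultimately show ?thesis using r True by (simp add: power2_eq_square)
      qed
      then show "m0 \<in> I" "lam m0 + \<gamma>\<^sup>2 > 0" "C * (lam m0 + \<gamma>\<^sup>2) = (lam m0 + \<gamma>\<^sup>2 + \<gamma> * (\<alpha> + 2))\<^sup>2"
        by auto
    qed
    have w: "eigenfunction sphere_measure dom\<Lambda> \<Lambda> (lam m0) (u m0)"
      using m0I by (simp add: eigenfunction_def op_u)
    have "(L2_norm sphere_measure (u m0))\<^sup>2 = 1"
      using u_inner[OF m0I m0I] L2_inner_self[of sphere_measure "u m0"] by (simp flip: of_real_power)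
    then have norm: "L2_norm sphere_measure (u m0) = 1"
      using L2_norm_nonneg[of sphere_measure "u m0"] by (simp add: power2_eq_1_iff)
    note est = power_trial_estimates[where g=g, OF cut w lam_nonneg[OF m0I] norm \<gamma>_def B K]
    show ?thesis
    proof (intro conjI impI ballI)
      show "power_trial \<alpha> g (u m0) \<epsilon> \<in> dom_calL dom\<Lambda> \<Lambda>"
        if "smooth_on (- {0}) (\<lambda>x. u m0 (sgn x))" "\<epsilon> \<in> {0<..<1/2}" for \<epsilon>
        using est(1)[OF that(2)] power_trial_test_function[where g=g, OF cut[OF that(2)] that(1)] by (simp add: dom_calL_def)
      show "filterlim (\<lambda>\<epsilon>. rellich_num \<alpha> \<Lambda> (power_trial \<alpha> g (u m0) \<epsilon>) /
                      rellich_den \<alpha> sqrt\<Lambda> (power_trial \<alpha> g (u m0) \<epsilon>)) (at_right C) (at_right 0)"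
        by (rule filterlim_quotient_at_right[OF B est(2,3,4)])
    qed
  qed
  have radial: "(\<forall>\<epsilon>\<in>{0<..<1/2}. radial_trial h \<epsilon> \<in> dom_calL_energy_closure \<alpha> dom\<Lambda> \<Lambda> sqrt\<Lambda>) \<and>
       filterlim (\<lambda>\<epsilon>. rellich_num \<alpha> \<Lambda> (radial_trial h \<epsilon>) / rellich_den \<alpha> sqrt\<Lambda> (radial_trial h \<epsilon>))
         (at_right C) (at_right 0)"
    if "d - \<alpha> - 4 = 0" "C = (real d - 2)\<^sup>2" "eigenfunction sphere_measure dom\<Lambda> \<Lambda> 0 (\<lambda>_. 1)"
  proof -
    have \<alpha>: "\<alpha> = real DIM('a) - 4" using that(1) d(1) by simp
    have CC: "C = (\<alpha> + 2)\<^sup>2" using that(2) \<alpha> d(1) by simp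
    have h': "(h \<epsilon> has_real_derivative g \<epsilon> r / r) (at r)" if "\<epsilon> \<in> {0<..<1/2}" "r > 0" for \<epsilon> r
      using h that by blast
    \<comment> \<open>Any fixed member of the family can serve as the cut-off for the truncation and
      as the instance giving positivity of the norm of the constant 1, which is independent of
      \<open>\<epsilon>\<close>.\<close>
    have quarter: "(1/4 :: real) \<in> {0<..<1/2}" by simp
    note est = radial_trial_estimates[where h=h, OF cut that(3) \<alpha> h']
    have "radial_trial h \<epsilon> \<in> dom_calL_energy_closure \<alpha> dom\<Lambda> \<Lambda> sqrt\<Lambda>" if "\<epsilon> \<in> {0<..<1/2}" for \<epsilon>
      by (rule radial_trial_energy_closure[where h=h, OF cut[OF that] cut[OF quarter] \<open>eigenfunction _ _ _ 0 _\<close> \<alpha> h'[OF that]])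
    moreover have "filterlim (\<lambda>\<epsilon>. rellich_num \<alpha> \<Lambda> (radial_trial h \<epsilon>) / rellich_den \<alpha> sqrt\<Lambda> (radial_trial h \<epsilon>))
         (at_right C) (at_right 0)"
      unfolding CC by (rule filterlim_quotient_at_right[OF est(5)[OF quarter quarter] est(2,3,4)])
    ultimately show ?thesis by blast
  qed
  have "rellich_num \<alpha> \<Lambda> \<psi> \<noteq> C * rellich_den \<alpha> sqrt\<Lambda> \<psi>"
    if \<psi>: "\<psi> \<in> dom_calL dom\<Lambda> \<Lambda>" and nz: "\<psi> \<noteq> (\<lambda>_. 0)" for \<psi>
  proof -
    have t: "test_function_away0 \<psi>" using \<psi> by (simp add: dom_calL_def)
    obtain a b where ab: "0 < a" "\<And>x. \<psi> x \<noteq> 0 \<Longrightarrow> a < norm x \<and> norm x < b"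
      using test_function_annulus[OF t] by metis
    obtain a1 b1 where ab1: "0 < a1" "\<And>x. radial_deriv \<psi> x \<noteq> 0 \<Longrightarrow> a1 < norm x \<and> norm x < b1"
      using test_function_annulus[OF test_function_radial_deriv[OF t]] by metis
    obtain a2 b2 where ab2: "0 < a2" "\<And>x. radial_deriv (radial_deriv \<psi>) x \<noteq> 0 \<Longrightarrow> a2 < norm x \<and> norm x < b2"
      using test_function_annulus[OF test_function_radial_deriv[OF test_function_radial_deriv[OF t]]] by metis
    show ?thesis
    \<comment> \<open>The annuli of the function and of its two radial derivatives are obtained
      separately; their common hull is used for all three.\<close>
    proof (rule not_attained[OF \<psi> _ _ m0' C' nz, of "min a (min a1 a2)" "max b (max b1 b2)"])
      fix x assume "\<psi> x \<noteq> 0 \<or> radial_deriv \<psi> x \<noteq> 0 \<or> radial_deriv (radial_deriv \<psi>) x \<noteq> 0"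
      then show "min a (min a1 a2) < norm x \<and> norm x < max b (max b1 b2)"
        using ab(2)[of x] ab1(2)[of x] ab2(2)[of x] by auto
    qed (use ab ab1 ab2 in auto)
  qed
  with power radial show ?thesis by blast
qed

end
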